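(* Let $T$ be the 30-60-90 triangle, i.e. the point $(\theta_1,\theta_2)=(\pi/6,\pi/3)$ in the space of triangles up to similarity. Let $\mathcal{O}$ be an open orbit tile such that $T\in\overline{\mathcal{O}}$. Then for any sufficiently small $\epsilon,\delta>0$, the ray emanating from $T$ with angle $\frac{7\pi}{4}-\epsilon$ is disjoint from $\mathcal{O}\cap B_\delta(T)$.
   Context: Triangles up to similarity (with labeled vertices) are parametrized by two of their angles $(\theta_1,\theta_2)$, viewed as a subset of the plane $\mathbb{R}^2$; the third angle is $\pi-\theta_1-\theta_2$. Rays and their angles (measured counter-clockwise from the positive $\theta_1$-axis) and the ball $B_\delta(T)$ of radius $\delta$ about $T$ are taken in this plane; the direction $7\pi/4$ is the direction of right triangles with $\theta_1$ increasing and $\theta_2$ decreasing. A trajectory on a polygon $P$ is a function $f:\mathbb{R}\to P$ with constant derivative except when $f(t)$ lies on an edge, where the direction is changed by elastic reflection; $f(t)$ is never a vertex. It is periodic if $f(0)=f(a)$, $f'(0)=f'(a)$ for some $a\neq0$; the period is taken so that the first and last copies of $P$ in the unfolding along one period differ by a translation. (The unfolding along $f$ is obtained by reflecting $P$ across each edge struck and letting $f$ continue in a straight line.) A polygon $Q$ with the same number of (labeled) edges admits the periodic trajectory $f$ if, after replacing the copies of $P$ in the unfolding along one period of $f$ by copies of $Q$ (reflecting successively in the same sequence of edges), the first and last copies of $Q$ differ by a translation, and there is a straight segment joining corresponding points of the first and last copies which passes through the successive copies of $Q$, crossing the same edges and avoiding vertices (i.e. a periodic trajectory on $Q$ striking the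 same sequence of edges). The orbit tile of $f$ is the set of triangles (up to similarity) admitting $f$. *)

theory Defs
  imports "HOL-Analysis.Analysis"
begin

section \<open>Labeled triangles\<close>

text \<open>A triangle is given by its vertices, labeled by the type \<open>3\<close>, whose elements are \<open>1\<close>, \<open>2\<close>
  and \<open>3 = 0\<close>. Arithmetic on labels is modulo 3, so \<open>i + 1\<close> and \<open>i + 2\<close> are the two labels other
  than \<open>i\<close>. The edge with label \<open>i\<close> is the one opposite the vertex with label \<open>i\<close>.\<close>

type_synonym triangle = "3 \<Rightarrow> complex"

definition nondegenerate :: "triangle \<Rightarrow> bool" where
  "nondegenerate P \<longleftrightarrow> \<not> collinear (range P)"

definition region :: "triangle \<Rightarrow> complex set" where
  "region P = convex hull (range P)"

definition edge :: "triangle \<Rightarrow> 3 \<Rightarrow> complex set" where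
  "edge P i = closed_segment (P (i + 1)) (P (i + 2))"

definition angle_at :: "triangle \<Rightarrow> 3 \<Rightarrow> real" where
  "angle_at P i =
     arccos (((P (i + 1) - P i) \<bullet> (P (i + 2) - P i))
             / (norm (P (i + 1) - P i) * norm (P (i + 2) - P i)))"

text \<open>The point \<open>(\<theta>\<^sub>1, \<theta>\<^sub>2)\<close> that represents the similarity class of a labeled triangle.\<close>

definition shape :: "triangle \<Rightarrow> real \<times> real" where
  "shape P = (angle_at P 1, angle_at P 2)"


section \<open>Reflections and unfoldings\<close>

text \<open>Linear part of the reflection of the plane in the line through edge \<open>i\<close>: if that line has the
  direction \<open>d\<close>, then \<open>u = (u/d) d\<close> is mapped to \<open>cnj (u/d) d\<close>.\<close>

definition reflect_direction :: "triangle \<Rightarrow> 3 \<Rightarrow> complex \<Rightarrow> complex" where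
  "reflect_direction P i u =
     (let d = P (i + 2) - P (i + 1) in d / cnj d * cnj u)"

definition reflect_point :: "triangle \<Rightarrow> 3 \<Rightarrow> complex \<Rightarrow> complex" where
  "reflect_point P i z = P (i + 1) + reflect_direction P i (z - P (i + 1))"

definition reflect_triangle :: "triangle \<Rightarrow> 3 \<Rightarrow> triangle" where
  "reflect_triangle P i = (\<lambda>j. reflect_point P i (P j))"

text \<open>The copy of \<open>P\<close> reached after the first \<open>k\<close> reflections along the edge sequence \<open>w\<close>. The edge
  \<open>w ! k\<close> is shared by the copies with numbers \<open>k\<close> and \<open>k + 1\<close>.\<close>

definition unfolding_copy :: "triangle \<Rightarrow> 3 list \<Rightarrow> nat \<Rightarrow> triangle" where
  "unfolding_copy P w k = foldl reflect_triangle P (take k w)"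

definition translate_by :: "complex \<Rightarrow> triangle \<Rightarrow> triangle \<Rightarrow> bool" where
  "translate_by \<tau> P P' \<longleftrightarrow> (\<forall>j. P' j = P j + \<tau>)"


section \<open>Billiard trajectories\<close>

text \<open>Around every time \<open>t\<close> the derivative is a nonzero constant \<open>u\<close> before \<open>t\<close> and a constant \<open>v\<close>
  after \<open>t\<close>. They agree unless \<open>f t\<close> lies on an edge, where \<open>v\<close> is the mirror image of \<open>u\<close>.
  The condition \<open>u \<noteq> 0\<close> excludes the constant functions.\<close>

definition trajectory :: "triangle \<Rightarrow> (real \<Rightarrow> complex) \<Rightarrow> bool" where
  "trajectory P f \<longleftrightarrow>
     continuous_on UNIV f \<and> range f \<subseteq> region P \<and> range f \<inter> range P = {} \<and>
     (\<forall>t. \<exists>u v d. u \<noteq> 0 \<and> d > 0 \<and>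
        (\<forall>s\<in>{t - d<..<t}. (f has_vector_derivative u) (at s)) \<and>
        (\<forall>s\<in>{t<..<t + d}. (f has_vector_derivative v) (at s)) \<and>
        (\<forall>i. f t \<in> edge P i \<longrightarrow> v = reflect_direction P i u) \<and>
        ((\<forall>i. f t \<notin> edge P i) \<longrightarrow> v = u))"

text \<open>The set of hit times in a bounded interval is finite, and since \<open>f\<close> avoids the vertices, the
  edge struck at each of them is unique.\<close>

definition hit_times :: "triangle \<Rightarrow> (real \<Rightarrow> complex) \<Rightarrow> real \<Rightarrow> real set" where
  "hit_times P f a = {t \<in> {0<..<a}. \<exists>i. f t \<in> edge P i}"

definition hit_sequence :: "triangle \<Rightarrow> (real \<Rightarrow> complex) \<Rightarrow> real \<Rightarrow> 3 list" where
  "hit_sequence P f a =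
     map (\<lambda>t. THE i. f t \<in> edge P i) (sorted_list_of_set (hit_times P f a))"

text \<open>\<open>f\<close> is a periodic trajectory on \<open>P\<close> and \<open>a\<close> is a period. Differentiability at \<open>0\<close> and \<open>a\<close>
  means that \<open>f 0 = f a\<close> is not on an edge. The last condition rules out the odd numbers of
  reflections.\<close>

definition periodic_trajectory :: "triangle \<Rightarrow> (real \<Rightarrow> complex) \<Rightarrow> real \<Rightarrow> bool" where
  "periodic_trajectory P f a \<longleftrightarrow>
     trajectory P f \<and> a > 0 \<and> f 0 = f a \<and>
     (\<exists>v. (f has_vector_derivative v) (at 0) \<and> (f has_vector_derivative v) (at a)) \<and>
     (let w = hit_sequence P f a in
        \<exists>\<tau>. translate_by \<tau> P (unfolding_copy P w (length w)))"


section \<open>Orbit tiles\<close>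

text \<open>The segment from \<open>x\<close> to \<open>x + \<tau>\<close>, parametrized by \<open>[0, 1]\<close>, is inside copy number \<open>k\<close> during
  \<open>(\<sigma> k, \<sigma> (k + 1))\<close> and crosses the common edge of the copies \<open>k\<close> and \<open>k + 1\<close>, away from its
  endpoints, at \<open>\<sigma> (k + 1)\<close>.\<close>

definition admits_sequence :: "triangle \<Rightarrow> 3 list \<Rightarrow> bool" where
  "admits_sequence Q w \<longleftrightarrow>
     (\<exists>\<tau> x. \<exists>\<sigma> :: nat \<Rightarrow> real.
        translate_by \<tau> Q (unfolding_copy Q w (length w)) \<and>
        x \<in> interior (region Q) \<and>
        \<sigma> 0 = 0 \<and> \<sigma> (Suc (length w)) = 1 \<and>
        (\<forall>k\<le>length w. \<sigma> k < \<sigma> (Suc k)) \<and>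
        (\<forall>k\<le>length w. \<forall>s\<in>{\<sigma> k<..<\<sigma> (Suc k)}.
           x + s *\<^sub>R \<tau> \<in> interior (region (unfolding_copy Q w k))) \<and>
        (\<forall>k<length w. x + \<sigma> (Suc k) *\<^sub>R \<tau> \<in>
           edge (unfolding_copy Q w k) (w ! k) - range (unfolding_copy Q w k)))"

definition orbit_tile :: "triangle \<Rightarrow> (real \<Rightarrow> complex) \<Rightarrow> real \<Rightarrow> (real \<times> real) set" where
  "orbit_tile P f a = {shape Q | Q. nondegenerate Q \<and> admits_sequence Q (hit_sequence P f a)}"

definition is_orbit_tile :: "(real \<times> real) set \<Rightarrow> bool" where
  "is_orbit_tile S \<longleftrightarrow>
     (\<exists>P f a. nondegenerate P \<and> periodic_trajectory P f a \<and> S = orbit_tile P f a)"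


section \<open>Rays in the parameter plane\<close>

definition ray :: "real \<times> real \<Rightarrow> real \<Rightarrow> (real \<times> real) set" where
  "ray p \<phi> = {p + r *\<^sub>R (cos \<phi>, sin \<phi>) | r. r \<ge> 0}"

end

theory Submission
  imports Defs "HOL-Analysis.Analysis"
begin

text \<open>Suppose that the conclusion fails. Then triangles with angles \<open>\<pi>/6 + t\<close>, \<open>\<pi>/3 - t - r\<close>, \<open>\<pi>/2 + r\<close>,
  where \<open>t, r > 0\<close> tend to \<open>0\<close> with \<open>r/t \<rightarrow> 0\<close>, all admit the same edge sequence. Normalize their
  periodic unfoldings so that the trajectory is horizontal and pass to the limit along a subsequence:
  an unfolding of the 30-60-90 triangle, which is a path in the kaleidoscopic tiling. A horizontal line
  through the lowest vertices above the trajectories, or through the highest ones below them, contains vertices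
  of the limit, and by the symmetry of the tiling the vertices on it form one of three patterns.

  If no vertex \<open>2\<close> is on the line, then at each vertex on the line the path makes a half-turn in the limit, and
  more than a half-turn before the limit. The highest vertex on the line is therefore below the
  trajectory and the lowest one above it, which is absurd.

  If the line contains vertices \<open>1, 2, 0, 2\<close> repeatedly, then the first-order variation in \<open>t\<close> of the heights of
  the vertices \<open>1\<close> is a piecewise linear periodic function whose slope increases at vertices above the trajectory
  and decreases at vertices below it. So the slope is constant, and the terms of order \<open>r\<close> contradict periodicity.

  If the line contains vertices \<open>2\<close> only, then counting letters modulo \<open>3\<close> shows that all of them are on the
  same side of the trajectory. So the lines above and below differ, and both have this form, which
  is impossible as well.\<close>

section \<open>Paths in the kaleidoscopic tiling\<close>

text \<open>The patterns come from a parity: half a turn about a vertex \<open>1\<close>,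
  \<open>0\<close> or \<open>2\<close> of the tiling takes 6, 2 or 3 tile angles. For 6 and 2 the
  limit path leaves the vertex as the point reflection of how it came, so such vertices act as
  mirrors for the sequence on the line; for 3 the two sides at the vertex exchange roles. Before the
  limit these half-turns measure \<open>pi + 6 t\<close>, \<open>pi + 2 r\<close> and
  \<open>pi - 3 t - 3 r\<close>. The defect has the opposite sign at \<open>2\<close>, which is why
  lines through vertices \<open>2\<close> resist the convexity argument and need counting or a
  second look at the slopes. The limit path may run through vertices and along edges, so heights
  alone do not determine it. The missing information is the side \<open>S\<close> of each vertex,
  which is inherited from the actual trajectories. As \<open>r/t\<close> tends to 0, a relation
  \<open>A t + B r = 0\<close> with fixed \<open>A\<close> and \<open>B\<close> along the sequence
  forces \<open>A = 0\<close> and then \<open>B = 0\<close>. This yields balanced letter counts and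
  trivial total rotations. When the slope along \<open>1, 2, 0, 2\<close> is constant, the terms of
  order \<open>r\<close> refute the case in which all vertices \<open>1\<close> are on one side; if
  both sides occur, the heights of order \<open>t\<close> themselves come out in the wrong
  order.\<close>

lemma label_cases: "(j::3) = 0 \<or> j = 1 \<or> j = 2"
  using exhaust_3[of j] by auto

lemma label_arith [simp]: "(3::3) = 0" "(4::3) = 1"
  "(j::3) + 3 = j" "(j::3) + 4 = j + 1"
  using label_cases[of j] by auto

text \<open>In the 30-60-90 triangle the reflections move the vertices by \<open>V\<^sub>1 \<mapsto> 2 V\<^sub>0 - V\<^sub>1\<close>,
  \<open>V\<^sub>2 \<mapsto> 2 V\<^sub>0 - V\<^sub>2\<close>, \<open>V\<^sub>0 \<mapsto> V\<^sub>1/2 + 3 V\<^sub>2/2 - V\<^sub>0\<close>, hence their heights likewise.\<close>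

definition refl_height :: "(3 \<Rightarrow> real) \<Rightarrow> 3 \<Rightarrow> real" where
  "refl_height h i =
     (if i = 1 then 2 * h 0 - h 1 else if i = 2 then 2 * h 0 - h 2 else h 1 / 2 + 3 / 2 * h 2 - h 0)"

text \<open>An unfolding of the 30-60-90 triangle, seen from a horizontal line at height \<open>0\<close>: \<open>w k\<close> is the edge
  shared by the copies \<open>k\<close> and \<open>k + 1\<close>, \<open>s k\<close> is the orientation of copy \<open>k\<close>, and \<open>H k j\<close> is the height of its
  vertex \<open>j\<close>. Vertices may lie on the line; \<open>S k j\<close> tells on which side of the vertex \<open>j\<close> the path passes
  (\<open>1\<close> if below it).\<close>

definition tpath ::
  "(int \<Rightarrow> 3) \<Rightarrow> (int \<Rightarrow> real) \<Rightarrow> (int \<Rightarrow> 3 \<Rightarrow> real) \<Rightarrow> (int \<Rightarrow> 3 \<Rightarrow> real) \<Rightarrow> bool" where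
  "tpath w s S H \<longleftrightarrow>
     (\<forall>k. (s k = 1 \<or> s k = -1) \<and> s (k + 1) = - s k \<and>
        (\<forall>j. S k j = 1 \<or> S k j = -1) \<and> (\<forall>j. j \<noteq> w k \<longrightarrow> S (k + 1) j = S k j) \<and>
        s k * S k (w k + 2) = 1 \<and> s k * S k (w k + 1) = -1 \<and>
        (\<forall>j. S k j * H k j \<ge> 0) \<and> (\<forall>j. j \<noteq> w k \<longrightarrow> H (k + 1) j = H k j) \<and>
        H (k + 1) (w k) = refl_height (H k) (w k) \<and> \<not> (H k 0 = H k 1 \<and> H k 1 = H k 2))"

context
  fixes w s S H
  assumes p: "tpath w s S H"
begin

lemma s_sgn: "s k = 1 \<or> s k = -1" using p unfolding tpath_def by blast
lemma s_Suc: "s (k + 1) = - s k" using p unfolding tpath_def by blast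
lemma S_sgn: "S k j = 1 \<or> S k j = -1" using p unfolding tpath_def by blast
lemma S_Suc: "j \<noteq> w k \<Longrightarrow> S (k + 1) j = S k j" using p unfolding tpath_def by blast
lemma S_w2: "s k * S k (w k + 2) = 1" using p unfolding tpath_def by blast
lemma S_w1: "s k * S k (w k + 1) = -1" using p unfolding tpath_def by blast
lemma SH: "S k j * H k j \<ge> 0" using p unfolding tpath_def by blast
lemma H_Suc: "j \<noteq> w k \<Longrightarrow> H (k + 1) j = H k j" using p unfolding tpath_def by blast
lemma H_w: "H (k + 1) (w k) = refl_height (H k) (w k)" using p unfolding tpath_def by blast
lemma H_nondeg: "\<not> (H k 0 = H k 1 \<and> H k 1 = H k 2)" using p unfolding tpath_def by blast

lemma S_of_H: "s k * H k j > 0 \<Longrightarrow> S k j = s k" "s k * H k j < 0 \<Longrightarrow> S k j = - s k"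
  using s_sgn[of k] S_sgn[of k j] SH[of k j] by (auto simp: zero_less_mult_iff mult_less_0_iff)

text \<open>The path runs to the right, so a tile with \<open>s k = 1\<close> is left through the
  edge whose endpoint \<open>i + 2\<close> is above the path and whose endpoint \<open>i + 1\<close>
  is below it; for \<open>s k = -1\<close> the roles are exchanged. Three signs that are not all
  equal show this pattern at exactly one cyclic place.\<close>

lemma w_unique:
  assumes "s k * S k (i + 2) = 1" "s k * S k (i + 1) = -1"
  shows "w k = i"
  using S_w1[of k] S_w2[of k] assms label_cases[of "w k"] label_cases[of i] s_sgn[of k]
  by auto

lemma w_forced:
  assumes "s k * H k (i + 2) > 0" "s k * H k (i + 1) < 0"
  shows "w k = i"
  using S_of_H(1)[OF assms(1)] S_of_H(2)[OF assms(2)] s_sgn[of k] by (intro w_unique) auto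

end

text \<open>A half-turn about a point of the line, followed by reversal of time, keeps the direction
  of travel and all orientations but exchanges above and below. The edge between copies
  \<open>k\<close> and \<open>k + 1\<close> of the new path is the old one between
  \<open>- k - 1\<close> and \<open>- k\<close>.\<close>

lemma tpath_reverse:
  assumes p: "tpath w s S H"
  shows "tpath (\<lambda>k. w (- k - 1)) (\<lambda>k. s (- k)) (\<lambda>k j. - S (- k) j) (\<lambda>k j. - H (- k) j)"
proof -
  have e: "- (k + 1) + 1 = - k" "- k - 1 = - (k + 1)" "-1 - k = - (k + 1)" for k :: int by auto
  { fix k :: int
    let ?m = "- (k + 1)"
    have s: "s (- k) = - s ?m" using s_Suc[OF p, of ?m] by simp
    have S: "j \<noteq> w ?m \<Longrightarrow> S (- k) j = S ?m j" for j using S_Suc[OF p, of j ?m] by simp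
    have H: "j \<noteq> w ?m \<Longrightarrow> H (- k) j = H ?m j" for j using H_Suc[OF p, of j ?m] by simp
    have Hw: "H (- k) (w ?m) = refl_height (H ?m) (w ?m)" using H_w[OF p, of ?m] by simp
    \<comment> \<open>A reflection is its own inverse, and \<open>refl_height\<close> inherits
      this.\<close>
    have Hr: "H ?m (w ?m) = refl_height (H (- k)) (w ?m)"
      using Hw H label_cases[of "w ?m"] by (auto simp: refl_height_def)
    have "- H ?m (w ?m) = refl_height (\<lambda>j. - H (- k) j) (w ?m)"
      using Hr by (auto simp: refl_height_def field_simps)
    moreover have "s (- k) * - S (- k) (w ?m + 2) = 1 \<and> s (- k) * - S (- k) (w ?m + 1) = -1"
      using s S S_w1[OF p, of ?m] S_w2[OF p, of ?m] by auto
    moreover have "- S (- k) j = 1 \<or> - S (- k) j = -1" for j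
      using S_sgn[OF p, of "- k" j] by auto
    moreover have "- S (- k) j * - H (- k) j \<ge> 0" for j
      using SH[OF p, of "- k" j] by simp
    moreover have "\<not> (- H (- k) 0 = - H (- k) 1 \<and> - H (- k) 1 = - H (- k) 2)"
      using H_nondeg[OF p, of "- k"] by auto
    moreover have "s (- k) = 1 \<or> s (- k) = -1" by (rule s_sgn[OF p])
    moreover have "s ?m = - s (- k)" using s by simp
    moreover have "j \<noteq> w ?m \<longrightarrow> - S ?m j = - S (- k) j" for j using S by simp
    moreover have "j \<noteq> w ?m \<longrightarrow> - H ?m j = - H (- k) j" for j using H by simp
    ultimately have "(s (- k) = 1 \<or> s (- k) = -1) \<and> s ?m = - s (- k) \<and>
        (\<forall>j. - S (- k) j = 1 \<or> - S (- k) j = -1) \<and> (\<forall>j. j \<noteq> w ?m \<longrightarrow> - S ?m j = - S (- k) j) \<and>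
        s (- k) * - S (- k) (w ?m + 2) = 1 \<and> s (- k) * - S (- k) (w ?m + 1) = -1 \<and>
        (\<forall>j. - S (- k) j * - H (- k) j \<ge> 0) \<and> (\<forall>j. j \<noteq> w ?m \<longrightarrow> - H ?m j = - H (- k) j) \<and>
        - H ?m (w ?m) = refl_height (\<lambda>j. - H (- k) j) (w ?m) \<and>
        \<not> (- H (- k) 0 = - H (- k) 1 \<and> - H (- k) 1 = - H (- k) 2)"
      by (elim conjE) (intro conjI allI, assumption+)
  }
  then show ?thesis unfolding tpath_def e by blast
qed

section \<open>Straight stretches between vertices on the line, and turns about such
  vertices\<close>

definition leaves :: "(int \<Rightarrow> real) \<Rightarrow> (int \<Rightarrow> 3 \<Rightarrow> real) \<Rightarrow> int \<Rightarrow> 3 \<Rightarrow> bool" where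
  "leaves s H k j \<longleftrightarrow> H k j = 0 \<and> s k * H k (j + 2) > 0 \<and> s k * H k (j + 1) < 0"

definition arrives :: "(int \<Rightarrow> real) \<Rightarrow> (int \<Rightarrow> 3 \<Rightarrow> real) \<Rightarrow> int \<Rightarrow> 3 \<Rightarrow> bool" where
  "arrives s H k j \<longleftrightarrow> H k j = 0 \<and> s k * H k (j + 1) > 0 \<and> s k * H k (j + 2) < 0"

text \<open>Marks the copies in which the heights alone decide the next edge. On such stretches a
  symmetry of the heights carries over to the letters; elsewhere the sides \<open>S\<close> have a
  say.\<close>

definition forced :: "(int \<Rightarrow> real) \<Rightarrow> (int \<Rightarrow> 3 \<Rightarrow> real) \<Rightarrow> int \<Rightarrow> bool" where
  "forced s H k \<longleftrightarrow> (\<exists>i. s k * H k (i + 2) > 0 \<and> s k * H k (i + 1) < 0)"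

text \<open>While the heights decide the next edge, orientation and heights are the state of a
  deterministic system. Forcedness is asked of one path only, since the other one has the same
  heights.\<close>

lemma determined:
  assumes p: "tpath w s S H" and p': "tpath w' s' S' H'"
    and eq: "s k = s' k'" "H k = H' k'"
    and f: "\<And>i::nat. i < m \<Longrightarrow> forced s H (k + int i)"
  shows "s (k + int m) = s' (k' + int m) \<and> H (k + int m) = H' (k' + int m) \<and>
         (\<forall>i<m. w (k + int i) = w' (k' + int i))"
  using f
proof (induction m)
  case 0
  then show ?case using eq by simp
next
  case (Suc m)
  let ?a = "k + int m" and ?b = "k' + int m"
  have IH: "s ?a = s' ?b" "H ?a = H' ?b" "\<forall>i<m. w (k + int i) = w' (k' + int i)"
    using Suc by auto
  obtain i where i: "s ?a * H ?a (i + 2) > 0" "s ?a * H ?a (i + 1) < 0"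
    using Suc.prems[of m] by (auto simp: forced_def)
  have "w ?a = i" by (rule w_forced[OF p i])
  moreover have "w' ?b = i" by (rule w_forced[OF p']) (use i IH in auto)
  ultimately have w: "w ?a = w' ?b" by simp
  have "s (?a + 1) = s' (?b + 1)" using s_Suc[OF p] s_Suc[OF p'] IH by simp
  moreover have "H (?a + 1) = H' (?b + 1)"
  proof
    fix j show "H (?a + 1) j = H' (?b + 1) j"
      using H_Suc[OF p, of j ?a] H_Suc[OF p', of j ?b] H_w[OF p, of ?a] H_w[OF p', of ?b] IH w
      by (cases "j = w ?a") auto
  qed
  ultimately show ?case using IH(3) w by (auto simp: less_Suc_eq ac_simps)
qed

text \<open>The path turns around the on-line vertex \<open>j\<close> of copy \<open>k\<close>: it crosses the edge opposite to \<open>y\<close> next, and then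
  the one opposite to \<open>x\<close>, as long as the vertices at the end of those edges are beyond the line.\<close>

definition fan ::
  "(int \<Rightarrow> real) \<Rightarrow> (int \<Rightarrow> 3 \<Rightarrow> real) \<Rightarrow> (int \<Rightarrow> 3 \<Rightarrow> real) \<Rightarrow> int \<Rightarrow> 3 \<Rightarrow> 3 \<Rightarrow> 3 \<Rightarrow> bool" where
  "fan s S H k j y x \<longleftrightarrow> H k j = 0 \<and> S k j * H k x < 0 \<and>
     (S k j = s k \<and> y = j + 1 \<and> x = j + 2 \<or> S k j = - s k \<and> y = j + 2 \<and> x = j + 1)"

text \<open>The side of \<open>x\<close> follows from its strict height and is opposite to that of
  \<open>j\<close>, so the path has to cross the edge that joins them, which is the one opposite
  \<open>y\<close>.\<close>

lemma fan_step:
  assumes p: "tpath w s S H" and f: "fan s S H k j y x"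
  shows "w k = y" "s (k + 1) = - s k" "S (k + 1) j = S k j" "H (k + 1) j = 0" "H (k + 1) x = H k x"
    "H (k + 1) y = refl_height (H k) y"
    "S k j * refl_height (H k) y < 0 \<Longrightarrow> fan s S H (k + 1) j x y"
proof -
  note f = f[unfolded fan_def]
  have Sx: "S k x = - S k j"
    using f S_sgn[OF p, of k x] S_sgn[OF p, of k j] SH[OF p, of k x] by auto
  show w: "w k = y"
    by (rule w_unique[OF p]) (use f Sx s_sgn[OF p, of k] in \<open>auto simp: add.assoc\<close>)
  have d: "j \<noteq> y" "x \<noteq> y" using f by auto
  show 1: "s (k + 1) = - s k" by (rule s_Suc[OF p])
  show 2: "S (k + 1) j = S k j" using S_Suc[OF p] w d by auto
  show 3: "H (k + 1) j = 0" using H_Suc[OF p] w d f by auto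
  show "H (k + 1) x = H k x" using H_Suc[OF p] w d by auto
  show 4: "H (k + 1) y = refl_height (H k) y" using H_w[OF p, of k] w by simp
  show "fan s S H (k + 1) j x y" if "S k j * refl_height (H k) y < 0"
    using that f 1 2 3 4 unfolding fan_def by auto
qed

text \<open>Half a turn is six angles of \<open>pi/6\<close>. If no edge at the vertex lies on the
  line, six crossings point-reflect the tile; if the edge to \<open>y\<close> does, five crossings
  lead to the edge on the opposite ray. By hypothesis \<open>b\<close>, \<open>y\<close> is on the
  line or on the other side of it than \<open>x\<close>, so copy \<open>k\<close> is where the turn
  begins.\<close>

lemma core_1:
  assumes p: "tpath w s S H" and f: "fan s S H k 1 y x" and b: "S k 1 * H k y \<ge> 0"
  shows "w k = y \<and> w (k+1) = x \<and> w (k+2) = y \<and> w (k+3) = x \<and> w (k+4) = y \<and>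
    s (k+5) = - s k \<and> S (k+5) 1 = S k 1 \<and> H (k+5) 1 = 0 \<and> H (k+5) y = - H k y \<and>
    S k 1 * H (k+5) x < 0 \<and>
    (H k y \<noteq> 0 \<longrightarrow> w (k+5) = x \<and> H (k+6) y = - H k y \<and> H (k+6) x = - H k x \<and> H (k+6) 1 = 0 \<and>
      S (k+6) 1 = S k 1 \<and> s (k+6) = s k)"
proof -
  have yx: "y = 2 \<and> x = 0 \<or> y = 0 \<and> x = 2" using f by (auto simp: fan_def)
  have H1: "H k 1 = 0" and x0: "S k 1 * H k x < 0" using f by (auto simp: fan_def)
  note st = fan_step[OF p]
  note r = refl_height_def
  have 1: "fan s S H (k+1) 1 x y"
    by (rule st(7)[OF f]) (use b x0 H1 yx S_sgn[OF p, of k 1] in \<open>auto simp: r diff_divide_distrib add_divide_distrib\<close>)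
  have 2: "fan s S H (k+1+1) 1 y x"
    by (rule st(7)[OF 1]) (use st(1-6)[OF f] b x0 H1 yx S_sgn[OF p, of k 1] in \<open>auto simp: r diff_divide_distrib add_divide_distrib\<close>)
  have 3: "fan s S H (k+1+1+1) 1 x y"
    by (rule st(7)[OF 2]) (use st(1-6)[OF f] st(1-6)[OF 1] b x0 H1 yx S_sgn[OF p, of k 1] in \<open>auto simp: r diff_divide_distrib add_divide_distrib\<close>)
  have 4: "fan s S H (k+1+1+1+1) 1 y x"
    by (rule st(7)[OF 3])
      (use st(1-6)[OF f] st(1-6)[OF 1] st(1-6)[OF 2] b x0 H1 yx S_sgn[OF p, of k 1] in \<open>auto simp: r diff_divide_distrib add_divide_distrib\<close>)
  note all = st(1-6)[OF f] st(1-6)[OF 1] st(1-6)[OF 2] st(1-6)[OF 3] st(1-6)[OF 4]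
  have e: "k+1+1 = k+2" "k+2+1 = k+3" "k+3+1 = k+4" "k+4+1 = k+5" "k+5+1 = k+6" by auto
  have A: "w k = y \<and> w (k+1) = x \<and> w (k+2) = y \<and> w (k+3) = x \<and> w (k+4) = y \<and>
    s (k+5) = - s k \<and> S (k+5) 1 = S k 1 \<and> H (k+5) 1 = 0 \<and> H (k+5) y = - H k y \<and>
    S k 1 * H (k+5) x < 0"
    using all[unfolded e] b x0 H1 yx S_sgn[OF p, of k 1] by (auto simp: r diff_divide_distrib add_divide_distrib)
  have H5: "H (k+5) x = (if y = 2 then H k x - 3 / 2 * H k y else H k x - 2 * H k y)"
    using all[unfolded e] H1 yx by (auto simp: r diff_divide_distrib add_divide_distrib)
  have "w (k+5) = x \<and> H (k+6) y = - H k y \<and> H (k+6) x = - H k x \<and> H (k+6) 1 = 0 \<and>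
      S (k+6) 1 = S k 1 \<and> s (k+6) = s k" if "H k y \<noteq> 0"
  proof -
    have "S k 1 * H k y > 0" using b that S_sgn[OF p, of k 1] by auto
    then have 5: "fan s S H (k+1+1+1+1+1) 1 x y"
      using st(7)[OF 4] st(6)[OF 4, symmetric] A all(3)[unfolded e] st(3)[OF 1] st(3)[OF 2] st(3)[OF 3] 
      unfolding e by auto
    show ?thesis using A H5 st(1-6)[OF 5, unfolded e] yx by (auto simp: r diff_divide_distrib add_divide_distrib)
  qed
  with A show ?thesis by blast
qed

text \<open>The same with two angles of \<open>pi/2\<close>: one crossing if the edge to
  \<open>y\<close> lies on the line, and two otherwise.\<close>

lemma core_0:
  assumes p: "tpath w s S H" and f: "fan s S H k 0 y x" and b: "S k 0 * H k y \<ge> 0"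
  shows "w k = y \<and> s (k+1) = - s k \<and> S (k+1) 0 = S k 0 \<and> H (k+1) 0 = 0 \<and> H (k+1) y = - H k y \<and>
    S k 0 * H (k+1) x < 0 \<and>
    (H k y \<noteq> 0 \<longrightarrow> w (k+1) = x \<and> H (k+2) y = - H k y \<and> H (k+2) x = - H k x \<and> H (k+2) 0 = 0 \<and>
      S (k+2) 0 = S k 0 \<and> s (k+2) = s k)"
proof -
  have yx: "y = 1 \<and> x = 2 \<or> y = 2 \<and> x = 1" using f by (auto simp: fan_def)
  have H1: "H k 0 = 0" and x0: "S k 0 * H k x < 0" using f by (auto simp: fan_def)
  note st = fan_step[OF p]
  note r = refl_height_def
  note all = st(1-6)[OF f]
  have "w (k+1) = x \<and> H (k+2) y = - H k y \<and> H (k+2) x = - H k x \<and> H (k+2) 0 = 0 \<and>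
      S (k+2) 0 = S k 0 \<and> s (k+2) = s k" if "H k y \<noteq> 0"
  proof -
    have "S k 0 * H k y > 0" using b that S_sgn[OF p, of k 0] by auto
    then have 1: "fan s S H (k+1) 0 x y"
      by (intro st(7)[OF f]) (use all b x0 H1 yx S_sgn[OF p, of k 0] in \<open>auto simp: r diff_divide_distrib add_divide_distrib\<close>)
    have e: "k+1+1 = k+2" by auto
    show ?thesis using all st(1-6)[OF 1, unfolded e] b x0 H1 yx S_sgn[OF p, of k 0]
      by (auto simp: r diff_divide_distrib add_divide_distrib)
  qed
  moreover have "w k = y \<and> s (k+1) = - s k \<and> S (k+1) 0 = S k 0 \<and> H (k+1) 0 = 0 \<and> H (k+1) y = - H k y \<and>
    S k 0 * H (k+1) x < 0"
    using all b x0 H1 yx S_sgn[OF p, of k 0] by (auto simp: r diff_divide_distrib add_divide_distrib)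
  ultimately show ?thesis by blast
qed

text \<open>Three angles of \<open>pi/3\<close> make the half-turn. As three is odd, the result is
  no point reflection: the rays to \<open>0\<close> and \<open>1\<close> are exchanged, and the
  factors 2 and 1/2 are the ratio of the two sides that meet at \<open>2\<close>.\<close>

lemma core_2:
  assumes p: "tpath w s S H" and f: "fan s S H k 2 y x" and b: "S k 2 * H k y \<ge> 0"
  shows "w k = y \<and> w (k+1) = x \<and> s (k+2) = s k \<and> S (k+2) 2 = S k 2 \<and> H (k+2) 2 = 0 \<and>
    (H (k+2) x = 0 \<longleftrightarrow> H k y = 0) \<and> S k 2 * H (k+2) y < 0 \<and> S k 2 * H (k+1) y < 0 \<and> S k 2 * H (k+1) x < 0 \<and>
    (H k y \<noteq> 0 \<longrightarrow> w (k+2) = y \<and> H (k+3) 1 = - 2 * H k 0 \<and> H (k+3) 0 = - H k 1 / 2 \<and> H (k+3) 2 = 0 \<and>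
      S (k+3) 2 = S k 2 \<and> s (k+3) = - s k \<and> H (k+2) x \<noteq> 0)"
proof -
  have yx: "y = 0 \<and> x = 1 \<or> y = 1 \<and> x = 0" using f by (auto simp: fan_def)
  have H1: "H k 2 = 0" and x0: "S k 2 * H k x < 0" using f by (auto simp: fan_def)
  note st = fan_step[OF p]
  note r = refl_height_def
  have 1: "fan s S H (k+1) 2 x y"
    by (rule st(7)[OF f]) (use b x0 H1 yx S_sgn[OF p, of k 2] in \<open>auto simp: r diff_divide_distrib add_divide_distrib\<close>)
  have e: "k+1+1 = k+2" "k+2+1 = k+3" by auto
  note all = st(1-6)[OF f] st(1-6)[OF 1, unfolded e]
  have A: "w k = y \<and> w (k+1) = x \<and> s (k+2) = s k \<and> S (k+2) 2 = S k 2 \<and> H (k+2) 2 = 0 \<and>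
    (H (k+2) x = 0 \<longleftrightarrow> H k y = 0) \<and> S k 2 * H (k+2) y < 0 \<and> S k 2 * H (k+1) y < 0 \<and> S k 2 * H (k+1) x < 0"
    using all b x0 H1 yx S_sgn[OF p, of k 2] by (auto simp: r diff_divide_distrib add_divide_distrib)
  have "w (k+2) = y \<and> H (k+3) 1 = - 2 * H k 0 \<and> H (k+3) 0 = - H k 1 / 2 \<and> H (k+3) 2 = 0 \<and>
      S (k+3) 2 = S k 2 \<and> s (k+3) = - s k \<and> H (k+2) x \<noteq> 0" if "H k y \<noteq> 0"
  proof -
    have "S k 2 * H k y > 0" using b that S_sgn[OF p, of k 2] by auto
    then have 2: "fan s S H (k+1+1) 2 y x"
      by (intro st(7)[OF 1]) (use all b x0 H1 yx S_sgn[OF p, of k 2] in \<open>auto simp: r diff_divide_distrib add_divide_distrib\<close>)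
    show ?thesis using all st(1-6)[OF 2, unfolded e] b x0 H1 yx that S_sgn[OF p, of k 2]
      by (auto simp: r diff_divide_distrib add_divide_distrib)
  qed
  with A show ?thesis by blast
qed

lemma arrives_not_forced: "arrives s H k j \<Longrightarrow> \<not> forced s H k"
proof
  assume a: "arrives s H k j" and "forced s H k"
  then obtain i where "s k * H k (i + 2) > 0" "s k * H k (i + 1) < 0" by (auto simp: forced_def)
  with a show False using label_cases[of i] label_cases[of j] by (auto simp: arrives_def)
qed

lemma leaves_forced: "leaves s H k j \<Longrightarrow> forced s H k"
  by (auto simp: leaves_def forced_def)

text \<open>The edge just crossed has its endpoints strictly on different sides, so only the third
  vertex can be on the line; if it is off the line, it is separated from one of these
  endpoints.\<close>

lemma forced_step:
  assumes p: "tpath w s S H" and f: "forced s H k"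
  shows "arrives s H (k + 1) (w k) \<or> forced s H (k + 1) \<and> (\<forall>j. H (k + 1) j \<noteq> 0)"
proof -
  obtain i where i: "s k * H k (i + 2) > 0" "s k * H k (i + 1) < 0"
    using f by (auto simp: forced_def)
  have w: "w k = i" by (rule w_forced[OF p i])
  have H: "H (k + 1) (i + 1) = H k (i + 1)" "H (k + 1) (i + 2) = H k (i + 2)"
    using H_Suc[OF p, of _ k] w by auto
  have 1: "s (k + 1) * H (k + 1) (i + 1) > 0" "s (k + 1) * H (k + 1) (i + 2) < 0"
    using i H s_Suc[OF p, of k] by auto
  have s: "s (k + 1) = 1 \<or> s (k + 1) = -1" by (rule s_sgn[OF p])
  have all_l: "j = i \<or> j = i + 1 \<or> j = i + 2" for j
    using label_cases[of j] label_cases[of i] by auto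
  consider "H (k + 1) i = 0" | "s (k + 1) * H (k + 1) i > 0" | "s (k + 1) * H (k + 1) i < 0"
  proof -
    have "s (k + 1) * H (k + 1) i = 0 \<Longrightarrow> H (k + 1) i = 0" using s by auto
    then show ?thesis using that by (metis linorder_neqE_linordered_idom)
  qed
  then show ?thesis
  proof cases
    case 1
    then show ?thesis using \<open>s (k + 1) * H (k + 1) (i + 1) > 0\<close> \<open>s (k + 1) * H (k + 1) (i + 2) < 0\<close> w
      by (auto simp: arrives_def)
  next
    case 2
    have "forced s H (k + 1)" unfolding forced_def
      by (rule exI[of _ "i + 1"]) (use 1 2 in \<open>auto simp: add.assoc\<close>)
    moreover have "H (k + 1) j \<noteq> 0" for j
      using all_l[of j] 1 2 by (metis less_irrefl mult_zero_right)
    ultimately show ?thesis by blast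
  next
    case 3
    have "forced s H (k + 1)" unfolding forced_def
      by (rule exI[of _ "i + 2"]) (use 1 3 in \<open>auto simp: add.assoc\<close>)
    moreover have "H (k + 1) j \<noteq> 0" for j
      using all_l[of j] 1 3 by (metis less_irrefl mult_zero_right)
    ultimately show ?thesis by blast
  qed
qed

text \<open>Were all later copies forced, \<open>forced_step\<close> would keep vertices off the
  line in copy \<open>k + n\<close>, where periodicity puts vertex \<open>j\<close> on it.\<close>

lemma segment:
  assumes p: "tpath w s S H" and l: "leaves s H k j"
    and per: "n > 0" "H (k + n) = H k" "s (k + n) = s k"
  shows "\<exists>m::nat. m \<ge> 1 \<and> arrives s H (k + int m) (w (k + int m - 1)) \<and>
           (\<forall>i<m. forced s H (k + int i)) \<and> (\<forall>i. 0 < i \<and> i < m \<longrightarrow> (\<forall>j. H (k + int i) j \<noteq> 0))"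
proof -
  have ex: "\<exists>i::nat. \<not> forced s H (k + int i)"
  proof (rule ccontr)
    assume "\<not> ?thesis"
    then have F: "forced s H (k + int (nat (n - 1)))" "forced s H (k + int (nat n))" by blast+
    have e: "k + int (nat (n - 1)) + 1 = k + n" "k + int (nat n) = k + n" using per by auto
    have "H (k + n) j = 0" using l per by (simp add: leaves_def)
    with forced_step[OF p F(1)] F(2) arrives_not_forced show False unfolding e by blast
  qed
  define m where "m = (LEAST i::nat. \<not> forced s H (k + int i))"
  have m: "\<not> forced s H (k + int m)" unfolding m_def using ex by (rule LeastI_ex)
  have lt: "forced s H (k + int i)" if "i < m" for i
    using not_less_Least[of i] that unfolding m_def by blast
  have "m \<noteq> 0" using m leaves_forced[OF l] by (cases m) auto
  have e: "k + int m - 1 = k + int (m - 1)" "k + int m = k + int (m - 1) + 1"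
    using \<open>m \<noteq> 0\<close> by auto
  have "arrives s H (k + int m) (w (k + int m - 1))"
    using forced_step[OF p lt[of "m - 1"]] m \<open>m \<noteq> 0\<close> unfolding e[symmetric] by simp
  moreover have "H (k + int i) j \<noteq> 0" if "0 < i" "i < m" for i j
  proof -
    have e: "k + int i = k + int (i - 1) + 1" using that by auto
    have "forced s H (k + int (i - 1))" by (rule lt) (use that in auto)
    from forced_step[OF p this] lt[OF that(2)] arrives_not_forced show ?thesis unfolding e by blast
  qed
  ultimately show ?thesis using \<open>m \<noteq> 0\<close> lt by (intro exI[of _ m]) auto
qed

text \<open>\<open>determined\<close>, applied to the path and its half-turn image: from two
  point-reflected copies, one followed forwards and one backwards, the path stays
  point-reflected.\<close>

lemma mirror:
  assumes p: "tpath w s S H" and eq: "s a = s b" "\<And>j. H a j = - H b j"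
    and f: "\<And>i::nat. i < m \<Longrightarrow> forced s H (a + int i)"
  shows "s (a + int m) = s (b - int m) \<and> (\<forall>j. H (a + int m) j = - H (b - int m) j) \<and>
         (\<forall>i<m. w (a + int i) = w (b - int i - 1))"
  using determined[OF p tpath_reverse[OF p], of a "- b" m] eq f by (auto simp: fun_eq_iff)

text \<open>A vertex moves only when the opposite edge is crossed. Both orders of \<open>k\<close>
  and \<open>l\<close> are covered, since the turn about a vertex may begin in a copy after the
  given one.\<close>

definition same_vertex :: "(int \<Rightarrow> 3) \<Rightarrow> int \<Rightarrow> int \<Rightarrow> 3 \<Rightarrow> bool" where
  "same_vertex w k l j \<longleftrightarrow> (\<forall>i. k \<le> i \<and> i < l \<or> l \<le> i \<and> i < k \<longrightarrow> w i \<noteq> j)"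

lemma same_vertex_const:
  assumes "same_vertex w k l j" and "\<And>i. w i \<noteq> j \<Longrightarrow> f (i + 1) = f i"
  shows "f k = f l"
proof -
  have *: "f k = f l" if "k \<le> l" "\<And>i. k \<le> i \<Longrightarrow> i < l \<Longrightarrow> w i \<noteq> j" for k l :: int
    using that
  proof (induction l rule: int_ge_induct)
    case base then show ?case by simp
  next
    case (step i) then show ?case using assms(2)[of i] by auto
  qed
  show ?thesis
  proof (cases "k \<le> l")
    case True then show ?thesis using * assms(1) by (auto simp: same_vertex_def)
  next
    case False then show ?thesis using *[of l k] assms(1) by (auto simp: same_vertex_def)
  qed
qed

text \<open>Go back to the copy \<open>a\<close> in which the vertex first appears. The turn about
  it begins there, or one copy later if the path first crosses an edge that lies on the
  line.\<close>

lemma online_core: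
  assumes p: "tpath w s S H" and h: "H k j = 0" and ev: "\<exists>i<k. w i = j"
  shows "\<exists>k0 y x. same_vertex w k k0 j \<and> fan s S H k0 j y x \<and>
           (H k0 y = 0 \<or> arrives s H k0 j \<and> S k0 j * H k0 y > 0)"
proof -
  obtain i0 where i0: "i0 < k" "w i0 = j" using ev by blast
  obtain m::nat where "w (k - 1 - int m) = j" and mm: "\<And>i. i < m \<Longrightarrow> w (k - 1 - int i) \<noteq> j"
  proof -
    have "\<exists>m::nat. w (k - 1 - int m) = j" using i0 by (intro exI[of _ "nat (k - 1 - i0)"]) auto
    from LeastI_ex[OF this] not_less_Least show ?thesis by (rule that)
  qed
  define a where "a = k - int m"
  have wa: "w (a - 1) = j" using \<open>w (k - 1 - int m) = j\<close> by (simp add: a_def algebra_simps)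
  have wn: "w i \<noteq> j" if "a \<le> i" "i < k" for i
    using mm[of "nat (k - 1 - i)"] that by (auto simp: a_def)
  have sv: "same_vertex w k a j" using wn by (auto simp: same_vertex_def a_def)
  have Ha: "H a j = 0"
    using same_vertex_const[OF sv, of "\<lambda>i. H i j"] H_Suc[OF p, of j] h by auto
  have s: "s a = 1 \<or> s a = -1" by (rule s_sgn[OF p])
  have sa: "s (a - 1) = - s a" using s_Suc[OF p, of "a - 1"] by simp
  have S1: "S a (j + 1) = s a" and S2: "S a (j + 2) = - s a"
    using S_w1[OF p, of "a - 1"] S_w2[OF p, of "a - 1"] S_Suc[OF p, of _ "a - 1"] wa sa s by auto
  have H1: "s a * H a (j + 1) \<ge> 0" and H2: "s a * H a (j + 2) \<le> 0"
    using SH[OF p, of a "j + 1"] SH[OF p, of a "j + 2"] S1 S2 by auto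
  have nd: "\<not> (H a (j + 1) = 0 \<and> H a (j + 2) = 0)"
    using H_nondeg[OF p, of a] Ha label_cases[of j] by auto
  have Sj: "S a j = s a \<or> S a j = - s a" using S_sgn[OF p, of a j] s by auto
  show ?thesis
  proof (cases "H a (j + 1) = 0 \<or> H a (j + 2) = 0")
    case False
    then have ar: "arrives s H a j" using H1 H2 Ha s by (auto simp: arrives_def)
    show ?thesis
    proof (cases "S a j = s a")
      case True
      then show ?thesis using ar sv by (intro exI[of _ a] exI[of _ "j + 1"] exI[of _ "j + 2"])
          (auto simp: fan_def arrives_def)
    next
      case F: False
      then show ?thesis using ar sv Sj by (intro exI[of _ a] exI[of _ "j + 2"] exI[of _ "j + 1"])
          (auto simp: fan_def arrives_def)
    qed
  next
    case True
    have "\<exists>y x. {x, y} = {j + 1, j + 2} \<and> x \<noteq> y \<and> H a y = 0 \<and> H a x \<noteq> 0"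
    proof (cases "H a (j + 1) = 0")
      case True then show ?thesis using nd by (intro exI[of _ "j + 1"] exI[of _ "j + 2"]) auto
    next
      case False then show ?thesis using True by (intro exI[of _ "j + 2"] exI[of _ "j + 1"]) auto
    qed
    then obtain y x where yx: "{x, y} = {j + 1, j + 2}" "x \<noteq> y" "H a y = 0" "H a x \<noteq> 0" by blast
    have ny: "y \<noteq> j" "x \<noteq> j" using yx by (auto simp: doubleton_eq_iff)
    show ?thesis
    proof (cases "S a j = s a \<and> y = j + 1 \<or> S a j = - s a \<and> y = j + 2")
      case True
      then have "fan s S H a j y x" using yx Ha H1 H2 nd s by (auto simp: fan_def doubleton_eq_iff)
      then show ?thesis using sv yx by blast
    next
      case False
      then have F: "S a j = s a \<and> y = j + 2 \<and> x = j + 1 \<or> S a j = - s a \<and> y = j + 1 \<and> x = j + 2"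
        using yx Sj by (auto simp: doubleton_eq_iff)
      \<comment> \<open>\<open>y\<close> and \<open>j\<close> are on different sides of the path, so
        it crosses their edge. That edge lies on the line, and the reflection in it negates the
        height of \<open>x\<close>.\<close>
      have w: "w a = x"
        by (rule w_unique[OF p]) (use F S1 S2 s in \<open>auto simp: add.assoc\<close>)
      have Hy: "H (a + 1) y = 0" "H (a + 1) j = 0" "S (a + 1) j = S a j"
        using H_Suc[OF p, of _ a] S_Suc[OF p, of _ a] w yx Ha ny by auto
      have Hx: "H (a + 1) x = - H a x"
        using H_w[OF p, of a] w yx Ha ny label_cases[of x] label_cases[of y] label_cases[of j]
        by (auto simp: refl_height_def)
      have "fan s S H (a + 1) j y x"
        using F Hy Hx s_Suc[OF p, of a] H1 H2 yx s unfolding fan_def by auto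
      moreover have "same_vertex w k (a + 1) j"
      proof -
        have "w a \<noteq> j" using w ny by simp
        then have W: "w i \<noteq> j" if "a \<le> i" "i < k \<or> i < a + 1" for i
          using wn[of i] that by (cases "i = a") auto
        have "a \<le> k" by (simp add: a_def)
        then have "w i \<noteq> j" if "k \<le> i \<and> i < a + 1 \<or> a + 1 \<le> i \<and> i < k" for i
          using that by (intro W) auto
        then show ?thesis by (simp add: same_vertex_def)
      qed
      ultimately show ?thesis using Hy by blast
    qed
  qed
qed

section \<open>Orientations of the tiles and the lattice of the vertices \<open>1\<close>\<close>

lemma int_rec:
  fixes d :: "int \<Rightarrow> int"
  shows "\<exists>X. X 0 = c \<and> (\<forall>k. X (k + 1) = X k + d k)"
proof -
  define X where "X k = (if k \<ge> 0 then c + sum d {0..<k} else c - sum d {k..<0})" for k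
  have "X (k + 1) = X k + d k" for k
  proof -
    consider "k \<ge> 0" | "k = -1" | "k < -1" by linarith
    then show ?thesis
    proof cases
      case 1
      then have "{0..<k + 1} = insert k {0..<k}" by auto
      with 1 show ?thesis by (simp add: X_def)
    next
      case 2
      then have "{k..<0} = {k}" by auto
      with 2 show ?thesis by (simp add: X_def)
    next
      case 3
      then have "{k..<0} = insert k {k + 1..<0}" by auto
      with 3 show ?thesis by (simp add: X_def)
    qed
  qed
  then show ?thesis by (intro exI[of _ X]) (simp add: X_def)
qed

text \<open>The twelve orientations of a tile: \<open>hexx i\<close> and \<open>hexy i\<close> are the coordinates of the \<open>i\<close>-th of
  the six shortest vectors of the triangular lattice, in clockwise or counterclockwise order.\<close>

definition hexx :: "int \<Rightarrow> int" where
  "hexx i = (if i mod 6 = 0 \<or> i mod 6 = 1 then 1 else if i mod 6 = 3 \<or> i mod 6 = 4 then -1 else 0)"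

definition hexy :: "int \<Rightarrow> int" where
  "hexy i = (if i mod 6 = 4 \<or> i mod 6 = 5 then 1 else if i mod 6 = 1 \<or> i mod 6 = 2 then -1 else 0)"

definition hexh :: "real \<Rightarrow> real \<Rightarrow> int \<Rightarrow> real" where
  "hexh a b i = a * hexx i + b * hexy i"

text \<open>A tile lies in the lattice triangle at its vertex \<open>1\<close> that is spanned by
  the directions \<open>r\<close> and \<open>r - 1\<close>. Its vertex \<open>2\<close> is the
  centroid, and the orientation tells on which of the two spanning edges its vertex \<open>0\<close>
  lies.\<close>

definition flag :: "real \<Rightarrow> int \<Rightarrow> int" where
  "flag \<sigma> r = (if \<sigma> = 1 then r else r - 1)"

text \<open>Changes of the direction from vertex \<open>1\<close> to vertex \<open>2\<close>, in
  units of \<open>pi/3\<close>: letter \<open>2\<close> swings \<open>2\<close> about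
  \<open>1\<close> by twice \<open>pi/6\<close>, letter \<open>1\<close> swings \<open>1\<close>
  about \<open>2\<close> by twice \<open>pi/3\<close> the other way, and letter \<open>0\<close>
  reflects in this very side.\<close>

definition dir_step :: "3 \<Rightarrow> int" where
  "dir_step i = (if i = 1 then -2 else if i = 2 then 1 else 0)"

text \<open>The vertices \<open>1\<close> form the lattice generated by 6 times the hexagonal
  vectors; the vertices \<open>0\<close> are midpoints of its edges and the vertices
  \<open>2\<close> centroids of its triangles, whence the factors 3 and 2. Only heights matter, so
  the plane enters through the heights \<open>a\<close>, \<open>b\<close> of two basis
  vectors.\<close>

definition frames ::
  "(int \<Rightarrow> 3) \<Rightarrow> (int \<Rightarrow> real) \<Rightarrow> (int \<Rightarrow> 3 \<Rightarrow> real) \<Rightarrow> real \<Rightarrow> real \<Rightarrow> (int \<Rightarrow> int) \<Rightarrow> bool" where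
  "frames w s H a b r \<longleftrightarrow> \<not> (a = 0 \<and> b = 0) \<and>
     (\<forall>k. r (k + 1) = r k + (if s k = 1 then 1 else - 1) * dir_step (w k) \<and>
        H k 0 - H k 1 = 3 * hexh a b (flag (s k) (r k)) \<and>
        H k 2 - H k 1 = 2 * (hexh a b (r k) + hexh a b (r k - 1)))"

lemma mod6_cases: "(i::int) mod 6 = 0 \<or> i mod 6 = 1 \<or> i mod 6 = 2 \<or> i mod 6 = 3 \<or> i mod 6 = 4 \<or> i mod 6 = 5"
  using pos_mod_sign[of 6 i] pos_mod_bound[of 6 i] by linarith

lemma mod6_diff:
  "(i::int) mod 6 = 0 \<Longrightarrow> (i - 1) mod 6 = 5" "(i::int) mod 6 = 1 \<Longrightarrow> (i - 1) mod 6 = 0"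
  "(i::int) mod 6 = 2 \<Longrightarrow> (i - 1) mod 6 = 1" "(i::int) mod 6 = 3 \<Longrightarrow> (i - 1) mod 6 = 2"
  "(i::int) mod 6 = 4 \<Longrightarrow> (i - 1) mod 6 = 3" "(i::int) mod 6 = 5 \<Longrightarrow> (i - 1) mod 6 = 4"
  by (simp_all add: mod_diff_left_eq[of i 6 1, symmetric])

lemma hexh_val:
  "hexh a b i = (if i mod 6 = 0 then a else if i mod 6 = 1 then a - b else if i mod 6 = 2 then - b
     else if i mod 6 = 3 then - a else if i mod 6 = 4 then b - a else b)"
  using mod6_cases[of i] by (auto simp: hexh_def hexx_def hexy_def)

text \<open>In a regular hexagon of vectors each one is the sum of its two neighbours.\<close>

lemma hexh_rec: "hexh a b (i + 1) = hexh a b i - hexh a b (i - 1)"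
proof -
  have "(i + 1) mod 6 = (i mod 6 + 1) mod 6" by (simp add: mod_add_left_eq)
  with mod6_cases[of i] show ?thesis
    by (elim disjE) (simp_all add: hexh_val[of a b "i + 1"] hexh_val[of a b i] hexh_val[of a b "i - 1"] mod6_diff)
qed

lemma hexh_add3: "hexh a b (i + 3) = - hexh a b i"
  using hexh_rec[of a b "i + 2"] hexh_rec[of a b "i + 1"] by (simp add: ac_simps)

text \<open>An equivalence, because the frame chosen in copy \<open>0\<close> has to be propagated
  both forwards and backwards.\<close>

lemma frames_step:
  fixes a b :: real
  assumes p: "tpath w s S H" and r: "r (k + 1) = r k + (if s k = 1 then 1 else - 1) * dir_step (w k)"
  defines "P \<equiv> \<lambda>k. H k 0 - H k 1 = 3 * hexh a b (flag (s k) (r k)) \<and>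
        H k 2 - H k 1 = 2 * (hexh a b (r k) + hexh a b (r k - 1))"
  shows "P (k + 1) \<longleftrightarrow> P k"
proof -
  have "s k = 1 \<or> s k = -1" "s (k + 1) = - s k" by (rule s_sgn[OF p] s_Suc[OF p])+
  moreover have "j \<noteq> w k \<Longrightarrow> H (k + 1) j = H k j" for j by (rule H_Suc[OF p])
  moreover have "H (k + 1) (w k) = refl_height (H k) (w k)" by (rule H_w[OF p])
  moreover have "hexh a b (i - 2) = hexh a b (i - 1) - hexh a b i"
    "hexh a b (i + 1) = hexh a b i - hexh a b (i - 1)" "hexh a b (1 + i) = hexh a b i - hexh a b (i - 1)"
    "hexh a b (i - 3) = - hexh a b i" "hexh a b (i + 2) = - hexh a b (i - 1)" for i
    using hexh_rec[of a b "i - 1"] hexh_rec[of a b i] hexh_add3[of a b "i - 3"] hexh_add3[of a b "i - 1"]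
    by (auto simp: ac_simps)
  ultimately show ?thesis using label_cases[of "w k"] r
    unfolding P_def by (auto simp: flag_def dir_step_def refl_height_def)
qed

lemma frames_exist:
  assumes p: "tpath w s S H"
  shows "\<exists>a b r. frames w s H a b r"
proof -
  from int_rec[of 0 "\<lambda>k. (if s k = 1 then 1 else - 1) * dir_step (w k)"]
  obtain r where r0: "r 0 = 0 \<and> (\<forall>k. r (k + 1) = r k + (if s k = 1 then 1 else - 1) * dir_step (w k))" ..
  then have r: "r 0 = 0" "\<And>k. r (k + 1) = r k + (if s k = 1 then 1 else - 1) * dir_step (w k)"
    by blast+
  define f g where "f = (H 0 0 - H 0 1) / 3" and "g = (H 0 2 - H 0 1) / 2"
  \<comment> \<open>In copy \<open>0\<close> the vertex \<open>0\<close> lies in direction 0 or -1,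
    depending on the orientation, and the heights of these directions are \<open>a\<close> and
    \<open>b\<close>.\<close>
  define a where "a = (if s 0 = 1 then f else g - f)"
  define b where "b = g - a"
  define P where "P = (\<lambda>k. H k 0 - H k 1 = 3 * hexh a b (flag (s k) (r k)) \<and>
        H k 2 - H k 1 = 2 * (hexh a b (r k) + hexh a b (r k - 1)))"
  have step: "P (k + 1) \<longleftrightarrow> P k" for k
    unfolding P_def by (rule frames_step[where r = r and k = k, OF p]) (rule r(2))
  have h: "hexh a b 0 = a" "hexh a b (-1) = b" by (simp_all add: hexh_val)
  have "P 0" using s_sgn[OF p, of 0] h
    by (auto simp: P_def r flag_def a_def b_def f_def g_def)
  have "P k" for k
  proof (induction k rule: int_induct[where k = 0])
    case base show ?case by fact
  next
    case (step1 i) then show ?case using step[of i] by blast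
  next
    case (step2 i) then show ?case using step[of "i - 1"] unfolding diff_add_cancel by blast
  qed
  moreover have "\<not> (a = 0 \<and> b = 0)"
  proof
    assume "a = 0 \<and> b = 0"
    then have "hexh a b i = 0" for i by (simp add: hexh_def)
    with \<open>P 0\<close> H_nondeg[OF p, of 0] show False by (auto simp: P_def)
  qed
  ultimately have "frames w s H a b r" using r0 unfolding frames_def P_def by blast
  then show ?thesis by (intro exI)
qed

context
  fixes w s S H a b r
  assumes p: "tpath w s S H" and fr: "frames w s H a b r"
begin

lemma f0: "H k 0 - H k 1 = 3 * hexh a b (flag (s k) (r k))"
  and f2: "H k 2 - H k 1 = 2 * (hexh a b (r k) + hexh a b (r k - 1))"
  using fr unfolding frames_def by blast+

text \<open>The second family \<open>H'\<close> serves for comparing two parallel lines through one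
  unfolding; on a single line it is \<open>H\<close> itself.\<close>

lemma frame_eq:
  assumes fr': "frames w s H' a b r"
    and "s k = s l" "r k mod 6 = r l mod 6" "H k j = H' l j"
  shows "H k = H' l"
proof -
  have g0: "H' k 0 - H' k 1 = 3 * hexh a b (flag (s k) (r k))"
    and g2: "H' k 2 - H' k 1 = 2 * (hexh a b (r k) + hexh a b (r k - 1))" for k
    using fr' unfolding frames_def by blast+
  have "(r k - 1) mod 6 = (r l - 1) mod 6" using assms(3) by (metis mod_diff_left_eq)
  then have e: "hexh a b (r k) = hexh a b (r l)" "hexh a b (r k - 1) = hexh a b (r l - 1)"
    "hexh a b (flag (s k) (r k)) = hexh a b (flag (s l) (r l))"
    using assms(2-) by (auto simp: hexh_def hexx_def hexy_def flag_def)
  have 1: "H k 1 = H' l 1"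
    using f0[of k] g0[of l] f2[of k] g2[of l] e assms(4) label_cases[of j] by auto
  show ?thesis
  proof
    fix i show "H k i = H' l i"
      using f0[of k] g0[of l] f2[of k] g2[of l] e 1 label_cases[of i] by auto
  qed
qed

lemma frame_opp:
  assumes fr': "frames w s H' a b r"
    and "s k = s l" "r k mod 6 = (r l + 3) mod 6" "H k j = - H' l j"
  shows "H k i = - H' l i"
proof -
  have g0: "H' k 0 - H' k 1 = 3 * hexh a b (flag (s k) (r k))"
    and g2: "H' k 2 - H' k 1 = 2 * (hexh a b (r k) + hexh a b (r k - 1))" for k
    using fr' unfolding frames_def by blast+
  have "r l - 1 + 3 = r l + 3 - 1" by simp
  then have m: "(r k - 1) mod 6 = (r l - 1 + 3) mod 6" using assms(3) by (metis mod_diff_left_eq)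
  have "hexh a b i = hexh a b i'" if "i mod 6 = i' mod 6" for i i'
    using that by (auto simp: hexh_def hexx_def hexy_def)
  from this[OF assms(3)] this[OF m]
  have e: "hexh a b (r k) = - hexh a b (r l)" "hexh a b (r k - 1) = - hexh a b (r l - 1)"
    using hexh_add3[of a b "r l"] hexh_add3[of a b "r l - 1"] by simp_all
  then have e': "hexh a b (flag (s k) (r k)) = - hexh a b (flag (s l) (r l))"
    using assms(2-) by (auto simp: flag_def)
  have 1: "H k 1 = - H' l 1"
    using f0[of k] g0[of l] f2[of k] g2[of l] e e' assms(4) label_cases[of j] by auto
  then show ?thesis
    using f0[of k] g0[of l] f2[of k] g2[of l] e e' 1 label_cases[of i] by auto
qed

text \<open>Expresses the six rotations of a tile by two lattice heights, which turns the uniqueness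
  claims below into six small systems of linear inequalities.\<close>

lemma frame_shift:
  obtains d where "d \<in> {0, 1, 2, 3, 4, 5}" "(r l) mod 6 = (r k + d) mod 6"
    "hexh a b (r l) = (let x = hexh a b (r k); y = hexh a b (r k - 1) in
       if d = 0 then x else if d = 1 then x - y else if d = 2 then - y else if d = 3 then - x
       else if d = 4 then y - x else y)"
    "hexh a b (r l - 1) = (let x = hexh a b (r k); y = hexh a b (r k - 1) in
       if d = 0 then y else if d = 1 then x else if d = 2 then x - y else if d = 3 then - y
       else if d = 4 then - x else y - x)"
proof -
  define d where "d = (r l - r k) mod 6"
  have d: "d \<in> {0, 1, 2, 3, 4, 5}" using mod6_cases[of "r l - r k"] by (auto simp: d_def)
  have m: "r l mod 6 = (r k + d) mod 6" unfolding d_def by (simp add: mod_add_right_eq)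
  then have m': "(r l - 1) mod 6 = (r k + d - 1) mod 6" by (metis mod_diff_left_eq)
  have per: "hexh a b i = hexh a b i'" if "i mod 6 = i' mod 6" for i i'
    using that by (auto simp: hexh_def hexx_def hexy_def)
  have sh: "hexh a b (i + 1) = hexh a b i - hexh a b (i - 1)" "hexh a b (i + 2) = - hexh a b (i - 1)"
    "hexh a b (i + 3) = - hexh a b i" "hexh a b (i + 4) = hexh a b (i - 1) - hexh a b i"
    "hexh a b (i + 5) = hexh a b (i - 1)" for i
    using hexh_rec[of a b i] hexh_add3[of a b "i - 1"] hexh_add3[of a b i] hexh_add3[of a b "i + 1"]
      hexh_add3[of a b "i + 2"] by (auto simp: ac_simps)
  show ?thesis
    by (rule that[OF d m]) (unfold per[OF m] per[OF m'], use d sh[of "r k"] sh[of "r k", unfolded add.commute[of "r k"]] in \<open>auto simp: Let_def\<close>)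
qed

text \<open>The six rotations of a tile of given orientation, moved to a common vertex
  \<open>2\<close>, fill the full angle once with sectors of \<open>pi/3\<close>. The line leaves
  through the interior of just one of them.\<close>

lemma leaves_2_frame:
  assumes fr': "frames w s H' a b r"
    and "leaves s H k 2" and "leaves s H' l 2" and "s k = s l"
  shows "r k mod 6 = r l mod 6"
proof -
  have g0: "H' k 0 - H' k 1 = 3 * hexh a b (flag (s k) (r k))"
    and g2: "H' k 2 - H' k 1 = 2 * (hexh a b (r k) + hexh a b (r k - 1))" for k
    using fr' unfolding frames_def by blast+
  have H: "H k 2 = 0" "s k * H k 1 > 0" "s k * H k 0 < 0" "H' l 2 = 0" "s l * H' l 1 > 0" "s l * H' l 0 < 0"
    using assms(2-) by (auto simp: leaves_def)
  have e: "H k 1 = - 2 * (hexh a b (r k) + hexh a b (r k - 1))"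
    "H' l 1 = - 2 * (hexh a b (r l) + hexh a b (r l - 1))"
    "H k 0 = 3 * hexh a b (flag (s k) (r k)) + H k 1" "H' l 0 = 3 * hexh a b (flag (s l) (r l)) + H' l 1"
    using f0[of k] g0[of l] f2[of k] g2[of l] H by auto
  obtain d where d: "d \<in> {0, 1, 2, 3, 4, 5}" "(r l) mod 6 = (r k + d) mod 6"
    "hexh a b (r l) = (let x = hexh a b (r k); y = hexh a b (r k - 1) in
       if d = 0 then x else if d = 1 then x - y else if d = 2 then - y else if d = 3 then - x
       else if d = 4 then y - x else y)"
    "hexh a b (r l - 1) = (let x = hexh a b (r k); y = hexh a b (r k - 1) in
       if d = 0 then y else if d = 1 then x else if d = 2 then x - y else if d = 3 then - y
       else if d = 4 then - x else y - x)"
    by (rule frame_shift)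
  have "d = 0" using d(1) H[unfolded e] s_sgn[OF p, of k] assms(4) d(3,4)
    by (auto simp: flag_def Let_def)
  with d show ?thesis by simp
qed

text \<open>In an arriving tile the sector at the vertex contains the backward ray of the line,
  hence the shift by 3, which is a half-turn.\<close>

lemma leaves_arrives_2_frame:
  assumes fr': "frames w s H' a b r"
    and "leaves s H k 2" and "arrives s H' l 2" and "s k = s l"
  shows "r l mod 6 = (r k + 3) mod 6"
proof -
  have g0: "H' k 0 - H' k 1 = 3 * hexh a b (flag (s k) (r k))"
    and g2: "H' k 2 - H' k 1 = 2 * (hexh a b (r k) + hexh a b (r k - 1))" for k
    using fr' unfolding frames_def by blast+
  have H: "H k 2 = 0" "s k * H k 1 > 0" "s k * H k 0 < 0" "H' l 2 = 0" "s l * H' l 1 < 0" "s l * H' l 0 > 0"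
    using assms(2-) by (auto simp: leaves_def arrives_def)
  have e: "H k 1 = - 2 * (hexh a b (r k) + hexh a b (r k - 1))"
    "H' l 1 = - 2 * (hexh a b (r l) + hexh a b (r l - 1))"
    "H k 0 = 3 * hexh a b (flag (s k) (r k)) + H k 1" "H' l 0 = 3 * hexh a b (flag (s l) (r l)) + H' l 1"
    using f0[of k] g0[of l] f2[of k] g2[of l] H by auto
  obtain d where d: "d \<in> {0, 1, 2, 3, 4, 5}" "(r l) mod 6 = (r k + d) mod 6"
    "hexh a b (r l) = (let x = hexh a b (r k); y = hexh a b (r k - 1) in
       if d = 0 then x else if d = 1 then x - y else if d = 2 then - y else if d = 3 then - x
       else if d = 4 then y - x else y)"
    "hexh a b (r l - 1) = (let x = hexh a b (r k); y = hexh a b (r k - 1) in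
       if d = 0 then y else if d = 1 then x else if d = 2 then x - y else if d = 3 then - y
       else if d = 4 then - x else y - x)"
    by (rule frame_shift)
  have "d = 3" using d(1) H[unfolded e] s_sgn[OF p, of k] assms(4) d(3,4)
    by (auto simp: flag_def Let_def)
  with d show ?thesis by simp
qed

text \<open>Sectors at a vertex \<open>1\<close> measure \<open>pi/6\<close>, so it takes all twelve
  orientations to fill the full angle once, and the line determines the sign \<open>s\<close> as
  well.\<close>

lemma leaves_1_frame:
  assumes "leaves s H k 1" "leaves s H l 1"
  shows "s k = s l \<and> r k mod 6 = r l mod 6"
proof -
  have H: "H k 1 = 0" "s k * H k 0 > 0" "s k * H k 2 < 0" "H l 1 = 0" "s l * H l 0 > 0" "s l * H l 2 < 0"
    using assms by (auto simp: leaves_def)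
  have e: "H k 2 = 2 * (hexh a b (r k) + hexh a b (r k - 1))"
    "H l 2 = 2 * (hexh a b (r l) + hexh a b (r l - 1))"
    "H k 0 = 3 * hexh a b (flag (s k) (r k))" "H l 0 = 3 * hexh a b (flag (s l) (r l))"
    using f0[of k] f0[of l] f2[of k] f2[of l] H by auto
  obtain d where d: "d \<in> {0, 1, 2, 3, 4, 5}" "(r l) mod 6 = (r k + d) mod 6"
    "hexh a b (r l) = (let x = hexh a b (r k); y = hexh a b (r k - 1) in
       if d = 0 then x else if d = 1 then x - y else if d = 2 then - y else if d = 3 then - x
       else if d = 4 then y - x else y)"
    "hexh a b (r l - 1) = (let x = hexh a b (r k); y = hexh a b (r k - 1) in
       if d = 0 then y else if d = 1 then x else if d = 2 then x - y else if d = 3 then - y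
       else if d = 4 then - x else y - x)"
    by (rule frame_shift)
  have "d = 0 \<and> s k = s l" using d(1) H[unfolded e] s_sgn[OF p, of k] s_sgn[OF p, of l] d(3,4)
    by (auto simp: flag_def Let_def)
  with d show ?thesis by simp
qed

text \<open>Modulo 2 the six vectors give the three nonzero classes, opposite vectors sharing a
  class, and two nonzero classes have even determinant only if they are equal.\<close>

lemma hex_parity:
  assumes "even (hexx i * hexy i' - hexy i * hexx i')"
  shows "(i - i') mod 3 = 0"
  using assms mod6_cases[of i] mod6_cases[of i'] unfolding hexx_def hexy_def
  by (elim disjE) (simp_all, presburger+)

text \<open>Twelve sectors of \<open>pi/2\<close> cover the full angle three times. The direction of
  the lattice edge with midpoint \<open>0\<close>, which is \<open>flag\<close> modulo 3, singles
  out four of them that cover it once.\<close>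

lemma leaves_0_frame:
  assumes "leaves s H k 0" "leaves s H l 0" "(flag (s k) (r k) - flag (s l) (r l)) mod 3 = 0"
  shows "s k = s l \<and> r k mod 6 = r l mod 6"
proof -
  have H: "H k 0 = 0" "s k * H k 2 > 0" "s k * H k 1 < 0" "H l 0 = 0" "s l * H l 2 > 0" "s l * H l 1 < 0"
    using assms by (auto simp: leaves_def)
  have e: "H k 1 = - 3 * hexh a b (flag (s k) (r k))" "H l 1 = - 3 * hexh a b (flag (s l) (r l))"
    "H k 2 = H k 1 + 2 * (hexh a b (r k) + hexh a b (r k - 1))"
    "H l 2 = H l 1 + 2 * (hexh a b (r l) + hexh a b (r l - 1))"
    using f0[of k] f0[of l] f2[of k] f2[of l] H by auto
  obtain d where d: "d \<in> {0, 1, 2, 3, 4, 5}" "(r l) mod 6 = (r k + d) mod 6"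
    "hexh a b (r l) = (let x = hexh a b (r k); y = hexh a b (r k - 1) in
       if d = 0 then x else if d = 1 then x - y else if d = 2 then - y else if d = 3 then - x
       else if d = 4 then y - x else y)"
    "hexh a b (r l - 1) = (let x = hexh a b (r k); y = hexh a b (r k - 1) in
       if d = 0 then y else if d = 1 then x else if d = 2 then x - y else if d = 3 then - y
       else if d = 4 then - x else y - x)"
    by (rule frame_shift)
  from d(2) have "6 dvd r l - (r k + d)" by (simp add: mod_eq_dvd_iff)
  then obtain q where q: "r l = r k + d + 6 * q" by (auto elim!: dvdE simp: algebra_simps)
  have m3: "(x - 6 * q) mod 3 = x mod 3" for x by presburger
  have m: "(flag (s k) (r k) - flag (s l) (r l)) mod 3 =
     (flag (s k) 0 - flag (s l) 0 - d) mod 3"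
    using m3[of "flag (s k) 0 - flag (s l) 0 - d"] by (auto simp: flag_def q algebra_simps)
  have "d = 0 \<and> s k = s l" using d(1) H[unfolded e] s_sgn[OF p, of k] s_sgn[OF p, of l] d(3,4) m assms(3)
    by (auto simp: flag_def Let_def)
  with d show ?thesis by simp
qed

text \<open>Letter \<open>1\<close> moves vertex \<open>1\<close> to the other end of the lattice
  edge whose midpoint is vertex \<open>0\<close>.\<close>

lemma lattice_1:
  assumes "k \<le> l"
  shows "\<exists>(x::int) (y::int). H l 1 - H k 1 = 6 * (a * x + b * y)"
  using assms
proof (induction l rule: int_ge_induct)
  case base show ?case by (intro exI[of _ 0]) simp
next
  case (step l)
  then obtain x :: int and y :: int where xy: "H l 1 - H k 1 = 6 * (a * x + b * y)" by blast
  show ?case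
  proof (cases "w l = 1")
    case True
    then have "H (l + 1) 1 - H l 1 = 6 * hexh a b (flag (s l) (r l))"
      using H_w[OF p, of l] f0[of l] by (simp add: refl_height_def)
    then have "H (l + 1) 1 - H k 1 =
        6 * (a * (x + hexx (flag (s l) (r l))) + b * (y + hexy (flag (s l) (r l))))"
      using xy by (simp add: hexh_def algebra_simps)
    then show ?thesis by (metis of_int_add)
  next
    case False
    then show ?thesis using H_Suc[OF p, of 1 l] xy by auto
  qed
qed

text \<open>A vertex \<open>2\<close> between two vertices \<open>0\<close> on a line forces the latter to be midpoints of parallel
  lattice edges: the two collinear differences are parallel modulo \<open>2\<close>, and nonzero.\<close>

lemma collinear_0_2_0:
  assumes "k \<le> m" "m \<le> l" "H k 0 = 0" "H m 2 = 0" "H l 0 = 0"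
  shows "(flag (s k) (r k) - flag (s l) (r l)) mod 3 = 0"
proof -
  define i i' where "i = flag (s k) (r k)" and "i' = flag (s l) (r l)"
  obtain x :: int and y :: int where xy: "H m 1 - H k 1 = 6 * (a * x + b * y)"
    using lattice_1[OF assms(1)] by blast
  obtain x' :: int and y' :: int where xy': "H l 1 - H m 1 = 6 * (a * x' + b * y')"
    using lattice_1[OF assms(2)] by blast
  define gx gy where "gx = hexx (r m) + hexx (r m - 1)" and "gy = hexy (r m) + hexy (r m - 1)"
  have g: "H m 2 - H m 1 = 2 * (a * gx + b * gy)"
    using f2[of m] by (simp add: hexh_def gx_def gy_def algebra_simps)
  have "a * real_of_int (6 * x + 2 * gx - 3 * hexx i) + b * real_of_int (6 * y + 2 * gy - 3 * hexy i) = 0"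
    using xy g f0[of k] assms by (simp add: hexh_def i_def algebra_simps)
  moreover have "a * real_of_int (6 * x' - 2 * gx + 3 * hexx i') + b * real_of_int (6 * y' - 2 * gy + 3 * hexy i') = 0"
    using xy' g f0[of l] assms by (simp add: hexh_def i'_def algebra_simps)
  moreover have "\<not> (a = 0 \<and> b = 0)" using fr by (auto simp: frames_def)
  \<comment> \<open>Both integer vectors are annihilated by the nonzero functional
    \<open>(a, b)\<close>.\<close>
  ultimately have "real_of_int ((6 * x + 2 * gx - 3 * hexx i) * (6 * y' - 2 * gy + 3 * hexy i') -
      (6 * y + 2 * gy - 3 * hexy i) * (6 * x' - 2 * gx + 3 * hexx i')) = 0"
    unfolding of_int_diff of_int_mult by algebra
  then have "(6 * x + 2 * gx - 3 * hexx i) * (6 * y' - 2 * gy + 3 * hexy i') -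
      (6 * y + 2 * gy - 3 * hexy i) * (6 * x' - 2 * gx + 3 * hexx i') = 0"
    using of_int_eq_0_iff by blast
  moreover have "even ((6 * x + 2 * gx - 3 * hexx i) * (6 * y' - 2 * gy + 3 * hexy i') -
      (6 * y + 2 * gy - 3 * hexy i) * (6 * x' - 2 * gx + 3 * hexx i')) \<longleftrightarrow>
      even (hexx i * hexy i' - hexy i * hexx i')"
    by simp
  ultimately have "even (hexx i * hexy i' - hexy i * hexx i')" by (metis even_zero)
  then show ?thesis unfolding i_def i'_def by (rule hex_parity)
qed

end

lemma s_parity:
  assumes p: "tpath w s S H"
  shows "s (k + int m) = (if even m then s k else - s k)"
proof (induction m)
  case (Suc m)
  have "s (k + int (Suc m)) = - s (k + int m)" using s_Suc[OF p, of "k + int m"] by (simp add: ac_simps)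
  then show ?case using Suc by simp
qed simp

section \<open>Complete half-turns about vertices met transversally\<close>

lemma arrives_fan:
  assumes p: "tpath w s S H" and a: "arrives s H k j"
  defines "y \<equiv> if S k j = s k then j + 1 else j + 2"
  defines "x \<equiv> if S k j = s k then j + 2 else j + 1"
  shows "fan s S H k j y x" "S k j * H k y > 0" "H k y \<noteq> 0"
  using a S_sgn[OF p, of k j] s_sgn[OF p, of k] by (auto simp: fan_def arrives_def y_def x_def)

lemma fan_1:
  assumes p: "tpath w s S H" and a: "arrives s H k 1"
  defines "y \<equiv> if S k 1 = s k then 2 else 0"
  defines "x \<equiv> if S k 1 = s k then 0 else 2"
  shows "leaves s H (k + 6) 1" "H (k + 6) j = - H k j" "s (k + 6) = s k" "S (k + 6) 1 = S k 1"
    "w k = y" "w (k+1) = x" "w (k+2) = y" "w (k+3) = x" "w (k+4) = y" "w (k+5) = x"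
proof -
  have f: "fan s S H k 1 y x" "S k 1 * H k y > 0" "H k y \<noteq> 0"
    using arrives_fan[OF p a] by (auto simp: y_def x_def)
  note c = core_1[OF p f(1)]
  have H1: "H k 1 = 0" using a by (simp add: arrives_def)
  have c': "H (k+6) y = - H k y" "H (k+6) x = - H k x" "H (k+6) 1 = 0"
    using c f by auto
  show "H (k + 6) j = - H k j"
    using c' H1 label_cases[of j] by (auto simp: y_def x_def split: if_splits)
  then have Hn: "H (k + 6) j = - H k j" for j
    using c' H1 label_cases[of j] by (auto simp: y_def x_def split: if_splits)
  show s: "s (k + 6) = s k" "S (k + 6) 1 = S k 1" "w k = y" "w (k+1) = x" "w (k+2) = y" "w (k+3) = x"
    "w (k+4) = y" "w (k+5) = x" using c f by auto
  show "leaves s H (k + 6) 1" using a by (auto simp: leaves_def arrives_def s Hn)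
qed

lemma fan_0:
  assumes p: "tpath w s S H" and a: "arrives s H k 0"
  defines "y \<equiv> if S k 0 = s k then 1 else 2"
  defines "x \<equiv> if S k 0 = s k then 2 else 1"
  shows "leaves s H (k + 2) 0" "H (k + 2) j = - H k j" "s (k + 2) = s k" "S (k + 2) 0 = S k 0"
    "w k = y" "w (k+1) = x"
proof -
  have f: "fan s S H k 0 y x" "S k 0 * H k y > 0" "H k y \<noteq> 0"
    using arrives_fan[OF p a] by (auto simp: y_def x_def)
  note c = core_0[OF p f(1)]
  have H1: "H k 0 = 0" using a by (simp add: arrives_def)
  have c': "H (k+2) y = - H k y" "H (k+2) x = - H k x" "H (k+2) 0 = 0"
    using c f by auto
  show "H (k + 2) j = - H k j"
    using c' H1 label_cases[of j] by (auto simp: y_def x_def split: if_splits)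
  then have Hn: "H (k + 2) j = - H k j" for j
    using c' H1 label_cases[of j] by (auto simp: y_def x_def split: if_splits)
  show s: "s (k + 2) = s k" "S (k + 2) 0 = S k 0" "w k = y" "w (k+1) = x" using c f by auto
  show "leaves s H (k + 2) 0" using a by (auto simp: leaves_def arrives_def s Hn)
qed

lemma fan_2:
  assumes p: "tpath w s S H" and a: "arrives s H k 2"
  defines "y \<equiv> if S k 2 = s k then 0 else 1"
  defines "x \<equiv> if S k 2 = s k then 1 else 0"
  shows "leaves s H (k + 3) 2" "H (k + 3) 1 = - 2 * H k 0" "H (k + 3) 0 = - H k 1 / 2"
    "s (k + 3) = - s k" "S (k + 3) 2 = S k 2" "w k = y" "w (k+1) = x" "w (k+2) = y"
    "j \<noteq> 2 \<Longrightarrow> 0 \<le> i \<Longrightarrow> i \<le> 3 \<Longrightarrow> H (k + i) j \<noteq> 0"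
proof -
  have f: "fan s S H k 2 y x" "S k 2 * H k y > 0" "H k y \<noteq> 0"
    using arrives_fan[OF p a] by (auto simp: y_def x_def)
  note c = core_2[OF p f(1)]
  have H1: "H k 2 = 0" using a by (simp add: arrives_def)
  show H: "H (k + 3) 1 = - 2 * H k 0" "H (k + 3) 0 = - H k 1 / 2"
    and s: "s (k + 3) = - s k" "S (k + 3) 2 = S k 2" "w k = y" "w (k+1) = x" "w (k+2) = y" using c f by auto
  have H2: "H (k + 3) 2 = 0" using c f by auto
  show "leaves s H (k + 3) 2" using a by (auto simp: leaves_def arrives_def s H H2)
  assume j: "j \<noteq> 2" and i: "0 \<le> i" "i \<le> 3"
  have x: "H k x \<noteq> 0" using f(1) by (auto simp: fan_def)
  have yx: "H (k + 1) y \<noteq> 0" "H (k + 1) x \<noteq> 0" "H (k + 2) y \<noteq> 0" "H (k + 2) x \<noteq> 0"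
    using c f by auto
  have 3: "H (k + 3) j \<noteq> 0" using H j a label_cases[of j] by (auto simp: arrives_def)
  have "j = y \<or> j = x" using j label_cases[of j] by (auto simp: y_def x_def)
  then have 0: "H k j \<noteq> 0" "H (k + 1) j \<noteq> 0" "H (k + 2) j \<noteq> 0" using x yx f(3) by blast+
  from i consider "i = 0" | "i = 1" | "i = 2" | "i = 3" by linarith
  then show "H (k + i) j \<noteq> 0" by cases (simp_all add: 0 3)
qed

section \<open>Periodic paths and the symmetries of their straight runs\<close>

locale tiling_path =
  fixes w :: "int \<Rightarrow> 3" and s :: "int \<Rightarrow> real" and S H :: "int \<Rightarrow> 3 \<Rightarrow> real" and n :: int
  assumes p: "tpath w s S H" and n: "n > 0"
    and Hn: "\<And>k. H (k + n) = H k" and sn: "\<And>k. s (k + n) = s k"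
    and Sn: "\<And>k. S (k + n) = S k" and wn: "\<And>k. w (k + n) = w k"
begin

lemma nonzero: "\<exists>j. H k j \<noteq> 0"
proof (rule ccontr)
  assume "\<not> ?thesis"
  then have "H k j = 0" for j by simp
  with H_nondeg[OF p, of k] show False by simp
qed

text \<open>The half-turn that exchanges the two ends carries the forced stretch to itself. Equal
  orientations make its length even, so there is a middle copy, which would be its own point
  reflection and have all heights 0.\<close>

lemma no_palindrome:
  assumes s: "s a = s (a + int m)" and H: "\<And>j. H a j = - H (a + int m) j"
    and f: "\<And>i::nat. i < m \<Longrightarrow> forced s H (a + int i)"
  shows False
proof -
  have "s a \<noteq> - s a" using s_sgn[OF p, of a] by auto
  then have "even m" using s s_parity[OF p, of a m] by metis
  then obtain h where h: "m = 2 * h" by (auto elim: evenE)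
  have fh: "forced s H (a + int i)" if "i < h" for i by (rule f) (use that h in simp)
  have "\<forall>j. H (a + int h) j = - H (a + int m - int h) j"
    using mirror[where a = a and b = "a + int m" and m = h, OF p s H fh] by blast
  moreover have "a + int m - int h = a + int h" by (simp add: h)
  ultimately have "\<forall>j. H (a + int h) j = - H (a + int h) j" by simp
  then have "H (a + int h) j = 0" for j by simp
  with nonzero[of "a + int h"] show False by blast
qed

text \<open>With equal orientations the departing and the arriving copy would be point reflections
  of each other, which \<open>no_palindrome\<close> excludes. Geometrically, the two vertices belong
  to the same translation class of centroids.\<close>

lemma same_class:
  assumes l: "leaves s H k 2" and a: "arrives s H (k + int m) 2"
    and f: "\<And>i::nat. i < m \<Longrightarrow> forced s H (k + int i)"
  shows "s (k + int m) = - s k"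
proof (rule ccontr)
  assume "\<not> ?thesis"
  then have s: "s k = s (k + int m)" using s_sgn[OF p, of k] s_sgn[OF p, of "k + int m"] by auto
  obtain u v r where fr: "frames w s H u v r" using frames_exist[OF p] by blast
  have "r (k + int m) mod 6 = (r k + 3) mod 6" by (rule leaves_arrives_2_frame[OF p fr fr l a s])
  moreover have "H (k + int m) 2 = - H k 2" using l a by (simp add: leaves_def arrives_def)
  ultimately have "H (k + int m) j = - H k j" for j
    using frame_opp[OF p fr fr s[symmetric], of 2 j] by simp
  then show False using no_palindrome[OF s _ f] by simp
qed

lemma same_state_2:
  assumes "leaves s H k 2" "leaves s H l 2" "s k = s l"
  shows "H k = H l"
proof -
  obtain u v r where fr: "frames w s H u v r" using frames_exist[OF p] by blast
  show ?thesis using frame_eq[OF p fr fr assms(3) leaves_2_frame[OF p fr fr assms], of 2] assms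
    by (simp add: leaves_def)
qed

lemma same_state_1:
  assumes "leaves s H k 1" "leaves s H l 1"
  shows "s k = s l \<and> H k = H l"
proof -
  obtain u v r where fr: "frames w s H u v r" using frames_exist[OF p] by blast
  show ?thesis using frame_eq[OF p fr fr, of k l 1] leaves_1_frame[OF p fr assms] assms
    by (simp add: leaves_def)
qed

lemma same_state_0:
  assumes "leaves s H k 0" "leaves s H l 0" "k \<le> m" "m \<le> l" "H m 2 = 0"
  shows "s k = s l \<and> H k = H l"
proof -
  obtain u v r where fr: "frames w s H u v r" using frames_exist[OF p] by blast
  have H0: "H k 0 = 0" "H l 0 = 0" using assms by (simp_all add: leaves_def)
  show ?thesis using frame_eq[OF p fr fr, of k l 0]
      leaves_0_frame[OF p fr assms(1,2) collinear_0_2_0[OF p fr assms(3,4) H0(1) assms(5) H0(2)]] H0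
    by simp
qed

text \<open>The straight path leaves a vertex on the line in copy \<open>k\<close> and arrives at the next one
  in copy \<open>k + m\<close>.\<close>

definition run :: "int \<Rightarrow> 3 \<Rightarrow> nat \<Rightarrow> 3 \<Rightarrow> bool" where
  "run k j m j' \<longleftrightarrow> leaves s H k j \<and> m \<ge> 1 \<and> arrives s H (k + int m) j' \<and>
     (\<forall>i<m. forced s H (k + int i)) \<and> (\<forall>i j. 0 < i \<and> i < m \<longrightarrow> H (k + int i) j \<noteq> 0)"

lemma run_ex: "leaves s H k j \<Longrightarrow> \<exists>m j'. run k j m j'"
  using segment[OF p _ n, of k j] Hn sn unfolding run_def by blast

lemma run_same:
  assumes r: "run k j m j'" and l: "leaves s H l j" and e: "s k = s l" "H k = H l"
  shows "run l j m j' \<and> (\<forall>i\<le>m. s (l + int i) = s (k + int i) \<and> H (l + int i) = H (k + int i)) \<and>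
         (\<forall>i<m. w (l + int i) = w (k + int i))"
proof -
  have E: "s (k + int i) = s (l + int i) \<and> H (k + int i) = H (l + int i) \<and>
      (\<forall>i'<i. w (k + int i') = w (l + int i'))" if "i \<le> m" for i
    by (rule determined[where m = i, OF p p e]) (use r that in \<open>auto simp: run_def\<close>)
  then have "run l j m j'" using r l E[of m] unfolding run_def forced_def arrives_def
    by (metis less_imp_le order_refl)
  then show ?thesis using E E[of m] by auto
qed

lemma run_unique:
  assumes r: "run k j m j'" and r': "run k i m' i'"
  shows "m = m' \<and> j' = i'"
proof -
  have "m = m'"
    using r r' arrives_not_forced unfolding run_def by (metis linorder_neqE_nat)
  moreover from this have "arrives s H (k + int m) j'" "arrives s H (k + int m) i'"
    using r r' by (auto simp: run_def)
  then have "j' = i'" using label_cases[of j'] label_cases[of i'] by (auto simp: arrives_def)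
  ultimately show ?thesis by blast
qed

text \<open>Hypothesis \<open>e\<close> is what a half-turn about a vertex \<open>0\<close> or
  \<open>1\<close> provides: afterwards the path repeats its incoming run backwards, rotated by
  \<open>pi\<close>.\<close>

lemma run_mirror:
  assumes r: "run k j m j'" and l: "leaves s H l j'"
    and e: "s l = s (k + int m)" "\<And>i. H l i = - H (k + int m) i"
  shows "run l j' m j \<and> (\<forall>i\<le>m. s (l + int i) = s (k + int m - int i) \<and>
      (\<forall>i'. H (l + int i) i' = - H (k + int m - int i) i')) \<and>
      (\<forall>i<m. w (l + int i) = w (k + int m - int i - 1))"
proof -
  obtain m' i' where r': "run l j' m' i'" using run_ex[OF l] by blast
  have f: "forced s H (l + int i)" if "i < m'" for i using r' that by (auto simp: run_def)
  have E: "s (l + int i) = s (k + int m - int i) \<and> (\<forall>j. H (l + int i) j = - H (k + int m - int i) j) \<and>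
         (\<forall>i'<i. w (l + int i') = w (k + int m - int i' - 1))" if "i \<le> m'" for i
    by (rule mirror[where m = i, OF p e]) (use f that in auto)
  have km: "leaves s H k j" "\<forall>i<m. forced s H (k + int i)" "m \<ge> 1"
    "arrives s H (k + int m) j'" "\<And>i j. 0 < i \<Longrightarrow> i < m \<Longrightarrow> H (k + int i) j \<noteq> 0"
    using r by (auto simp: run_def)
  have "m' = m"
  proof (rule ccontr)
    assume "m' \<noteq> m"
    then consider "m' < m" | "m < m'" by linarith
    then show False
    proof cases
      case 1
      have "m' \<ge> 1" using r' by (simp add: run_def)
      have "arrives s H (l + int m') i'" using r' by (simp add: run_def)
      then have "H (l + int m') i' = 0" by (simp add: arrives_def)
      then have "H (k + int (m - m')) i' = 0" using E[of m'] 1 by (simp add: of_nat_diff algebra_simps)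
      then show False using km(5)[of "m - m'" i'] 1 \<open>m' \<ge> 1\<close> by auto
    next
      case 2
      have "H (l + int m) j = 0" using E[of m] 2 km(1) by (simp add: leaves_def)
      then show False using r' 2 km(3) unfolding run_def by auto
    qed
  qed
  moreover have "i' = j"
  proof -
    have "H (l + int m) j = 0" using E[of m] km(1) \<open>m' = m\<close> by (simp add: leaves_def)
    moreover have "arrives s H (l + int m) i'" using r' \<open>m' = m\<close> by (simp add: run_def)
    ultimately show ?thesis using label_cases[of j] label_cases[of i'] by (auto simp: arrives_def)
  qed
  ultimately show ?thesis using r' E by auto
qed

end

section \<open>The pattern of vertices on a line through a vertex \<open>2\<close>\<close>

context tiling_path
begin

text \<open>The path is followed over vertices \<open>2\<close>, \<open>c'\<close>,
  \<open>2\<close>, \<open>c\<close>, \<open>2\<close>. Half-turns at \<open>0\<close> and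
  \<open>1\<close> mirror the runs, so the pattern is settled by the two neighbours
  \<open>c'\<close> and \<open>c\<close> of a vertex \<open>2\<close>; unless some run joins two
  vertices \<open>2\<close>, they turn out to be \<open>0\<close> and \<open>1\<close> in some
  order.\<close>

lemma classify:
  assumes a: "arrives s H k 2"
  shows "(\<exists>l m. run l 2 m 2) \<or> (\<exists>l m1 m2. run l 1 m1 2 \<and> run (l + int m1 + 3) 2 m2 0)"
proof -
  define K where "K = k + 3"
  note fk = fan_2[OF p a, folded K_def]
  obtain m c' where r1: "run K 2 m c'" using run_ex[OF fk(1)] by blast
  show ?thesis
  proof (cases "c' = 2")
    case True then show ?thesis using r1 by blast
  next
    case c': False
    have turn: "\<exists>f>0. leaves s H (l + f) c \<and> (\<forall>j. H (l + f) j = - H l j) \<and> s (l + f) = s l"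
      if "arrives s H l c" "c \<noteq> 2" for l c
      using fan_1(1-3)[OF p, of l] fan_0(1-3)[OF p, of l] that label_cases[of c]
      by (metis zero_less_numeral)
    have aK: "arrives s H (K + int m) c'" using r1 by (simp add: run_def)
    obtain f where f: "f > 0" "leaves s H (K + int m + f) c'"
      "\<And>j. H (K + int m + f) j = - H (K + int m) j" "s (K + int m + f) = s (K + int m)"
      using turn[OF aK c'] by blast
    define Kc where "Kc = K + int m + f"
    note f = f[folded Kc_def]
    have rc: "run Kc c' m 2" "s (Kc + int m) = s K" "\<And>j. H (Kc + int m) j = - H K j"
      using run_mirror[OF r1 f(2) f(4) f(3)] by auto
    define D where "D = Kc + int m + 3"
    have aD: "arrives s H (Kc + int m) 2" using rc by (simp add: run_def)
    note fD = fan_2[OF p aD, folded D_def]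
    obtain m' c where rD: "run D 2 m' c" using run_ex[OF fD(1)] by blast
    have sD: "s D = - s K" "s D = s k" unfolding fD(4) rc(2) fk(4) by simp_all
    have aDm: "arrives s H (D + int m') c" using rD by (simp add: run_def)
    \<comment> \<open>Copy \<open>D\<close> is the point reflection of copy \<open>k\<close>, so a
      run from \<open>D\<close> to a vertex \<open>2\<close> has a mirror image that ends at
      \<open>k\<close>. That run starts in the same state as the run from \<open>K\<close>, which
      leads to \<open>c'\<close> instead.\<close>
    have cn: "c \<noteq> 2"
    proof
      assume c: "c = 2"
      have HD: "H D j = - H k j" for j
      proof -
        have "H D 2 = 0" "H k 2 = 0" using fD(1) a by (simp_all add: leaves_def arrives_def)
        moreover have "H D 1 = - H k 1" using fD(2) rc(3)[of 0] fk(3) by simp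
        moreover have "H D 0 = - H k 0" using fD(3) rc(3)[of 1] fk(2) by simp
        ultimately show ?thesis using label_cases[of j] by (elim disjE) simp_all
      qed
      have mm: "s (D + int m') = s (k - int m') \<and> (\<forall>j. H (D + int m') j = - H (k - int m') j)"
        using mirror[where m = m' and a = D and b = k, OF p sD(2) HD] rD unfolding run_def by blast
      then have H': "H (k - int m') j = - H (D + int m') j" for j by simp
      have s': "s (D + int m') = - s D"
        by (rule same_class[OF fD(1)]) (use rD c in \<open>auto simp: run_def\<close>)
      have lv: "leaves s H (k - int m') 2"
        using aDm c conjunct1[OF mm, symmetric] unfolding leaves_def arrives_def H' by simp
      have s2: "s K = s (k - int m')" unfolding conjunct1[OF mm, symmetric] s' sD by simp
      have "run (k - int m') 2 m c'"
        using run_same[OF r1 lv s2 same_state_2[OF fk(1) lv s2]] by blast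
      moreover have "run (k - int m') 2 m' 2"
        using run_mirror[OF rD[unfolded c] lv conjunct1[OF mm, symmetric] H'] by blast
      ultimately show False using run_unique c' by blast
    qed
    obtain g where g: "g > 0" "leaves s H (D + int m' + g) c"
      "\<And>j. H (D + int m' + g) j = - H (D + int m') j" "s (D + int m' + g) = s (D + int m')"
      using turn[OF aDm cn] by blast
    define E where "E = D + int m' + g"
    note g = g[folded E_def]
    have rE: "run E c m' 2" "s (E + int m') = s D"
      using run_mirror[OF rD g(2) g(4) g(3)] by auto
    define F where "F = E + int m' + 3"
    have aF: "arrives s H (E + int m') 2" using rE by (simp add: run_def)
    note fF = fan_2[OF p aF, folded F_def]
    have sF: "s K = s F" using fF(4) rE(2) sD by simp
    have rF: "run F 2 m c'" using run_same[OF r1 fF(1) sF same_state_2[OF fk(1) fF(1) sF]] by blast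
    \<comment> \<open>Equal labels would let the path leave both vertices in the same state and
      reach the next vertices \<open>2\<close> with equal orientations, contrary to
      \<open>s D = - s K\<close>. For label \<open>0\<close> the equality of states relies on the
      vertex \<open>2\<close> of copy \<open>D\<close> in between.\<close>
    have "c \<noteq> c'"
    proof
      assume cc: "c = c'"
      have "s Kc = s E \<and> H Kc = H E"
      proof (cases "c = 1")
        case True
        then show ?thesis using same_state_1 f(2) g(2) cc by blast
      next
        case False
        then have "c = 0" using cn label_cases[of c] by auto
        moreover have "Kc \<le> D" "D \<le> E" using g(1) by (auto simp: D_def E_def)
        moreover have "H D 2 = 0" using fD(1) by (simp add: leaves_def)
        ultimately show ?thesis using same_state_0[of Kc E D] f(2) g(2) cc by blast
      qed
      then have "run E c m 2 \<and> s (E + int m) = s (Kc + int m)"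
        using run_same[OF rc(1), of E] g(2) cc by auto
      moreover from this have "m = m'" using run_unique rE(1) by blast
      ultimately have "s D = s K" using rE(2) rc(2) by simp
      then show False using sD s_sgn[OF p, of K] by auto
    qed
    then consider "c' = 1" "c = 0" | "c' = 0" "c = 1"
      using c' cn label_cases[of c] label_cases[of c'] by auto
    then show ?thesis
    proof cases
      case 1
      then show ?thesis using rc(1) rD unfolding D_def by blast
    next
      case 2
      then show ?thesis using rE(1) rF unfolding F_def by blast
    qed
  qed
qed

text \<open>A run changes the orientation by \<open>same_class\<close>, and so do the three
  crossings of the turn. Together they restore it, and with it the whole state of the previous
  departure.\<close>

lemma line_2:
  assumes r: "run k 2 m 2"
  shows "run (k + int i * (int m + 3)) 2 m 2 \<and> s (k + int i * (int m + 3)) = s k \<and>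
    H (k + int i * (int m + 3)) = H k \<and> (\<forall>l<m. w (k + int i * (int m + 3) + int l) = w (k + int l))"
proof (induction i)
  case 0
  then show ?case using r by simp
next
  case (Suc i)
  define l where "l = k + int i * (int m + 3)"
  have e: "k + int (Suc i) * (int m + 3) = l + int m + 3" by (simp add: l_def algebra_simps)
  have rl: "run l 2 m 2" "s l = s k" "H l = H k" using Suc by (auto simp: l_def)
  have al: "arrives s H (l + int m) 2" "leaves s H l 2" "leaves s H k 2" using rl r by (auto simp: run_def)
  note fl = fan_2[OF p al(1)]
  have "s (l + int m) = - s l" by (rule same_class[OF al(2,1)]) (use rl in \<open>auto simp: run_def\<close>)
  then have sl: "s k = s (l + int m + 3)" using fl(4) rl by simp
  have Hl: "H k = H (l + int m + 3)" by (rule same_state_2[OF al(3) fl(1) sl])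
  show ?case unfolding e using run_same[OF r fl(1) sl Hl] sl Hl by auto
qed

text \<open>Half of the period \<open>1, 2, 0, 2\<close>; the half-turn at \<open>0\<close> supplies
  the other half. The 3 crossings are the turn about the vertex \<open>2\<close>.\<close>

definition cell :: "int \<Rightarrow> nat \<Rightarrow> nat \<Rightarrow> bool" where
  "cell l m1 m2 \<longleftrightarrow> run l 1 m1 2 \<and> run (l + int m1 + 3) 2 m2 0"

text \<open>The offsets add up the runs \<open>m1\<close>, \<open>m2\<close>, \<open>m2\<close>,
  \<open>m1\<close> and the turns at \<open>2\<close>, \<open>0\<close>, \<open>2\<close>,
  \<open>1\<close>: \<open>14 = 3 + 2 + 3 + 6\<close>. The letters are recorded because they, unlike
  the heights, are shared by the unfoldings of nearby triangles.\<close>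

lemma cell_structure:
  assumes c: "cell l m1 m2"
  shows "run (l + int m1 + 3 + int m2 + 2) 0 m2 2"
    "run (l + int m1 + 2 * int m2 + 8) 2 m1 1"
    "cell (l + 2 * int m1 + 2 * int m2 + 14) m1 m2"
    "s (l + 2 * int m1 + 2 * int m2 + 14) = s l" "H (l + 2 * int m1 + 2 * int m2 + 14) = H l"
    "s (l + int m1 + 2 * int m2 + 5) = s (l + int m1 + 3)"
    "i < m2 \<Longrightarrow> w (l + int m1 + 3 + int m2 + 2 + int i) = w (l + int m1 + 3 + int m2 - int i - 1)"
    "i < m1 \<Longrightarrow> w (l + int m1 + 2 * int m2 + 8 + int i) = w (l + int m1 - int i - 1)"
    "i < m1 \<Longrightarrow> w (l + 2 * int m1 + 2 * int m2 + 14 + int i) = w (l + int i)"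
    "i < m2 \<Longrightarrow> w (l + 2 * int m1 + 2 * int m2 + 14 + int m1 + 3 + int i) = w (l + int m1 + 3 + int i)"
proof -
  define L2 where "L2 = l + int m1 + 3"
  define L0 where "L0 = L2 + int m2 + 2"
  define M2 where "M2 = L0 + int m2 + 3"
  define L1 where "L1 = M2 + int m1 + 6"
  have e: "l + int m1 + 3 + int m2 + 2 = L0" "l + int m1 + 2 * int m2 + 8 = M2"
    "l + 2 * int m1 + 2 * int m2 + 14 = L1" "l + int m1 + 2 * int m2 + 5 = L0 + int m2"
    by (simp_all add: L0_def L1_def L2_def M2_def)
  have r1: "run l 1 m1 2" and r2: "run L2 2 m2 0" using c by (auto simp: cell_def L2_def)
  have a2: "arrives s H (l + int m1) 2" and a0: "arrives s H (L2 + int m2) 0" and l1: "leaves s H l 1"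
    using r1 r2 by (auto simp: run_def)
  note f2 = fan_2[OF p a2, folded L2_def] and f0 = fan_0[OF p a0, folded L0_def]
  have R0: "run L0 0 m2 2" "\<forall>i\<le>m2. s (L0 + int i) = s (L2 + int m2 - int i) \<and>
      (\<forall>i'. H (L0 + int i) i' = - H (L2 + int m2 - int i) i')"
    "\<forall>i<m2. w (L0 + int i) = w (L2 + int m2 - int i - 1)"
    using run_mirror[OF r2 f0(1) f0(3) f0(2)] by auto
  have b2: "arrives s H (L0 + int m2) 2" using R0 by (simp add: run_def)
  note g2 = fan_2[OF p b2, folded M2_def]
  have sH: "s (L0 + int m2) = s L2" "\<And>j. H (L0 + int m2) j = - H L2 j" using R0(2) by auto
  have sM: "s M2 = s (l + int m1)" using g2(4) sH f2(4) by simp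
  have HM: "H M2 j = - H (l + int m1) j" for j
  proof -
    have "H M2 2 = 0" "H (l + int m1) 2 = 0" using g2(1) a2 by (simp_all add: leaves_def arrives_def)
    moreover have "H M2 1 = - H (l + int m1) 1" using g2(2) sH(2)[of 0] f2(3) by simp
    moreover have "H M2 0 = - H (l + int m1) 0" using g2(3) sH(2)[of 1] f2(2) by simp
    ultimately show ?thesis using label_cases[of j] by (elim disjE) simp_all
  qed
  have R1: "run M2 2 m1 1" "\<forall>i\<le>m1. s (M2 + int i) = s (l + int m1 - int i) \<and>
      (\<forall>i'. H (M2 + int i) i' = - H (l + int m1 - int i) i')"
    "\<forall>i<m1. w (M2 + int i) = w (l + int m1 - int i - 1)"
    using run_mirror[OF r1 g2(1) sM HM] by auto
  have b1: "arrives s H (M2 + int m1) 1" using R1 by (simp add: run_def)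
  note g1 = fan_1[OF p b1, folded L1_def]
  have sL: "s l = s L1" using g1(3) R1(2) by auto
  have HL: "H l = H L1" using g1(2) R1(2) by (auto simp: fun_eq_iff)
  have r1': "run L1 1 m1 2" "s (L1 + int m1) = s (l + int m1)" "H (L1 + int m1) = H (l + int m1)"
    "\<forall>i<m1. w (L1 + int i) = w (l + int i)"
    using run_same[OF r1 g1(1) sL HL] by auto
  have a2': "arrives s H (L1 + int m1) 2" using r1' by (simp add: run_def)
  note f2' = fan_2[OF p a2']
  have s2: "s L2 = s (L1 + int m1 + 3)" using f2'(4) f2(4) r1'(2) by simp
  have H2: "H L2 = H (L1 + int m1 + 3)"
  proof
    fix j show "H L2 j = H (L1 + int m1 + 3) j"
      using f2'(1-3) f2(1-3) r1'(3) label_cases[of j] by (auto simp: leaves_def)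
  qed
  have r2': "run (L1 + int m1 + 3) 2 m2 0" "\<forall>i<m2. w (L1 + int m1 + 3 + int i) = w (L2 + int i)"
    using run_same[OF r2 f2'(1) s2 H2] by auto
  show "run (l + int m1 + 3 + int m2 + 2) 0 m2 2" "run (l + int m1 + 2 * int m2 + 8) 2 m1 1"
    "cell (l + 2 * int m1 + 2 * int m2 + 14) m1 m2"
    "s (l + 2 * int m1 + 2 * int m2 + 14) = s l" "H (l + 2 * int m1 + 2 * int m2 + 14) = H l"
    "s (l + int m1 + 2 * int m2 + 5) = s (l + int m1 + 3)"
    unfolding e cell_def using R0 R1 r1' r2' sL HL sH L2_def by auto
  show "i < m2 \<Longrightarrow> w (l + int m1 + 3 + int m2 + 2 + int i) = w (l + int m1 + 3 + int m2 - int i - 1)"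
    "i < m1 \<Longrightarrow> w (l + int m1 + 2 * int m2 + 8 + int i) = w (l + int m1 - int i - 1)"
    "i < m1 \<Longrightarrow> w (l + 2 * int m1 + 2 * int m2 + 14 + int i) = w (l + int i)"
    "i < m2 \<Longrightarrow> w (l + 2 * int m1 + 2 * int m2 + 14 + int m1 + 3 + int i) = w (l + int m1 + 3 + int i)"
    unfolding e using R0(3) R1(3) r1'(4) r2'(2) unfolding L2_def by auto
qed

text \<open>The case in which an edge of the tiling, from \<open>y\<close> to \<open>j\<close>, lies
  along the line.\<close>

definition edge_fan :: "int \<Rightarrow> 3 \<Rightarrow> 3 \<Rightarrow> 3 \<Rightarrow> bool" where
  "edge_fan k j y x \<longleftrightarrow> fan s S H k j y x \<and> H k y = 0"

text \<open>A half-turn from an edge on the line to the next edge on the line crosses one edge less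
  than the number 6, 3 or 2 of tile angles.\<close>

definition fan_len :: "3 \<Rightarrow> int" where
  "fan_len j = (if j = 1 then 5 else if j = 2 then 2 else 1)"

text \<open>The edge ahead joins \<open>j\<close> to \<open>q\<close> along the line. If both are on
  the same side of the path, the turn about \<open>q\<close> begins in this copy; otherwise the path
  crosses that edge first, and \<open>\<delta> = 1\<close>.\<close>

lemma edge_next_aux:
  assumes h: "H k j = 0" "H k q = 0" and S: "S k j * H k t < 0"
    and o: "S k j = s k \<and> (j = q + 1 \<and> t = q + 2) \<or> S k j = - s k \<and> (j = q + 2 \<and> t = q + 1)"
  shows "\<exists>\<delta>\<in>{0, 1}. edge_fan (k + \<delta>) q j t \<and> (\<delta> = 1 \<longrightarrow> w k = t)"
proof (cases "S k q = S k j")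
  case True
  then show ?thesis using assms by (intro bexI[of _ 0]) (auto simp: edge_fan_def fan_def)
next
  case False
  then have Sq: "S k q = - S k j" using S_sgn[OF p, of k q] S_sgn[OF p, of k j] by auto
  have wt: "w k = t"
    by (rule w_unique[OF p]) (use o Sq s_sgn[OF p, of k] in \<open>auto simp: add.assoc\<close>)
  have d: "j \<noteq> t" "q \<noteq> t" using o by auto
  have "H (k + 1) t = - H k t"
    using H_w[OF p, of k] wt h o label_cases[of q] by (auto simp: refl_height_def)
  moreover have "H (k + 1) j = 0" "H (k + 1) q = 0" "S (k + 1) q = - S k j" "s (k + 1) = - s k"
    using H_Suc[OF p] S_Suc[OF p] s_Suc[OF p] wt d h Sq by auto
  ultimately show ?thesis using wt S o
    by (intro bexI[of _ 1]) (auto simp: edge_fan_def fan_def)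
qed

lemma edge_fan_letters:
  assumes e: "edge_fan k j y x"
  shows "w k = y" "j = 1 \<Longrightarrow> w (k+1) = x" "j = 1 \<Longrightarrow> w (k+2) = y" "j = 1 \<Longrightarrow> w (k+3) = x"
    "j = 1 \<Longrightarrow> w (k+4) = y" "j = 2 \<Longrightarrow> w (k+1) = x" "j \<noteq> y" "j \<noteq> x" "x \<noteq> y"
    "y = (if S k j = s k then j + 1 else j + 2)" "x = (if S k j = s k then j + 2 else j + 1)"
proof -
  have f: "fan s S H k j y x" "S k j * H k y \<ge> 0" using e by (auto simp: edge_fan_def)
  show "w k = y" by (rule fan_step(1)[OF p f(1)])
  show "j = 1 \<Longrightarrow> w (k+1) = x" "j = 1 \<Longrightarrow> w (k+2) = y" "j = 1 \<Longrightarrow> w (k+3) = x" "j = 1 \<Longrightarrow> w (k+4) = y"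
    using core_1[OF p, of k y x] f by auto
  show "j = 2 \<Longrightarrow> w (k+1) = x" using core_2[OF p, of k y x] f by auto
  show "j \<noteq> y" "j \<noteq> x" "x \<noteq> y" "y = (if S k j = s k then j + 1 else j + 2)"
    "x = (if S k j = s k then j + 2 else j + 1)"
    using f(1) s_sgn[OF p, of k] by (auto simp: fan_def)
qed

text \<open>An even number of tile angles, at \<open>0\<close> and \<open>1\<close>, brings the same
  kind of edge ahead that was behind; the odd number at \<open>2\<close> brings the other kind.
  Hence the choice of \<open>q\<close>.\<close>

lemma edge_next:
  assumes e: "edge_fan k j y x"
  defines "q \<equiv> if j = 2 then x else y" and "t \<equiv> if j = 2 then y else x"
  shows "\<exists>\<delta>\<in>{0, 1}. edge_fan (k + fan_len j + \<delta>) q j t \<and> (\<delta> = 1 \<longrightarrow> w (k + fan_len j) = t)"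
    "H (k + fan_len j) q = 0"
proof -
  have f: "fan s S H k j y x" "S k j * H k y \<ge> 0" "H k y = 0" using e by (auto simp: edge_fan_def)
  have o: "S k j = s k \<and> y = j + 1 \<and> x = j + 2 \<or> S k j = - s k \<and> y = j + 2 \<and> x = j + 1"
    using f(1) by (simp add: fan_def)
  consider "j = 1" | "j = 2" | "j = 0" using label_cases[of j] by blast
  then have "H (k + fan_len j) j = 0 \<and> H (k + fan_len j) q = 0 \<and> S (k + fan_len j) j * H (k + fan_len j) t < 0 \<and>
     (S (k + fan_len j) j = s (k + fan_len j) \<and> (j = q + 1 \<and> t = q + 2) \<or>
      S (k + fan_len j) j = - s (k + fan_len j) \<and> (j = q + 2 \<and> t = q + 1))"
  proof cases
    case 1
    then show ?thesis using core_1[OF p, of k y x] f o by (auto simp: q_def t_def fan_len_def)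
  next
    case 2
    then show ?thesis using core_2[OF p, of k y x] f o by (auto simp: q_def t_def fan_len_def)
  next
    case 3
    then show ?thesis using core_0[OF p, of k y x] f o by (auto simp: q_def t_def fan_len_def)
  qed
  then show "\<exists>\<delta>\<in>{0, 1}. edge_fan (k + fan_len j + \<delta>) q j t \<and> (\<delta> = 1 \<longrightarrow> w (k + fan_len j) = t)"
    "H (k + fan_len j) q = 0"
    using edge_next_aux[of "k + fan_len j" j q t] by blast+
qed

end

section \<open>Unfoldings of nearby triangles\<close>

text \<open>An unfolding of a triangle with angles \<open>\<phi>\<close>, in the plane; \<open>\<rho> j\<close> is the ratio of the sides at vertex \<open>j\<close>.\<close>

definition qpath ::
  "(int \<Rightarrow> 3) \<Rightarrow> (int \<Rightarrow> real) \<Rightarrow> (3 \<Rightarrow> real) \<Rightarrow> (3 \<Rightarrow> real) \<Rightarrow> (int \<Rightarrow> 3 \<Rightarrow> complex) \<Rightarrow> bool" where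
  "qpath w s \<phi> \<rho> P \<longleftrightarrow> (\<forall>j. \<rho> j > 0) \<and>
     (\<forall>k j. (j \<noteq> w k \<longrightarrow> P (k + 1) j = P k j) \<and>
        P k (j + 2) - P k j = of_real (\<rho> j) * cis (s k * \<phi> j) * (P k (j + 1) - P k j))"

text \<open>Abscissas \<open>X\<close> of the vertices, compatible with the heights: the triangles are oriented according to \<open>s\<close>.\<close>

definition along ::
  "(int \<Rightarrow> 3) \<Rightarrow> (int \<Rightarrow> real) \<Rightarrow> (int \<Rightarrow> 3 \<Rightarrow> real) \<Rightarrow> (int \<Rightarrow> 3 \<Rightarrow> real) \<Rightarrow> bool" where
  "along w s H X \<longleftrightarrow> (\<forall>k j. (j \<noteq> w k \<longrightarrow> X (k + 1) j = X k j) \<and>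
     s k * ((X k (j + 1) - X k j) * (H k (j + 2) - H k j)
            - (X k (j + 2) - X k j) * (H k (j + 1) - H k j)) > 0)"

section \<open>Rotations between the copies of an unfolding\<close>

lemma cis_cancel: "cis a * z = cis b * z' \<Longrightarrow> z' = cis (a - b) * z"
proof -
  assume h: "cis a * z = cis b * z'"
  have "z' = cis (- b) * (cis b * z')" by (simp add: mult.assoc[symmetric] cis_mult)
  also have "\<dots> = cis (a - b) * z" unfolding h[symmetric] by (simp add: mult.assoc[symmetric] cis_mult)
  finally show ?thesis .
qed

lemma qpath_Suc: "qpath w s \<phi> \<rho> P \<Longrightarrow> j \<noteq> w k \<Longrightarrow> P (k + 1) j = P k j"
  and qpath_shape: "qpath w s \<phi> \<rho> P \<Longrightarrow>
    P k (j + 2) - P k j = of_real (\<rho> j) * cis (s k * \<phi> j) * (P k (j + 1) - P k j)"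
  and qpath_pos: "qpath w s \<phi> \<rho> P \<Longrightarrow> \<rho> j > 0"
  unfolding qpath_def by blast+

text \<open>The two copies are mirror images in a side at \<open>j\<close>, so the other side at
  \<open>j\<close> is rotated by twice the angle.\<close>

lemma qpath_step:
  assumes q: "qpath w s \<phi> \<rho> P" and s: "s (k + 1) = - s k" and w: "w k = j + 1"
  shows "P (k + 1) (j + 1) - P k j = cis (2 * s k * \<phi> j) * (P k (j + 1) - P k j)"
proof -
  have e: "P (k + 1) j = P k j" "P (k + 1) (j + 2) = P k (j + 2)" using qpath_Suc[OF q] w by auto
  have \<rho>: "\<rho> j > 0" by (rule qpath_pos[OF q])
  have "P k (j + 2) - P k j = of_real (\<rho> j) * cis (- s k * \<phi> j) * (P (k + 1) (j + 1) - P k j)"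
    using qpath_shape[OF q, of "k + 1" j] unfolding e s .
  with qpath_shape[OF q, of k j] have "of_real (\<rho> j) * cis (s k * \<phi> j) * (P k (j + 1) - P k j) =
      of_real (\<rho> j) * cis (- s k * \<phi> j) * (P (k + 1) (j + 1) - P k j)" by (rule trans[OF sym])
  then have "cis (s k * \<phi> j) * (P k (j + 1) - P k j) = cis (- s k * \<phi> j) * (P (k + 1) (j + 1) - P k j)"
    using \<rho> unfolding mult.assoc by simp
  from cis_cancel[OF this] have "P (k + 1) (j + 1) - P k j =
      cis (s k * \<phi> j - - s k * \<phi> j) * (P k (j + 1) - P k j)" .
  moreover have "s k * \<phi> j - - s k * \<phi> j = 2 * s k * \<phi> j" by simp
  ultimately show ?thesis by metis
qed

context
  fixes w s S H \<phi> \<rho> P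
  assumes p: "tpath w s S H" and q: "qpath w s \<phi> \<rho> P"
begin

lemma P_Suc: "j \<noteq> w k \<Longrightarrow> P (k + 1) j = P k j"
  and P_shape: "P k (j + 2) - P k j = of_real (\<rho> j) * cis (s k * \<phi> j) * (P k (j + 1) - P k j)"
  and \<rho>_pos: "\<rho> j > 0"
  using q unfolding qpath_def by blast+

lemma turn_1:
  assumes "w k = j + 1"
  shows "P (k + 1) (j + 1) - P k j = cis (2 * s k * \<phi> j) * (P k (j + 1) - P k j)"
  by (rule qpath_step[OF q s_Suc[OF p] assms])

lemma turn_2:
  assumes "w k = j + 2"
  shows "P (k + 1) (j + 2) - P k j = cis (- (2 * s k * \<phi> j)) * (P k (j + 2) - P k j)"
proof -
  have "P (k + 1) j = P k j" "P (k + 1) (j + 1) = P k (j + 1)" using P_Suc assms by auto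
  note e = this
  have "P (k + 1) (j + 2) - P k j = of_real (\<rho> j) * cis (- s k * \<phi> j) * (P k (j + 1) - P k j)"
    using P_shape[of "k + 1" j] unfolding e s_Suc[OF p] .
  also have "\<dots> = cis (- (2 * s k * \<phi> j)) * (of_real (\<rho> j) * cis (s k * \<phi> j) * (P k (j + 1) - P k j))"
  proof -
    have "cis (- s k * \<phi> j) = cis (- (2 * s k * \<phi> j)) * cis (s k * \<phi> j)" by (simp add: cis_mult mult_ac)
    then show ?thesis by simp
  qed
  also have "\<dots> = cis (- (2 * s k * \<phi> j)) * (P k (j + 2) - P k j)" unfolding P_shape[of k j] ..
  finally show ?thesis .
qed

lemma fan_turn:
  assumes "w k = (if e = s k then j + 1 else j + 2)" "e = 1 \<or> e = -1"
  shows "P (k + 1) (w k) - P k j = cis (2 * e * \<phi> j) * (P k (w k) - P k j)"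
  using turn_1[of k j] turn_2[of k j] assms s_sgn[OF p, of k] by (auto split: if_splits)

text \<open>Two successive reflections in sides through \<open>j\<close> compose to a rotation of
  the whole tile, counterclockwise if the vertex is above the path (\<open>e = 1\<close>).\<close>

lemma fan_turn_2:
  assumes "w k = (if e = s k then j + 1 else j + 2)" "w (k + 1) = (if e = s k then j + 2 else j + 1)"
    "e = 1 \<or> e = -1"
  shows "P (k + 2) i = P k j + cis (2 * e * \<phi> j) * (P k i - P k j)"
proof -
  have s: "s (k + 1) = - s k" "s k = 1 \<or> s k = -1" by (rule s_Suc[OF p] s_sgn[OF p])+
  have w1: "w (k + 1) = (if e = s (k + 1) then j + 1 else j + 2)"
    using assms(2,3) s(2) unfolding s(1) by (elim disjE) simp_all
  have e1: "k + 1 + 1 = k + 2" by simp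
  have d: "w k \<noteq> j" "w (k + 1) \<noteq> j" "w (k + 1) \<noteq> w k" using assms by auto
  have 1: "P (k + 1) (w k) - P k j = cis (2 * e * \<phi> j) * (P k (w k) - P k j)"
    by (rule fan_turn[OF assms(1,3)])
  have 2: "P (k + 2) (w (k + 1)) - P (k + 1) j = cis (2 * e * \<phi> j) * (P (k + 1) (w (k + 1)) - P (k + 1) j)"
    using fan_turn[OF w1 assms(3)] unfolding e1 .
  have 3: "P (k + 1) j = P k j" "P (k + 2) j = P k j" "P (k + 2) (w k) = P (k + 1) (w k)"
    "P (k + 1) (w (k + 1)) = P k (w (k + 1))"
    using P_Suc[of _ k] P_Suc[of _ "k + 1"] d unfolding e1 by auto
  have "i = j \<or> i = w k \<or> i = w (k + 1)"
    using assms label_cases[of i] label_cases[of j] by auto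
  then show ?thesis using 1 2 3 by (auto simp: algebra_simps)
qed

text \<open>Equal letters continue congruent copies congruently, for every triangle. In this way
  symmetries of the limit tiling, once expressed in letters, become exact identities for the nearby
  triangles.\<close>

lemma congruent_step:
  assumes "s a = s b" "w a = w b" "\<And>i. P b i = c * P a i + d"
  shows "P (b + 1) i = c * P (a + 1) i + d"
proof (cases "i = w a")
  case False
  then show ?thesis using P_Suc assms by metis
next
  case True
  define j where "j = w a + 1"
  have wa: "w a = j + 2" "w b = j + 2" using assms by (simp_all add: j_def add.assoc)
  have Pj: "P (a + 1) j = P a j" "P (b + 1) j = P b j" using P_Suc wa by auto
  have "P (b + 1) (j + 2) - P b j = cis (- (2 * s a * \<phi> j)) * (c * (P a (j + 2) - P a j))"
    unfolding turn_2[OF wa(2)] assms(1) using assms(3) by (simp add: algebra_simps)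
  also have "\<dots> = c * (P (a + 1) (j + 2) - P a j)" unfolding turn_2[OF wa(1)] by simp
  finally have "P (b + 1) (j + 2) = P b j + c * (P (a + 1) (j + 2) - P a j)" by (simp add: diff_eq_eq)
  also have "\<dots> = c * P (a + 1) (j + 2) + d" unfolding assms(3) by (simp add: algebra_simps)
  finally show ?thesis using True wa by simp
qed

lemma congruent_step_back:
  assumes "s (a + 1) = s b" "w a = w b" "\<And>i. P b i = c * P (a + 1) i + d"
  shows "P (b + 1) i = c * P a i + d"
proof (cases "i = w a")
  case False
  then show ?thesis using P_Suc assms by metis
next
  case True
  define j where "j = w a + 1"
  have wa: "w a = j + 2" "w b = j + 2" using assms by (simp_all add: j_def add.assoc)
  have sa: "s (a + 1) = - s a" by (rule s_Suc[OF p])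
  have Pj: "P (a + 1) j = P a j" using P_Suc wa by simp
  have "s b = - s a" unfolding sa[symmetric] by (rule assms(1)[symmetric])
  then have sb: "- (2 * s b * \<phi> j) = 2 * s a * \<phi> j" by simp
  have 1: "P a (j + 2) - P a j = cis (- (2 * s b * \<phi> j)) * (P (a + 1) (j + 2) - P a j)"
    unfolding sb turn_2[OF wa(1)] by (simp add: mult.assoc[symmetric] cis_mult)
  have "P (b + 1) (j + 2) - P b j = cis (- (2 * s b * \<phi> j)) * (c * (P (a + 1) (j + 2) - P a j))"
    unfolding turn_2[OF wa(2)] using assms(3) Pj by (simp add: algebra_simps)
  also have "\<dots> = c * (P a (j + 2) - P a j)" unfolding 1 by simp
  finally show ?thesis using assms(3)[of j] Pj True wa by (simp add: algebra_simps)
qed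

lemma congruent_run:
  assumes "s a = s b" "\<And>i. P b i = c * P a i + d" "\<And>i::nat. i < m \<Longrightarrow> w (b + int i) = w (a + int i)"
  shows "P (b + int m) i = c * P (a + int m) i + d"
  using assms(3)
proof (induction m arbitrary: i)
  case 0
  then show ?case using assms(2) by simp
next
  case (Suc m)
  have sm: "s (a + int m) = s (b + int m)" using s_parity[OF p] assms(1) by metis
  have "P (b + int m + 1) i = c * P (a + int m + 1) i + d"
    by (rule congruent_step[OF sm]) (use Suc in auto)
  then show ?case by (simp add: ac_simps)
qed

lemma congruent_mirror:
  assumes "s a = s b" "\<And>i. P b i = c * P a i + d" "\<And>i::nat. i < m \<Longrightarrow> w (b + int i) = w (a - int i - 1)"
  shows "P (b + int m) i = c * P (a - int m) i + d"
  using assms(3)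
proof (induction m arbitrary: i)
  case 0
  then show ?case using assms(2) by simp
next
  case (Suc m)
  have sm: "s (a - int m - 1 + 1) = s (b + int m)"
    using s_parity[OF p, of "a - int m" m] s_parity[OF p, of b m] assms(1) by (auto split: if_splits)
  have "P (b + int m + 1) i = c * P (a - int m - 1) i + d"
    by (rule congruent_step_back[OF sm]) (use Suc in auto)
  then show ?case by (simp add: algebra_simps)
qed

lemma fan_1_rotation:
  assumes a: "arrives s H k 1"
  shows "P (k + 6) i = P k 1 + cis (6 * S k 1 * \<phi> 1) * (P k i - P k 1)"
proof -
  let ?e = "S k 1"
  have e: "?e = 1 \<or> ?e = -1" by (rule S_sgn[OF p])
  have ee: "k + 1 + 1 = k + 2" "k + 2 + 1 = k + 3" "k + 3 + 1 = k + 4" "k + 4 + 1 = k + 5"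
    "k + 2 + 2 = k + 4" "k + 4 + 2 = k + 6" by auto
  have s: "s (k + 2) = s k" "s (k + 4) = s k"
    using s_parity[OF p, of k 2] s_parity[OF p, of k 4] by auto
  note f = fan_1[OF p a]
  have 1: "P (k + 2) i = P k 1 + cis (2 * ?e * \<phi> 1) * (P k i - P k 1)" for i
    by (rule fan_turn_2[where j = 1 and e = ?e, OF _ _ e]) (use f in auto)
  have 2: "P (k + 2 + 2) i = P (k + 2) 1 + cis (2 * ?e * \<phi> 1) * (P (k + 2) i - P (k + 2) 1)" for i
    by (rule fan_turn_2[where j = 1 and e = ?e, OF _ _ e]) (use f s in \<open>auto simp: ee\<close>)
  have 3: "P (k + 4 + 2) i = P (k + 4) 1 + cis (2 * ?e * \<phi> 1) * (P (k + 4) i - P (k + 4) 1)" for i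
    by (rule fan_turn_2[where j = 1 and e = ?e, OF _ _ e]) (use f s in \<open>auto simp: ee\<close>)
  have "cis (6 * ?e * \<phi> 1) = cis (2 * ?e * \<phi> 1) * cis (2 * ?e * \<phi> 1) * cis (2 * ?e * \<phi> 1)"
    by (simp add: cis_mult mult_ac)
  then show ?thesis using 3[of i] 2[of i] 1[of i] 1[of 1] 2[of 1] unfolding ee by (simp add: algebra_simps)
qed

lemma fan_0_rotation:
  assumes a: "arrives s H k 0"
  shows "P (k + 2) i = P k 0 + cis (2 * S k 0 * \<phi> 0) * (P k i - P k 0)"
  by (rule fan_turn_2[where j = 0 and e = "S k 0", OF _ _ S_sgn[OF p]]) (use fan_0[OF p a] in auto)

text \<open>Three crossings reverse the orientation, so one turn about \<open>2\<close> is not a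
  rotation, but two such turns can be compared: they agree if taken on the same side and differ by
  six angles if taken on opposite sides.\<close>

lemma fan_2_rotation:
  assumes a: "arrives s H k 2" and b: "arrives s H l 2" and e: "s k = s l" "\<And>i. P l i = c * P k i + d"
  shows "P (l + 3) i = P l 2 + cis (3 * (S l 2 - S k 2) * \<phi> 2) * c * (P (k + 3) i - P k 2)"
proof (cases "S l 2 = S k 2")
  case True
  have "w (l + int i) = w (k + int i)" if "i < 3" for i
  proof -
    have "i = 0 \<or> i = 1 \<or> i = 2" using that by auto
    then show ?thesis using fan_2(6-8)[OF p a] fan_2(6-8)[OF p b] True e(1) by auto
  qed
  from congruent_run[OF e this, of 3] show ?thesis using True e(2)[of 2] by (simp add: algebra_simps)
next
  case False
  then have S: "S l 2 = - S k 2" using S_sgn[OF p, of l 2] S_sgn[OF p, of k 2] by auto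
  let ?e = "S k 2" and ?q = "P k 2"
  have ee: "?e = 1 \<or> ?e = -1" by (rule S_sgn[OF p])
  have ek: "k + 1 + 1 = k + 2" "k + 2 + 1 = k + 3" "l + 1 + 1 = l + 2" "l + 2 + 1 = l + 3" by auto
  have s: "s (k + 1) = - s k" "s (k + 2) = s k" "s (l + 1) = - s l" "s (l + 2) = s l" "s k = 1 \<or> s k = -1"
    using s_Suc[OF p] s_sgn[OF p, of k] s_parity[OF p, of k 2] s_parity[OF p, of l 2] by auto
  define y x :: 3 where "y = (if ?e = s k then 0 else 1)" and "x = (if ?e = s k then 1 else 0)"
  have wk: "w k = y" "w (k + 1) = x" "w (k + 2) = y"
    using fan_2(6-8)[OF p a] by (auto simp: y_def x_def)
  have wl: "w l = x" "w (l + 1) = y" "w (l + 2) = x"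
    using fan_2(6-8)[OF p b] S e(1) ee s(5) by (auto simp: y_def x_def)
  let ?c = "cis (2 * ?e * \<phi> 2)" and ?d = "cis (- (2 * ?e * \<phi> 2))"
  have k1: "P (k + 2) i = ?q + ?c * (P k i - ?q)" for i
    by (rule fan_turn_2[where e = ?e, OF _ _ ee]) (use wk in \<open>auto simp: y_def x_def\<close>)
  have k2: "P (k + 3) y - P (k + 2) 2 = ?c * (P (k + 2) y - P (k + 2) 2)" "P (k + 3) x = P (k + 2) x"
     "P (k + 3) 2 = P (k + 2) 2"
    using fan_turn[where k = "k + 2" and e = ?e and j = 2, OF _ ee] wk s P_Suc[of _ "k + 2"]
    unfolding ek by (auto simp: y_def x_def)
  have l1: "P (l + 2) i = P l 2 + ?d * (P l i - P l 2)" for i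
    using fan_turn_2[where k = l and e = "- ?e" and j = 2 and i = i] wl e(1) s(5) ee
    by (auto simp: y_def x_def)
  have l2: "P (l + 3) x - P (l + 2) 2 = ?d * (P (l + 2) x - P (l + 2) 2)" "P (l + 3) y = P (l + 2) y"
     "P (l + 3) 2 = P (l + 2) 2"
    using fan_turn[where k = "l + 2" and e = "- ?e" and j = 2] wl s P_Suc[of _ "l + 2"] e(1) ee
    unfolding ek by (auto simp: y_def x_def)
  have "cis (3 * (S l 2 - S k 2) * \<phi> 2) = ?d * ?d * ?d" by (simp add: S cis_mult mult_ac)
  note C = this
  have dc: "?d * ?c = 1" by (simp add: cis_mult)
  have i: "i = 2 \<or> i = y \<or> i = x" using label_cases[of i] by (auto simp: y_def x_def)
  have ky: "P k y - ?q = ?d * ?d * (P (k + 3) y - ?q)"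
  proof -
    have "P (k + 2) 2 = ?q" using k1[of 2] by simp
    then have "P (k + 3) y - ?q = ?c * (?c * (P k y - ?q))" using k2(1) k1[of y] by simp
    then have "?d * ?d * (P (k + 3) y - ?q) = (?d * ?c) * ((?d * ?c) * (P k y - ?q))"
      by (simp only: mult_ac)
    then show ?thesis using dc by simp
  qed
  have kx: "P k x - ?q = ?d * (P (k + 3) x - ?q)"
  proof -
    have "P (k + 3) x - ?q = ?c * (P k x - ?q)" using k2(2) k1[of x] by simp
    then have "?d * (P (k + 3) x - ?q) = (?d * ?c) * (P k x - ?q)" by (simp only: mult_ac)
    then show ?thesis using dc by simp
  qed
  have lx: "P (l + 3) x - P l 2 = ?d * ?d * (c * (P k x - ?q))"
    using l2(1) l1[of x] l1[of 2] e(2)[of x] e(2)[of 2] by (simp add: algebra_simps)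
  have ly: "P (l + 3) y - P l 2 = ?d * (c * (P k y - ?q))"
    using l2(2) l1[of y] e(2)[of y] e(2)[of 2] by (simp add: algebra_simps)
  have l2': "P (l + 3) 2 = P l 2" "P (k + 3) 2 = ?q" using l2(3) l1[of 2] k2(3) k1[of 2] by simp_all
  have "P (l + 3) i - P l 2 = ?d * ?d * ?d * c * (P (k + 3) i - ?q)"
    using i
  proof (elim disjE)
    assume "i = y"
    then show ?thesis using ly[unfolded ky] by (simp only: mult_ac)
  next
    assume "i = x"
    then show ?thesis using lx[unfolded kx] by (simp only: mult_ac)
  qed (simp add: l2')
  then show ?thesis unfolding C by (simp add: algebra_simps)
qed

end

section \<open>Order of the vertices along the line\<close>

lemma crossing_sgn:
  fixes x1 x2 h1 h2 \<sigma> :: real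
  assumes "\<sigma> = 1 \<or> \<sigma> = -1"
  shows "(x1 * (\<sigma> * h2) - x2 * (\<sigma> * h1)) / (\<sigma> * h2 - \<sigma> * h1) = (x1 * h2 - x2 * h1) / (h2 - h1)"
proof -
  have "(x1 * (\<sigma> * h2) - x2 * (\<sigma> * h1)) = \<sigma> * (x1 * h2 - x2 * h1)" "\<sigma> * h2 - \<sigma> * h1 = \<sigma> * (h2 - h1)"
    by (simp_all add: algebra_simps)
  then show ?thesis using assms by (metis mult_divide_mult_cancel_left zero_neq_one neg_equal_0_iff_equal)
qed

text \<open>Positions at which the line crosses the edges; \<open>along\<close> makes them increase.\<close>

lemma crossing_order:
  fixes x0 x1 x2 h0 h1 h2 :: real
  assumes "(x1 - x0) * (h2 - h0) - (x2 - x0) * (h1 - h0) > 0" "h1 > 0" "h2 < 0"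
  shows "h0 \<ge> 0 \<Longrightarrow> (x1 * h2 - x2 * h1) / (h2 - h1) < (x0 * h2 - x2 * h0) / (h2 - h0)"
    "h0 \<le> 0 \<Longrightarrow> (x1 * h2 - x2 * h1) / (h2 - h1) < (x1 * h0 - x0 * h1) / (h0 - h1)"
proof -
  let ?D = "(x1 - x0) * (h2 - h0) - (x2 - x0) * (h1 - h0)"
  have 1: "(x1 * h2 - x2 * h1) * (h2 - h0) - (x0 * h2 - x2 * h0) * (h2 - h1) = h2 * ?D"
    and 2: "(x1 * h0 - x0 * h1) * (h2 - h1) - (x1 * h2 - x2 * h1) * (h0 - h1) = h1 * ?D" by algebra+
  show "(x1 * h2 - x2 * h1) / (h2 - h1) < (x0 * h2 - x2 * h0) / (h2 - h0)" if "h0 \<ge> 0"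
  proof -
    have "h2 * ?D < 0" using assms by (simp add: mult_neg_pos)
    then have "(x1 * h2 - x2 * h1) * (h2 - h0) < (x0 * h2 - x2 * h0) * (h2 - h1)" using 1 by linarith
    moreover have "h2 - h1 < 0" "h2 - h0 < 0" using assms that by auto
    ultimately show ?thesis by (simp add: divide_simps mult_ac)
  qed
  show "(x1 * h2 - x2 * h1) / (h2 - h1) < (x1 * h0 - x0 * h1) / (h0 - h1)" if "h0 \<le> 0"
  proof -
    have "h1 * ?D > 0" using assms by simp
    then have "(x1 * h2 - x2 * h1) * (h0 - h1) < (x1 * h0 - x0 * h1) * (h2 - h1)" using 2 by linarith
    moreover have "h2 - h1 < 0" "h0 - h1 < 0" using assms that by auto
    ultimately show ?thesis by (simp add: divide_simps mult_ac)
  qed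
qed

context tiling_path
begin

lemma run_forward:
  assumes r: "run k j m j'" and X: "along w s H X"
  shows "X k j < X (k + int m) j'"
proof -
  define \<xi> where "\<xi> l = (X l (w l + 1) * H l (w l + 2) - X l (w l + 2) * H l (w l + 1)) /
      (H l (w l + 2) - H l (w l + 1))" for l
  have XS: "i \<noteq> w l \<Longrightarrow> X (l + 1) i = X l i" for l i using X by (simp add: along_def)
  have Xo: "s l * ((X l (i + 1) - X l i) * (H l (i + 2) - H l i)
            - (X l (i + 2) - X l i) * (H l (i + 1) - H l i)) > 0" for l i using X by (simp add: along_def)
  have f: "forced s H (k + int i)" if "i < m" for i using r that by (auto simp: run_def)
  have fh: "s l * H l (w l + 2) > 0 \<and> s l * H l (w l + 1) < 0" if "forced s H l" for l
    using that w_forced[OF p] unfolding forced_def by metis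
  have first: "X k j < \<xi> k"
  proof -
    have l: "leaves s H k j" using r by (simp add: run_def)
    have m1: "m \<ge> 1" using r by (simp add: run_def)
    have wj: "w k = j" by (rule w_forced[OF p]) (use l in \<open>auto simp: leaves_def\<close>)
    let ?x0 = "X k j" and ?x1 = "X k (j + 1)" and ?x2 = "X k (j + 2)"
    let ?h1 = "H k (j + 1)" and ?h2 = "H k (j + 2)"
    have h: "H k j = 0" "s k * ?h2 > 0" "s k * ?h1 < 0" using l by (auto simp: leaves_def)
    have D: "s k * ((?x1 - ?x0) * ?h2 - (?x2 - ?x0) * ?h1) > 0" using Xo[of k j] h(1) by simp
    have "s k * (?h2 - ?h1) > 0" using h by (simp add: algebra_simps)
    moreover have "?x0 * (s k * (?h2 - ?h1)) < s k * (?x1 * ?h2 - ?x2 * ?h1)" using D by (simp add: algebra_simps)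
    ultimately have "?x0 < s k * (?x1 * ?h2 - ?x2 * ?h1) / (s k * (?h2 - ?h1))"
      by (rule pos_less_divide_eq[THEN iffD2])
    also have "\<dots> = \<xi> k" using s_sgn[OF p, of k] by (auto simp: \<xi>_def wj minus_divide_left)
    finally show ?thesis .
  qed
  have next_gen: "(H (l + 1) (w l) = 0 \<longrightarrow> \<xi> l < X (l + 1) (w l)) \<and> (forced s H (l + 1) \<longrightarrow> \<xi> l < \<xi> (l + 1))"
    if fl: "forced s H l" for l
  proof -
    define a where "a = w l"
    define \<sigma> where "\<sigma> = s (l + 1)"
    have \<sigma>: "\<sigma> = 1 \<or> \<sigma> = -1" "s l = - \<sigma>" using s_sgn[OF p, of "l + 1"] s_Suc[OF p, of l] by (auto simp: \<sigma>_def)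
    let ?x0 = "X (l + 1) a" and ?x1 = "X (l + 1) (a + 1)" and ?x2 = "X (l + 1) (a + 2)"
    let ?h0 = "\<sigma> * H (l + 1) a" and ?h1 = "\<sigma> * H (l + 1) (a + 1)" and ?h2 = "\<sigma> * H (l + 1) (a + 2)"
    have e: "X l (a + 1) = ?x1" "X l (a + 2) = ?x2" "H l (a + 1) = H (l + 1) (a + 1)"
      "H l (a + 2) = H (l + 1) (a + 2)"
      using XS[of _ l] H_Suc[OF p, of _ l] by (simp_all add: a_def)
    have h: "?h1 > 0" "?h2 < 0" using fh[OF fl] e \<sigma> by (auto simp: a_def)
    have D: "(?x1 - ?x0) * (?h2 - ?h0) - (?x2 - ?x0) * (?h1 - ?h0) > 0"
      using Xo[of "l + 1" a] unfolding \<sigma>_def[symmetric] by (simp add: algebra_simps)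
    have \<xi>l: "\<xi> l = (?x1 * ?h2 - ?x2 * ?h1) / (?h2 - ?h1)"
      unfolding crossing_sgn[OF \<sigma>(1)] by (simp add: \<xi>_def a_def[symmetric] e)
    note co = crossing_order[OF D h]
    have "\<xi> l < ?x0" if "H (l + 1) a = 0"
    proof -
      have "\<xi> l < (?x0 * ?h2 - ?x2 * ?h0) / (?h2 - ?h0)" unfolding \<xi>l by (rule co(1)) (simp add: that)
      also have "\<dots> = ?x0" using h(2) that by (simp add: mult_less_0_iff) auto
      finally show ?thesis .
    qed
    moreover have "\<xi> l < \<xi> (l + 1)" if fo: "forced s H (l + 1)"
    proof -
      have g: "\<sigma> * H (l + 1) (w (l + 1) + 2) > 0" "\<sigma> * H (l + 1) (w (l + 1) + 1) < 0"
        using fh[OF fo] by (auto simp: \<sigma>_def)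
      have "w (l + 1) = a \<or> w (l + 1) = a + 1 \<or> w (l + 1) = a + 2"
        using label_cases[of a] label_cases[of "w (l + 1)"] by auto
      then consider "w (l + 1) = a + 1" | "w (l + 1) = a + 2" using g h by auto
      then show ?thesis
      proof cases
        case 1
        then have w: "w (l + 1) + 1 = a + 2" "w (l + 1) + 2 = a" by (simp_all add: add.assoc)
        have "\<xi> l < (?x0 * ?h2 - ?x2 * ?h0) / (?h2 - ?h0)"
          unfolding \<xi>l by (rule co(1)) (use g w in simp)
        also have "\<dots> = \<xi> (l + 1)" unfolding \<xi>_def w using \<sigma>(1)
          by (auto simp: divide_simps) (auto simp: algebra_simps)
        finally show ?thesis .
      next
        case 2
        then have w: "w (l + 1) + 1 = a" "w (l + 1) + 2 = a + 1" by (simp_all add: add.assoc)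
        have "\<xi> l < (?x1 * ?h0 - ?x0 * ?h1) / (?h0 - ?h1)"
          unfolding \<xi>l by (rule co(2)) (use g w in simp)
        also have "\<dots> = \<xi> (l + 1)" unfolding \<xi>_def w using \<sigma>(1)
          by (auto simp: divide_simps) (auto simp: algebra_simps)
        finally show ?thesis .
      qed
    qed
    ultimately show ?thesis by (simp add: a_def)
  qed
  have inc: "X k j < \<xi> (k + int i)" if "i < m" for i
    using that
  proof (induction i)
    case 0 then show ?case using first by simp
  next
    case (Suc i)
    have "forced s H (k + int i + 1)" using f[of "Suc i"] Suc.prems by (simp add: ac_simps)
    then have "\<xi> (k + int i) < \<xi> (k + int i + 1)" using next_gen[OF f[of i]] Suc.prems by simp
    then show ?case using Suc by (simp add: ac_simps)
  qed
  have m: "m \<ge> 1" and ar: "arrives s H (k + int m) j'" using r by (auto simp: run_def)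
  define l where "l = k + int (m - 1)"
  have l: "k + int m = l + 1" "forced s H l" "X k j < \<xi> l"
    using m f[of "m - 1"] inc[of "m - 1"] by (auto simp: l_def)
  have "arrives s H (l + 1) (w l)" using forced_step[OF p l(2)] ar arrives_not_forced l(1) by metis
  then have "w l = j'" "H (l + 1) (w l) = 0"
    using ar label_cases[of j'] label_cases[of "w l"] unfolding l(1) by (auto simp: arrives_def)
  then show ?thesis using next_gen[OF l(2)] l by auto
qed

lemma edge_fan_forward:
  assumes e: "edge_fan k j y x" and X: "along w s H X"
  shows "X k y < X k j"
proof -
  have Xo: "s k * ((X k (j + 1) - X k j) * (H k (j + 2) - H k j)
            - (X k (j + 2) - X k j) * (H k (j + 1) - H k j)) > 0" using X by (simp add: along_def)
  have h: "H k j = 0" "H k y = 0" "S k j * H k x < 0"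
    "S k j = s k \<and> y = j + 1 \<and> x = j + 2 \<or> S k j = - s k \<and> y = j + 2 \<and> x = j + 1"
    using e by (auto simp: edge_fan_def fan_def)
  then have "(X k y - X k j) * (S k j * H k x) > 0" using Xo by (auto simp: algebra_simps)
  then show ?thesis using h(3) zero_less_mult_iff[of "X k y - X k j" "S k j * H k x"] by linarith
qed

end

context tiling_path
begin

lemma shift_n: "H (k + int i * n) = H k \<and> s (k + int i * n) = s k \<and> S (k + int i * n) = S k \<and> w (k + int i * n) = w k"
proof (induction i)
  case (Suc i)
  have e: "k + int (Suc i) * n = k + int i * n + n" by (simp add: algebra_simps)
  show ?case unfolding e Hn sn Sn wn by (rule Suc)
qed simp

text \<open>An exact relation for all triangles between the neighbours of a vertex on the limit
  line; its angle is \<open>pi\<close> only in the limit. Vertices \<open>2\<close> are excluded,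
  since an odd number of reflections is no rotation.\<close>

lemma half_turn:
  assumes h: "H k j = 0" and j: "j \<noteq> 2" and letters: "\<And>j. \<exists>i. w i = j"
  shows "\<exists>k1 j1 k2 j2. H k1 j1 = 0 \<and> H k2 j2 = 0 \<and>
     (\<forall>X. along w s H X \<longrightarrow> X k1 j1 < X k j \<and> X k j < X k2 j2) \<and>
     (\<forall>P \<phi> \<rho>. qpath w s \<phi> \<rho> P \<longrightarrow>
        P k2 j2 - P k j = cis (S k j * (if j = 1 then 6 * \<phi> 1 else 2 * \<phi> 0)) * (P k1 j1 - P k j))"
proof -
  have "\<exists>i<k. w i = j"
  proof -
    obtain i where i: "w i = j" using letters by blast
    define m where "m = nat (\<bar>i\<bar> + \<bar>k\<bar> + 1)"
    have "int m * n \<ge> int m" using n by (simp add: mult_le_cancel_left1)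
    moreover have "int m = \<bar>i\<bar> + \<bar>k\<bar> + 1" by (simp add: m_def)
    ultimately have "i - int m * n < k" by linarith
    moreover have "w (i - int m * n) = j" using shift_n[of "i - int m * n" m] i by simp
    ultimately show ?thesis by blast
  qed
  from online_core[OF p h this] obtain k0 y x where c: "same_vertex w k k0 j" "fan s S H k0 j y x"
    "H k0 y = 0 \<or> arrives s H k0 j" by blast
  have Pk: "P k j = P k0 j" if "qpath w s \<phi> \<rho> P" for P \<phi> \<rho>
    by (rule same_vertex_const[OF c(1)]) (use that in \<open>auto simp: qpath_def\<close>)
  have Xk: "X k j = X k0 j" if "along w s H X" for X
    by (rule same_vertex_const[OF c(1)]) (use that in \<open>auto simp: along_def\<close>)
  have Sk: "S k j = S k0 j"
    by (rule same_vertex_const[OF c(1)]) (use S_Suc[OF p] in auto)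
  have j01: "j = 1 \<or> j = 0" using j label_cases[of j] by auto
  show ?thesis
  proof (cases "arrives s H k0 j")
    case True
    define f :: int where "f = (if j = 1 then 6 else 2)"
    have fl: "leaves s H (k0 + f) j" "\<And>i. H (k0 + f) i = - H k0 i" "s (k0 + f) = s k0"
      using fan_1(1-3)[OF p] fan_0(1-3)[OF p] True j01 unfolding f_def by auto
    have rot: "P (k0 + f) i = P k0 j + cis (S k j * (if j = 1 then 6 * \<phi> 1 else 2 * \<phi> 0)) * (P k0 i - P k0 j)"
      if "qpath w s \<phi> \<rho> P" for P \<phi> \<rho> i
      using fan_1_rotation[OF p that] fan_0_rotation[OF p that] True j01 unfolding f_def Sk by (auto simp: mult_ac)
    obtain m j2 where r: "run (k0 + f) j m j2" using run_ex[OF fl(1)] by blast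
    \<comment> \<open>After the half-turn the path is the point reflection of its past, so the next
      vertex ahead has a counterpart behind.\<close>
    have mir: "s (k0 + f + int m) = s (k0 - int m) \<and> (\<forall>i. H (k0 + f + int m) i = - H (k0 - int m) i) \<and>
         (\<forall>i<m. w (k0 + f + int i) = w (k0 - int i - 1))"
      by (rule mirror[where m = m, OF p fl(3,2)]) (use r in \<open>auto simp: run_def\<close>)
    have H2: "H (k0 + f + int m) j2 = 0" using r by (simp add: run_def arrives_def)
    then have H1: "H (k0 - int m) j2 = 0" using mir by simp
    have dev: "P (k0 + f + int m) j2 - P k j =
        cis (S k j * (if j = 1 then 6 * \<phi> 1 else 2 * \<phi> 0)) * (P (k0 - int m) j2 - P k j)"
      if "qpath w s \<phi> \<rho> P" for P \<phi> \<rho>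
    proof -
      let ?c = "cis (S k j * (if j = 1 then 6 * \<phi> 1 else 2 * \<phi> 0))"
      have "P (k0 + f + int m) j2 = ?c * P (k0 - int m) j2 + (P k0 j - ?c * P k0 j)"
        by (rule congruent_mirror[OF p that, where a = k0])
          (use fl(3) rot[OF that] mir in \<open>auto simp: algebra_simps\<close>)
      then show ?thesis unfolding Pk[OF that] by (simp add: algebra_simps)
    qed
    have lv: "leaves s H (k0 - int m) j2"
      using r mir H1 unfolding run_def arrives_def leaves_def by auto
    have e1: "s (k0 - int m) = s (k0 + f + int m)" "\<And>i. H (k0 - int m) i = - H (k0 + f + int m) i"
      using mir by auto
    have "run (k0 - int m) j2 m j" using run_mirror[OF r lv e1] by blast
    then have "X (k0 - int m) j2 < X k j" if "along w s H X" for X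
      using run_forward[of "k0 - int m" j2 m j X] that Xk[OF that] by simp
    moreover have "X k j < X (k0 + f + int m) j2" if "along w s H X" for X
    proof -
      have "X (k0 + f) j = X k j"
      proof -
        have "X k0 j = X (k0 + f) j"
        proof (rule same_vertex_const[of w])
          have "w (k0 + i) \<noteq> j" if "0 \<le> i" "i < f" for i
          proof -
            from that j01 have "j = 1 \<and> (i = 0 \<or> i = 1 \<or> i = 2 \<or> i = 3 \<or> i = 4 \<or> i = 5) \<or> j = 0 \<and> (i = 0 \<or> i = 1)"
              unfolding f_def by auto
            then show ?thesis using fan_1(5-10)[OF p, of k0] fan_0(5,6)[OF p, of k0] True
              by (elim disjE conjE) auto
          qed
          from this[of "i - k0" for i] show "same_vertex w k0 (k0 + f) j" by (force simp: same_vertex_def f_def)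
        qed (use that in \<open>auto simp: along_def\<close>)
        then show ?thesis using Xk[OF that] by simp
      qed
      then show ?thesis using run_forward[OF r that] by simp
    qed
    ultimately show ?thesis using H1 H2 dev by blast
  next
    case False
    then have e: "edge_fan k0 j y x" using c by (simp add: edge_fan_def)
    note l = edge_fan_letters[OF e]
    have e1: "k0 + 1 + 1 = k0 + 2" "k0 + 2 + 1 = k0 + 3" "k0 + 3 + 1 = k0 + 4" "k0 + 4 + 1 = k0 + 5" by auto
    have q: "H (k0 + fan_len j) y = 0" using edge_next(2)[OF e] j by simp
    have "\<exists>\<delta>\<in>{0, 1}. edge_fan (k0 + fan_len j + \<delta>) y j x \<and> (\<delta> = 1 \<longrightarrow> w (k0 + fan_len j) = x)"
      using edge_next(1)[OF e] j by simp
    then obtain \<delta> where d: "edge_fan (k0 + fan_len j + \<delta>) y j x" "\<delta> = 0 \<or> \<delta> = 1 \<and> w (k0 + fan_len j) = x"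
      by blast
    have ne: "x \<noteq> y" "x \<noteq> j" using edge_fan_letters(7-9)[OF d(1)] by auto
    have S: "S k0 j = 1 \<or> S k0 j = -1" by (rule S_sgn[OF p])
    have fwd: "X k j < X (k0 + fan_len j) y" if X: "along w s H X" for X
    proof -
      have XS: "i \<noteq> w a \<Longrightarrow> X (a + 1) i = X a i" for i a using X by (simp add: along_def)
      have "X (k0 + fan_len j) j = X k0 j"
        using XS[of j k0] XS[of j "k0 + 1", unfolded e1] XS[of j "k0 + 2", unfolded e1]
          XS[of j "k0 + 3", unfolded e1] XS[of j "k0 + 4", unfolded e1] l j01
        by (auto simp: fan_len_def)
      moreover have "X (k0 + fan_len j + \<delta>) j = X (k0 + fan_len j) j" "X (k0 + fan_len j + \<delta>) y = X (k0 + fan_len j) y"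
        using d(2) XS[of j "k0 + fan_len j"] XS[of y "k0 + fan_len j"] ne by auto
      ultimately show ?thesis using edge_fan_forward[OF d(1) X] Xk[OF X] by simp
    qed
    have dev: "P (k0 + fan_len j) y - P k j =
        cis (S k j * (if j = 1 then 6 * \<phi> 1 else 2 * \<phi> 0)) * (P k0 y - P k j)"
      if Q: "qpath w s \<phi> \<rho> P" for P \<phi> \<rho>
    proof -
      let ?c = "cis (2 * S k0 j * \<phi> j)"
      have PS: "i \<noteq> w a \<Longrightarrow> P (a + 1) i = P a i" for i a using P_Suc[OF p Q] by blast
      have ss: "s (k0 + 1) = - s k0" "s (k0 + 2) = s k0" "s (k0 + 3) = - s k0" "s (k0 + 4) = s k0"
        using s_parity[OF p, of k0 1] s_parity[OF p, of k0 2] s_parity[OF p, of k0 3] s_parity[OF p, of k0 4] by auto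
      have t0: "P (k0 + 1) y - P k0 j = ?c * (P k0 y - P k0 j)"
        using fan_turn[OF p Q, of k0 "S k0 j" j] l S by auto
      show ?thesis
      proof (cases "j = 1")
        case False
        then show ?thesis using t0 j01 unfolding Pk[OF Q] Sk by (simp add: fan_len_def mult_ac)
      next
        case True
        have pj: "P (k0 + 1) j = P k0 j" "P (k0 + 2) j = P k0 j" "P (k0 + 3) j = P k0 j" "P (k0 + 4) j = P k0 j"
          using PS[of j k0] PS[of j "k0 + 1", unfolded e1] PS[of j "k0 + 2", unfolded e1]
            PS[of j "k0 + 3", unfolded e1] l True by auto
        have py: "P (k0 + 2) y = P (k0 + 1) y" "P (k0 + 4) y = P (k0 + 3) y"
          using PS[of y "k0 + 1", unfolded e1] PS[of y "k0 + 3", unfolded e1] l True by auto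
        have t2: "P (k0 + 2 + 1) y - P (k0 + 2) j = ?c * (P (k0 + 2) y - P (k0 + 2) j)"
          using fan_turn[OF p Q, of "k0 + 2" "S k0 j" j] l S ss True by auto
        have t4: "P (k0 + 4 + 1) y - P (k0 + 4) j = ?c * (P (k0 + 4) y - P (k0 + 4) j)"
          using fan_turn[OF p Q, of "k0 + 4" "S k0 j" j] l S ss True by auto
        have e: "k0 + 2 + 1 = k0 + 3" "k0 + 4 + 1 = k0 + 5" by auto
        have "P (k0 + 5) y - P k0 j = ?c * (?c * (?c * (P k0 y - P k0 j)))"
          using t0 t2 t4 unfolding e pj py by simp
        also have "\<dots> = cis (6 * S k0 j * \<phi> j) * (P k0 y - P k0 j)"
          by (simp add: mult.assoc[symmetric] cis_mult) (simp add: mult_ac)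
        finally show ?thesis using True unfolding Pk[OF Q] Sk by (simp add: fan_len_def mult_ac)
      qed
    qed
    have "X k0 y < X k j" if "along w s H X" for X using edge_fan_forward[OF e that] Xk[OF that] by simp
    then show ?thesis using q fwd dev e unfolding edge_fan_def by blast
  qed
qed

end

text \<open>The second turn starts from a rotated image of the end of the first, as happens after a
  half-turn at \<open>0\<close>. On the opposite side it undoes the first turn; on the same side the
  two add up to six angles.\<close>

lemma fan_2_mirror:
  assumes p: "tpath w s S H" and q: "qpath w s \<phi> \<rho> P"
    and a: "arrives s H k 2" and b: "arrives s H l 2" and e: "s l = - s k" "\<And>i. P l i = c * P (k + 3) i + d"
  shows "P (l + 3) i = P l 2 + cis (3 * (S l 2 + S k 2) * \<phi> 2) * c * (P k i - P k 2)"
proof (cases "S l 2 = S k 2")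
  case F: False
  then have S: "S l 2 = - S k 2" using S_sgn[OF p, of l 2] S_sgn[OF p, of k 2] by auto
  have s3: "s (k + 3) = s l" using s_parity[OF p, of k 3] e(1) by simp
  have sk: "s k = 1 \<or> s k = -1" "S k 2 = 1 \<or> S k 2 = -1" by (rule s_sgn[OF p] S_sgn[OF p])+
  have wl: "w (l + int i) = w (k + 3 - int i - 1)" if "i < 3" for i
  proof -
    have "i = 0 \<or> i = 1 \<or> i = 2" using that by auto
    moreover have "w (k + 3 - 0 - 1) = w (k + 2)" "w (k + 3 - 1 - 1) = w (k + 1)" "w (k + 3 - 2 - 1) = w k"
      by (simp_all add: ac_simps)
    ultimately show ?thesis using fan_2(6-8)[OF p a] fan_2(6-8)[OF p b] S e(1) sk by (elim disjE) auto
  qed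
  have "P (l + int 3) i = c * P (k + 3 - int 3) i + d"
    by (rule congruent_mirror[OF p q s3 e(2) wl])
  moreover have "P l 2 = c * P k 2 + d"
  proof -
    have "w k \<noteq> 2" "w (k + 1) \<noteq> 2" "w (k + 2) \<noteq> 2" using fan_2(6-8)[OF p a] by auto
    then have "P (k + 1) 2 = P k 2" "P (k + 1 + 1) 2 = P (k + 1) 2" "P (k + 2 + 1) 2 = P (k + 2) 2"
      using P_Suc[OF p q, of 2 k] P_Suc[OF p q, of 2 "k + 1"] P_Suc[OF p q, of 2 "k + 2"]
      by simp_all
    moreover have "k + 1 + 1 = k + 2" "k + 2 + 1 = k + 3" by auto
    ultimately show ?thesis using e(2)[of 2] by simp
  qed
  ultimately show ?thesis using S by (simp add: algebra_simps)
next
  case True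
  let ?e = "S k 2" and ?q = "P k 2"
  have ee: "?e = 1 \<or> ?e = -1" by (rule S_sgn[OF p])
  have ek: "k + 1 + 1 = k + 2" "k + 2 + 1 = k + 3" "l + 1 + 1 = l + 2" "l + 2 + 1 = l + 3" by auto
  have s: "s (k + 2) = s k" "s (l + 2) = s l" "s k = 1 \<or> s k = -1"
    using s_sgn[OF p, of k] s_parity[OF p, of k 2] s_parity[OF p, of l 2] by auto
  define y x :: 3 where "y = (if ?e = s k then 0 else 1)" and "x = (if ?e = s k then 1 else 0)"
  have wk: "w k = y" "w (k + 1) = x" "w (k + 2) = y"
    using fan_2(6-8)[OF p a] by (auto simp: y_def x_def)
  have wl: "w l = x" "w (l + 1) = y" "w (l + 2) = x"
    using fan_2(6-8)[OF p b] True e(1) ee s(3) by (auto simp: y_def x_def)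
  have ne: "y \<noteq> 2" "x \<noteq> 2" "x \<noteq> y" by (auto simp: y_def x_def)
  let ?c = "cis (2 * ?e * \<phi> 2)"
  have k1: "P (k + 2) i = ?q + ?c * (P k i - ?q)" for i
    by (rule fan_turn_2[OF p q, where e = ?e, OF _ _ ee]) (use wk in \<open>auto simp: y_def x_def\<close>)
  have k2: "P (k + 3) y - P (k + 2) 2 = ?c * (P (k + 2) y - P (k + 2) 2)"
    using fan_turn[OF p q, where k = "k + 2" and e = ?e and j = 2, OF _ ee] wk s
    unfolding ek by (auto simp: y_def x_def)
  have k3: "P (k + 3) x = P (k + 2) x" "P (k + 3) 2 = P (k + 2) 2"
    using P_Suc[OF p q, of _ "k + 2"] wk ne unfolding ek by auto
  have l1: "P (l + 2) i = P l 2 + ?c * (P l i - P l 2)" for i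
    by (rule fan_turn_2[OF p q, where e = ?e, OF _ _ ee]) (use wl e(1) s(3) ee in \<open>auto simp: y_def x_def\<close>)
  have l2: "P (l + 3) x - P (l + 2) 2 = ?c * (P (l + 2) x - P (l + 2) 2)"
    using fan_turn[OF p q, where k = "l + 2" and e = ?e and j = 2, OF _ ee] wl s e(1) ee
    unfolding ek by (auto simp: y_def x_def)
  have l3: "P (l + 3) y = P (l + 2) y" "P (l + 3) 2 = P (l + 2) 2"
    using P_Suc[OF p q, of _ "l + 2"] wl ne unfolding ek by auto
  have C: "cis (3 * (S l 2 + S k 2) * \<phi> 2) = ?c * ?c * ?c" by (simp add: True cis_mult mult_ac)
  have q2: "P (k + 2) 2 = ?q" "P (l + 2) 2 = P l 2" using k1[of 2] l1[of 2] by simp_all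
  have Pl: "P l i - P l 2 = c * (P (k + 3) i - ?q)" for i
    using e(2)[of i] e(2)[of 2] k3(2) q2 by (simp add: algebra_simps)
  have ky: "P (k + 3) y - ?q = ?c * (?c * (P k y - ?q))" using k2 k1[of y] q2 by simp
  have kx: "P (k + 3) x - ?q = ?c * (P k x - ?q)" using k3 k1[of x] by simp
  have lx: "P (l + 3) x - P l 2 = ?c * (?c * (c * (P (k + 3) x - ?q)))"
    using l2 l1[of x] q2 Pl[of x] by simp
  have ly: "P (l + 3) y - P l 2 = ?c * (c * (P (k + 3) y - ?q))" using l3 l1[of y] Pl[of y] by simp
  have "i = 2 \<or> i = y \<or> i = x" using label_cases[of i] by (auto simp: y_def x_def)
  then have "P (l + 3) i - P l 2 = ?c * ?c * ?c * c * (P k i - ?q)"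
  proof (elim disjE)
    assume "i = y"
    then show ?thesis using ly[unfolded ky] by (simp only: mult_ac)
  next
    assume "i = x"
    then show ?thesis using lx[unfolded kx] by (simp only: mult_ac)
  qed (simp add: l3 q2)
  then show ?thesis unfolding C by (simp add: algebra_simps)
qed

context tiling_path
begin

text \<open>A line through vertices \<open>1, 2, 0, 2, 1, 2, 0, 2, \<dots>\<close>: node \<open>i\<close> is the vertex \<open>1\<close> of copy \<open>\<kappa> i\<close>,
  followed by the vertex \<open>2\<close> of copy \<open>q i\<close>, the vertex \<open>0\<close> of copy \<open>g i\<close>, and another vertex \<open>2\<close>;
  \<open>a, b, d, c\<close> are the sides of these four vertices.\<close>

definition chain ::
  "(nat \<Rightarrow> int) \<Rightarrow> (nat \<Rightarrow> int) \<Rightarrow> (nat \<Rightarrow> int) \<Rightarrow> (nat \<Rightarrow> real) \<Rightarrow> (nat \<Rightarrow> real) \<Rightarrow> (nat \<Rightarrow> real) \<Rightarrow>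
    (nat \<Rightarrow> real) \<Rightarrow> nat \<Rightarrow> int \<Rightarrow> bool" where
  "chain \<kappa> q g a b c d N D \<longleftrightarrow> N > 0 \<and>
     (\<forall>i. H (\<kappa> i) 1 = 0 \<and> H (q i) 2 = 0 \<and> H (g i) 0 = 0 \<and>
        a i = S (\<kappa> i) 1 \<and> b i = S (q i) 2 \<and> d i = S (g i) 0 \<and> (c i = 1 \<or> c i = -1) \<and>
        \<kappa> (i + N) = \<kappa> i + D * n \<and> q (i + N) = q i + D * n \<and> g (i + N) = g i + D * n \<and> c (i + N) = c i \<and>
        (\<forall>X. along w s H X \<longrightarrow> X (\<kappa> i) 1 < X (q i) 2 \<and> X (q i) 2 < X (g i) 0) \<and>
        (\<forall>P \<phi> \<rho>. qpath w s \<phi> \<rho> P \<longrightarrow>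
           (let z1 = (\<lambda>i. P (q i) 2 - P (\<kappa> i) 1); z2 = (\<lambda>i. P (g i) 0 - P (q i) 2);
                u = cis (2 * d i * \<phi> 0); v = cis (3 * (b i + c i) * \<phi> 2)
            in P (\<kappa> (i + 1)) 1 - P (\<kappa> i) 1 = z1 i * (1 - u * v) + z2 i * (1 - u) \<and>
               z1 (i + 1) = cis (6 * a (i + 1) * \<phi> 1) * u * v * z1 i \<and>
               z2 (i + 1) * z1 i = cis (3 * (b (i + 1) - b i) * \<phi> 2) * z2 i * z1 (i + 1))))"

lemma vertex_const:
  assumes "\<And>i. k \<le> i \<Longrightarrow> i < l \<Longrightarrow> w i \<noteq> j" "k \<le> l" "\<And>i. w i \<noteq> j \<Longrightarrow> f (i + 1) = f i"
  shows "f l = f k"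
  by (rule same_vertex_const[of w, symmetric]) (use assms in \<open>auto simp: same_vertex_def\<close>)

lemma fan_2_const:
  assumes a: "arrives s H k 2" and f: "\<And>i. w i \<noteq> 2 \<Longrightarrow> f (i + 1) = f i"
  shows "f (k + 3) = f k"
proof (rule vertex_const[of _ _ 2])
  fix i assume "k \<le> i" "i < k + 3"
  then have "i = k \<or> i = k + 1 \<or> i = k + 2" by auto
  then show "w i \<noteq> 2" using fan_2(6-8)[OF p a] by (auto split: if_splits)
qed (use f in auto)

lemma fan_1_const:
  assumes a: "arrives s H k 1" and f: "\<And>i. w i \<noteq> 1 \<Longrightarrow> f (i + 1) = f i"
  shows "f (k + 6) = f k"
proof (rule vertex_const[of _ _ 1])
  fix i assume "k \<le> i" "i < k + 6"
  then have "i = k \<or> i = k + 1 \<or> i = k + 2 \<or> i = k + 3 \<or> i = k + 4 \<or> i = k + 5" by auto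
  then show "w i \<noteq> 1" using fan_1(5-10)[OF p a] by (auto split: if_splits)
qed (use f in auto)

text \<open>After \<open>z1\<close> and \<open>z2\<close>, the half-turn at \<open>0\<close> yields
  the displacement \<open>- u * z2\<close> and the second turn at \<open>2\<close> yields
  \<open>- u * v * z1\<close>; the four add up to the first identity of \<open>chain\<close>. The
  last identity says how \<open>z2 / z1\<close> rotates from node to node, freed of the
  division.\<close>

lemma cell_chain:
  assumes c0: "cell l m1 m2"
  shows "\<exists>\<kappa> q g a b c d N D. chain \<kappa> q g a b c d N D"
proof -
  define M where "M = 2 * int m1 + 2 * int m2 + 14"
  define \<kappa> where "\<kappa> i = l + int i * M" for i :: nat
  define q where "q i = \<kappa> i + int m1" for i
  define g where "g i = \<kappa> i + int m1 + 3 + int m2" for i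
  define q' where "q' i = \<kappa> i + int m1 + 2 * int m2 + 5" for i
  have \<kappa>S: "\<kappa> (i + 1) = \<kappa> i + M" for i by (simp add: \<kappa>_def algebra_simps)
  have cell: "cell (\<kappa> i) m1 m2" for i
  proof (induction i)
    case 0 show ?case using c0 by (simp add: \<kappa>_def)
  next
    case (Suc i)
    have e: "\<kappa> (Suc i) = \<kappa> i + 2 * int m1 + 2 * int m2 + 14"
      by (simp add: \<kappa>_def M_def algebra_simps)
    show ?case using cell_structure(3)[OF Suc] unfolding e .
  qed
  define a where "a i = S (\<kappa> i) 1" for i
  define b where "b i = S (q i) 2" for i
  define c where "c i = S (q' i) 2" for i
  define d where "d i = S (g i) 0" for i
  have main: "H (\<kappa> i) 1 = 0 \<and> H (q i) 2 = 0 \<and> H (g i) 0 = 0 \<and>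
     (\<forall>X. along w s H X \<longrightarrow> X (\<kappa> i) 1 < X (q i) 2 \<and> X (q i) 2 < X (g i) 0)" for i
  proof -
    have r: "run (\<kappa> i) 1 m1 2" "run (q i + 3) 2 m2 0" using cell[of i] by (auto simp: cell_def q_def)
    have aq: "arrives s H (q i) 2" and ag: "arrives s H (g i) 0" and lk: "leaves s H (\<kappa> i) 1"
      using r by (auto simp: run_def q_def g_def)
    have "X (\<kappa> i) 1 < X (q i) 2 \<and> X (q i) 2 < X (g i) 0" if X: "along w s H X" for X
    proof -
      have "X (q i + 3) 2 = X (q i) 2"
        by (rule fan_2_const[OF aq, of "\<lambda>k. X k 2"]) (use X in \<open>auto simp: along_def\<close>)
      moreover have "g i = q i + 3 + int m2" by (simp add: g_def q_def)
      ultimately show ?thesis using run_forward[OF r(1) X] run_forward[OF r(2) X] by (simp add: q_def[of i])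
    qed
    then show ?thesis using aq ag lk by (auto simp: arrives_def leaves_def)
  qed
  have dev: "let z1 = (\<lambda>i. P (q i) 2 - P (\<kappa> i) 1); z2 = (\<lambda>i. P (g i) 0 - P (q i) 2);
                u = cis (2 * d i * \<phi> 0); v = cis (3 * (b i + c i) * \<phi> 2)
            in P (\<kappa> (i + 1)) 1 - P (\<kappa> i) 1 = z1 i * (1 - u * v) + z2 i * (1 - u) \<and>
               z1 (i + 1) = cis (6 * a (i + 1) * \<phi> 1) * u * v * z1 i \<and>
               z2 (i + 1) * z1 i = cis (3 * (b (i + 1) - b i) * \<phi> 2) * z2 i * z1 (i + 1)"
    if Q: "qpath w s \<phi> \<rho> P" for P \<phi> \<rho> i
  proof -
    note cs = cell_structure[OF cell[of i]]
    define L2 L0 M2 b1 \<kappa>' where "L2 = q i + 3" and "L0 = g i + 2" and "M2 = q' i + 3"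
      and "b1 = M2 + int m1" and "\<kappa>' = \<kappa> (i + 1)"
    have kM: "\<kappa>' = \<kappa> i + M" unfolding \<kappa>'_def by (rule \<kappa>S)
    have e: "\<kappa>' = b1 + 6" "L2 = \<kappa> i + int m1 + 3" "g i = L2 + int m2" "q' i = L0 + int m2"
      "M2 = \<kappa> i + int m1 + 2 * int m2 + 8" "\<kappa>' = \<kappa> i + 2 * int m1 + 2 * int m2 + 14"
      "L0 = \<kappa> i + int m1 + 3 + int m2 + 2"
      by (simp_all add: kM M_def L2_def L0_def M2_def b1_def q_def g_def q'_def)
    have rk: "run (\<kappa> i) 1 m1 2" "run L2 2 m2 0" using cell[of i] by (auto simp: cell_def e)
    have r0: "run L0 0 m2 2" and r2: "run M2 2 m1 1" using cs(1,2) unfolding e by auto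
    have aq: "arrives s H (q i) 2" and ag: "arrives s H (g i) 0" and aq': "arrives s H (q' i) 2"
      and a1: "arrives s H b1 1"
      using rk r0 r2 by (auto simp: run_def q_def e b1_def)
    have PS: "w k \<noteq> j \<Longrightarrow> P (k + 1) j = P k j" for k j using P_Suc[OF p Q] by metis
    have PL2: "P L2 2 = P (q i) 2" unfolding L2_def
      by (rule fan_2_const[OF aq, of "\<lambda>k. P k 2"]) (rule PS)
    have PM2: "P M2 2 = P (q' i) 2" unfolding M2_def
      by (rule fan_2_const[OF aq', of "\<lambda>k. P k 2"]) (rule PS)
    have Pb1: "P \<kappa>' 1 = P b1 1" unfolding e(1)
      by (rule fan_1_const[OF a1, of "\<lambda>k. P k 1"]) (rule PS)
    have Sb1: "a (i + 1) = S b1 1" unfolding a_def \<kappa>'_def[symmetric] e(1)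
      by (rule fan_1_const[OF a1, of "\<lambda>k. S k 1"]) (use S_Suc[OF p] in metis)
    let ?u = "cis (2 * d i * \<phi> 0)" and ?v = "cis (3 * (b i + c i) * \<phi> 2)"
    let ?t = "cis (6 * a (i + 1) * \<phi> 1)"
    have s0: "s (g i) = s L0" using fan_0(3)[OF p ag] by (simp add: L0_def)
    have w0: "w (L0 + int j) = w (g i - int j - 1)" if "j < m2" for j
      using cs(7)[OF that] unfolding e by (simp add: algebra_simps)
    have P0: "P L0 j = ?u * P (g i) j + (P (g i) 0 - ?u * P (g i) 0)" for j
      using fan_0_rotation[OF p Q ag, of j] by (simp add: L0_def d_def algebra_simps)
    have "P (L0 + int m2) j = ?u * P (g i - int m2) j + (P (g i) 0 - ?u * P (g i) 0)" for j
      by (rule congruent_mirror[OF p Q s0 P0 w0])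
    then have Pq': "P (q' i) j = ?u * P L2 j + (P (g i) 0 - ?u * P (g i) 0)" for j
      by (simp add: e(3,4))
    have z3: "P (q' i) 2 - P (g i) 0 = - ?u * (P (g i) 0 - P (q i) 2)"
      unfolding Pq' PL2 by (simp add: algebra_simps)
    have sq': "s (q' i) = - s (q i)"
    proof -
      have "s (q' i) = s L2" using cs(6) by (simp add: e(2) q'_def)
      then show ?thesis using fan_2(4)[OF p aq] by (simp add: L2_def)
    qed
    have PM: "P M2 j = P (q' i) 2 + ?v * ?u * (P (q i) j - P (q i) 2)" for j
      using fan_2_mirror[OF p Q aq aq' sq' Pq'[unfolded L2_def], of j]
      by (simp add: M2_def b_def c_def add.commute)
    have sM: "s (q i) = s M2" using fan_2(4)[OF p aq'] sq' by (simp add: M2_def)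
    have wM: "w (M2 + int j) = w (q i - int j - 1)" if "j < m1" for j
      using cs(8)[OF that] unfolding e by (simp add: q_def)
    have "P (M2 + int m1) j = ?v * ?u * P (q i - int m1) j + (P (q' i) 2 - ?v * ?u * P (q i) 2)" for j
      by (rule congruent_mirror[OF p Q sM _ wM]) (use PM in \<open>simp_all add: algebra_simps\<close>)
    then have Pb: "P b1 j = ?v * ?u * P (\<kappa> i) j + (P (q' i) 2 - ?v * ?u * P (q i) 2)" for j
      by (simp add: b1_def q_def)
    have z4: "P \<kappa>' 1 - P (q' i) 2 = - (?u * ?v) * (P (q i) 2 - P (\<kappa> i) 1)"
      unfolding Pb1 Pb by (simp add: algebra_simps)
    have Pk: "P \<kappa>' j = ?t * P b1 j + (P b1 1 - ?t * P b1 1)" for j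
      using fan_1_rotation[OF p Q a1, of j] unfolding e(1) Sb1 by (simp add: algebra_simps)
    define C where "C = ?t * (?v * ?u)"
    have PkC: "P \<kappa>' j = C * P (\<kappa> i) j + (?t * (P (q' i) 2 - ?v * ?u * P (q i) 2) + (P b1 1 - ?t * P b1 1))" for j
      unfolding Pk[of j] Pb[of j] by (simp add: C_def algebra_simps)
    have sk: "s (\<kappa> i) = s \<kappa>'" using cs(4) by (simp add: e(6))
    have wk: "w (\<kappa>' + int j) = w (\<kappa> i + int j)" if "j < m1" for j
      using cs(9)[OF that] by (simp add: e(6))
    obtain E where E: "\<And>j. P (\<kappa>' + int m1) j = C * P (\<kappa> i + int m1) j + E" "\<And>j. P \<kappa>' j = C * P (\<kappa> i) j + E"
      using congruent_run[OF p Q sk PkC wk] PkC by blast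
    have q1: "q (i + 1) = \<kappa>' + int m1" by (simp add: q_def \<kappa>'_def)
    have z1: "P (q (i + 1)) 2 - P \<kappa>' 1 = C * (P (q i) 2 - P (\<kappa> i) 1)"
      unfolding q1 E by (simp add: q_def algebra_simps)
    have aq1: "arrives s H (q (i + 1)) 2" using cell[of "i + 1"] by (auto simp: cell_def run_def q_def)
    have sq: "s (q i) = s (q (i + 1))" unfolding q1 unfolding q_def
      using s_parity[OF p, of "\<kappa> i" m1] s_parity[OF p, of \<kappa>' m1] sk by simp
    have Pq: "P (q (i + 1)) j = C * P (q i) j + E" for j unfolding q1 E by (simp add: q_def)
    let ?r = "cis (3 * (b (i + 1) - b i) * \<phi> 2)"
    have PL: "P (q (i + 1) + 3) j = ?r * C * P L2 j + (P (q (i + 1)) 2 - ?r * C * P (q i) 2)" for j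
      using fan_2_rotation[OF p Q aq aq1 sq Pq, of j] by (simp add: b_def L2_def algebra_simps)
    have sL: "s L2 = s (q (i + 1) + 3)" using fan_2(4)[OF p aq] fan_2(4)[OF p aq1] sq by (simp add: L2_def)
    have wL: "w (q (i + 1) + 3 + int j) = w (L2 + int j)" if "j < m2" for j
      using cs(10)[OF that] unfolding e(2) q1 e(6) by (simp add: algebra_simps)
    have "P (q (i + 1) + 3 + int m2) 0 = ?r * C * P (L2 + int m2) 0 + (P (q (i + 1)) 2 - ?r * C * P (q i) 2)"
      by (rule congruent_run[OF p Q sL PL wL])
    moreover have "q (i + 1) + 3 + int m2 = g (i + 1)" by (simp add: q_def g_def)
    ultimately have z2: "P (g (i + 1)) 0 - P (q (i + 1)) 2 = ?r * C * (P (g i) 0 - P (q i) 2)"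
      by (simp add: e(3) algebra_simps)
    have sum: "P \<kappa>' 1 - P (\<kappa> i) 1 = (P (q i) 2 - P (\<kappa> i) 1) * (1 - ?u * ?v) + (P (g i) 0 - P (q i) 2) * (1 - ?u)"
    proof -
      have "P \<kappa>' 1 - P (\<kappa> i) 1 = (P (q i) 2 - P (\<kappa> i) 1) + (P (g i) 0 - P (q i) 2) +
          (P (q' i) 2 - P (g i) 0) + (P \<kappa>' 1 - P (q' i) 2)" by simp
      also have "\<dots> = (P (q i) 2 - P (\<kappa> i) 1) * (1 - ?u * ?v) + (P (g i) 0 - P (q i) 2) * (1 - ?u)"
        unfolding z3 z4 by (simp only: ring_distribs mult_1_right mult_minus_left mult.commute) simp
      finally show ?thesis .
    qed
    show ?thesis unfolding Let_def
    proof (intro conjI)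
      show "P (\<kappa> (i + 1)) 1 - P (\<kappa> i) 1 =
          (P (q i) 2 - P (\<kappa> i) 1) * (1 - ?u * ?v) + (P (g i) 0 - P (q i) 2) * (1 - ?u)"
        using sum unfolding \<kappa>'_def .
      show "P (q (i + 1)) 2 - P (\<kappa> (i + 1)) 1 = ?t * ?u * ?v * (P (q i) 2 - P (\<kappa> i) 1)"
        using z1 unfolding \<kappa>'_def C_def by (simp only: mult_ac)
      show "(P (g (i + 1)) 0 - P (q (i + 1)) 2) * (P (q i) 2 - P (\<kappa> i) 1) =
          ?r * (P (g i) 0 - P (q i) 2) * (P (q (i + 1)) 2 - P (\<kappa> (i + 1)) 1)"
        unfolding z1[unfolded \<kappa>'_def] z2 by (simp only: mult_ac)
    qed
  qed
  \<comment> \<open>\<open>n\<close> nodes advance by \<open>M * n\<close> copies, that is, by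
    \<open>M\<close> periods of the path.\<close>
  have per: "\<kappa> (i + nat n) = \<kappa> i + M * n" for i using n by (simp add: \<kappa>_def algebra_simps)
  have "c (i + nat n) = c i" for i
  proof -
    have "M = int (nat M)" by (simp add: M_def)
    then have "q' (i + nat n) = q' i + int (nat M) * n" using per[of i] by (simp add: q'_def)
    then show ?thesis using shift_n[of "q' i" "nat M"] by (simp add: c_def)
  qed
  then have "chain \<kappa> q g a b c d (nat n) M"
    unfolding chain_def using main dev per n S_sgn[OF p]
    by (auto simp: a_def b_def d_def c_def q_def g_def)
  then show ?thesis by blast
qed

end

context tiling_path
begin

text \<open>Up to sign, the factor between consecutive displacements along edges on the line. At
  \<open>2\<close> consecutive edges have different lengths, hence the ratio of sides there.\<close>

definition side_ratio :: "(3 \<Rightarrow> real) \<Rightarrow> (3 \<Rightarrow> real) \<Rightarrow> real \<Rightarrow> 3 \<Rightarrow> 3 \<Rightarrow> complex" where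
  "side_ratio \<phi> \<rho> e j y =
     (if j = 1 then cis (6 * e * \<phi> 1) else if j = 0 then cis (2 * e * \<phi> 0)
      else of_real (if y = 0 then \<rho> 2 else 1 / \<rho> 2) * cis (3 * e * \<phi> 2))"

lemma edge_turn:
  assumes e: "edge_fan k j y x"
  defines "q \<equiv> if j = 2 then x else y" and "t \<equiv> if j = 2 then y else x"
  assumes d: "edge_fan (k + fan_len j + \<delta>) q j t" "\<delta> = 0 \<or> \<delta> = 1 \<and> w (k + fan_len j) = t"
    and Q: "qpath w s \<phi> \<rho> P"
  shows "P (k + fan_len j + \<delta>) q - P (k + fan_len j + \<delta>) j = - side_ratio \<phi> \<rho> (S k j) j y * (P k j - P k y)"
    "P (k + fan_len j + \<delta>) j = P k j"
proof -
  let ?c = "cis (2 * S k j * \<phi> j)"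
  note l = edge_fan_letters[OF e]
  have e1: "k + 1 + 1 = k + 2" "k + 2 + 1 = k + 3" "k + 3 + 1 = k + 4" "k + 4 + 1 = k + 5" by auto
  have S: "S k j = 1 \<or> S k j = -1" by (rule S_sgn[OF p])
  have PS: "i \<noteq> w a \<Longrightarrow> P (a + 1) i = P a i" for i a using P_Suc[OF p Q] by blast
  have ss: "s (k + 1) = - s k" "s (k + 2) = s k" "s (k + 3) = - s k" "s (k + 4) = s k"
    using s_parity[OF p, of k 1] s_parity[OF p, of k 2] s_parity[OF p, of k 3] s_parity[OF p, of k 4] by auto
  have t0: "P (k + 1) y - P k j = ?c * (P k y - P k j)"
    using fan_turn[OF p Q, of k "S k j" j] l S by auto
  have ne: "t \<noteq> q" "t \<noteq> j" using edge_fan_letters(7-9)[OF d(1)] by auto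
  have \<delta>: "P (k + fan_len j + \<delta>) q = P (k + fan_len j) q" "P (k + fan_len j + \<delta>) j = P (k + fan_len j) j"
    using d(2) PS[of q "k + fan_len j"] PS[of j "k + fan_len j"] ne by auto
  consider "j = 1" | "j = 2" | "j = 0" using label_cases[of j] by blast
  then have "P (k + fan_len j) q - P k j = side_ratio \<phi> \<rho> (S k j) j y * (P k y - P k j) \<and>
      P (k + fan_len j) j = P k j"
  proof cases
    case 1
    have pj: "P (k + 1) j = P k j" "P (k + 2) j = P k j" "P (k + 3) j = P k j" "P (k + 4) j = P k j"
      "P (k + 5) j = P k j"
      using PS[of j k] PS[of j "k + 1", unfolded e1] PS[of j "k + 2", unfolded e1]
        PS[of j "k + 3", unfolded e1] PS[of j "k + 4", unfolded e1] l 1 by auto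
    have py: "P (k + 2) y = P (k + 1) y" "P (k + 4) y = P (k + 3) y"
      using PS[of y "k + 1", unfolded e1] PS[of y "k + 3", unfolded e1] l 1 by auto
    have t2: "P (k + 2 + 1) y - P (k + 2) j = ?c * (P (k + 2) y - P (k + 2) j)"
      using fan_turn[OF p Q, of "k + 2" "S k j" j] l S ss 1 by auto
    have t4: "P (k + 4 + 1) y - P (k + 4) j = ?c * (P (k + 4) y - P (k + 4) j)"
      using fan_turn[OF p Q, of "k + 4" "S k j" j] l S ss 1 by auto
    have "P (k + 5) y - P k j = ?c * (?c * (?c * (P k y - P k j)))"
      using t0 t2 t4 unfolding e1 pj py by simp
    also have "\<dots> = cis (6 * S k j * \<phi> j) * (P k y - P k j)"
      by (simp add: mult.assoc[symmetric] cis_mult) (simp add: mult_ac)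
    finally show ?thesis using 1 pj by (simp add: fan_len_def side_ratio_def q_def)
  next
    case 2
    have pj: "P (k + 1) j = P k j" "P (k + 2) j = P k j" "P (k + 1) x = P k x"
      using PS[of j k] PS[of x k] PS[of j "k + 1", unfolded e1] l 2 by auto
    have t1: "P (k + 1 + 1) x - P (k + 1) j = ?c * (P (k + 1) x - P (k + 1) j)"
      using fan_turn[OF p Q, of "k + 1" "S k j" j] l S ss s_sgn[OF p, of k] 2 by auto
    have sh: "P k 1 - P k 2 = of_real (\<rho> 2) * cis (s k * \<phi> 2) * (P k 0 - P k 2)"
      using P_shape[OF p Q, of k 2] by simp
    have sh': "P k 0 - P k 2 = of_real (1 / \<rho> 2) * cis (- (s k * \<phi> 2)) * (P k 1 - P k 2)"
    proof -
      have "of_real (1 / \<rho> 2) * cis (- (s k * \<phi> 2)) * (P k 1 - P k 2) =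
          of_real (1 / \<rho> 2 * \<rho> 2) * (cis (- (s k * \<phi> 2)) * cis (s k * \<phi> 2)) * (P k 0 - P k 2)"
        unfolding sh of_real_mult by (simp only: mult_ac)
      then show ?thesis using \<rho>_pos[OF p Q, of 2] by (simp add: cis_mult)
    qed
    have "P k x - P k 2 = of_real (if y = 0 then \<rho> 2 else 1 / \<rho> 2) * cis (S k 2 * \<phi> 2) * (P k y - P k 2)"
    proof (cases "S k 2 = s k")
      case True
      then show ?thesis using l(10,11) 2 sh by simp
    next
      case False
      then have "S k 2 = - s k" using S s_sgn[OF p, of k] 2 by auto
      then show ?thesis using l(10,11) 2 sh' False by simp
    qed
    then have "P (k + 2) x - P k 2 = (?c * cis (S k 2 * \<phi> 2)) * of_real (if y = 0 then \<rho> 2 else 1 / \<rho> 2) * (P k y - P k 2)"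
      using t1 2 unfolding e1 pj by (simp only: mult_ac)
    also have "?c * cis (S k 2 * \<phi> 2) = cis (3 * S k 2 * \<phi> 2)" using 2 by (simp add: cis_mult algebra_simps)
    finally show ?thesis using 2 pj by (simp add: fan_len_def side_ratio_def q_def mult_ac)
  next
    case 3
    then show ?thesis using t0 PS[of j k] l by (simp add: fan_len_def side_ratio_def q_def mult_ac)
  qed
  then show "P (k + fan_len j + \<delta>) q - P (k + fan_len j + \<delta>) j = - side_ratio \<phi> \<rho> (S k j) j y * (P k j - P k y)"
    "P (k + fan_len j + \<delta>) j = P k j" using \<delta> by (simp_all add: algebra_simps)
qed

definition next_fan :: "3 \<Rightarrow> 3 \<Rightarrow> 3 \<Rightarrow> int \<Rightarrow> int" where
  "next_fan j y x k =
     (if edge_fan (k + fan_len j) (if j = 2 then x else y) j (if j = 2 then y else x) then k + fan_len j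
      else k + fan_len j + 1)"

lemma edge_fan_n: "edge_fan (k + n) j y x = edge_fan k j y x"
  by (simp add: edge_fan_def fan_def Hn sn Sn)

lemma next_fan_n: "next_fan j y x (k + n) = next_fan j y x k + n"
proof -
  have e: "k + n + fan_len j = (k + fan_len j) + n" by simp
  show ?thesis unfolding next_fan_def e edge_fan_n by simp
qed

lemma next_fan:
  assumes e: "edge_fan k j y x"
  defines "q \<equiv> if j = 2 then x else y" and "t \<equiv> if j = 2 then y else x"
  shows "edge_fan (next_fan j y x k) q j t"
    "qpath w s \<phi> \<rho> P \<Longrightarrow> P (next_fan j y x k) q - P (next_fan j y x k) j = - side_ratio \<phi> \<rho> (S k j) j y * (P k j - P k y)"
    "qpath w s \<phi> \<rho> P \<Longrightarrow> P (next_fan j y x k) j = P k j"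
    "along w s H X \<Longrightarrow> X (next_fan j y x k) j = X k j"
proof -
  obtain \<delta> where d: "next_fan j y x k = k + fan_len j + \<delta>" "edge_fan (k + fan_len j + \<delta>) q j t"
    "\<delta> = 0 \<or> \<delta> = 1 \<and> w (k + fan_len j) = t"
    using edge_next(1)[OF e] unfolding next_fan_def q_def[symmetric] t_def[symmetric]
    by (cases "edge_fan (k + fan_len j) q j t") auto
  show "edge_fan (next_fan j y x k) q j t" using d by simp
  show "qpath w s \<phi> \<rho> P \<Longrightarrow> P (next_fan j y x k) q - P (next_fan j y x k) j = - side_ratio \<phi> \<rho> (S k j) j y * (P k j - P k y)"
    "qpath w s \<phi> \<rho> P \<Longrightarrow> P (next_fan j y x k) j = P k j"
    using edge_turn[OF e, of \<delta> \<phi> \<rho> P] d unfolding q_def t_def by auto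
  assume X: "along w s H X"
  have XS: "i \<noteq> w a \<Longrightarrow> X (a + 1) i = X a i" for i a using X by (simp add: along_def)
  have e1: "k + 1 + 1 = k + 2" "k + 2 + 1 = k + 3" "k + 3 + 1 = k + 4" "k + 4 + 1 = k + 5" by auto
  note l = edge_fan_letters[OF e]
  have "X (k + fan_len j) j = X k j"
    using XS[of j k] XS[of j "k + 1", unfolded e1] XS[of j "k + 2", unfolded e1]
      XS[of j "k + 3", unfolded e1] XS[of j "k + 4", unfolded e1] l label_cases[of j]
    by (auto simp: fan_len_def)
  moreover have "X (k + fan_len j + \<delta>) j = X (k + fan_len j) j"
    using d(3) XS[of j "k + fan_len j"] edge_fan_letters(7-9)[OF d(2)] by auto
  ultimately show "X (next_fan j y x k) j = X k j" using d(1) by simp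
qed

text \<open>Edges along the line pass through \<open>1, 2, 0, 2\<close> cyclically, and
  \<open>F\<close> is one cycle. The number of copies in a cycle depends on the sides, so a period
  of the nodes is found by the pigeonhole principle for copies modulo \<open>n\<close>.\<close>

lemma edge_chain:
  assumes e0: "edge_fan l 1 2 0"
  shows "\<exists>\<kappa> q g a b c d N D. chain \<kappa> q g a b c d N D"
proof -
  define f1 f2 f3 f4 where "f1 = next_fan 1 2 0" and "f2 = next_fan 2 1 0" and "f3 = next_fan 0 2 1"
    and "f4 = next_fan 2 0 1"
  define F where "F k = f4 (f3 (f2 (f1 k)))" for k
  have fn: "f1 (k + n) = f1 k + n" "f2 (k + n) = f2 k + n" "f3 (k + n) = f3 k + n" "f4 (k + n) = f4 k + n" for k
    unfolding f1_def f2_def f3_def f4_def by (rule next_fan_n)+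
  have st: "edge_fan (f1 k) 2 1 0" "edge_fan (f2 (f1 k)) 0 2 1" "edge_fan (f3 (f2 (f1 k))) 2 0 1"
    "edge_fan (F k) 1 2 0" if "edge_fan k 1 2 0" for k
  proof -
    show 1: "edge_fan (f1 k) 2 1 0" using next_fan(1)[OF that] by (simp add: f1_def)
    show 2: "edge_fan (f2 (f1 k)) 0 2 1" using next_fan(1)[OF 1] by (simp add: f2_def)
    show 3: "edge_fan (f3 (f2 (f1 k))) 2 0 1" using next_fan(1)[OF 2] by (simp add: f3_def)
    show "edge_fan (F k) 1 2 0" using next_fan(1)[OF 3] by (simp add: f4_def F_def)
  qed
  have Fn: "F (k + n) = F k + n" for k by (simp add: F_def fn)
  have Fi: "edge_fan ((F ^^ i) l) 1 2 0" for i by (induction i) (simp_all add: e0 st)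
  have Fin: "(F ^^ i) (k + n) = (F ^^ i) k + n" for i k by (induction i) (simp_all add: Fn)
  have Fint: "(F ^^ i) (k + D * n) = (F ^^ i) k + D * n" for i k D
  proof (induction D rule: int_induct[where k = 0])
    case base show ?case by simp
  next
    case (step1 D)
    have "k + (D + 1) * n = k + D * n + n" by (simp add: algebra_simps)
    then show ?case using Fin[of i "k + D * n"] step1 by (simp add: algebra_simps)
  next
    case (step2 D)
    have "k + D * n = k + (D - 1) * n + n" by (simp add: algebra_simps)
    then show ?case using Fin[of i "k + (D - 1) * n"] step2 by (simp add: algebra_simps)
  qed
  have "\<not> inj_on (\<lambda>i. (F ^^ i) l mod n) {..nat n}"
  proof (rule pigeonhole)
    have "(\<lambda>i. (F ^^ i) l mod n) ` {..nat n} \<subseteq> {0..<n}" using n by auto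
    then have "card ((\<lambda>i. (F ^^ i) l mod n) ` {..nat n}) \<le> card {0..<n}" by (intro card_mono) auto
    also have "\<dots> < card {..nat n}" using n by simp
    finally show "card ((\<lambda>i. (F ^^ i) l mod n) ` {..nat n}) < card {..nat n}" .
  qed
  then obtain i0 i1 where i: "i0 < i1" "(F ^^ i0) l mod n = (F ^^ i1) l mod n"
    unfolding inj_on_def by (metis linorder_neqE_nat)
  \<comment> \<open>Counting starts at \<open>i0\<close>, from where on the residues modulo
    \<open>n\<close> repeat.\<close>
  define \<kappa> where "\<kappa> i = (F ^^ (i0 + i)) l" for i
  define N where "N = i1 - i0"
  obtain D where D: "\<kappa> N = \<kappa> 0 + D * n"
  proof -
    have "n dvd (F ^^ i1) l - (F ^^ i0) l" using i(2)[symmetric] by (simp add: mod_eq_dvd_iff)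
    then obtain D where "(F ^^ i1) l - (F ^^ i0) l = n * D" by (auto elim: dvdE)
    then have "\<kappa> N = \<kappa> 0 + D * n" using i(1) by (simp add: \<kappa>_def N_def algebra_simps)
    then show ?thesis by (rule that)
  qed
  have \<kappa>S: "\<kappa> (i + 1) = F (\<kappa> i)" for i by (simp add: \<kappa>_def)
  have \<kappa>e: "edge_fan (\<kappa> i) 1 2 0" for i unfolding \<kappa>_def by (rule Fi)
  have \<kappa>i: "\<kappa> (m + i) = (F ^^ i) (\<kappa> m)" for i m by (induction i) (simp_all add: \<kappa>S[simplified])
  have per: "\<kappa> (i + N) = \<kappa> i + D * n" for i
    using \<kappa>i[of N i] \<kappa>i[of 0 i] Fint[of i "\<kappa> 0" D] D by (simp add: add.commute)
  define q where "q i = f1 (\<kappa> i)" for i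
  define g where "g i = f2 (q i)" for i
  define q' where "q' i = f3 (g i)" for i
  have fD: "f (k + D * n) = f k + D * n" if "\<And>k. f (k + n) = f k + n" for f :: "int \<Rightarrow> int" and k D
  proof (induction D rule: int_induct[where k = 0])
    case base show ?case by simp
  next
    case (step1 D)
    have "k + (D + 1) * n = k + D * n + n" by (simp add: algebra_simps)
    then show ?case using that[of "k + D * n"] step1 by (simp add: algebra_simps)
  next
    case (step2 D)
    have "k + D * n = k + (D - 1) * n + n" by (simp add: algebra_simps)
    then show ?case using that[of "k + (D - 1) * n"] step2 by (simp add: algebra_simps)
  qed
  have qper: "q (i + N) = q i + D * n" "g (i + N) = g i + D * n" "q' (i + N) = q' i + D * n" for i
    using fD[where f = f1, OF fn(1), of "\<kappa> i" D] fD[where f = f2, OF fn(2), of "q i" D]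
      fD[where f = f3, OF fn(3), of "g i" D] per[of i]
    by (simp_all add: q_def g_def q'_def)
  have E: "edge_fan (q i) 2 1 0" "edge_fan (g i) 0 2 1" "edge_fan (q' i) 2 0 1" for i
    using st[OF \<kappa>e[of i]] by (simp_all add: q_def g_def q'_def)
  define a where "a i = S (\<kappa> i) 1" for i
  define b where "b i = S (q i) 2" for i
  define c where "c i = S (q' i) 2" for i
  define d where "d i = S (g i) 0" for i
  have S_D: "S (k + D * n) = S k" for k
  proof (cases "D \<ge> 0")
    case True then show ?thesis using shift_n[of k "nat D"] by simp
  next
    case False then show ?thesis using shift_n[of "k + D * n" "nat (- D)"] by simp
  qed
  have main: "H (\<kappa> i) 1 = 0 \<and> H (q i) 2 = 0 \<and> H (g i) 0 = 0 \<and>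
     (\<forall>X. along w s H X \<longrightarrow> X (\<kappa> i) 1 < X (q i) 2 \<and> X (q i) 2 < X (g i) 0)" for i
    using \<kappa>e[of i] E[of i] edge_fan_forward[OF E(1)[of i]] edge_fan_forward[OF E(2)[of i]]
      next_fan(4)[OF \<kappa>e[of i]] next_fan(4)[OF E(1)[of i]]
    unfolding edge_fan_def fan_def f1_def[symmetric] f2_def[symmetric] q_def[symmetric] g_def[symmetric]
    by metis
  have dev: "let z1 = (\<lambda>i. P (q i) 2 - P (\<kappa> i) 1); z2 = (\<lambda>i. P (g i) 0 - P (q i) 2);
                u = cis (2 * d i * \<phi> 0); v = cis (3 * (b i + c i) * \<phi> 2)
            in P (\<kappa> (i + 1)) 1 - P (\<kappa> i) 1 = z1 i * (1 - u * v) + z2 i * (1 - u) \<and>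
               z1 (i + 1) = cis (6 * a (i + 1) * \<phi> 1) * u * v * z1 i \<and>
               z2 (i + 1) * z1 i = cis (3 * (b (i + 1) - b i) * \<phi> 2) * z2 i * z1 (i + 1)"
    if Q: "qpath w s \<phi> \<rho> P" for P \<phi> \<rho> i
  proof -
    let ?R = "complex_of_real (\<rho> 2)"
    have R0: "?R \<noteq> 0" using \<rho>_pos[OF p Q, of 2] by simp
    have c1: "P (q i) 1 = P (\<kappa> i) 1" for i
      using next_fan(3)[OF \<kappa>e[of i] Q] by (simp add: q_def f1_def)
    have c2: "P (g i) 2 = P (q i) 2" for i
      using next_fan(3)[OF E(1)[of i] Q] by (simp add: g_def f2_def)
    have c3: "P (q' i) 0 = P (g i) 0"
      using next_fan(3)[OF E(2)[of i] Q] by (simp add: q'_def f3_def)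
    have K: "\<kappa> (i + 1) = f4 (q' i)" unfolding \<kappa>S F_def by (simp add: q_def g_def q'_def)
    have c4: "P (\<kappa> (i + 1)) 2 = P (q' i) 2"
      using next_fan(3)[OF E(3)[of i] Q] unfolding K by (simp add: f4_def)
    have z2: "P (g i) 0 - P (q i) 2 = - (of_real (1 / \<rho> 2) * cis (3 * b i * \<phi> 2)) * (P (q i) 2 - P (\<kappa> i) 1)" for i
      using next_fan(2)[OF E(1)[of i] Q] c1[of i] c2[of i] by (simp add: g_def f2_def side_ratio_def b_def)
    have z3: "P (q' i) 2 - P (g i) 0 = - cis (2 * d i * \<phi> 0) * (P (g i) 0 - P (q i) 2)"
      using next_fan(2)[OF E(2)[of i] Q] c2[of i] c3 by (simp add: q'_def f3_def side_ratio_def d_def)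
    have z4: "P (\<kappa> (i + 1)) 1 - P (q' i) 2 = - (?R * cis (3 * c i * \<phi> 2)) * (P (q' i) 2 - P (g i) 0)"
      using next_fan(2)[OF E(3)[of i] Q] c3 c4 unfolding K by (simp add: f4_def side_ratio_def c_def)
    have z1: "P (q (i + 1)) 2 - P (\<kappa> (i + 1)) 1 = - cis (6 * a (i + 1) * \<phi> 1) * (P (\<kappa> (i + 1)) 1 - P (q' i) 2)"
      using next_fan(2)[OF \<kappa>e[of "i + 1"] Q] c1[of "i + 1"] c4
      by (simp add: q_def f1_def side_ratio_def a_def)
    let ?u = "cis (2 * d i * \<phi> 0)" and ?v = "cis (3 * (b i + c i) * \<phi> 2)"
    have v: "?v = cis (3 * b i * \<phi> 2) * cis (3 * c i * \<phi> 2)" by (simp add: cis_mult algebra_simps)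
    \<comment> \<open>The ratios of sides at the two vertices \<open>2\<close> of a cycle
      cancel.\<close>
    have RR: "?R * of_real (1 / \<rho> 2) = 1" using R0 by (simp add: field_simps)
    have z4': "P (\<kappa> (i + 1)) 1 - P (q' i) 2 = - (?u * ?v) * (P (q i) 2 - P (\<kappa> i) 1)"
    proof -
      have "P (\<kappa> (i + 1)) 1 - P (q' i) 2 = - ((?R * of_real (1 / \<rho> 2)) *
          (?u * (cis (3 * b i * \<phi> 2) * cis (3 * c i * \<phi> 2)) * (P (q i) 2 - P (\<kappa> i) 1)))"
        unfolding z4 z3 z2[of i] by (simp only: mult_ac mult_minus_left mult_minus_right minus_minus)
      then show ?thesis unfolding RR v by simp
    qed
    show ?thesis unfolding Let_def
    proof (intro conjI)
      show "P (\<kappa> (i + 1)) 1 - P (\<kappa> i) 1 =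
          (P (q i) 2 - P (\<kappa> i) 1) * (1 - ?u * ?v) + (P (g i) 0 - P (q i) 2) * (1 - ?u)"
      proof -
        have "P (\<kappa> (i + 1)) 1 - P (\<kappa> i) 1 = (P (q i) 2 - P (\<kappa> i) 1) + (P (g i) 0 - P (q i) 2) +
            (P (q' i) 2 - P (g i) 0) + (P (\<kappa> (i + 1)) 1 - P (q' i) 2)" by simp
        also have "\<dots> = (P (q i) 2 - P (\<kappa> i) 1) * (1 - ?u * ?v) + (P (g i) 0 - P (q i) 2) * (1 - ?u)"
          unfolding z3 z4' by (simp only: ring_distribs mult_1_right mult_minus_left mult.commute) simp
        finally show ?thesis .
      qed
      show "P (q (i + 1)) 2 - P (\<kappa> (i + 1)) 1 = cis (6 * a (i + 1) * \<phi> 1) * ?u * ?v * (P (q i) 2 - P (\<kappa> i) 1)"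
        unfolding z1 z4' by (simp add: mult_ac)
      have "cis (3 * b (i + 1) * \<phi> 2) = cis (3 * (b (i + 1) - b i) * \<phi> 2) * cis (3 * b i * \<phi> 2)"
        by (simp add: cis_mult algebra_simps)
      then show "(P (g (i + 1)) 0 - P (q (i + 1)) 2) * (P (q i) 2 - P (\<kappa> i) 1) =
          cis (3 * (b (i + 1) - b i) * \<phi> 2) * (P (g i) 0 - P (q i) 2) * (P (q (i + 1)) 2 - P (\<kappa> (i + 1)) 1)"
        unfolding z2[of i] z2[of "i + 1"] by (simp add: mult_ac)
    qed
  qed
  have "chain \<kappa> q g a b c d N D"
    unfolding chain_def using main dev per qper i(1) S_sgn[OF p] S_D
    by (auto simp: a_def b_def d_def c_def N_def)
  then show ?thesis by blast
qed

lemma line_through_2: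
  assumes h: "H k 2 = 0" and letters: "\<And>j. \<exists>i. w i = j"
  shows "(\<exists>l m. run l 2 m 2) \<or> (\<exists>\<kappa> q g a b c d N D. chain \<kappa> q g a b c d N D)"
proof -
  have "\<exists>i<k. w i = 2"
  proof -
    obtain i where i: "w i = 2" using letters by blast
    define m where "m = nat (\<bar>i\<bar> + \<bar>k\<bar> + 1)"
    have "int m * n \<ge> int m" using n by (simp add: mult_le_cancel_left1)
    moreover have "int m = \<bar>i\<bar> + \<bar>k\<bar> + 1" by (simp add: m_def)
    ultimately have "i - int m * n < k" by linarith
    moreover have "w (i - int m * n) = 2" using shift_n[of "i - int m * n" m] i by simp
    ultimately show ?thesis by blast
  qed
  from online_core[OF p h this] obtain k0 y x where c: "fan s S H k0 2 y x"
    "H k0 y = 0 \<or> arrives s H k0 2" by blast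
  show ?thesis
  proof (cases "arrives s H k0 2")
    case True
    from classify[OF this] show ?thesis using cell_chain unfolding cell_def by blast
  next
    case False
    then have e: "edge_fan k0 2 y x" using c by (simp add: edge_fan_def)
    have "y = 1 \<and> x = 0 \<or> y = 0 \<and> x = 1" using c(1) by (auto simp: fan_def)
    then show ?thesis
    proof
      assume "y = 0 \<and> x = 1"
      then show ?thesis using next_fan(1)[OF e] edge_chain by auto
    next
      assume yx: "y = 1 \<and> x = 0"
      then have e1: "edge_fan (next_fan 2 1 0 k0) 0 2 1" using next_fan(1)[OF e] by simp
      have e2: "edge_fan (next_fan 0 2 1 (next_fan 2 1 0 k0)) 2 0 1" using next_fan(1)[OF e1] by simp
      show ?thesis using next_fan(1)[OF e2] edge_chain by auto
    qed
  qed
qed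

end

section \<open>Letter counts on lines with vertices \<open>2\<close> only\<close>

lemma count_run:
  fixes X :: "int \<Rightarrow> int"
  assumes X: "\<And>k. X (k + 1) = X k + (if s k = 1 then 1 else - 1) * (if w k = j then 1 else 0)"
    and "\<And>i::nat. i < m \<Longrightarrow> w (a + int i) = w (b + int i) \<and> s (a + int i) = s (b + int i)"
  shows "X (a + int m) - X a = X (b + int m) - X b"
  using assms(2)
proof (induction m)
  case (Suc m)
  have e: "a + int (Suc m) = a + int m + 1" "b + int (Suc m) = b + int m + 1" by simp_all
  have "X (a + int m) - X a = X (b + int m) - X b" using Suc by simp
  moreover have "w (a + int m) = w (b + int m)" "s (a + int m) = s (b + int m)" using Suc(2)[of m] by auto
  ultimately show ?case unfolding e X[of "a + int m"] X[of "b + int m"] by simp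
qed simp

context tiling_path
begin

text \<open>On a line with vertices \<open>2\<close> only, the developments between consecutive vertices are translates of
  each other in the tiling, which forces the counts of letters to be divisible by \<open>3\<close>; periodicity
  then leaves no room for vertices on both sides.\<close>

lemma line_2_sides:
  assumes r0: "run K 2 m 2"
    and X1: "\<And>k. X1 (k + 1) = X1 k + (if s k = 1 then 1 else - 1) * (if w k = 1 then 1 else (0::int))"
    and X2: "\<And>k. X2 (k + 1) = X2 k + (if s k = 1 then 1 else - 1) * (if w k = 2 then 1 else (0::int))"
    and Xn: "\<And>k. X1 (k + n) = X1 k" "\<And>k. X2 (k + n) = X2 k"
  shows "\<exists>b. (b = 1 \<or> b = -1) \<and> (\<forall>k j. H k j = 0 \<longrightarrow> j = 2 \<and> S k j = b) \<and>
    of_int (X1 (K + int m) - X1 K) - s K / 2 = 3 / 2 * b"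
proof -
  define M where "M = int m + 3"
  define \<kappa> where "\<kappa> i = K + int i * M" for i :: nat
  have \<kappa>S: "\<kappa> (Suc i) = \<kappa> i + int m + 3" for i by (simp add: \<kappa>_def M_def algebra_simps)
  have L: "run (\<kappa> i) 2 m 2 \<and> s (\<kappa> i) = s K \<and> H (\<kappa> i) = H K \<and> (\<forall>l<m. w (\<kappa> i + int l) = w (K + int l))" for i
    using line_2[OF r0, of i] unfolding \<kappa>_def M_def by blast
  have ar: "arrives s H (\<kappa> i + int m) 2" and lv: "leaves s H (\<kappa> i) 2" for i using L[of i] by (auto simp: run_def)
  define b where "b i = S (\<kappa> i + int m) 2" for i
  have sm: "s (\<kappa> i + int m) = - s K" for i
  proof -
    have "s (\<kappa> i + int m) = - s (\<kappa> i)"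
      by (rule same_class[OF lv ar]) (use L[of i] in \<open>auto simp: run_def\<close>)
    then show ?thesis using L by simp
  qed
  have sK: "s K = 1 \<or> s K = -1" by (rule s_sgn[OF p])
  define e1 e2 where "e1 = X1 (K + int m) - X1 K" and "e2 = X2 (K + int m) - X2 K"
  have ss: "s (\<kappa> i + int l) = s (K + int l)" for i l
    using s_parity[OF p, of "\<kappa> i" l] s_parity[OF p, of K l] L[of i] by simp
  have E: "X1 (\<kappa> i + int m) - X1 (\<kappa> i) = e1" "X2 (\<kappa> i + int m) - X2 (\<kappa> i) = e2" for i
    unfolding e1_def e2_def using count_run[where X = X1 and s = s and w = w and j = 1, OF X1, of m "\<kappa> i" K] count_run[where X = X2 and s = s and w = w and j = 2, OF X2, of m "\<kappa> i" K] L[of i] ss by auto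
  \<comment> \<open>The letters \<open>1\<close> contribute \<open>e1\<close> on the run and, at the
    vertex, 1 or -2 times \<open>s K\<close>, depending on the side. The correction is chosen such
    that the total is \<open>A\<close> at a vertex above the path and \<open>A + 3\<close> at one
    below, for both orientations.\<close>
  define A where "A = e1 - (if s K = 1 then 2 else 1)"
  have F: "X1 (\<kappa> (Suc i)) - X1 (\<kappa> i) = (if b i = 1 then A else A + 3) \<and> X2 (\<kappa> (Suc i)) - X2 (\<kappa> i) = e2" for i
  proof -
    let ?k = "\<kappa> i + int m"
    have ek: "?k + 1 + 1 = ?k + 2" "?k + 2 + 1 = ?k + 3" by auto
    have s: "s ?k = - s K" "s (?k + 1) = s K" "s (?k + 2) = - s K"
      using sm[of i] s_parity[OF p, of ?k 1] s_parity[OF p, of ?k 2] by auto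
    note w3 = fan_2(6-8)[OF p ar[of i]]
    have x1: "X1 (?k + 3) - X1 ?k = (if b i = s ?k then (if s K = 1 then 1 else - 1) else (if s K = 1 then - 2 else 2))"
      using X1[of ?k] X1[of "?k + 1"] X1[of "?k + 2"] w3 s sK unfolding ek b_def by auto
    have x2: "X2 (?k + 3) - X2 ?k = 0"
      using X2[of ?k] X2[of "?k + 1"] X2[of "?k + 2"] w3 unfolding ek by (auto split: if_splits)
    have "b i = 1 \<or> b i = -1" unfolding b_def by (rule S_sgn[OF p])
    then show ?thesis using x1 x2 E[of i] s(1) sK unfolding \<kappa>S A_def by auto
  qed
  define N where "N = nat n"
  have \<kappa>N: "\<kappa> N = K + int (nat M) * n" using n by (simp add: \<kappa>_def N_def M_def algebra_simps)
  have Xt: "X1 (k + int t * n) = X1 k" "X2 (k + int t * n) = X2 k" for k t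
  proof (induction t)
    case (Suc t)
    have e: "k + int (Suc t) * n = k + int t * n + n" by (simp add: algebra_simps)
    show "X1 (k + int (Suc t) * n) = X1 k" "X2 (k + int (Suc t) * n) = X2 k" unfolding e Xn by (rule Suc)+
  qed simp_all
  have \<kappa>0: "\<kappa> 0 = K" by (simp add: \<kappa>_def)
  have tel: "(\<Sum>i<N. X1 (\<kappa> (Suc i)) - X1 (\<kappa> i)) = 0" "(\<Sum>i<N. X2 (\<kappa> (Suc i)) - X2 (\<kappa> i)) = 0"
    unfolding sum_lessThan_telescope[of "\<lambda>i. X1 (\<kappa> i)" N] sum_lessThan_telescope[of "\<lambda>i. X2 (\<kappa> i)" N]
      \<kappa>N \<kappa>0 Xt by simp_all
  have Npos: "N > 0" using n by (simp add: N_def)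
  have e20: "e2 = 0" using tel(2) F Npos by simp
  obtain u v r where fr: "frames w s H u v r" using frames_exist[OF p] by blast
  have rX: "r k - (X2 k - 2 * X1 k) = r K - (X2 K - 2 * X1 K)" for k
  proof -
    have step: "r (k + 1) - (X2 (k + 1) - 2 * X1 (k + 1)) = r k - (X2 k - 2 * X1 k)" for k
    proof -
      have "r (k + 1) = r k + (if s k = 1 then 1 else - 1) * dir_step (w k)"
        using fr unfolding frames_def by blast
      then show ?thesis using X1[of k] X2[of k] by (auto simp: dir_step_def algebra_simps)
    qed
    show ?thesis
    proof (induction k rule: int_induct[where k = K])
      case base show ?case ..
    next
      case (step1 i) then show ?case using step[of i] by simp
    next
      case (step2 i) then show ?case using step[of "i - 1"] by simp
    qed
  qed
  \<comment> \<open>Consecutive departures have the same direction modulo 6. The letters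
    \<open>2\<close> balance, so the direction changes by -2 times the count of letters
    \<open>1\<close>, which is therefore divisible by 3.\<close>
  have div3: "(X1 (\<kappa> (Suc i)) - X1 (\<kappa> i)) mod 3 = 0" for i
  proof -
    have "s (\<kappa> (Suc i)) = s (\<kappa> i)" using L by simp
    then have "r (\<kappa> (Suc i)) mod 6 = r (\<kappa> i) mod 6" using leaves_2_frame[OF p fr fr lv lv] by blast
    moreover have "r (\<kappa> (Suc i)) - r (\<kappa> i) = - 2 * (X1 (\<kappa> (Suc i)) - X1 (\<kappa> i))"
      using rX[of "\<kappa> (Suc i)"] rX[of "\<kappa> i"] F[of i] e20 by (simp add: algebra_simps)
    ultimately have "6 dvd - 2 * (X1 (\<kappa> (Suc i)) - X1 (\<kappa> i))" by (metis mod_eq_dvd_iff)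
    then show ?thesis by presburger
  qed
  define B :: real where "B = (if A = 0 then 1 else -1)"
  \<comment> \<open>Over a period the terms \<open>A\<close> and \<open>A + 3\<close> add up to 0.
    As \<open>A\<close> is a multiple of 3, one of the two values is 0, and only this one
    occurs.\<close>
  have AB: "(A = 0 \<or> A = - 3) \<and> (\<forall>i<N. b i = B)"
  proof -
    have d: "(if b i = 1 then A else A + 3) mod 3 = 0" for i using div3[of i] F[of i] by simp
    have "A mod 3 = 0"
    proof (cases "b 0 = 1")
      case True then show ?thesis using d[of 0] by simp
    next
      case False then show ?thesis using d[of 0] by presburger
    qed
    have sum0: "(\<Sum>i<N. if b i = 1 then A else A + 3) = 0" using tel(1) F by simp
    have bb: "b i = 1 \<or> b i = -1" for i unfolding b_def by (rule S_sgn[OF p])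
    have "A \<le> 0"
    proof (rule ccontr)
      assume "\<not> A \<le> 0"
      then have "(\<Sum>i<N. if b i = 1 then A else A + 3) > 0" using Npos by (intro sum_pos) auto
      then show False using sum0 by simp
    qed
    moreover have "A \<ge> -3"
    proof (rule ccontr)
      assume "\<not> A \<ge> -3"
      then have "(\<Sum>i<N. - (if b i = 1 then A else A + 3)) > 0" using Npos by (intro sum_pos) auto
      then show False using sum0 by (simp add: sum_negf)
    qed
    ultimately have A: "A = 0 \<or> A = -3" using \<open>A mod 3 = 0\<close> by presburger
    then show ?thesis
    proof
      assume A0: "A = 0"
      have "\<forall>i\<in>{..<N}. (if b i = 1 then A else A + 3) = 0"
        using sum0 by (subst (asm) sum_nonneg_eq_0_iff) (auto simp: A0)
      then show ?thesis using A0 bb by (auto simp: B_def split: if_splits)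
    next
      assume A0: "A = -3"
      have "(\<Sum>i<N. - (if b i = 1 then A else A + 3)) = 0" using sum0 by (simp add: sum_negf)
      then have "\<forall>i\<in>{..<N}. - (if b i = 1 then A else A + 3) = 0"
        by (subst (asm) sum_nonneg_eq_0_iff) (auto simp: A0)
      then show ?thesis using A0 bb by (auto simp: B_def split: if_splits)
    qed
  qed
  have bN: "b (i + N) = b i" for i
  proof -
    have "\<kappa> (i + N) = \<kappa> i + int (nat M) * n" using n by (simp add: \<kappa>_def N_def M_def algebra_simps)
    then have e: "\<kappa> (i + N) + int m = (\<kappa> i + int m) + int (nat M) * n" by linarith
    have "S (\<kappa> (i + N) + int m) = S (\<kappa> i + int m)" unfolding e using shift_n[of "\<kappa> i + int m" "nat M"] by blast
    then show ?thesis unfolding b_def by simp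
  qed
  have bB: "b i = B" for i
  proof (induction i rule: less_induct)
    case (less i)
    show ?case
    proof (cases "i < N")
      case True then show ?thesis using AB by blast
    next
      case False
      then have "b (i - N) = B" using less Npos by simp
      then show ?thesis using bN[of "i - N"] False by simp
    qed
  qed
  have onl: "j = 2 \<and> S k j = B" if h: "H k j = 0" for k j
  proof -
    define t where "t = nat (\<bar>k\<bar> + \<bar>K\<bar> + M)"
    have "int t * n \<ge> int t" using n by (simp add: mult_le_cancel_left1)
    moreover have "int t = \<bar>k\<bar> + \<bar>K\<bar> + M" by (simp add: t_def M_def)
    ultimately have kt: "k + int t * n - K \<ge> M" by linarith
    define k' where "k' = k + int t * n"
    have h': "H k' j = 0" "S k' = S k" using shift_n[of k t] h by (auto simp: k'_def)
    define i l where "i = nat ((k' - K) div M)" and "l = (k' - K) mod M"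
    have Mpos: "M > 0" by (simp add: M_def)
    have l: "0 \<le> l" "l < M" using Mpos by (simp_all add: l_def)
    have d1: "(k' - K) div M \<ge> 1" using kt Mpos by (simp add: k'_def zdiv_mono1[of M "k' - K" M, simplified] pos_imp_zdiv_pos_iff int_one_le_iff_zero_less)
    then have i1: "i \<ge> 1" by (simp add: i_def)
    have kk: "k' = \<kappa> i + l"
    proof -
      have "int i = (k' - K) div M" using d1 by (simp add: i_def)
      then show ?thesis using div_mult_mod_eq[of "k' - K" M] by (simp add: \<kappa>_def l_def)
    qed
    have run: "run (\<kappa> i) 2 m 2" using L by blast
    have Sfan: "S (\<kappa> a + int m + l') 2 = B" if "0 \<le> l'" "l' \<le> 3" for a l'
    proof -
      let ?k = "\<kappa> a + int m"
      have "S (?k + l') 2 = S ?k 2"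
      proof (rule vertex_const[of _ _ 2])
        fix i assume "?k \<le> i" "i < ?k + l'"
        then have "i = ?k \<or> i = ?k + 1 \<or> i = ?k + 2" using that by auto
        then show "w i \<noteq> 2" using fan_2(6-8)[OF p ar[of a]] by (auto split: if_splits)
      qed (use that S_Suc[OF p] in auto)
      then show ?thesis using bB[of a] by (simp add: b_def)
    qed
    consider "l = 0" | "0 < l" "l < int m" | "int m \<le> l" using l by linarith
    then have "j = 2 \<and> S k' j = B"
    proof cases
      case 1
      have "\<kappa> i = \<kappa> (i - 1) + int m + 3" using \<kappa>S[of "i - 1"] i1 by simp
      then have "S k' 2 = B" using Sfan[of 3 "i - 1"] kk 1 by simp
      moreover have "j = 2" using lv[of i] h' kk 1 label_cases[of j] by (auto simp: leaves_def)
      ultimately show ?thesis by blast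
    next
      case 2
      then have "0 < nat l \<and> nat l < m" by linarith
      then have "H (\<kappa> i + int (nat l)) j \<noteq> 0" using run unfolding run_def by blast
      then show ?thesis using h' kk l by simp
    next
      case 3
      define l' where "l' = l - int m"
      have l': "0 \<le> l'" "l' \<le> 3" using 3 l by (auto simp: l'_def M_def)
      have k': "k' = \<kappa> i + int m + l'" using kk by (simp add: l'_def)
      have "j = 2" using fan_2(9)[OF p ar[of i], of j l'] l' h' k' by auto
      then show ?thesis using Sfan[OF l'] k' by simp
    qed
    then show ?thesis unfolding h'(2) .
  qed
  \<comment> \<open>The term \<open>s K / 2\<close> absorbs the case distinction in
    \<open>A\<close>, so that the count on a single run reveals the side.\<close>
  have "of_int (X1 (K + int m) - X1 K) - s K / 2 = 3 / 2 * B"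
    using AB sK by (auto simp: A_def e1_def[symmetric] B_def)
  then show ?thesis using onl by (intro exI[of _ B]) (auto simp: B_def)
qed

end

text \<open>\<open>H\<close> is measured from the lower line, whose vertices are below the path, and
  \<open>H'\<close> from the upper one. If the departures on both lines have the same orientation,
  the runs coincide, but their letter counts reveal different sides. Otherwise the end of the upper
  run is a point reflection of the start of the lower one.\<close>

lemma two_lines_2:
  assumes l: "tiling_path w s S H n" and l': "tiling_path w s S H' n"
    and \<delta>: "\<delta> > 0" "\<And>k j. H k j = H' k j + \<delta>"
    and r: "tiling_path.run s H K 2 m 2" and r': "tiling_path.run s H' K' 2 m' 2"
    and X1: "\<And>k. X1 (k + 1) = X1 k + (if s k = 1 then 1 else - 1) * (if w k = 1 then 1 else (0::int))"
    and X2: "\<And>k. X2 (k + 1) = X2 k + (if s k = 1 then 1 else - 1) * (if w k = 2 then 1 else (0::int))"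
    and Xn: "\<And>k. X1 (k + n) = X1 k" "\<And>k. X2 (k + n) = X2 k"
  shows False
proof -
  interpret A: tiling_path w s S H n by (rule l)
  interpret B: tiling_path w s S H' n by (rule l')
  have p: "tpath w s S H" and p': "tpath w s S H'" by (rule A.p B.p)+
  obtain b where b: "\<forall>k j. H k j = 0 \<longrightarrow> j = 2 \<and> S k j = b" "of_int (X1 (K + int m) - X1 K) - s K / 2 = 3 / 2 * b"
    "b = 1 \<or> b = -1"
    using A.line_2_sides[OF r X1 X2 Xn] by blast
  obtain b' where b': "\<forall>k j. H' k j = 0 \<longrightarrow> j = 2 \<and> S k j = b'"
    "of_int (X1 (K' + int m') - X1 K') - s K' / 2 = 3 / 2 * b'" "b' = 1 \<or> b' = -1"
    using B.line_2_sides[OF r' X1 X2 Xn] by blast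
  have lv: "leaves s H K 2" "leaves s H' K' 2" using r r' by (auto simp: A.run_def B.run_def)
  have ar': "arrives s H' (K' + int m') 2" using r' by (simp add: B.run_def)
  have bb: "b = -1" "b' = 1"
  proof -
    have "H K 2 = 0" "H' K' 2 = 0" using lv by (auto simp: leaves_def)
    moreover from this have "S K 2 = b" "S K' 2 = b'" using b(1) b'(1) by blast+
    ultimately have "S K 2 = b" "S K' 2 = b'" "H' K 2 < 0" "H K' 2 > 0"
      using \<delta>(1) \<delta>(2)[of K 2] \<delta>(2)[of K' 2] by simp_all
    moreover have "S K 2 * H' K 2 \<ge> 0" "S K' 2 * H K' 2 \<ge> 0" by (rule SH[OF p'] SH[OF p])+
    ultimately show "b = -1" "b' = 1" using b(3) b'(3) by auto
  qed
  obtain u v rr where fr: "frames w s H u v rr" using frames_exist[OF p] by blast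
  then have fr': "frames w s H' u v rr" unfolding frames_def \<delta>(2) by simp
  show False
  proof (cases "s K = s K'")
    case True
    have H0: "H K 2 = H' K' 2" using lv by (auto simp: leaves_def)
    have HK: "H K = H' K'"
      by (rule frame_eq[OF p fr fr' True leaves_2_frame[OF p fr fr' lv True] H0])
    have f: "forced s H (K + int i)" if "i < m" for i using r that by (auto simp: A.run_def)
    have f': "forced s H' (K' + int i)" if "i < m'" for i using r' that by (auto simp: B.run_def)
    have D: "s (K + int i) = s (K' + int i) \<and> H (K + int i) = H' (K' + int i) \<and>
         (\<forall>i'<i. w (K + int i') = w (K' + int i'))" if "i \<le> m" for i
      by (rule determined[where m = i, OF p p' True HK]) (use f that in auto)
    have D': "s (K' + int i) = s (K + int i) \<and> H' (K' + int i) = H (K + int i) \<and>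
         (\<forall>i'<i. w (K' + int i') = w (K + int i'))" if "i \<le> m'" for i
      by (rule determined[where m = i, OF p' p True[symmetric] HK[symmetric]]) (use f' that in auto)
    have "\<not> forced s H (K + int m)" "\<not> forced s H' (K' + int m')"
      using r r' arrives_not_forced by (auto simp: A.run_def B.run_def)
    then have "m = m'" using D[of m'] D'[of m] f[of m'] f'[of m] unfolding forced_def
      by (metis linorder_neqE_nat order_less_imp_le)
    then have "X1 (K + int m) - X1 K = X1 (K' + int m') - X1 K'"
      using count_run[where X = X1 and s = s and w = w and j = 1, OF X1, of m K K'] D[of m] s_parity[OF p] True by auto
    then show False using b(2) b'(2) bb True by simp
  next
    case False
    then have sK: "s K = - s K'" using s_sgn[OF p, of K] s_sgn[OF p, of K'] by auto
    define k where "k = K' + int m'"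
    have "s k = - s K'" unfolding k_def
      by (rule B.same_class[OF lv(2) ar']) (use r' in \<open>auto simp: B.run_def\<close>)
    then have sk: "s K = s k" using sK by simp
    have ark: "arrives s H' k 2" using ar' by (simp add: k_def)
    have H0: "H K 2 = - H' k 2" using lv ark by (auto simp: leaves_def arrives_def)
    have rm: "rr K mod 6 = (rr k + 3) mod 6"
    proof -
      have "rr k mod 6 = (rr K + 3) mod 6" by (rule leaves_arrives_2_frame[OF p fr fr' lv(1) ark sk])
      then show ?thesis by presburger
    qed
    have HK: "H K j = - H' k j" for j by (rule frame_opp[OF p fr fr' sk rm H0])
    \<comment> \<open>Heights over the line midway between the two. No vertex lies on it, so every
      crossing is forced, and it contains the centre of the point reflection between copies
      \<open>K\<close> and \<open>k\<close>.\<close>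
    define G where "G k j = H' k j + \<delta> / 2" for k j
    have G: "tpath w s S G"
    proof -
      have sg: "S k j * G k j \<ge> 0" for k j
        using SH[OF p, of k j] SH[OF p', of k j] S_sgn[OF p, of k j] \<delta>(2)[of k j] \<delta>(1) by (auto simp: G_def)
      have gw: "G (k + 1) (w k) = refl_height (G k) (w k)" for k
        using H_w[OF p', of k] by (auto simp: G_def refl_height_def field_simps)
      have gn: "\<not> (G k 0 = G k 1 \<and> G k 1 = G k 2)" for k using H_nondeg[OF p', of k] by (simp add: G_def)
      have gS: "j \<noteq> w k \<Longrightarrow> G (k + 1) j = G k j" for j k using H_Suc[OF p'] by (simp add: G_def)
      show ?thesis unfolding tpath_def
        using s_sgn[OF p] s_Suc[OF p] S_sgn[OF p] S_Suc[OF p] S_w1[OF p] S_w2[OF p] sg gw gn gS by blast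
    qed
    interpret G: tiling_path w s S G n
      by unfold_locales (use G A.n A.sn A.Sn A.wn B.Hn in \<open>auto simp: G_def fun_eq_iff\<close>)
    have Gn: "G k j \<noteq> 0" for k j
      using SH[OF p, of k j] SH[OF p', of k j] S_sgn[OF p, of k j] \<delta>(2)[of k j] \<delta>(1) by (auto simp: G_def)
    have fG: "forced s G k" for k
    proof -
      have a: "s k * S k (w k + 2) = 1" "s k * S k (w k + 1) = -1" by (rule S_w2[OF p] S_w1[OF p])+
      have "S k j * G k j > 0" for j using SH[OF G, of k j] Gn[of k j] S_sgn[OF p, of k j] by auto
      from this[of "w k + 2"] this[of "w k + 1"] a show ?thesis unfolding forced_def
        using s_sgn[OF p, of k] S_sgn[OF p, of k "w k + 1"] S_sgn[OF p, of k "w k + 2"]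
        by (intro exI[of _ "w k"]) auto
    qed
    define t where "t = nat (\<bar>k\<bar> + \<bar>K\<bar>)"
    have "int t * n \<ge> int t" using A.n by (simp add: mult_le_cancel_left1)
    moreover have "int t = \<bar>k\<bar> + \<bar>K\<bar>" by (simp add: t_def)
    ultimately have "K \<le> k + int t * n" by linarith
    then obtain q where q: "k + int t * n = K + int q" by (metis zle_iff_zadd)
    have "s K = s (K + int q)" using A.shift_n[of k t] sk q by simp
    moreover have "G K j = - G (K + int q) j" for j
      using G.shift_n[of k t] HK[of j] \<delta>(2)[of K j] q by (simp add: G_def)
    ultimately show False using G.no_palindrome fG by blast
  qed
qed

section \<open>Degenerating sequences of unfoldings\<close>

lemma periodic_mod:
  fixes f :: "nat \<Rightarrow> 'a"
  assumes "\<And>i. f (i + N) = f i"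
  shows "f i = f (i mod N)"
proof -
  have "f (m + q * N) = f m" for m q
  proof (induction q)
    case (Suc q)
    have "m + Suc q * N = m + q * N + N" by simp
    then show ?case using assms[of "m + q * N"] Suc by metis
  qed simp
  from this[of "i mod N" "i div N"] show ?thesis by simp
qed

text \<open>A maximal slope above \<open>K\<close> is reached by an increase, hence at an index with
  \<open>a = 1\<close>. From there \<open>y\<close> rises above \<open>y0\<close>, so all later
  indices have \<open>a = 1\<close> too and the slope cannot fall again. A slope that is constant
  and above \<open>K\<close> would let \<open>y\<close> drift.\<close>

lemma periodic_slope_le:
  fixes y \<nu> a :: "nat \<Rightarrow> real"
  assumes N: "N > 0" and per: "\<And>i. y (i + N) = y i" "\<And>i. \<nu> (i + N) = \<nu> i"
    and a: "\<And>i. a i = 1 \<or> a i = -1"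
    and down: "\<And>i. a (i + 1) = -1 \<Longrightarrow> \<nu> (i + 1) \<le> \<nu> i" and up: "\<And>i. a (i + 1) = 1 \<Longrightarrow> \<nu> (i + 1) \<ge> \<nu> i"
    and y: "\<And>i. y (i + 1) \<ge> y i + \<nu> i - K"
    and sides: "\<And>i. a i = 1 \<Longrightarrow> y i \<ge> y0" "\<And>i. a i = -1 \<Longrightarrow> y i \<le> y0"
  shows "\<nu> i \<le> K"
proof (rule ccontr)
  assume "\<not> \<nu> i \<le> K"
  define M where "M = Max (\<nu> ` {..<N})"
  have M: "\<nu> j \<le> M" for j
    unfolding M_def periodic_mod[of \<nu> N j, OF per(2)] using N by (intro Max_ge) auto
  have MK: "M > K" using M[of i] \<open>\<not> \<nu> i \<le> K\<close> by simp
  have "M \<in> \<nu> ` {..<N}" unfolding M_def using N by (intro Max_in) auto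
  then obtain m where m: "\<nu> m = M" by auto
  show False
  proof (cases "\<forall>j. \<nu> j = M")
    case True
    have "y j \<ge> y 0 + real j * (M - K)" for j
    proof (induction j)
      case (Suc j)
      then show ?case using y[of j] True by (simp add: algebra_simps)
    qed simp
    from this[of N] show False using per(1)[of 0] N MK by (simp add: mult_le_0_iff)
  next
    case False
    then obtain j where j: "\<nu> j \<noteq> M" by blast
    have mj: "\<nu> (m + j * N) = M"
      using m periodic_mod[of \<nu> N, OF per(2)] by (metis mod_mult_self1)
    define l where "l = (LEAST l. l > j \<and> \<nu> l = M)"
    have "\<exists>l. l > j \<and> \<nu> l = M"
    proof -
      have "\<nu> (m + (j + 1) * N) = M" using m periodic_mod[of \<nu> N, OF per(2)] by (metis mod_mult_self1)
      moreover have "m + (j + 1) * N > j" using N by (cases N) auto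
      ultimately show ?thesis by blast
    qed
    then have l: "l > j" "\<nu> l = M" unfolding l_def by (metis (mono_tags, lifting) LeastI_ex)+
    have lm: "\<nu> (l - 1) \<noteq> M"
    proof (cases "l - 1 = j")
      case True then show ?thesis using j by simp
    next
      case False
      then have "l - 1 > j" "l - 1 < l" using l by auto
      then show ?thesis using not_less_Least[of "l - 1" "\<lambda>l. l > j \<and> \<nu> l = M"] unfolding l_def by blast
    qed
    have l1: "l = (l - 1) + 1" using l by simp
    have "a l = 1" using down[of "l - 1"] a[of l] l(2) lm M[of "l - 1"] l1 by fastforce
    then have "\<nu> (l + i) = M \<and> y (l + i) \<ge> y0" for i
    proof (induction i)
      case 0 then show ?case using l sides(1) by simp
    next
      case (Suc i)
      have "y (l + i + 1) > y0" using y[of "l + i"] Suc MK by simp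
      then have "a (l + i + 1) = 1" using a[of "l + i + 1"] sides(2)[of "l + i + 1"] by auto
      then have "\<nu> (l + i + 1) = M" using up[of "l + i"] M[of "l + i + 1"] Suc by simp
      then show ?case using \<open>y (l + i + 1) > y0\<close> by simp
    qed
    from this[of "N - 1"] have "\<nu> (l - 1 + N) = M" using N l1 by (metis Nat.add_diff_assoc Nat.add_diff_assoc2 Suc_leI add.commute l(1) One_nat_def less_nat_zero_code not_gr_zero)
    then show False using per(2)[of "l - 1"] lm by simp
  qed
qed

text \<open>The first-order heights \<open>y\<close> of the vertices \<open>1\<close> along a chain. The slope \<open>\<nu>\<close> can only increase at
  vertices above the path and decrease below it; a vertex above the path is not lower than a vertex below.\<close>

lemma chain_heights:
  fixes a b c d D E y :: "nat \<Rightarrow> real"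
  assumes N: "N > 0" and l: "l1 > 0" "l2 > 0"
    and sg: "\<And>i. a i = 1 \<or> a i = -1" "\<And>i. b i = 1 \<or> b i = -1" "\<And>i. c i = 1 \<or> c i = -1" "\<And>i. d i = 1 \<or> d i = -1"
    and per: "\<And>i. a (i + N) = a i" "\<And>i. b (i + N) = b i" "\<And>i. c (i + N) = c i"
    and E: "\<And>i. E (i + 1) = E i + 6 * a (i + 1) - 3 * (b i + c i)" "E N = E 0"
    and D: "\<And>i. D (i + 1) = D i + 2 * d i - 3 * (b i + c i)" "D N = D 0"
    and y: "\<And>i. y (i + 1) = y i + 2 * (l1 + l2) * (E i - 3 * b i) + 3 * l1 * (b i - c i) + C" "y N = y 0"
    and ord: "\<And>i j. a i = 1 \<Longrightarrow> a j = -1 \<Longrightarrow> y j \<le> y i"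
  shows False
proof -
  \<comment> \<open>The bounded term \<open>3 * l1 * (b i - c i)\<close> is kept out of the slope.
    What remains changes by multiples of \<open>2 * a (i + 1) - b (i + 1) - c i\<close>, which is 0
    or has the sign of \<open>a (i + 1)\<close>.\<close>
  define \<nu> where "\<nu> i = 2 * (l1 + l2) * (E i - 3 * b i) + C" for i
  have E_per: "E (i + N) = E i" for i
  proof (induction i)
    case (Suc i)
    then show ?case using E(1)[of i] E(1)[of "i + N"] per(1)[of "Suc i"] per(2,3)[of i] by simp
  qed (use E in simp)
  have y_per: "y (i + N) = y i" for i
  proof (induction i)
    case (Suc i)
    then show ?case using y(1)[of i] y(1)[of "i + N"] per(2,3)[of i] E_per[of i] by simp
  qed (use y in simp)
  have \<nu>_per: "\<nu> (i + N) = \<nu> i" for i using E_per per by (simp add: \<nu>_def)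
  have step: "\<nu> (i + 1) = \<nu> i + 6 * (l1 + l2) * (2 * a (i + 1) - b (i + 1) - c i)" for i
    unfolding \<nu>_def E(1) by (simp add: algebra_simps)
  have y': "y (i + 1) = y i + \<nu> i + 3 * l1 * (b i - c i)" for i using y(1)[of i] by (simp add: \<nu>_def)
  have up: "\<nu> (i + 1) \<ge> \<nu> i" if "a (i + 1) = 1" for i
    unfolding step using that sg(2)[of "i + 1"] sg(3)[of i] l by auto
  have down: "\<nu> (i + 1) \<le> \<nu> i" if "a (i + 1) = -1" for i
    unfolding step using that sg(2)[of "i + 1"] sg(3)[of i] l by (auto simp: mult_nonneg_nonpos)
  have bc: "\<bar>3 * l1 * (b i - c i)\<bar> \<le> 6 * l1" for i using sg(2)[of i] sg(3)[of i] l by auto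
  have uniform_all: "\<And>i. a (i + 1) = b (i + 1) \<and> a (i + 1) = c i" if eq: "\<And>i. \<nu> (i + 1) = \<nu> i"
  proof -
    fix i show "a (i + 1) = b (i + 1) \<and> a (i + 1) = c i"
      using step[of i] eq[of i] l sg(1)[of "i + 1"] sg(2)[of "i + 1"] sg(3)[of i] by auto
  qed
  \<comment> \<open>With \<open>a = b = c = e\<close> throughout, \<open>D\<close> changes by
    \<open>2 * d i - 6 * e\<close>, which has the sign of \<open>- e\<close> whatever
    \<open>d i\<close> is.\<close>
  have rot: "(\<forall>i. a i = e) \<Longrightarrow> (\<And>i. \<nu> (i + 1) = \<nu> i) \<Longrightarrow> False" if e: "e = 1 \<or> e = -1" for e
  proof -
    assume ae: "\<forall>i. a i = e" and eq: "\<And>i. \<nu> (i + 1) = \<nu> i"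
    have be: "b i = e" for i
    proof -
      obtain m where "i + N = m + 1" using N by (cases N) auto
      then show ?thesis using uniform_all[OF eq, of m] per(2)[of i] ae by metis
    qed
    have ce: "c i = e" for i using uniform_all[OF eq, of i] ae by metis
    have "e * (D i - D 0) \<le> - 4 * real i" for i
    proof (induction i)
      case (Suc i)
      have "e * (D (i + 1) - D 0) = e * (D i - D 0) + e * (2 * d i - 6 * e)"
        unfolding D(1) be ce by (simp add: algebra_simps)
      moreover have "e * (2 * d i - 6 * e) \<le> -4" using e sg(4)[of i] by auto
      ultimately show ?case using Suc by simp
    qed simp
    from this[of N] show False using D(2) N by simp
  qed
  show False
  proof (cases "\<exists>e. \<forall>i. a i = e")
    case True
    then obtain e where ae: "\<forall>i. a i = e" by blast
    then have e: "e = 1 \<or> e = -1" using sg(1) by metis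
    have mono: "e * \<nu> (i + 1) \<ge> e * \<nu> i" for i
      using up[of i] down[of i] ae e by auto
    have "e * \<nu> (j + i) \<ge> e * \<nu> j" for i j
    proof (induction i)
      case (Suc i)
      then show ?case using mono[of "j + i"] by simp
    qed simp
    note m = this
    have "\<nu> (i + 1) = \<nu> i" for i
    proof -
      have "i + 1 + (N - 1) = i + N" using N by simp
      then have "e * \<nu> (i + 1) \<le> e * \<nu> i" using m[of "i + 1" "N - 1"] \<nu>_per[of i] by simp
      then have "e * \<nu> (i + 1) = e * \<nu> i" using mono[of i] by (rule antisym)
      then show ?thesis using e by auto
    qed
    then show False using rot[OF e ae] by blast
  next
    case False
    then have pm: "\<exists>i. a i = 1" "\<exists>i. a i = -1" using sg(1) by metis+
    define A where "A = {i. i < N \<and> a i = -1}"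
    have a_mod: "a i = a (i mod N)" and y_mod: "y i = y (i mod N)" for i
      using periodic_mod[of a N] periodic_mod[of y N] per(1) y_per by blast+
    have modN: "i mod N < N" for i using N by simp
    obtain i where "a i = -1" using pm(2) by blast
    then have "i mod N \<in> A" using a_mod[of i] modN by (simp add: A_def)
    then have fA: "finite A" "A \<noteq> {}" by (auto simp: A_def)
    define y0 where "y0 = Max (y ` A)"
    have lo: "y i \<le> y0" if "a i = -1" for i
    proof -
      have "i mod N \<in> A" using that a_mod[of i] modN by (auto simp: A_def)
      then show ?thesis unfolding y0_def y_mod[of i] using fA by (intro Max_ge) auto
    qed
    have "y0 \<in> y ` A" unfolding y0_def using fA by (intro Max_in) auto
    then have hi: "y0 \<le> y i" if "a i = 1" for i using ord[OF that] by (auto simp: A_def)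
    have le: "\<nu> i \<le> 6 * l1" for i
    proof (rule periodic_slope_le[where y = y and a = a and N = N and ?y0.0 = y0])
      fix i
      show "y (i + 1) \<ge> y i + \<nu> i - 6 * l1" using y'[of i] bc[of i] by linarith
    qed (use N y_per \<nu>_per sg(1) down up hi lo in auto)
    have ge: "- \<nu> i \<le> 6 * l1" for i
    proof (rule periodic_slope_le[where y = "\<lambda>i. - y i" and \<nu> = "\<lambda>i. - \<nu> i" and a = "\<lambda>i. - a i" and N = N and ?y0.0 = "- y0"])
      fix i
      show "- y (i + 1) \<ge> - y i + - \<nu> i - 6 * l1" using y'[of i] bc[of i] by linarith
      show "- a i = 1 \<or> - a i = -1" using sg(1)[of i] by auto
      show "- a (i + 1) = -1 \<Longrightarrow> - \<nu> (i + 1) \<le> - \<nu> i" using up[of i] by simp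
      show "- a (i + 1) = 1 \<Longrightarrow> - \<nu> (i + 1) \<ge> - \<nu> i" using down[of i] by simp
      show "- a i = 1 \<Longrightarrow> - y i \<ge> - y0" using lo[of i] by simp
      show "- a i = -1 \<Longrightarrow> - y i \<le> - y0" using hi[of i] by simp
    qed (use N y_per \<nu>_per in auto)
    \<comment> \<open>A nonzero jump is at least \<open>12 * (l1 + l2)\<close> in absolute value,
      but the slope ranges between \<open>- 6 * l1\<close> and \<open>6 * l1\<close>.\<close>
    have eq: "\<nu> (i + 1) = \<nu> i" for i
    proof (rule ccontr)
      assume ne: "\<nu> (i + 1) \<noteq> \<nu> i"
      define x where "x = 2 * a (i + 1) - b (i + 1) - c i"
      have "x \<noteq> 0" using ne step[of i] by (auto simp: x_def)
      then have x2: "x \<ge> 2 \<or> x \<le> -2"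
        using sg(1)[of "i + 1"] sg(2)[of "i + 1"] sg(3)[of i] by (auto simp: x_def)
      have d: "\<nu> (i + 1) - \<nu> i = 6 * (l1 + l2) * x" using step[of i] by (simp add: x_def)
      from x2 show False
      proof
        assume "x \<ge> 2"
        then have "6 * (l1 + l2) * x \<ge> 6 * (l1 + l2) * 2" using l by (intro mult_left_mono) auto
        then show False using d le[of "i + 1"] ge[of i] l by (simp add: algebra_simps)
      next
        assume "x \<le> -2"
        then have "6 * (l1 + l2) * x \<le> 6 * (l1 + l2) * (-2)" using l by (intro mult_left_mono) auto
        then show False using d le[of i] ge[of "i + 1"] l by (simp add: algebra_simps)
      qed
    qed
    have b_eq: "b i = a i" for i
    proof -
      obtain m where "i + N = m + 1" using N by (cases N) auto
      then show ?thesis using uniform_all[OF eq, of m] per(1,2)[of i] by metis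
    qed
    have c_eq: "c i = a (i + 1)" for i using uniform_all[OF eq, of i] by metis
    have \<nu>0: "\<nu> i = \<nu> 0" for i by (induction i) (use eq in auto)
    \<comment> \<open>As \<open>b i = a i\<close> and \<open>c i = a (i + 1)\<close>, the bounded
      term telescopes and \<open>z\<close> is an arithmetic progression; being periodic, it is
      constant. Vertices with \<open>a = 1\<close> are then lower by \<open>6 * l1\<close> than
      those with \<open>a = -1\<close>.\<close>
    define z where "z i = y i + 3 * l1 * a i" for i
    have z: "z i = z 0 + real i * \<nu> 0" for i
    proof (induction i)
      case (Suc i)
      have "z (Suc i) = z i + \<nu> 0"
        using y'[of i] \<nu>0[of i] unfolding b_eq c_eq by (simp add: z_def algebra_simps)
      then show ?case using Suc by (simp add: algebra_simps)
    qed simp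
    have "z N = z 0" using y(2) per(1)[of 0] by (simp add: z_def)
    then have "\<nu> 0 = 0" using z[of N] N by simp
    then have zc: "z i = z j" for i j using z[of i] z[of j] by simp
    obtain i j where "a i = 1" "a j = -1" using pm by blast
    then show False using ord[of i j] zc[of i j] l by (simp add: z_def)
  qed
qed

lemma cis_slope:
  fixes x t :: "nat \<Rightarrow> real"
  assumes x: "x \<longlonglongrightarrow> 0" "(\<lambda>\<nu>. x \<nu> / t \<nu>) \<longlonglongrightarrow> A"
  shows "(\<lambda>\<nu>. (cis (x \<nu>) - 1) / of_real (t \<nu>)) \<longlonglongrightarrow> \<i> * of_real A"
proof -
  have "DERIV exp (0::complex) :> exp 0" by (rule DERIV_exp)
  \<comment> \<open>Caratheodory's form of the derivative avoids dividing by \<open>x \<nu>\<close>,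
    which may be 0.\<close>
  then obtain g where g: "\<And>z. exp z - exp (0::complex) = g z * (z - 0)" "isCont g 0" "g 0 = exp 0"
    unfolding CARAT_DERIV by blast
  have gx: "(cis (x \<nu>) - 1) / of_real (t \<nu>) = g (\<i> * of_real (x \<nu>)) * (\<i> * of_real (x \<nu> / t \<nu>))" for \<nu>
    using g(1)[of "\<i> * of_real (x \<nu>)"] by (simp add: cis_conv_exp)
  have "(\<lambda>\<nu>. \<i> * complex_of_real (x \<nu>)) \<longlonglongrightarrow> \<i> * of_real 0" by (intro tendsto_intros x)
  then have i0: "(\<lambda>\<nu>. \<i> * complex_of_real (x \<nu>)) \<longlonglongrightarrow> 0" unfolding of_real_0 mult_zero_right .
  have "(\<lambda>\<nu>. g (\<i> * of_real (x \<nu>))) \<longlonglongrightarrow> g 0"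
    by (rule isCont_tendsto_compose[OF g(2) i0])
  then have "(\<lambda>\<nu>. g (\<i> * of_real (x \<nu>)) * (\<i> * of_real (x \<nu> / t \<nu>))) \<longlonglongrightarrow> g 0 * (\<i> * of_real A)"
    by (intro tendsto_intros x)
  then show ?thesis unfolding gx g(3) by simp
qed

text \<open>\<open>v\<close> and \<open>q\<close> lead to the left and the right neighbour of a
  vertex. An angle larger than \<open>pi\<close> below the vertex lifts one of them above it; so a
  vertex without higher neighbours has the large angle above it, which is the case
  \<open>e = -1\<close>.\<close>

lemma turn_sign:
  assumes "Re v < 0" "0 < \<epsilon>" "\<epsilon> < pi / 2" "e = 1 \<or> e = -1" "q = cis (e * (pi + \<epsilon>)) * v"
  shows "Im v \<le> 0 \<Longrightarrow> Im q \<le> 0 \<Longrightarrow> e = -1" "Im v \<ge> 0 \<Longrightarrow> Im q \<ge> 0 \<Longrightarrow> e = 1"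
proof -
  have sc: "sin \<epsilon> > 0" "cos \<epsilon> > 0" using assms by (auto intro!: sin_gt_zero cos_gt_zero)
  have q: "Im q = - (e * sin \<epsilon> * Re v) - cos \<epsilon> * Im v"
    using assms(4) unfolding assms(5) by (auto simp: algebra_simps sin_add cos_add)
  have n: "sin \<epsilon> * Re v < 0" using sc assms(1) by (simp add: mult_pos_neg)
  show "Im v \<le> 0 \<Longrightarrow> Im q \<le> 0 \<Longrightarrow> e = -1"
    using q n sc(2) assms(4) mult_nonneg_nonpos[of "cos \<epsilon>" "Im v"] by auto
  show "Im v \<ge> 0 \<Longrightarrow> Im q \<ge> 0 \<Longrightarrow> e = 1"
    using q n mult_nonneg_nonneg[OF less_imp_le[OF sc(2)], of "Im v"] assms(4) by auto
qed

section \<open>Normalized unfoldings and their limit\<close>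

locale degenerating_path =
  fixes w :: "int \<Rightarrow> 3" and s :: "int \<Rightarrow> real" and n :: int and x1 x2 :: "int \<Rightarrow> int"
    and t r L h :: "nat \<Rightarrow> real" and \<phi> :: "nat \<Rightarrow> 3 \<Rightarrow> real"
    and W :: "nat \<Rightarrow> int \<Rightarrow> 3 \<Rightarrow> complex" and W0 :: "int \<Rightarrow> 3 \<Rightarrow> complex"
  assumes npos: "n > 0" and w_n: "\<And>k. w (k + n) = w k" and s_n: "\<And>k. s (k + n) = s k"
    and ssgn: "\<And>k. s k = 1 \<or> s k = -1" and sSuc: "\<And>k. s (k + 1) = - s k"
    and x1: "\<And>k. x1 (k + 1) = x1 k + (if s k = 1 then 1 else - 1) * (if w k = 1 then 1 else 0)"
    and x2: "\<And>k. x2 (k + 1) = x2 k + (if s k = 1 then 1 else - 1) * (if w k = 2 then 1 else 0)"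
    and x_n: "\<And>k. x1 (k + n) = x1 k" "\<And>k. x2 (k + n) = x2 k"
    and t: "\<And>\<nu>. t \<nu> > 0" "t \<longlonglongrightarrow> 0" and r: "\<And>\<nu>. r \<nu> > 0" "(\<lambda>\<nu>. r \<nu> / t \<nu>) \<longlonglongrightarrow> 0"
    and \<phi>: "\<And>\<nu>. \<phi> \<nu> 1 = pi / 6 + t \<nu>" "\<And>\<nu>. \<phi> \<nu> 2 = pi / 3 - t \<nu> - r \<nu>" "\<And>\<nu>. \<phi> \<nu> 0 = pi / 2 + r \<nu>"
    and Q: "\<And>\<nu>. qpath w s (\<phi> \<nu>) (\<lambda>j. sin (\<phi> \<nu> (j + 1)) / sin (\<phi> \<nu> (j + 2))) (W \<nu>)"
    and side: "\<And>\<nu> k. cmod (W \<nu> k 2 - W \<nu> k 1) = sin (\<phi> \<nu> 0)"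
    and W_n: "\<And>\<nu> k j. W \<nu> (k + n) j = W \<nu> k j + of_real (L \<nu>)" and L: "\<And>\<nu>. L \<nu> > 0"
    and cross: "\<And>\<nu> k. s k * (Im (W \<nu> k (w k + 2)) - h \<nu>) > 0" "\<And>\<nu> k. s k * (Im (W \<nu> k (w k + 1)) - h \<nu>) < 0"
    and lim: "\<And>k j. (\<lambda>\<nu>. W \<nu> k j) \<longlonglongrightarrow> W0 k j"
begin

text \<open>Read off at \<open>\<nu> = 0\<close>; all unfoldings have the same letters, so by
  \<open>S_cross\<close> the sides do not depend on \<open>\<nu>\<close>.\<close>

definition S :: "int \<Rightarrow> 3 \<Rightarrow> real" where "S k j = sgn (Im (W 0 k j) - h 0)"

lemma W_Suc: "j \<noteq> w k \<Longrightarrow> W \<nu> (k + 1) j = W \<nu> k j"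
  using Q unfolding qpath_def by blast

lemma S_edge: "S k (w k + 2) = s k" "S k (w k + 1) = - s k"
  using cross[where \<nu> = 0, of k] ssgn[of k] by (auto simp: S_def)

lemma S_cross: "S k j = 1 \<or> S k j = -1" "S k j * (Im (W \<nu> k j) - h \<nu>) > 0"
proof -
  have main: "(S k j = 1 \<or> S k j = -1) \<and> S k j * (Im (W \<nu> k j) - h \<nu>) > 0"
  proof (cases "j = w k")
    case False
    then have "j = w k + 1 \<or> j = w k + 2" using label_cases[of j] label_cases[of "w k"] by auto
    then show ?thesis using S_edge[of k] cross[of k \<nu>] ssgn[of k] by auto
  next
    case True
    define l where "l = k - 1"
    have k: "k = l + 1" by (simp add: l_def)
    \<comment> \<open>The vertex opposite the exit edge is an endpoint of the entry edge, unless
      both edges are the same; but then an endpoint would be on both sides of the path.\<close>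
    have "w l \<noteq> w k"
    proof
      assume e: "w l = w k"
      have "W 0 k (w k + 2) = W 0 l (w l + 2)" using W_Suc[of "w l + 2" l 0] e k by simp
      then show False using cross(1)[of l 0] cross(1)[of k 0] sSuc[of l] e unfolding k by simp
    qed
    then have j: "j \<noteq> w l" using True by simp
    then have W: "W \<nu> k j = W \<nu> l j" for \<nu> using W_Suc[of j l] k by simp
    have "j = w l + 1 \<or> j = w l + 2" using j label_cases[of j] label_cases[of "w l"] by auto
    moreover have "S k j = S l j" unfolding S_def W ..
    ultimately show ?thesis using S_edge[of l] cross[of l \<nu>] ssgn[of l] unfolding W by auto
  qed
  show "S k j = 1 \<or> S k j = -1" "S k j * (Im (W \<nu> k j) - h \<nu>) > 0" using main by blast+
qed

lemma r_lim: "r \<longlonglongrightarrow> 0"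
proof -
  have "(\<lambda>\<nu>. r \<nu> / t \<nu> * t \<nu>) \<longlonglongrightarrow> 0 * 0" by (intro tendsto_intros r t)
  moreover have "r \<nu> / t \<nu> * t \<nu> = r \<nu>" for \<nu> using t(1)[of \<nu>] by simp
  ultimately show ?thesis by simp
qed

definition \<phi>0 :: "3 \<Rightarrow> real" where "\<phi>0 j = (if j = 1 then pi / 6 else if j = 2 then pi / 3 else pi / 2)"

lemma \<phi>_lim: "(\<lambda>\<nu>. \<phi> \<nu> j) \<longlonglongrightarrow> \<phi>0 j"
proof -
  have a: "(\<lambda>\<nu>. pi / 6 + t \<nu>) \<longlonglongrightarrow> pi / 6 + 0" "(\<lambda>\<nu>. pi / 3 - t \<nu> - r \<nu>) \<longlonglongrightarrow> pi / 3 - 0 - 0"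
    "(\<lambda>\<nu>. pi / 2 + r \<nu>) \<longlonglongrightarrow> pi / 2 + 0" by (intro tendsto_intros t r_lim)+
  then show ?thesis using label_cases[of j] by (auto simp: \<phi> \<phi>0_def)
qed

definition \<rho>0 :: "3 \<Rightarrow> real" where "\<rho>0 j = sin (\<phi>0 (j + 1)) / sin (\<phi>0 (j + 2))"

lemma sin_\<phi>0: "sin (\<phi>0 j) > 0"
  using label_cases[of j] by (auto simp: \<phi>0_def sin_30 sin_60)

lemma Q0: "qpath w s \<phi>0 \<rho>0 W0"
  unfolding qpath_def
proof (intro conjI allI impI)
  fix j show "\<rho>0 j > 0" using sin_\<phi>0 by (simp add: \<rho>0_def)
next
  fix k j assume "j \<noteq> w k"
  then have "W \<nu> (k + 1) j = W \<nu> k j" for \<nu> by (rule W_Suc)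
  then show "W0 (k + 1) j = W0 k j" using LIMSEQ_unique lim[of "k + 1" j] lim[of k j] by simp
next
  fix k j
  have e: "W \<nu> k (j + 2) - W \<nu> k j =
      of_real (sin (\<phi> \<nu> (j + 1)) / sin (\<phi> \<nu> (j + 2))) * cis (s k * \<phi> \<nu> j) * (W \<nu> k (j + 1) - W \<nu> k j)" for \<nu>
    using Q unfolding qpath_def by blast
  have c: "(\<lambda>\<nu>. cis (s k * \<phi> \<nu> j)) \<longlonglongrightarrow> cis (s k * \<phi>0 j)"
    unfolding cis_conv_exp by (intro tendsto_intros \<phi>_lim)
  have "(\<lambda>\<nu>. of_real (sin (\<phi> \<nu> (j + 1)) / sin (\<phi> \<nu> (j + 2))) * cis (s k * \<phi> \<nu> j) * (W \<nu> k (j + 1) - W \<nu> k j))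
      \<longlonglongrightarrow> of_real (\<rho>0 j) * cis (s k * \<phi>0 j) * (W0 k (j + 1) - W0 k j)"
    unfolding \<rho>0_def using sin_\<phi>0[of "j + 2"] by (intro tendsto_intros c lim \<phi>_lim) auto
  moreover have "(\<lambda>\<nu>. W \<nu> k (j + 2) - W \<nu> k j) \<longlonglongrightarrow> W0 k (j + 2) - W0 k j" by (intro tendsto_intros lim)
  ultimately show "W0 k (j + 2) - W0 k j = of_real (\<rho>0 j) * cis (s k * \<phi>0 j) * (W0 k (j + 1) - W0 k j)"
    unfolding e[symmetric] by (rule LIMSEQ_unique[rotated])
qed

lemma W0_Suc: "j \<noteq> w k \<Longrightarrow> W0 (k + 1) j = W0 k j"
  and W0_shape: "W0 k (j + 2) - W0 k j = of_real (\<rho>0 j) * cis (s k * \<phi>0 j) * (W0 k (j + 1) - W0 k j)"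
  using Q0 unfolding qpath_def by blast+

lemma W0_ne: "W0 k (j + 1) \<noteq> W0 k j"
proof
  assume e: "W0 k (j + 1) = W0 k j"
  then have "W0 k (j + 2) = W0 k j" using W0_shape[of k j] by simp
  then have "W0 k 1 = W0 k 2" using e label_cases[of j] by (auto simp: add.assoc)
  moreover have "(\<lambda>\<nu>. cmod (W \<nu> k 2 - W \<nu> k 1)) \<longlonglongrightarrow> cmod (W0 k 2 - W0 k 1)" by (intro tendsto_intros lim)
  moreover have "(\<lambda>\<nu>. sin (\<phi> \<nu> 0)) \<longlonglongrightarrow> sin (\<phi>0 0)" by (intro tendsto_intros \<phi>_lim)
  ultimately have "sin (\<phi>0 0) = 0" unfolding side using LIMSEQ_unique by fastforce
  then show False using sin_\<phi>0[of 0] by simp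
qed

lemma area0: "s k * (Re (W0 k (j + 1) - W0 k j) * Im (W0 k (j + 2) - W0 k j)
    - Re (W0 k (j + 2) - W0 k j) * Im (W0 k (j + 1) - W0 k j)) > 0"
proof -
  define z where "z = W0 k (j + 1) - W0 k j"
  have z0: "z \<noteq> 0" using W0_ne by (simp add: z_def)
  have \<rho>: "\<rho>0 j > 0" using Q0 by (simp add: qpath_def)
  have "s k * (Re z * Im (of_real (\<rho>0 j) * cis (s k * \<phi>0 j) * z) - Re (of_real (\<rho>0 j) * cis (s k * \<phi>0 j) * z) * Im z)
      = \<rho>0 j * sin (\<phi>0 j) * ((Re z)\<^sup>2 + (Im z)\<^sup>2)"
    using ssgn[of k] by (auto simp: algebra_simps power2_eq_square)
  moreover have "(Re z)\<^sup>2 + (Im z)\<^sup>2 > 0"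
    using z0 by (metis complex_eq_0 not_sum_power2_lt_zero linorder_neqE_linordered_idom)
  ultimately show ?thesis unfolding W0_shape[of k j] z_def[symmetric] using \<rho> sin_\<phi>0[of j] by simp
qed

lemma W0_refl: "Im (W0 (k + 1) (w k)) = refl_height (\<lambda>j. Im (W0 k j)) (w k)"
proof -
  have e: "W0 (k + 1) (j + 2) - W0 (k + 1) j =
      of_real (\<rho>0 j) * cis (- (s k * \<phi>0 j)) * (W0 (k + 1) (j + 1) - W0 (k + 1) j)" for j
    using W0_shape[of "k + 1" j] by (simp add: sSuc)
  have c0: "cis (- (s k * \<phi>0 0)) = - cis (s k * \<phi>0 0)"
    using ssgn[of k] by (auto simp: \<phi>0_def complex_eq_iff)
  have \<rho>: "\<rho>0 0 > 0" using Q0 by (simp add: qpath_def)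
  consider "w k = 1" | "w k = 2" | "w k = 0" using label_cases[of "w k"] by blast
  then show ?thesis
  proof cases
    case 1
    have f: "W0 (k + 1) 0 = W0 k 0" "W0 (k + 1) 2 = W0 k 2" using W0_Suc 1 by auto
    let ?c = "of_real (\<rho>0 0) * cis (s k * \<phi>0 0)"
    have "W0 k 2 - W0 k 0 = ?c * (W0 k 1 - W0 k 0)" using W0_shape[of k 0] by simp
    moreover have "W0 k 2 - W0 k 0 = ?c * (- (W0 (k + 1) 1 - W0 k 0))"
      using e[of 0] unfolding c0 mult_minus_right mult_minus_left by (simp only: f add_0)
    ultimately have "?c * (W0 k 1 - W0 k 0) = ?c * (- (W0 (k + 1) 1 - W0 k 0))" by (rule trans[OF sym])
    then have "W0 k 1 - W0 k 0 = - (W0 (k + 1) 1 - W0 k 0)" using \<rho> by (subst (asm) mult_cancel_left) simp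
    then have "W0 (k + 1) 1 = 2 * W0 k 0 - W0 k 1" by (simp add: algebra_simps)
    then show ?thesis by (simp add: 1 refl_height_def)
  next
    case 2
    have f: "W0 (k + 1) 0 = W0 k 0" "W0 (k + 1) 1 = W0 k 1" using W0_Suc 2 by auto
    have "W0 (k + 1) 2 - W0 k 0 = - (W0 k 2 - W0 k 0)"
      using e[of 0] W0_shape[of k 0] unfolding c0 by (simp add: f)
    then have "W0 (k + 1) 2 = 2 * W0 k 0 - W0 k 2" by (simp add: algebra_simps)
    then show ?thesis by (simp add: 2 refl_height_def)
  next
    case 3
    have f: "W0 (k + 1) 1 = W0 k 1" "W0 (k + 1) 2 = W0 k 2" using W0_Suc 3 by auto
    have \<rho>1: "\<rho>0 1 = sqrt 3 / 2" by (simp add: \<rho>0_def \<phi>0_def sin_60)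
    have "cis (s k * \<phi>0 1) + cis (- (s k * \<phi>0 1)) = of_real (sqrt 3)"
      using ssgn[of k] by (auto simp: \<phi>0_def complex_eq_iff cos_30)
    \<comment> \<open>\<open>3/2\<close> is \<open>2 * cos (pi/6)\<close> times the ratio
      \<open>cos (pi/6)\<close> of the sides at \<open>1\<close>: the foot of the altitude from
      \<open>0\<close> divides the hypotenuse at 3/4 of the way from \<open>1\<close> to
      \<open>2\<close>.\<close>
    then have c: "of_real (\<rho>0 1) * (cis (s k * \<phi>0 1) + cis (- (s k * \<phi>0 1))) = (3 / 2 :: complex)"
      unfolding \<rho>1 by (simp add: complex_eq_iff)
    have A: "W0 k 0 - W0 k 1 = of_real (\<rho>0 1) * cis (s k * \<phi>0 1) * (W0 k 2 - W0 k 1)"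
      using W0_shape[of k 1] by simp
    have B: "W0 (k + 1) 0 - W0 k 1 = of_real (\<rho>0 1) * cis (- (s k * \<phi>0 1)) * (W0 k 2 - W0 k 1)"
      using e[of 1] by (simp add: f)
    have "(W0 k 0 - W0 k 1) + (W0 (k + 1) 0 - W0 k 1) =
        of_real (\<rho>0 1) * (cis (s k * \<phi>0 1) + cis (- (s k * \<phi>0 1))) * (W0 k 2 - W0 k 1)"
      unfolding A B by (simp only: distrib_left distrib_right)
    then have "Im ((W0 k 0 - W0 k 1) + (W0 (k + 1) 0 - W0 k 1)) = Im (3 / 2 * (W0 k 2 - W0 k 1))"
      unfolding c by (rule arg_cong)
    then show ?thesis by (simp add: 3 refl_height_def field_simps)
  qed
qed

lemma W0_n: "\<exists>L0. \<forall>k j. W0 (k + n) j = W0 k j + of_real L0"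
proof -
  have "(\<lambda>\<nu>. Re (W \<nu> (0 + n) 0 - W \<nu> 0 0)) \<longlonglongrightarrow> Re (W0 (0 + n) 0 - W0 0 0)" by (intro tendsto_intros lim)
  then obtain L0 where L0: "L \<longlonglongrightarrow> L0" unfolding W_n by auto
  have "W0 (k + n) j = W0 k j + of_real L0" for k j
  proof -
    have "(\<lambda>\<nu>. W \<nu> k j + of_real (L \<nu>)) \<longlonglongrightarrow> W0 k j + of_real L0" by (intro tendsto_intros lim L0)
    then show ?thesis using lim[of "k + n" j] unfolding W_n using LIMSEQ_unique by blast
  qed
  then show ?thesis by blast
qed

lemma Im_W0_n: "Im (W0 (k + n) j) = Im (W0 k j)" using W0_n by force

lemma S_n: "S (k + n) = S k" by (simp add: S_def W_n fun_eq_iff)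

lemma letters: "\<exists>i. w i = j"
proof (rule ccontr)
  assume "\<nexists>i. w i = j"
  then have "W 0 (k + 1) j = W 0 k j" for k using W_Suc[of j k 0] by metis
  then have "W 0 (0 + int i) j = W 0 0 j" for i
  proof (induction i)
    case (Suc i)
    have "0 + int (Suc i) = (0 + int i) + 1" by simp
    then show ?case using Suc by metis
  qed simp
  from this[of "nat n"] show False using npos W_n[of 0 0 j] L[of 0] by simp
qed

text \<open>The heights \<open>h\<close> of the trajectories are not assumed to converge; any
  \<open>c\<close> that weakly separates the limits of upper and lower vertices can serve as the
  line.\<close>

definition side_of :: "real \<Rightarrow> real \<Rightarrow> bool" where
  "side_of e c \<longleftrightarrow> (\<forall>k j. S k j = e \<longrightarrow> e * (Im (W0 k j) - c) \<ge> 0)"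

lemma line:
  assumes c: "side_of 1 c" "side_of (-1) c"
  shows "tiling_path w s S (\<lambda>k j. Im (W0 k j) - c) n"
proof unfold_locales
  have SH: "S k j * (Im (W0 k j) - c) \<ge> 0" for k j
    using c S_cross(1)[of k j] unfolding side_of_def by metis
  have nondeg: "\<not> (Im (W0 k 0) - c = Im (W0 k 1) - c \<and> Im (W0 k 1) - c = Im (W0 k 2) - c)" for k
    using area0[of k 0] by auto
  have "refl_height (\<lambda>j. Im (W0 k j) - c) i = refl_height (\<lambda>j. Im (W0 k j)) i - c" for k i
    by (simp add: refl_height_def field_simps)
  then have re: "Im (W0 (k + 1) (w k)) - c = refl_height (\<lambda>j. Im (W0 k j) - c) (w k)" for k using W0_refl by simp
  have S_Suc: "j \<noteq> w k \<Longrightarrow> S (k + 1) j = S k j" for k j by (simp add: S_def W_Suc)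
  have S_e: "s k * S k (w k + 2) = 1" "s k * S k (w k + 1) = -1" for k
    unfolding S_edge using ssgn[of k] by auto
  have H_Suc: "j \<noteq> w k \<Longrightarrow> Im (W0 (k + 1) j) - c = Im (W0 k j) - c" for k j by (simp add: W0_Suc)
  show "tpath w s S (\<lambda>k j. Im (W0 k j) - c)"
    unfolding tpath_def using ssgn sSuc S_cross(1) S_Suc S_e SH H_Suc re nondeg by blast
qed (use npos w_n s_n S_n Im_W0_n in \<open>auto simp: fun_eq_iff\<close>)

lemma alongX: "along w s (\<lambda>k j. Im (W0 k j) - c) (\<lambda>k j. Re (W0 k j))"
  unfolding along_def using W0_Suc area0 by (simp add: algebra_simps)

end

lemma int_periodic:
  fixes f :: "int \<Rightarrow> 'a"
  assumes "\<And>k. f (k + n) = f k"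
  shows "f (k + D * n) = f k"
proof (induction D rule: int_induct[where k = 0])
  case (step1 D)
  have "k + (D + 1) * n = k + D * n + n" by (simp add: algebra_simps)
  then show ?case using assms[of "k + D * n"] step1 by metis
next
  case (step2 D)
  have "k + D * n = k + (D - 1) * n + n" by (simp add: algebra_simps)
  then show ?case using assms[of "k + (D - 1) * n"] step2 by metis
qed simp

lemma int_periodic_mod:
  fixes f :: "int \<Rightarrow> 'a"
  assumes "\<And>k. f (k + n) = f k"
  shows "f (k mod n) = f k"
  using int_periodic[of f n "k mod n" "k div n", OF assms] by (simp add: add.commute)

lemma cis_odd_pi: "e = 1 \<or> e = -1 \<Longrightarrow> cis (e * pi + x) = - cis x"
  by (auto simp: complex_eq_iff cos_add sin_add cos_diff sin_diff)

lemma cis_even_pi: "e = 1 \<or> e = -1 \<Longrightarrow> e' = 1 \<or> e' = -1 \<Longrightarrow> cis ((e + e') * pi + x) = cis x"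
proof -
  assume e: "e = 1 \<or> e = -1" "e' = 1 \<or> e' = -1"
  have "(e + e') * pi + x = e * pi + (e' * pi + x)" by (simp add: algebra_simps)
  then show ?thesis by (simp only: cis_odd_pi[OF e(1)] cis_odd_pi[OF e(2)] minus_minus)
qed

lemma eventually_less_limits:
  fixes f g :: "nat \<Rightarrow> real"
  assumes "f \<longlonglongrightarrow> x" "g \<longlonglongrightarrow> y" "x < y"
  shows "\<forall>\<^sub>F \<nu> in sequentially. f \<nu> < g \<nu>"
  using order_tendstoD(1)[OF tendsto_diff[OF assms(2,1)], of 0] assms(3) by simp

section \<open>Exclusion of the patterns\<close>

context degenerating_path
begin

lemma Im_W_n: "Im (W \<nu> (k + n) j) = Im (W \<nu> k j)" by (simp add: W_n)

text \<open>Modulo the period there are finitely many vertices on the line, so one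
  \<open>\<nu>\<close> can be fixed for which all neighbours are still in order from left to right.
  For it the angles \<open>pi + 6 t\<close> and \<open>pi + 2 r\<close> truly exceed
  \<open>pi\<close>.\<close>

lemma no_2:
  assumes c: "side_of 1 c" "side_of (-1) c" and on: "Im (W0 K J) = c"
    and n2: "\<And>k j. Im (W0 k j) = c \<Longrightarrow> j \<noteq> 2"
  shows False
proof -
  define H where "H = (\<lambda>k j. Im (W0 k j) - c)"
  interpret T: tiling_path w s S H n unfolding H_def by (rule line[OF c])
  define A where "A = {p. 0 \<le> fst p \<and> fst p < n \<and> H (fst p) (snd p) = 0}"
  have fA: "finite A" by (rule finite_subset[of _ "{0..<n} \<times> UNIV"]) (auto simp: A_def)
  have red: "(k mod n, j) \<in> A" if "H k j = 0" for k j
    using that npos int_periodic_mod[of H n k] T.Hn by (simp add: A_def)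
  have redI: "Im (W \<nu> (k mod n) j) = Im (W \<nu> k j)" for \<nu> k j
    by (rule int_periodic_mod[of "\<lambda>k. Im (W \<nu> k j)"]) (rule Im_W_n)
  have Ane: "A \<noteq> {}" using red[of K J] on by (auto simp: H_def)
  define G where "G \<nu> p \<longleftrightarrow> (\<exists>k1 j1 k2 j2. H k1 j1 = 0 \<and> H k2 j2 = 0 \<and>
     Re (W \<nu> k1 j1) < Re (W \<nu> (fst p) (snd p)) \<and> Re (W \<nu> (fst p) (snd p)) < Re (W \<nu> k2 j2) \<and>
     W \<nu> k2 j2 - W \<nu> (fst p) (snd p) = cis (S (fst p) (snd p) * (if snd p = 1 then 6 * \<phi> \<nu> 1 else 2 * \<phi> \<nu> 0)) *
       (W \<nu> k1 j1 - W \<nu> (fst p) (snd p)))" for \<nu> and p :: "int \<times> 3"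
  have "\<forall>p\<in>A. \<forall>\<^sub>F \<nu> in sequentially. G \<nu> p"
  proof
    fix p assume "p \<in> A"
    then have h: "H (fst p) (snd p) = 0" by (simp add: A_def)
    then have "snd p \<noteq> 2" using n2 by (simp add: H_def)
    from T.half_turn[OF h this letters] obtain k1 j1 k2 j2 where k: "H k1 j1 = 0" "H k2 j2 = 0"
      and X: "\<forall>X. along w s H X \<longrightarrow> X k1 j1 < X (fst p) (snd p) \<and> X (fst p) (snd p) < X k2 j2"
      and P: "\<forall>P \<phi> \<rho>. qpath w s \<phi> \<rho> P \<longrightarrow> P k2 j2 - P (fst p) (snd p) =
        cis (S (fst p) (snd p) * (if snd p = 1 then 6 * \<phi> 1 else 2 * \<phi> 0)) * (P k1 j1 - P (fst p) (snd p))"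
      by (elim exE conjE) (rule that)
    have x: "Re (W0 k1 j1) < Re (W0 (fst p) (snd p))" "Re (W0 (fst p) (snd p)) < Re (W0 k2 j2)"
      using X[rule_format, OF alongX[of c, folded H_def]] by blast+
    have RL: "(\<lambda>\<nu>. Re (W \<nu> k j)) \<longlonglongrightarrow> Re (W0 k j)" for k j by (intro tendsto_intros lim)
    have "\<forall>\<^sub>F \<nu> in sequentially. Re (W \<nu> k1 j1) < Re (W \<nu> (fst p) (snd p))"
      by (rule eventually_less_limits) (fact RL x)+
    moreover have "\<forall>\<^sub>F \<nu> in sequentially. Re (W \<nu> (fst p) (snd p)) < Re (W \<nu> k2 j2)"
      by (rule eventually_less_limits) (fact RL x)+
    ultimately show "\<forall>\<^sub>F \<nu> in sequentially. G \<nu> p"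
    proof eventually_elim
      case (elim \<nu>)
      have rot: "W \<nu> k2 j2 - W \<nu> (fst p) (snd p) = cis (S (fst p) (snd p) * (if snd p = 1 then 6 * \<phi> \<nu> 1 else 2 * \<phi> \<nu> 0)) *
          (W \<nu> k1 j1 - W \<nu> (fst p) (snd p))" using P[rule_format, OF Q] .
      show ?case unfolding G_def using k elim rot by blast
    qed
  qed
  then have "\<forall>\<^sub>F \<nu> in sequentially. \<forall>p\<in>A. G \<nu> p" by (rule eventually_ball_finite[OF fA])
  \<comment> \<open>Below \<open>pi / 12\<close> the excess \<open>6 * t\<close> is smaller than
    \<open>pi / 2\<close>, as \<open>turn_sign\<close> requires.\<close>
  moreover have "\<forall>\<^sub>F \<nu> in sequentially. t \<nu> < pi / 12" by (rule order_tendstoD(2)[OF t(2)]) simp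
  moreover have "\<forall>\<^sub>F \<nu> in sequentially. r \<nu> < pi / 12" by (rule order_tendstoD(2)[OF r_lim]) simp
  ultimately have "\<forall>\<^sub>F \<nu> in sequentially. (\<forall>p\<in>A. G \<nu> p) \<and> t \<nu> < pi / 12 \<and> r \<nu> < pi / 12"
    by eventually_elim blast
  then obtain \<nu> where \<nu>: "\<forall>p\<in>A. G \<nu> p" "t \<nu> < pi / 12" "r \<nu> < pi / 12"
    by (auto dest: eventually_happens'[OF sequentially_bot])
  let ?Y = "\<lambda>p. Im (W \<nu> (fst p) (snd p))"
  have turn: "((\<forall>p'\<in>A. ?Y p' \<le> ?Y p) \<longrightarrow> S (fst p) (snd p) = -1) \<and>
      ((\<forall>p'\<in>A. ?Y p \<le> ?Y p') \<longrightarrow> S (fst p) (snd p) = 1)" if pA: "p \<in> A" for p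
  proof -
    obtain k1 j1 k2 j2 where k: "H k1 j1 = 0" "H k2 j2 = 0" "Re (W \<nu> k1 j1) < Re (W \<nu> (fst p) (snd p))"
      and rot: "W \<nu> k2 j2 - W \<nu> (fst p) (snd p) = cis (S (fst p) (snd p) * (if snd p = 1 then 6 * \<phi> \<nu> 1 else 2 * \<phi> \<nu> 0)) *
       (W \<nu> k1 j1 - W \<nu> (fst p) (snd p))"
      using bspec[OF \<nu>(1) pA, unfolded G_def] by (elim exE conjE) (rule that)
    define \<epsilon> where "\<epsilon> = (if snd p = 1 then 6 * t \<nu> else 2 * r \<nu>)"
    have e: "0 < \<epsilon>" "\<epsilon> < pi / 2" using \<nu> t(1)[of \<nu>] r(1)[of \<nu>] by (auto simp: \<epsilon>_def)
    have ee: "(if snd p = 1 then 6 * \<phi> \<nu> 1 else 2 * \<phi> \<nu> 0) = pi + \<epsilon>" by (simp add: \<phi> \<epsilon>_def)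
    have re: "Re (W \<nu> k1 j1 - W \<nu> (fst p) (snd p)) < 0" using k by simp
    note ts = turn_sign[OF re e S_cross(1) rot[unfolded ee]]
    show ?thesis
    proof (intro conjI impI)
      assume m: "\<forall>p'\<in>A. ?Y p' \<le> ?Y p"
      have "Im (W \<nu> k1 j1) \<le> ?Y p" "Im (W \<nu> k2 j2) \<le> ?Y p"
        using bspec[OF m red[OF k(1)]] bspec[OF m red[OF k(2)]] unfolding fst_conv snd_conv redI by blast+
      then show "S (fst p) (snd p) = -1" using ts(1) by simp
    next
      assume m: "\<forall>p'\<in>A. ?Y p \<le> ?Y p'"
      have "?Y p \<le> Im (W \<nu> k1 j1)" "?Y p \<le> Im (W \<nu> k2 j2)"
        using bspec[OF m red[OF k(1)]] bspec[OF m red[OF k(2)]] unfolding fst_conv snd_conv redI by blast+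
      then show "S (fst p) (snd p) = 1" using ts(2) by simp
    qed
  qed
  have "Max (?Y ` A) \<in> ?Y ` A" "Min (?Y ` A) \<in> ?Y ` A" using fA Ane by (auto intro: Max_in Min_in)
  then obtain p p' where p: "p \<in> A" "?Y p = Max (?Y ` A)" and p': "p' \<in> A" "?Y p' = Min (?Y ` A)" by auto
  have M: "?Y a \<le> ?Y p" "?Y p' \<le> ?Y a" if "a \<in> A" for a
    using fA that unfolding p p' by (auto intro: Max_ge Min_le)
  have "S (fst p) (snd p) = -1" "S (fst p') (snd p') = 1" using turn[OF p(1)] turn[OF p'(1)] M by blast+
  then show False using S_cross(2)[of "fst p" "snd p" \<nu>] S_cross(2)[of "fst p'" "snd p'" \<nu>] M(1)[OF p'(1)] by simp
qed

text \<open>Multiples of \<open>r\<close> disappear at first order in \<open>t\<close>, because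
  \<open>r / t\<close> tends to 0.\<close>

lemma slope: "(\<lambda>\<nu>. (cis (A * t \<nu> + B * r \<nu>) - 1) / of_real (t \<nu>)) \<longlonglongrightarrow> \<i> * of_real A"
proof (rule cis_slope)
  have "(\<lambda>\<nu>. A * t \<nu> + B * r \<nu>) \<longlonglongrightarrow> A * 0 + B * 0" by (intro tendsto_intros t r_lim)
  then show "(\<lambda>\<nu>. A * t \<nu> + B * r \<nu>) \<longlonglongrightarrow> 0" by simp
  have "(\<lambda>\<nu>. A + B * (r \<nu> / t \<nu>)) \<longlonglongrightarrow> A + B * 0" by (intro tendsto_intros r)
  moreover have "(A * t \<nu> + B * r \<nu>) / t \<nu> = A + B * (r \<nu> / t \<nu>)" for \<nu>
    using t(1)[of \<nu>] by (simp add: add_divide_distrib)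
  ultimately show "(\<lambda>\<nu>. (A * t \<nu> + B * r \<nu>) / t \<nu>) \<longlonglongrightarrow> A" by simp
qed

text \<open>Up to sign, every rotation in a chain has the form \<open>cis (A * t + B * r)\<close>.
  The exponents of \<open>z1\<close> accumulate in \<open>E\<close> and \<open>D\<close>; heights
  divided by \<open>t\<close> converge to the sequence \<open>y\<close> that
  \<open>chain_heights\<close> refutes.\<close>

lemma no_chain:
  assumes c: "side_of 1 c" "side_of (-1) c"
    and ch: "tiling_path.chain w s S (\<lambda>k j. Im (W0 k j) - c) n \<kappa> q g a b cc d N Dn"
  shows False
proof -
  define H where "H = (\<lambda>k j. Im (W0 k j) - c)"
  interpret T: tiling_path w s S H n unfolding H_def by (rule line[OF c])
  note ch = ch[folded H_def, unfolded T.chain_def]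
  have N: "N > 0" using ch by blast
  have H0: "H (\<kappa> i) 1 = 0" "H (q i) 2 = 0" "H (g i) 0 = 0" for i using ch by blast+
  have side_eq: "a i = S (\<kappa> i) 1" "b i = S (q i) 2" "d i = S (g i) 0" "cc i = 1 \<or> cc i = -1" for i using ch by blast+
  have per: "\<kappa> (i + N) = \<kappa> i + Dn * n" "q (i + N) = q i + Dn * n" "g (i + N) = g i + Dn * n" "cc (i + N) = cc i"
    for i using ch by blast+
  have X: "Re (W0 (\<kappa> i) 1) < Re (W0 (q i) 2)" "Re (W0 (q i) 2) < Re (W0 (g i) 0)" for i
  proof -
    have "\<forall>X. along w s H X \<longrightarrow> X (\<kappa> i) 1 < X (q i) 2 \<and> X (q i) 2 < X (g i) 0" using ch by blast
    from this[rule_format, OF alongX[of c, folded H_def]]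
    show "Re (W0 (\<kappa> i) 1) < Re (W0 (q i) 2)" "Re (W0 (q i) 2) < Re (W0 (g i) 0)" by blast+
  qed
  have sg: "a i = 1 \<or> a i = -1" "b i = 1 \<or> b i = -1" "cc i = 1 \<or> cc i = -1" "d i = 1 \<or> d i = -1" for i
    using side_eq[of i] S_cross(1) by auto
  define z1 z2 where "z1 \<nu> i = W \<nu> (q i) 2 - W \<nu> (\<kappa> i) 1" and "z2 \<nu> i = W \<nu> (g i) 0 - W \<nu> (q i) 2" for \<nu> i
  have dev: "W \<nu> (\<kappa> (i + 1)) 1 - W \<nu> (\<kappa> i) 1 =
        z1 \<nu> i * (1 - cis (2 * d i * \<phi> \<nu> 0) * cis (3 * (b i + cc i) * \<phi> \<nu> 2)) + z2 \<nu> i * (1 - cis (2 * d i * \<phi> \<nu> 0)) \<and>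
      z1 \<nu> (i + 1) = cis (6 * a (i + 1) * \<phi> \<nu> 1) * cis (2 * d i * \<phi> \<nu> 0) * cis (3 * (b i + cc i) * \<phi> \<nu> 2) * z1 \<nu> i \<and>
      z2 \<nu> (i + 1) * z1 \<nu> i = cis (3 * (b (i + 1) - b i) * \<phi> \<nu> 2) * z2 \<nu> i * z1 \<nu> (i + 1)" for \<nu> i
  proof -
    have "\<forall>P \<phi> \<rho>. qpath w s \<phi> \<rho> P \<longrightarrow>
           (let z1 = (\<lambda>i. P (q i) 2 - P (\<kappa> i) 1); z2 = (\<lambda>i. P (g i) 0 - P (q i) 2);
                u = cis (2 * d i * \<phi> 0); v = cis (3 * (b i + cc i) * \<phi> 2)
            in P (\<kappa> (i + 1)) 1 - P (\<kappa> i) 1 = z1 i * (1 - u * v) + z2 i * (1 - u) \<and>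
               z1 (i + 1) = cis (6 * a (i + 1) * \<phi> 1) * u * v * z1 i \<and>
               z2 (i + 1) * z1 i = cis (3 * (b (i + 1) - b i) * \<phi> 2) * z2 i * z1 (i + 1))"
      using ch by blast
    from this[rule_format, OF Q[of \<nu>]] show ?thesis unfolding Let_def z1_def z2_def .
  qed
  define e where "e A B \<nu> = cis (A * t \<nu> + B * r \<nu>)" for A B \<nu>
  have e_mult: "e A B \<nu> * e A' B' \<nu> = e (A + A') (B + B') \<nu>" for A B A' B' \<nu>
    by (simp add: e_def cis_mult algebra_simps)
  have U: "cis (2 * d i * \<phi> \<nu> 0) = - e 0 (2 * d i) \<nu>" for i \<nu>
  proof -
    have "2 * d i * \<phi> \<nu> 0 = d i * pi + (0 * t \<nu> + 2 * d i * r \<nu>)" by (simp add: \<phi> algebra_simps)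
    then show ?thesis unfolding e_def by (simp only: cis_odd_pi[OF sg(4)])
  qed
  have V: "cis (3 * (b i + cc i) * \<phi> \<nu> 2) = e (- 3 * (b i + cc i)) (- 3 * (b i + cc i)) \<nu>" for i \<nu>
  proof -
    have "3 * (b i + cc i) * \<phi> \<nu> 2 = (b i + cc i) * pi + (- 3 * (b i + cc i) * t \<nu> + - 3 * (b i + cc i) * r \<nu>)"
      by (simp add: \<phi> algebra_simps)
    then show ?thesis unfolding e_def by (simp only: cis_even_pi[OF sg(2) sg(3)])
  qed
  have A6: "cis (6 * a i * \<phi> \<nu> 1) = - e (6 * a i) 0 \<nu>" for i \<nu>
  proof -
    have "6 * a i * \<phi> \<nu> 1 = a i * pi + (6 * a i * t \<nu> + 0 * r \<nu>)" by (simp add: \<phi> algebra_simps)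
    then show ?thesis unfolding e_def by (simp only: cis_odd_pi[OF sg(1)])
  qed
  have B3: "cis (3 * (b (i + 1) - b i) * \<phi> \<nu> 2) = e (- 3 * (b (i + 1) - b i)) (- 3 * (b (i + 1) - b i)) \<nu>" for i \<nu>
  proof -
    have "3 * (b (i + 1) - b i) * \<phi> \<nu> 2 = (b (i + 1) + - b i) * pi +
        (- 3 * (b (i + 1) - b i) * t \<nu> + - 3 * (b (i + 1) - b i) * r \<nu>)"
      by (simp add: \<phi> algebra_simps)
    moreover have "- b i = 1 \<or> - b i = -1" using sg(2)[of i] by auto
    ultimately show ?thesis unfolding e_def by (simp only: cis_even_pi[OF sg(2)])
  qed
  define E D where "E i = (\<Sum>j<i. 6 * a (j + 1) - 3 * (b j + cc j))" and "D i = (\<Sum>j<i. 2 * d j - 3 * (b j + cc j))" for i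
  have ES: "E (i + 1) = E i + 6 * a (i + 1) - 3 * (b i + cc i)" and DS: "D (i + 1) = D i + 2 * d i - 3 * (b i + cc i)" for i
    by (simp_all add: E_def D_def)
  have E0: "E 0 = 0" "D 0 = 0" by (simp_all add: E_def D_def)
  have Z1: "z1 \<nu> i = e (E i) (D i) \<nu> * z1 \<nu> 0" for \<nu> i
  proof (induction i)
    case 0 show ?case by (simp add: E0 e_def)
  next
    case (Suc i)
    have "z1 \<nu> (i + 1) = (e (6 * a (i + 1)) 0 \<nu> * e 0 (2 * d i) \<nu>) * e (- 3 * (b i + cc i)) (- 3 * (b i + cc i)) \<nu> * e (E i) (D i) \<nu> * z1 \<nu> 0"
      using dev[of \<nu> i] unfolding U V A6 Suc by simp
    also have "\<dots> = e (E (i + 1)) (D (i + 1)) \<nu> * z1 \<nu> 0"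
      unfolding e_mult ES DS by (simp add: algebra_simps)
    finally show ?case by simp
  qed
  have Z2: "z2 \<nu> i = e (E i - 3 * (b i - b 0)) (D i - 3 * (b i - b 0)) \<nu> * z2 \<nu> 0" if nz: "z1 \<nu> 0 \<noteq> 0" for \<nu> i
  proof (induction i)
    case 0 show ?case by (simp add: E0 e_def)
  next
    case (Suc i)
    let ?m = "- 3 * (b (i + 1) - b i)"
    have en: "e A B \<nu> \<noteq> 0" for A B by (simp add: e_def)
    have "z2 \<nu> (i + 1) * (e (E i) (D i) \<nu> * z1 \<nu> 0) = e ?m ?m \<nu> * z2 \<nu> i * (e (E (i + 1)) (D (i + 1)) \<nu> * z1 \<nu> 0)"
      using dev[of \<nu> i] unfolding B3 Z1[of \<nu> i] Z1[of \<nu> "i + 1"] by blast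
    then have "z2 \<nu> (i + 1) * e (E i) (D i) \<nu> = e ?m ?m \<nu> * z2 \<nu> i * e (E (i + 1)) (D (i + 1)) \<nu>"
      using nz by (simp add: mult.assoc[symmetric])
    also have "\<dots> = (e ?m ?m \<nu> * e (E i - 3 * (b i - b 0)) (D i - 3 * (b i - b 0)) \<nu> * e (E (i + 1)) (D (i + 1)) \<nu>) * z2 \<nu> 0"
      unfolding Suc by (simp only: mult_ac)
    also have "\<dots> = e (E (i + 1) - 3 * (b (i + 1) - b 0)) (D (i + 1) - 3 * (b (i + 1) - b 0)) \<nu> * z2 \<nu> 0 * e (E i) (D i) \<nu>"
    proof -
      have "e ?m ?m \<nu> * e (E i - 3 * (b i - b 0)) (D i - 3 * (b i - b 0)) \<nu> * e (E (i + 1)) (D (i + 1)) \<nu> =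
          e (E (i + 1) - 3 * (b (i + 1) - b 0)) (D (i + 1) - 3 * (b (i + 1) - b 0)) \<nu> * e (E i) (D i) \<nu>"
        unfolding e_mult by (simp add: algebra_simps)
      then show ?thesis by (simp only: mult_ac)
    qed
    finally show ?case using en by simp
  qed
  define l1 l2 where "l1 = Re (W0 (q 0) 2 - W0 (\<kappa> 0) 1)" and "l2 = Re (W0 (g 0) 0 - W0 (q 0) 2)"
  have l: "l1 > 0" "l2 > 0" using X[of 0] by (simp_all add: l1_def l2_def)
  have "W0 (q 0) 2 - W0 (\<kappa> 0) 1 = of_real l1" "W0 (g 0) 0 - W0 (q 0) 2 = of_real l2"
    using H0[of 0] by (simp_all add: complex_eq_iff l1_def l2_def H_def)
  moreover have "(\<lambda>\<nu>. z1 \<nu> 0) \<longlonglongrightarrow> W0 (q 0) 2 - W0 (\<kappa> 0) 1" "(\<lambda>\<nu>. z2 \<nu> 0) \<longlonglongrightarrow> W0 (g 0) 0 - W0 (q 0) 2"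
    unfolding z1_def z2_def by (intro tendsto_intros lim)+
  ultimately have zl: "(\<lambda>\<nu>. z1 \<nu> 0) \<longlonglongrightarrow> of_real l1" "(\<lambda>\<nu>. z2 \<nu> 0) \<longlonglongrightarrow> of_real l2" by simp_all
  have nz: "\<forall>\<^sub>F \<nu> in sequentially. z1 \<nu> 0 \<noteq> 0"
    by (rule tendsto_imp_eventually_ne[OF zl(1)]) (use l in simp)
  define k where "k A B \<nu> = (e A B \<nu> - 1) / of_real (t \<nu>)" for A B \<nu>
  have k_lim: "k A B \<longlonglongrightarrow> \<i> * of_real A" for A B using slope[of A B] unfolding k_def e_def .
  have e_k: "e A B \<nu> = 1 + of_real (t \<nu>) * k A B \<nu>" for A B \<nu> using t(1)[of \<nu>] by (simp add: k_def)
  \<comment> \<open>\<open>t * F\<close> is the exact difference between the displacement from node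
    to node and its main part \<open>2 * (z1 + z2)\<close> taken at node 0.\<close>
  define F where "F \<nu> i = z1 \<nu> 0 * (k (E i) (D i) \<nu> + k (E i - 3 * (b i + cc i)) (D i + 2 * d i - 3 * (b i + cc i)) \<nu>) +
     z2 \<nu> 0 * (k (E i - 3 * (b i - b 0)) (D i - 3 * (b i - b 0)) \<nu> + k (E i - 3 * (b i - b 0)) (D i - 3 * (b i - b 0) + 2 * d i) \<nu>)" for \<nu> i
  define G where "G i = l1 * (2 * E i - 3 * (b i + cc i)) + l2 * (2 * (E i - 3 * (b i - b 0)))" for i
  have F_lim: "(\<lambda>\<nu>. Im (F \<nu> i)) \<longlonglongrightarrow> G i" for i
  proof -
    have "(\<lambda>\<nu>. F \<nu> i) \<longlonglongrightarrow> of_real l1 * (\<i> * of_real (E i) + \<i> * of_real (E i - 3 * (b i + cc i))) +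
       of_real l2 * (\<i> * of_real (E i - 3 * (b i - b 0)) + \<i> * of_real (E i - 3 * (b i - b 0)))"
      unfolding F_def by (intro tendsto_intros zl k_lim)
    then have "(\<lambda>\<nu>. Im (F \<nu> i)) \<longlonglongrightarrow> Im (of_real l1 * (\<i> * of_real (E i) + \<i> * of_real (E i - 3 * (b i + cc i))) +
       of_real l2 * (\<i> * of_real (E i - 3 * (b i - b 0)) + \<i> * of_real (E i - 3 * (b i - b 0))))" by (rule tendsto_Im)
    then show ?thesis by (simp add: G_def algebra_simps)
  qed
  define v where "v \<nu> i = Im (W \<nu> (\<kappa> (i + 1)) 1 - W \<nu> (\<kappa> i) 1)" for \<nu> i
  have v_F: "v \<nu> i = 2 * Im (z1 \<nu> 0 + z2 \<nu> 0) + t \<nu> * Im (F \<nu> i)" if nz: "z1 \<nu> 0 \<noteq> 0" for \<nu> i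
  proof -
    let ?x = "- 3 * (b i + cc i)" and ?y = "3 * (b i - b 0)"
    have "W \<nu> (\<kappa> (i + 1)) 1 - W \<nu> (\<kappa> i) 1 = z1 \<nu> i * (1 + e 0 (2 * d i) \<nu> * e ?x ?x \<nu>) + z2 \<nu> i * (1 + e 0 (2 * d i) \<nu>)"
      using dev[of \<nu> i] unfolding U V by simp
    also have "\<dots> = z1 \<nu> 0 * (e (E i) (D i) \<nu> + e (E i) (D i) \<nu> * (e 0 (2 * d i) \<nu> * e ?x ?x \<nu>)) +
        z2 \<nu> 0 * (e (E i - ?y) (D i - ?y) \<nu> + e (E i - ?y) (D i - ?y) \<nu> * e 0 (2 * d i) \<nu>)"
      unfolding Z1[of \<nu> i] Z2[OF nz, of i] by (simp add: algebra_simps)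
    also have "\<dots> = z1 \<nu> 0 * (e (E i) (D i) \<nu> + e (E i - 3 * (b i + cc i)) (D i + 2 * d i - 3 * (b i + cc i)) \<nu>) +
        z2 \<nu> 0 * (e (E i - ?y) (D i - ?y) \<nu> + e (E i - ?y) (D i - ?y + 2 * d i) \<nu>)"
      unfolding e_mult by (simp add: algebra_simps)
    also have "\<dots> = 2 * (z1 \<nu> 0 + z2 \<nu> 0) + of_real (t \<nu>) * F \<nu> i"
      unfolding e_k F_def by (simp add: algebra_simps)
    finally show ?thesis unfolding v_def by simp
  qed
  have tel: "(\<Sum>j<i. v \<nu> j) = Im (W \<nu> (\<kappa> i) 1) - Im (W \<nu> (\<kappa> 0) 1)" for \<nu> i
    using sum_lessThan_telescope[of "\<lambda>i. Im (W \<nu> (\<kappa> i) 1)" i] by (simp add: v_def)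
  have kN: "Im (W \<nu> (\<kappa> N) 1) = Im (W \<nu> (\<kappa> 0) 1)" for \<nu>
    using per(1)[of 0] int_periodic[of "\<lambda>k. Im (W \<nu> k 1)" n "\<kappa> 0" Dn] Im_W_n by simp
  \<comment> \<open>The main part is the same at all nodes, and the heights return after
    \<open>N\<close> nodes. This forces its imaginary part divided by \<open>t\<close> to converge,
    although nothing is known about the speed at which \<open>z1\<close> and \<open>z2\<close>
    become horizontal.\<close>
  define C where "C = - (\<Sum>i<N. G i) / real N"
  have "(\<lambda>\<nu>. - (\<Sum>i<N. Im (F \<nu> i)) / real N) \<longlonglongrightarrow> C"
    unfolding C_def by (intro tendsto_intros F_lim) (use N in simp)
  moreover have "\<forall>\<^sub>F \<nu> in sequentially. - (\<Sum>i<N. Im (F \<nu> i)) / real N = 2 * Im (z1 \<nu> 0 + z2 \<nu> 0) / t \<nu>"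
    using nz
  proof eventually_elim
    case (elim \<nu>)
    have "(\<Sum>i<N. v \<nu> i) = 0" unfolding tel kN by simp
    then have "real N * (2 * Im (z1 \<nu> 0 + z2 \<nu> 0)) + t \<nu> * (\<Sum>i<N. Im (F \<nu> i)) = 0"
      unfolding v_F[OF elim] by (simp add: sum.distrib sum_distrib_left)
    then show ?case using N t(1)[of \<nu>] by (simp add: field_simps)
  qed
  ultimately have C_lim: "(\<lambda>\<nu>. 2 * Im (z1 \<nu> 0 + z2 \<nu> 0) / t \<nu>) \<longlonglongrightarrow> C" by (rule Lim_transform_eventually)
  have v_lim: "(\<lambda>\<nu>. v \<nu> i / t \<nu>) \<longlonglongrightarrow> C + G i" for i
  proof (rule Lim_transform_eventually)
    show "(\<lambda>\<nu>. 2 * Im (z1 \<nu> 0 + z2 \<nu> 0) / t \<nu> + Im (F \<nu> i)) \<longlonglongrightarrow> C + G i" by (intro tendsto_intros C_lim F_lim)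
    show "\<forall>\<^sub>F \<nu> in sequentially. 2 * Im (z1 \<nu> 0 + z2 \<nu> 0) / t \<nu> + Im (F \<nu> i) = v \<nu> i / t \<nu>"
      using nz
    proof eventually_elim
      case (elim \<nu>)
      show ?case unfolding v_F[OF elim] using t(1)[of \<nu>] by (simp add: add_divide_distrib)
    qed
  qed
  define y where "y i = (\<Sum>j<i. C + G j)" for i
  have y_lim: "(\<lambda>\<nu>. (Im (W \<nu> (\<kappa> i) 1) - Im (W \<nu> (\<kappa> 0) 1)) / t \<nu>) \<longlonglongrightarrow> y i" for i
    unfolding y_def tel[symmetric] sum_divide_distrib by (intro tendsto_sum v_lim)
  \<comment> \<open>The constant \<open>6 * l2 * b 0\<close> stems from the reference value
    \<open>b 0\<close> in \<open>Z2\<close>.\<close>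
  have yS: "y (i + 1) = y i + 2 * (l1 + l2) * (E i - 3 * b i) + 3 * l1 * (b i - cc i) + (C + 6 * l2 * b 0)" for i
    by (simp add: y_def G_def algebra_simps)
  have yN: "y N = y 0"
    using y_lim[of N] unfolding kN by (simp add: LIMSEQ_const_iff y_def)
  have ord: "y j \<le> y i" if "a i = 1" "a j = -1" for i j
  proof (rule LIMSEQ_le[OF y_lim y_lim], intro exI allI impI)
    fix \<nu> :: nat
    have "Im (W \<nu> (\<kappa> i) 1) > h \<nu>" "Im (W \<nu> (\<kappa> j) 1) < h \<nu>"
      using S_cross(2)[of "\<kappa> i" 1 \<nu>] S_cross(2)[of "\<kappa> j" 1 \<nu>] that side_eq by auto
    then show "(Im (W \<nu> (\<kappa> j) 1) - Im (W \<nu> (\<kappa> 0) 1)) / t \<nu> \<le> (Im (W \<nu> (\<kappa> i) 1) - Im (W \<nu> (\<kappa> 0) 1)) / t \<nu>"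
      using t(1)[of \<nu>] by (simp add: divide_right_mono)
  qed
  \<comment> \<open>\<open>z1\<close> returns after \<open>N\<close> nodes, so the accumulated
    rotation is trivial; its angle is small for large \<open>\<nu>\<close> and hence exactly 0.
    Comparing the orders of \<open>t\<close> and \<open>r\<close> then gives \<open>E N = 0\<close>
    and \<open>D N = 0\<close>.\<close>
  have eN: "\<forall>\<^sub>F \<nu> in sequentially. E N * t \<nu> + D N * r \<nu> = 0"
  proof -
    have "(\<lambda>\<nu>. E N * t \<nu> + D N * r \<nu>) \<longlonglongrightarrow> E N * 0 + D N * 0" by (intro tendsto_intros t r_lim)
    then have l0: "(\<lambda>\<nu>. E N * t \<nu> + D N * r \<nu>) \<longlonglongrightarrow> 0" by simp
    have "\<forall>\<^sub>F \<nu> in sequentially. E N * t \<nu> + D N * r \<nu> < pi" "\<forall>\<^sub>F \<nu> in sequentially. - pi < E N * t \<nu> + D N * r \<nu>"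
      by (rule order_tendstoD[OF l0], simp)+
    then show ?thesis using nz
    proof eventually_elim
      case (elim \<nu>)
      have "z1 \<nu> N = z1 \<nu> 0"
      proof -
        have "W \<nu> (q 0 + (m + n)) 2 - W \<nu> (\<kappa> 0 + (m + n)) 1 = W \<nu> (q 0 + m) 2 - W \<nu> (\<kappa> 0 + m) 1" for m
          by (simp add: add.assoc[symmetric] W_n)
        from int_periodic[of "\<lambda>m. W \<nu> (q 0 + m) 2 - W \<nu> (\<kappa> 0 + m) 1" n 0 Dn, OF this]
        show ?thesis using per(1,2)[of 0] by (simp add: z1_def)
      qed
      then have "e (E N) (D N) \<nu> = 1" using Z1[of \<nu> N] elim(3) by simp
      then have "sin (E N * t \<nu> + D N * r \<nu>) = 0" by (simp add: e_def complex_eq_iff)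
      then show ?case using elim sin_eq_0_pi by blast
    qed
  qed
  have EN: "E N = 0"
  proof -
    have "(\<lambda>\<nu>. E N + D N * (r \<nu> / t \<nu>)) \<longlonglongrightarrow> E N + D N * 0" by (intro tendsto_intros r)
    moreover have "\<forall>\<^sub>F \<nu> in sequentially. E N + D N * (r \<nu> / t \<nu>) = 0"
      using eN
    proof eventually_elim
      case (elim \<nu>)
      then show ?case using t(1)[of \<nu>] by (simp add: field_simps)
    qed
    ultimately have "(\<lambda>\<nu>. 0 :: real) \<longlonglongrightarrow> E N" using Lim_transform_eventually by fastforce
    then show ?thesis by (simp add: LIMSEQ_const_iff)
  qed
  have DN: "D N = 0"
  proof -
    obtain \<nu> where "E N * t \<nu> + D N * r \<nu> = 0" using eventually_happens'[OF sequentially_bot eN] by blast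
    then show ?thesis using EN r(1)[of \<nu>] by simp
  qed
  have perS: "S (k + Dn * n) = S k" for k by (rule int_periodic[of S]) (rule S_n)
  show False
  proof (rule chain_heights[OF N l sg, where y = y and C = "C + 6 * l2 * b 0" and D = D and E = E])
    fix i
    show "a (i + N) = a i" using side_eq(1)[of "i + N"] side_eq(1)[of i] unfolding per perS by metis
    show "b (i + N) = b i" using side_eq(2)[of "i + N"] side_eq(2)[of i] unfolding per perS by metis
    show "cc (i + N) = cc i" by (rule per)
    show "E N = E 0" "D N = D 0" by (simp_all only: EN DN E0)
    fix j
    assume "a i = 1" "a j = -1"
    then show "y j \<le> y i" by (rule ord)
  qed (fact ES DS yS yN)+
qed

lemma extremal_lines:
  obtains c0 c1 where "c0 \<le> c1" "side_of 1 c0" "side_of (-1) c0" "side_of 1 c1" "side_of (-1) c1"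
    "\<exists>k j. S k j = -1 \<and> Im (W0 k j) = c0" "\<exists>k j. S k j = 1 \<and> Im (W0 k j) = c1"
proof -
  have le: "Im (W0 k' j') \<le> Im (W0 k j)" if "S k j = 1" "S k' j' = -1" for k j k' j'
  proof (rule LIMSEQ_le[OF tendsto_Im[OF lim] tendsto_Im[OF lim]], intro exI allI impI)
    fix \<nu> :: nat
    show "Im (W \<nu> k' j') \<le> Im (W \<nu> k j)"
      using S_cross(2)[of k j \<nu>] S_cross(2)[of k' j' \<nu>] that by simp
  qed
  define A where "A e = {p. 0 \<le> fst p \<and> fst p < n \<and> S (fst p) (snd p) = e}" for e
  let ?Y = "\<lambda>p. Im (W0 (fst p) (snd p))"
  have fA: "finite (A e)" for e by (rule finite_subset[of _ "{0..<n} \<times> UNIV"]) (auto simp: A_def)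
  have red: "(k mod n, j) \<in> A (S k j)" "?Y (k mod n, j) = Im (W0 k j)" for k j
  proof -
    show "(k mod n, j) \<in> A (S k j)" using npos int_periodic_mod[of S n k, OF S_n] by (simp add: A_def)
    show "?Y (k mod n, j) = Im (W0 k j)" using int_periodic_mod[of "\<lambda>k. Im (W0 k j)" n k, OF Im_W0_n] by simp
  qed
  have ex: "S 0 (w 0 + 2) = s 0" "S 0 (w 0 + 1) = - s 0" by (rule S_edge)+
  have ne: "A 1 \<noteq> {}" "A (-1) \<noteq> {}"
    using red(1)[of 0 "w 0 + 2"] red(1)[of 0 "w 0 + 1"] ssgn[of 0] unfolding ex by auto
  define c0 c1 where "c0 = Max (?Y ` A (-1))" and "c1 = Min (?Y ` A 1)"
  have "c0 \<in> ?Y ` A (-1)" "c1 \<in> ?Y ` A 1"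
    unfolding c0_def c1_def using fA ne by (intro Max_in Min_in; simp)+
  then obtain p0 p1 where p: "p0 \<in> A (-1)" "c0 = ?Y p0" "p1 \<in> A 1" "c1 = ?Y p1" by auto
  have m: "Im (W0 k j) \<le> c0" if "S k j = -1" for k j
  proof -
    have "(k mod n, j) \<in> A (-1)" using red(1)[of k j] that by simp
    then have "?Y (k mod n, j) \<le> c0" unfolding c0_def by (intro Max_ge finite_imageI fA imageI)
    then show ?thesis unfolding red(2) .
  qed
  have m': "c1 \<le> Im (W0 k j)" if "S k j = 1" for k j
  proof -
    have "(k mod n, j) \<in> A 1" using red(1)[of k j] that by simp
    then have "c1 \<le> ?Y (k mod n, j)" unfolding c1_def by (intro Min_le finite_imageI fA imageI)
    then show ?thesis unfolding red(2) .
  qed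
  have q: "S (fst p0) (snd p0) = -1" "S (fst p1) (snd p1) = 1" using p by (auto simp: A_def)
  have "c0 \<le> c1" unfolding p by (rule le) (rule q)+
  moreover have "side_of 1 c1" "side_of (-1) c0" using m m' by (auto simp: side_of_def)
  moreover have "side_of 1 c0" "side_of (-1) c1" using \<open>c0 \<le> c1\<close> m m' by (fastforce simp: side_of_def)+
  ultimately show ?thesis using that q p by blast
qed

lemma contradiction: False
proof -
  obtain c0 c1 where c: "c0 \<le> c1" "side_of 1 c0" "side_of (-1) c0" "side_of 1 c1" "side_of (-1) c1"
    and on: "\<exists>k j. S k j = -1 \<and> Im (W0 k j) = c0" "\<exists>k j. S k j = 1 \<and> Im (W0 k j) = c1"
    by (rule extremal_lines)
  have run: "\<exists>l m. tiling_path.run s (\<lambda>k j. Im (W0 k j) - c) l 2 m 2"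
    if sc: "side_of 1 c" "side_of (-1) c" and on: "\<exists>k j. Im (W0 k j) = c" for c
  proof -
    interpret T: tiling_path w s S "\<lambda>k j. Im (W0 k j) - c" n by (rule line[OF sc])
    obtain k j where kj: "Im (W0 k j) = c" using on by blast
    obtain k' where "Im (W0 k' 2) = c" using no_2[OF sc kj] by blast
    then have "Im (W0 k' 2) - c = 0" by simp
    from T.line_through_2[OF this letters] show ?thesis
    proof
      assume "\<exists>\<kappa> q g a b c' d N D. T.chain \<kappa> q g a b c' d N D"
      then show ?thesis using no_chain[OF sc] by blast
    qed
  qed
  obtain K m where r: "tiling_path.run s (\<lambda>k j. Im (W0 k j) - c0) K 2 m 2" using run[OF c(2,3)] on(1) by blast
  obtain K' m' where r': "tiling_path.run s (\<lambda>k j. Im (W0 k j) - c1) K' 2 m' 2" using run[OF c(4,5)] on(2) by blast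
  show False
  proof (cases "c0 = c1")
    \<comment> \<open>A single line would carry vertices of both sides, which
      \<open>line_2_sides\<close> excludes.\<close>
    case True
    interpret T: tiling_path w s S "\<lambda>k j. Im (W0 k j) - c0" n by (rule line[OF c(2,3)])
    obtain e where "\<forall>k j. Im (W0 k j) - c0 = 0 \<longrightarrow> j = 2 \<and> S k j = e"
      using T.line_2_sides[OF r x1 x2 x_n] by blast
    then have "\<And>k j. Im (W0 k j) = c0 \<Longrightarrow> S k j = e" by simp
    then show False using on True by fastforce
  next
    case False
    show False
      by (rule two_lines_2[OF line[OF c(2,3)] line[OF c(4,5)], of "c1 - c0", OF _ _ r r' x1 x2 x_n])
        (use False c in auto)
  qed
qed

end

section \<open>Billiard trajectories and their unfoldings\<close>

text \<open>Twice the signed area; its sign is the orientation of the labels.\<close>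

definition area :: "triangle \<Rightarrow> real" where
  "area P = Im (cnj (P 1 - P 0) * (P 2 - P 0))"

lemma area_rotate: "Im (cnj (P (j + 1) - P j) * (P (j + 2) - P j)) = area P"
  using label_cases[of j] by (auto simp: area_def algebra_simps)

lemma range_triangle: "range P = {P i, P (i + 1), P (i + 2 :: 3)}"
proof -
  have "j = i \<or> j = i + 1 \<or> j = i + 2" for j using label_cases[of i] label_cases[of j] by auto
  then have U: "UNIV = {i, i + 1, i + 2}" by blast
  have "P ` UNIV = P ` {i, i + 1, i + 2}" by (rule arg_cong[OF U])
  then show ?thesis by simp
qed

lemma complex_parallel:
  assumes "Im (cnj d * z) = 0" "d \<noteq> 0"
  shows "\<exists>c. z = of_real c * d"
proof -
  have "cnj d * z = of_real (Re (cnj d * z))" using assms(1) by (simp add: complex_eq_iff)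
  then have "d * (cnj d * z) = of_real (Re (cnj d * z)) * d" by (simp add: mult.commute)
  moreover have "d * cnj d = of_real ((cmod d)\<^sup>2)" by (rule complex_norm_square[symmetric])
  ultimately have "of_real ((cmod d)\<^sup>2) * z = of_real (Re (cnj d * z)) * d" by (simp add: mult.assoc[symmetric])
  then have "z = of_real (Re (cnj d * z) / (cmod d)\<^sup>2) * d" using assms(2) by (simp add: field_simps)
  then show ?thesis by blast
qed

lemma area_nonzero:
  assumes "nondegenerate P"
  shows "area P \<noteq> 0"
proof
  assume 0: "area P = 0"
  have "collinear (range P)"
  proof (cases "P 1 = P 0")
    case True
    then show ?thesis unfolding range_triangle[of P 0] by (simp add: collinear_2)
  next
    case False
    then obtain c where c: "P 2 - P 0 = of_real c * (P 1 - P 0)"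
      using complex_parallel[of "P 1 - P 0" "P 2 - P 0"] 0 by (auto simp: area_def)
    have e: "P j - P 0 = (if j = 0 then 0 else if j = 1 then 1 else c) *\<^sub>R (P 1 - P 0)" for j
      using c label_cases[of j] by (auto simp: scaleR_conv_of_real)
    show ?thesis unfolding collinear_def
    proof (intro exI[of _ "P 1 - P 0"] ballI)
      fix x y assume "x \<in> range P" "y \<in> range P"
      then obtain i j where "x = P i" "y = P j" by blast
      then have "x - y = (P i - P 0) - (P j - P 0)" by simp
      also have "\<dots> = ((if i = 0 then 0 else if i = 1 then 1 else c) - (if j = 0 then 0 else if j = 1 then 1 else c)) *\<^sub>R (P 1 - P 0)"
        unfolding e[of i] e[of j] by (rule scaleR_left_diff_distrib[symmetric])
      finally show "\<exists>k. x - y = k *\<^sub>R (P 1 - P 0)" by blast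
    qed
  qed
  then show False using assms by (simp add: nondegenerate_def)
qed

lemma vertices_distinct:
  assumes "area P \<noteq> 0"
  shows "P (j + 1) \<noteq> P j" "P (j + 2) \<noteq> P (j + 1)"
  using area_rotate[of P j] area_rotate[of P "j + 1"] assms by (auto simp: add.assoc)

lemma region_coordinates:
  assumes "z \<in> region P"
  obtains u v w where "u \<ge> 0" "v \<ge> 0" "w \<ge> 0" "u + v + w = 1" "z = u *\<^sub>R P i + v *\<^sub>R P (i + 1) + w *\<^sub>R P (i + 2)"
  using assms unfolding region_def range_triangle[of P i] convex_hull_3 by auto

lemma edge_height:
  assumes "u + v + w = 1"
  shows "Im (cnj (P (i + 2) - P (i + 1)) * (u *\<^sub>R P i + v *\<^sub>R P (i + 1) + w *\<^sub>R P (i + 2) - P (i + 1))) = u * area P"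
proof -
  let ?d = "P (i + 2) - P (i + 1)"
  have v: "v = 1 - u - w" using assms by simp
  have e: "u *\<^sub>R P i + v *\<^sub>R P (i + 1) + w *\<^sub>R P (i + 2) - P (i + 1) = u *\<^sub>R (P i - P (i + 1)) + w *\<^sub>R ?d"
    unfolding v by (simp add: algebra_simps)
  have "Im (cnj ?d * (w *\<^sub>R ?d)) = 0" by (simp add: algebra_simps)
  moreover have "Im (cnj ?d * (P i - P (i + 1))) = area P"
    using area_rotate[of P "i + 1"] by (simp add: add.assoc)
  ultimately show ?thesis unfolding e distrib_left by (simp del: minus_complex.sel complex_cnj_diff)
qed

lemma in_edge_iff:
  assumes P: "area P \<noteq> 0" and z: "z \<in> region P"
  shows "z \<in> edge P i \<longleftrightarrow> Im (cnj (P (i + 2) - P (i + 1)) * (z - P (i + 1))) = 0"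
proof
  assume "z \<in> edge P i"
  then obtain w where w: "z = (1 - w) *\<^sub>R P (i + 1) + w *\<^sub>R P (i + 2)"
    unfolding edge_def closed_segment_def by auto
  show "Im (cnj (P (i + 2) - P (i + 1)) * (z - P (i + 1))) = 0"
    using edge_height[of 0 "1 - w" w P i] unfolding w by simp
next
  assume 0: "Im (cnj (P (i + 2) - P (i + 1)) * (z - P (i + 1))) = 0"
  obtain u v w where c: "u \<ge> 0" "v \<ge> 0" "w \<ge> 0" "u + v + w = 1" "z = u *\<^sub>R P i + v *\<^sub>R P (i + 1) + w *\<^sub>R P (i + 2)"
    using region_coordinates[OF z] by blast
  have "u = 0" using edge_height[OF c(4), of P i] 0 P unfolding c(5) by simp
  moreover from this have v: "v = 1 - w" using c(4) by simp
  ultimately have "z = (1 - w) *\<^sub>R P (i + 1) + w *\<^sub>R P (i + 2)" "w \<le> 1" using c(2,5) by simp_all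
  then show "z \<in> edge P i" unfolding edge_def closed_segment_def using c(3) by auto
qed

lemma reflect_direction_fixed:
  assumes "P (i + 2) \<noteq> P (i + 1)"
  shows "reflect_direction P i u = u \<longleftrightarrow> Im (cnj (P (i + 2) - P (i + 1)) * u) = 0"
proof -
  let ?d = "P (i + 2) - P (i + 1)"
  have "reflect_direction P i u = u \<longleftrightarrow> ?d * cnj u = u * cnj ?d"
    using assms by (simp add: reflect_direction_def Let_def divide_eq_eq del: complex_cnj_diff)
  also have "\<dots> \<longleftrightarrow> Im (cnj ?d * u) = 0"
  proof -
    have "d * cnj u = u * cnj d \<longleftrightarrow> Im (cnj d * u) = 0" for d :: complex
      by (auto simp: complex_eq_iff algebra_simps)
    then show ?thesis .
  qed
  finally show ?thesis .
qed

lemma reflect_direction_involution: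
  assumes "P (i + 2) \<noteq> P (i + 1)"
  shows "reflect_direction P i (reflect_direction P i u) = u"
  using assms by (simp add: reflect_direction_def Let_def del: complex_cnj_diff)

lemma linear_if_const_derivative:
  fixes f :: "real \<Rightarrow> complex"
  assumes f: "continuous_on UNIV f" and d: "\<And>x. a < x \<Longrightarrow> x < b \<Longrightarrow> x \<noteq> t \<Longrightarrow> (f has_vector_derivative u) (at x)"
    and y: "a < y" "y < b" "a < z" "z < b"
  shows "f z = f y + (z - y) *\<^sub>R u"
proof -
  define g where "g x = f x - x *\<^sub>R u" for x
  have "g z = g y"
  proof (rule has_derivative_zero_unique_strong_convex[of "{a<..<b}" "{t}"])
    show "continuous_on {a<..<b} g" unfolding g_def
      by (intro continuous_intros continuous_on_subset[OF f]) auto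
    fix x assume x: "x \<in> {a<..<b} - {t}"
    have "(g has_vector_derivative u - 1 *\<^sub>R u) (at x)" unfolding g_def
      using d[of x] x by (auto intro!: derivative_eq_intros)
    then show "(g has_derivative (\<lambda>h. 0)) (at x within {a<..<b})"
      by (auto simp: has_vector_derivative_def intro: has_derivative_at_withinI)
  qed (use y in auto)
  then show ?thesis by (simp add: g_def algebra_simps)
qed

lemma trajectoryD:
  assumes "trajectory P f"
  shows "continuous_on UNIV f" "f t \<in> region P" "f t \<notin> range P"
    "\<exists>u v d. u \<noteq> 0 \<and> d > 0 \<and> (\<forall>s\<in>{t - d<..<t}. (f has_vector_derivative u) (at s)) \<and>
        (\<forall>s\<in>{t<..<t + d}. (f has_vector_derivative v) (at s)) \<and>
        (\<forall>i. f t \<in> edge P i \<longrightarrow> v = reflect_direction P i u) \<and>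
        ((\<forall>i. f t \<notin> edge P i) \<longrightarrow> v = u)"
  using assms unfolding trajectory_def by blast+

text \<open>A direction along an edge is fixed by the reflection, so the condition at a single hit
  does not exclude sliding. But sliding could never stop: the set \<open>C\<close> of sliding times
  is open and closed, and eternal motion at constant velocity leaves the bounded triangle.\<close>

lemma no_motion_along_edge:
  assumes tr: "trajectory P f" and P: "area P \<noteq> 0" and s: "f s \<in> edge P i" and e: "e > 0"
    and d: "\<And>x. s - e < x \<Longrightarrow> x < s + e \<Longrightarrow> x \<noteq> s \<Longrightarrow> (f has_vector_derivative u) (at x)"
  shows False
proof -
  note tD = trajectoryD[OF tr]
  have ne: "P (i + 2) \<noteq> P (i + 1)" by (rule vertices_distinct[OF P])
  have uu: "u \<noteq> 0 \<and> reflect_direction P i u = u"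
  proof -
    obtain u' v' d' where h: "u' \<noteq> 0" "d' > 0" "\<forall>x\<in>{s - d'<..<s}. (f has_vector_derivative u') (at x)"
      "\<forall>x\<in>{s<..<s + d'}. (f has_vector_derivative v') (at x)" "\<forall>i. f s \<in> edge P i \<longrightarrow> v' = reflect_direction P i u'"
      using tD(4)[of s] by blast
    define m where "m = min d' e / 2"
    have m: "0 < m" "m < d'" "m < e" using h(2) e by (auto simp: m_def)
    have "(f has_vector_derivative u) (at (s - m))" "(f has_vector_derivative u) (at (s + m))" by (rule d; use m in simp)+
    moreover have "(f has_vector_derivative u') (at (s - m))" "(f has_vector_derivative v') (at (s + m))" using h(3,4) m by auto
    ultimately have "u' = u" "v' = u" using vector_derivative_unique_at by blast+
    then show ?thesis using h s by metis
  qed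
  define C where "C = {t. f t \<in> edge P i \<and> (\<exists>d>0. \<forall>x. t - d < x \<longrightarrow> x < t + d \<longrightarrow> x \<noteq> t \<longrightarrow> (f has_vector_derivative u) (at x))}"
  have "s \<in> C" using s d e by (auto simp: C_def)
  have op: "open C"
  proof (rule openI)
    fix t assume "t \<in> C"
    then obtain d where t: "f t \<in> edge P i" "d > 0" "\<And>x. t - d < x \<Longrightarrow> x < t + d \<Longrightarrow> x \<noteq> t \<Longrightarrow> (f has_vector_derivative u) (at x)"
      by (auto simp: C_def)
    have "ball t d \<subseteq> C"
    proof
      fix x assume "x \<in> ball t d"
      then have x: "t - d < x" "x < t + d" by (auto simp: dist_real_def)
      have fx: "f x = f t + (x - t) *\<^sub>R u"
        by (rule linear_if_const_derivative[OF tD(1), of "t - d" "t + d" t]) (use t x in auto)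
      have "f x \<in> edge P i"
      proof -
        have "Im (cnj (P (i + 2) - P (i + 1)) * u) = 0" using uu reflect_direction_fixed[OF ne] by blast
        moreover have "Im (cnj (P (i + 2) - P (i + 1)) * (f t - P (i + 1))) = 0" using t(1) in_edge_iff[OF P tD(2)] by blast
        moreover have "f x - P (i + 1) = (f t - P (i + 1)) + (x - t) *\<^sub>R u" unfolding fx by simp
        ultimately have "Im (cnj (P (i + 2) - P (i + 1)) * (f x - P (i + 1))) = 0"
          by (simp only: distrib_left mult_scaleR_right plus_complex.sel scaleR_complex.sel mult_zero_right add_0_right)
        then show ?thesis using in_edge_iff[OF P tD(2)] by blast
      qed
      moreover have "\<exists>d'>0. \<forall>y. x - d' < y \<longrightarrow> y < x + d' \<longrightarrow> y \<noteq> x \<longrightarrow> (f has_vector_derivative u) (at y)"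
      proof (cases "x = t")
        case True then show ?thesis using t by blast
      next
        case False
        define d' where "d' = min \<bar>x - t\<bar> (d - \<bar>x - t\<bar>)"
        have "d' > 0" using False x by (auto simp: d'_def)
        moreover have "(f has_vector_derivative u) (at y)" if "x - d' < y" "y < x + d'" for y
          by (rule t(3)) (use that in \<open>auto simp: d'_def min_def abs_if split: if_splits\<close>)
        ultimately show ?thesis by blast
      qed
      ultimately show "x \<in> C" by (simp add: C_def)
    qed
    then show "\<exists>T>0. ball t T \<subseteq> C" using t(2) by blast
  qed
  have cl: "closed C"
  proof -
    have "closure C \<subseteq> C"
    proof
      fix t assume t: "t \<in> closure C"
      have "closed (f -` edge P i)" by (rule continuous_closed_vimage) (use tD(1) in \<open>auto simp: edge_def continuous_on_eq_continuous_at\<close>)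
      moreover have "C \<subseteq> f -` edge P i" by (auto simp: C_def)
      ultimately have ft: "f t \<in> edge P i" using t closure_minimal by blast
      obtain u' v' d' where h: "u' \<noteq> 0" "d' > 0" "\<forall>x\<in>{t - d'<..<t}. (f has_vector_derivative u') (at x)"
        "\<forall>x\<in>{t<..<t + d'}. (f has_vector_derivative v') (at x)" "v' = reflect_direction P i u'"
        using tD(4)[of t] ft by blast
      obtain y where y: "y \<in> C" "dist y t < d'" using t h(2) closure_approachable by blast
      obtain dy where dy: "dy > 0" "\<And>x. y - dy < x \<Longrightarrow> x < y + dy \<Longrightarrow> x \<noteq> y \<Longrightarrow> (f has_vector_derivative u) (at x)"
        using y(1) by (auto simp: C_def)
      consider "y = t" | "y < t" | "y > t" by linarith
      then show "t \<in> C"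
      proof cases
        case 1 then show ?thesis using y by simp
      next
        case 2
        obtain z where "y < z" "z < min t (y + dy)" using dense[of y "min t (y + dy)"] 2 dy(1) by auto
        then have z: "y < z" "z < y + dy" "z < t" "t - d' < z" using 2 y(2) by (auto simp: dist_real_def)
        have "(f has_vector_derivative u) (at z)" "(f has_vector_derivative u') (at z)"
          using dy(2)[of z] h(3) z dy(1) by auto
        then have "u' = u" using vector_derivative_unique_at by blast
        then have "v' = u" using h(5) uu by simp
        have "\<forall>x. t - d' < x \<longrightarrow> x < t + d' \<longrightarrow> x \<noteq> t \<longrightarrow> (f has_vector_derivative u) (at x)"
        proof (intro allI impI)
          fix x assume "t - d' < x" "x < t + d'" "x \<noteq> t"
          then show "(f has_vector_derivative u) (at x)" using h(3,4) \<open>u' = u\<close> \<open>v' = u\<close> by (cases "x < t") auto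
        qed
        then show ?thesis using ft h(2) by (auto simp: C_def)
      next
        case 3
        obtain z where "max t (y - dy) < z" "z < y" using dense[of "max t (y - dy)" y] 3 dy(1) by auto
        then have z: "y - dy < z" "z < y" "t < z" "z < t + d'" using 3 y(2) by (auto simp: dist_real_def)
        have "(f has_vector_derivative u) (at z)" "(f has_vector_derivative v') (at z)"
          using dy(2)[of z] h(4) z dy(1) by auto
        then have "v' = u" using vector_derivative_unique_at by blast
        then have "u' = u" using h(5) uu reflect_direction_involution[OF ne, of u'] by simp
        have "\<forall>x. t - d' < x \<longrightarrow> x < t + d' \<longrightarrow> x \<noteq> t \<longrightarrow> (f has_vector_derivative u) (at x)"
        proof (intro allI impI)
          fix x assume "t - d' < x" "x < t + d'" "x \<noteq> t"
          then show "(f has_vector_derivative u) (at x)" using h(3,4) \<open>u' = u\<close> \<open>v' = u\<close> by (cases "x < t") auto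
        qed
        then show ?thesis using ft h(2) by (auto simp: C_def)
      qed
    qed
    then have "closure C = C" using closure_subset by (rule subset_antisym)
    then show ?thesis by (simp only: closure_eq)
  qed
  have "C = UNIV" using op cl \<open>s \<in> C\<close> clopen[of C] by blast
  have der: "(f has_vector_derivative u) (at t)" for t
  proof -
    obtain d where t: "d > 0" "\<And>x. t - d < x \<Longrightarrow> x < t + d \<Longrightarrow> x \<noteq> t \<Longrightarrow> (f has_vector_derivative u) (at x)"
      using \<open>C = UNIV\<close> unfolding C_def by blast
    have lin: "f x = f t + (x - t) *\<^sub>R u" if "x \<in> {t - d<..<t + d}" for x
      by (rule linear_if_const_derivative[OF tD(1), of "t - d" "t + d" t]) (use t that in auto)
    have "((\<lambda>x. f t + (x - t) *\<^sub>R u) has_vector_derivative u) (at t)"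
      by (auto intro!: derivative_eq_intros)
    then show ?thesis
      by (rule has_vector_derivative_transform_within_open[of _ _ _ "{t - d<..<t + d}"])
        (use t(1) in simp_all, rule lin[symmetric], simp)
  qed
  have lin: "f x = f 0 + x *\<^sub>R u" for x
    using linear_if_const_derivative[OF tD(1), of "- \<bar>x\<bar> - 1" "\<bar>x\<bar> + 1" 0 u 0 x] der by simp
  have "bounded (region P)" unfolding region_def by (intro compact_imp_bounded compact_convex_hull finite_imp_compact) simp
  then obtain B where B: "\<And>x. norm (f x) \<le> B" using tD(2) by (auto simp: bounded_iff)
  define x where "x = (2 * B + 1) / norm u"
  have "B \<ge> 0" using B[of 0] norm_ge_zero order_trans by blast
  have "2 * B + 1 = norm (x *\<^sub>R u)" using uu \<open>B \<ge> 0\<close> by (simp add: x_def)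
  also have "\<dots> = norm (f x - f 0)" unfolding lin[of x] by simp
  also have "\<dots> \<le> B + B" using norm_triangle_ineq4[of "f x" "f 0"] B[of x] B[of 0] by linarith
  finally show False by simp
qed

text \<open>On either side of a time the velocity is constant for a while, so another hit nearby
  would be motion along an edge.\<close>

lemma hits_isolated:
  assumes tr: "trajectory P f" and P: "area P \<noteq> 0"
  shows "\<exists>d>0. \<forall>s. \<bar>s - t\<bar> < d \<longrightarrow> s \<noteq> t \<longrightarrow> (\<forall>i. f s \<notin> edge P i)"
proof -
  obtain u v d where h: "d > 0" "\<forall>s\<in>{t - d<..<t}. (f has_vector_derivative u) (at s)"
      "\<forall>s\<in>{t<..<t + d}. (f has_vector_derivative v) (at s)" using trajectoryD(4)[OF tr, of t] by blast
  have "f s \<notin> edge P i" if "\<bar>s - t\<bar> < d" "s \<noteq> t" for s i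
  proof
    assume s: "f s \<in> edge P i"
    define e where "e = min \<bar>s - t\<bar> (d - \<bar>s - t\<bar>)"
    have e: "e > 0" using that by (auto simp: e_def)
    show False
    proof (cases "s < t")
      case True
      show False by (rule no_motion_along_edge[OF tr P s e, of u])
        (use h(2) True in \<open>auto simp: e_def min_def abs_if split: if_splits\<close>)
    next
      case False
      show False by (rule no_motion_along_edge[OF tr P s e, of v])
        (use h(3) False in \<open>auto simp: e_def min_def abs_if split: if_splits\<close>)
    qed
  qed
  then show ?thesis using h(1) by blast
qed

text \<open>For an infinite set \<open>sorted_list_of_set\<close> yields the empty list, so
  finiteness of the hit times comes first. Without any hit, the constant nonzero velocity would
  contradict \<open>f 0 = f a\<close>.\<close>

lemma hit_sequence_nonempty:
  assumes P: "nondegenerate P" and pt: "periodic_trajectory P f a"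
  shows "hit_sequence P f a \<noteq> []"
proof -
  have tr: "trajectory P f" and a: "a > 0" "f 0 = f a" using pt by (auto simp: periodic_trajectory_def)
  note tD = trajectoryD[OF tr]
  note iso = hits_isolated[OF tr area_nonzero[OF P]]
  have fin: "finite (hit_times P f a)"
  proof (rule ccontr)
    assume inf: "infinite (hit_times P f a)"
    have "hit_times P f a \<subseteq> {0..a}" by (auto simp: hit_times_def)
    then obtain t where t: "t islimpt hit_times P f a"
      using Heine_Borel_imp_Bolzano_Weierstrass[OF compact_Icc inf] by blast
    obtain d where d: "d > 0" "\<And>s. \<bar>s - t\<bar> < d \<Longrightarrow> s \<noteq> t \<Longrightarrow> (\<forall>i. f s \<notin> edge P i)" using iso by blast
    obtain s where "s \<in> hit_times P f a" "s \<noteq> t" "dist s t < d" using t d(1) islimpt_approachable by blast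
    then show False using d(2)[of s] by (auto simp: hit_times_def dist_real_def)
  qed
  moreover have "hit_times P f a \<noteq> {}"
  proof
    assume none: "hit_times P f a = {}"
    define D where "D t = vector_derivative f (at t)" for t
    have loc: "\<exists>u d. u \<noteq> 0 \<and> d > 0 \<and> (\<forall>x. \<bar>x - t\<bar> < d \<longrightarrow> (f has_vector_derivative u) (at x))" if t: "0 < t" "t < a" for t
    proof -
      have no: "\<forall>i. f t \<notin> edge P i" using none t by (auto simp: hit_times_def)
      obtain u d where h: "u \<noteq> 0" "d > 0" "\<forall>s\<in>{t - d<..<t}. (f has_vector_derivative u) (at s)"
        "\<forall>s\<in>{t<..<t + d}. (f has_vector_derivative u) (at s)" using tD(4)[of t] no by blast
      have d: "(f has_vector_derivative u) (at x)" if "t - d < x" "x < t + d" "x \<noteq> t" for x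
        using h(3,4) that by (cases "x < t") auto
      have lin: "f x = f t + (x - t) *\<^sub>R u" if "x \<in> {t - d<..<t + d}" for x
        by (rule linear_if_const_derivative[OF tD(1), of "t - d" "t + d" t]) (use d h that in auto)
      have "((\<lambda>x. f t + (x - t) *\<^sub>R u) has_vector_derivative u) (at t)"
        by (auto intro!: derivative_eq_intros)
      then have at_t: "(f has_vector_derivative u) (at t)"
        by (rule has_vector_derivative_transform_within_open[of _ _ _ "{t - d<..<t + d}"])
          (use h(2) in simp_all, rule lin[symmetric], simp)
      have "(f has_vector_derivative u) (at x)" if "\<bar>x - t\<bar> < d" for x
      proof (cases "x = t")
        case False
        have "t - d < x" "x < t + d" using that by linarith+
        then show ?thesis using d False by blast
      qed (use at_t in simp)
      then show ?thesis using h by blast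
    qed
    have "\<exists>c. \<forall>t\<in>{0<..<a}. D t = c"
    proof (rule has_derivative_zero_constant)
      fix t assume "t \<in> {0<..<a}"
      then obtain u d where u: "d > 0" "\<And>x. \<bar>x - t\<bar> < d \<Longrightarrow> (f has_vector_derivative u) (at x)" using loc[of t] by auto
      have "((\<lambda>_. u) has_derivative (\<lambda>h. 0)) (at t)" by simp
      then have "(D has_derivative (\<lambda>h. 0)) (at t)"
      proof (rule has_derivative_transform_within_open[of _ _ _ _ "{t - d<..<t + d}"])
        fix x assume "x \<in> {t - d<..<t + d}"
        then have "(f has_vector_derivative u) (at x)" by (intro u(2)) (simp add: abs_less_iff)
        then show "u = D x" by (simp add: D_def vector_derivative_at)
      qed (use u in auto)
      then show "(D has_derivative (\<lambda>h. 0)) (at t within {0<..<a})" by (rule has_derivative_at_withinI)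
    qed simp
    then obtain c where c: "\<And>t. 0 < t \<Longrightarrow> t < a \<Longrightarrow> D t = c" by auto
    have der: "(f has_vector_derivative c) (at t) \<and> c \<noteq> 0" if t: "0 < t" "t < a" for t
    proof -
      obtain u d where u: "u \<noteq> 0" "d > 0" "\<And>x. \<bar>x - t\<bar> < d \<Longrightarrow> (f has_vector_derivative u) (at x)" using loc[OF t] by blast
      have "(f has_vector_derivative u) (at t)" using u(2) by (intro u(3)) simp
      moreover from this have "D t = u" by (simp add: D_def vector_derivative_at)
      ultimately show ?thesis using c[OF t] u(1) by simp
    qed
    define g where "g x = f x - x *\<^sub>R c" for x
    have "g a = g 0"
    proof (rule has_derivative_zero_unique_strong_interval[of "{0, a}" 0 a])
      show "continuous_on {0..a} g" unfolding g_def by (intro continuous_intros continuous_on_subset[OF tD(1)]) auto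
      fix x assume x: "x \<in> {0..a} - {0, a}"
      have "(g has_vector_derivative c - 1 *\<^sub>R c) (at x)" unfolding g_def
        using der[of x] x by (auto intro!: derivative_eq_intros)
      then show "(g has_derivative (\<lambda>h. 0)) (at x within {0..a})"
        by (auto simp: has_vector_derivative_def intro: has_derivative_at_withinI)
    qed (use a in auto)
    then show False using a der[of "a / 2"] by (simp add: g_def)
  qed
  ultimately show ?thesis by (simp add: hit_sequence_def)
qed

section \<open>Normalized periodic unfoldings of a triangle of given shape\<close>

definition shaped :: "(3 \<Rightarrow> real) \<Rightarrow> real \<Rightarrow> triangle \<Rightarrow> bool" where
  "shaped \<phi> e P \<longleftrightarrow> (\<forall>j. P (j + 2) - P j =
     of_real (sin (\<phi> (j + 1)) / sin (\<phi> (j + 2))) * cis (e * \<phi> j) * (P (j + 1) - P j))"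

text \<open>\<open>arccos\<close> yields an unsigned angle; the sign of the cross product restores
  its sense and so gives the polar form of the quotient of two sides.\<close>

lemma angle_polar:
  fixes p q :: complex
  assumes I: "Im (cnj p * q) \<noteq> 0"
  defines "\<phi> \<equiv> arccos ((p \<bullet> q) / (norm p * norm q))"
  shows "cis (sgn (Im (cnj p * q)) * \<phi>) = cnj p * q / of_real (cmod p * cmod q)"
    "sin \<phi> = \<bar>Im (cnj p * q)\<bar> / (cmod p * cmod q)" "0 < \<phi>" "\<phi> < pi"
proof -
  have pq: "p \<noteq> 0" "q \<noteq> 0" using I by auto
  define z where "z = cnj p * q / of_real (cmod p * cmod q)"
  have z1: "cmod z = 1" using pq by (simp add: z_def norm_divide norm_mult)
  have Re: "(p \<bullet> q) / (norm p * norm q) = Re z"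
    unfolding z_def Re_divide_of_real by (simp add: inner_complex_def)
  have Im: "Im z = Im (cnj p * q) / (cmod p * cmod q)" unfolding z_def Im_divide_of_real ..
  have b: "-1 \<le> Re z" "Re z \<le> 1" using abs_Re_le_cmod[of z] z1 by auto
  have c: "cos \<phi> = Re z" unfolding \<phi>_def Re using b by (rule cos_arccos)
  have "1 - (Re z)\<^sup>2 = (Im z)\<^sup>2" using z1 cmod_power2[of z] by simp
  then have s: "sin \<phi> = \<bar>Im z\<bar>" unfolding \<phi>_def Re sin_arccos[OF b] by simp
  have pos: "cmod p * cmod q > 0" using pq by simp
  have "sgn (y / c) = sgn y" if "c > 0" for y c :: real using that by (simp add: sgn_divide)
  from this[OF pos] have sg: "sgn (Im (cnj p * q)) = sgn (Im z)" unfolding Im by (rule sym)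
  have z0: "Im z \<noteq> 0" unfolding Im using I pq by (simp only: divide_eq_0_iff mult_eq_0_iff norm_eq_zero) simp
  have "cis (sgn (Im z) * \<phi>) = z"
    using c s z0 by (cases "Im z > 0") (auto simp: complex_eq_iff sgn_if)
  then show "cis (sgn (Im (cnj p * q)) * \<phi>) = cnj p * q / of_real (cmod p * cmod q)" unfolding sg z_def .
  show "sin \<phi> = \<bar>Im (cnj p * q)\<bar> / (cmod p * cmod q)" unfolding s Im using pos by (simp add: abs_divide)
  have r: "0 \<le> \<phi>" "\<phi> \<le> pi" unfolding \<phi>_def Re using b by (auto intro: arccos_lbound arccos_ubound)
  have "\<phi> \<noteq> 0" "\<phi> \<noteq> pi" using s z0 by auto
  then show "0 < \<phi>" "\<phi> < pi" using r by auto
qed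

text \<open>The ratio of sides in \<open>shaped\<close> is the law of sines. As \<open>shape\<close>
  records two angles only, the third one comes from the angle sum.\<close>

lemma nondegenerate_shaped:
  assumes nd: "nondegenerate Q" and sh: "shape Q = (\<alpha>, \<beta>)"
  defines "\<phi> \<equiv> \<lambda>j :: 3. if j = 1 then \<alpha> else if j = 2 then \<beta> else pi - \<alpha> - \<beta>"
  shows "shaped \<phi> (sgn (area Q)) Q" "sin (\<phi> j) > 0"
proof -
  let ?o = "sgn (area Q)"
  define l where "l j = cmod (Q (j + 1) - Q (j + 2))" for j
  have A: "area Q \<noteq> 0" by (rule area_nonzero[OF nd])
  have lpos: "l j > 0" for j using vertices_distinct(2)[OF A, of j] by (simp add: l_def)
  have I: "Im (cnj (Q (j + 1) - Q j) * (Q (j + 2) - Q j)) \<noteq> 0" for j unfolding area_rotate by (rule A)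
  have n: "cmod (Q (j + 1) - Q j) = l (j + 2)" "cmod (Q (j + 2) - Q j) = l (j + 1)" for j
    by (simp_all add: l_def add.assoc norm_minus_commute)
  note ap = angle_polar[OF I, folded angle_at_def, unfolded area_rotate n]
  have c: "cis (?o * angle_at Q j) = cnj (Q (j + 1) - Q j) * (Q (j + 2) - Q j) / of_real (l (j + 2) * l (j + 1))" for j
    by (rule ap(1))
  have sn: "sin (angle_at Q j) = \<bar>area Q\<bar> / (l (j + 2) * l (j + 1))" for j by (rule ap(2))
  have bd: "0 < angle_at Q j" "angle_at Q j < pi" for j by (rule ap(3,4))+
  \<comment> \<open>The product of the three rotations is -1, so the sum is an odd multiple of
    \<open>pi\<close>, and between 0 and \<open>3 * pi\<close> only \<open>pi\<close> is
    left.\<close>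
  have sum: "angle_at Q 0 + angle_at Q 1 + angle_at Q 2 = pi"
  proof -
    let ?S = "angle_at Q 0 + angle_at Q 1 + angle_at Q 2"
    let ?x = "Q 1 - Q 0" and ?y = "Q 2 - Q 1" and ?z = "Q 0 - Q 2"
    have nz: "l 0 \<noteq> 0" "l 1 \<noteq> 0" "l 2 \<noteq> 0" using lpos[of 0] lpos[of 1] lpos[of 2] by auto
    have ll: "cnj ?y * ?y = of_real ((l 0)\<^sup>2)" "cnj ?z * ?z = of_real ((l 1)\<^sup>2)" "cnj ?x * ?x = of_real ((l 2)\<^sup>2)"
      using complex_norm_square[of ?y] complex_norm_square[of ?z] complex_norm_square[of ?x]
      by (simp_all add: l_def norm_minus_commute mult.commute)
    have "cis (?o * ?S) = cis (?o * angle_at Q 0) * cis (?o * angle_at Q 1) * cis (?o * angle_at Q 2)"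
      by (simp add: cis_mult algebra_simps)
    also have "\<dots> = (cnj ?x * (- ?z)) / of_real (l 2 * l 1) * ((cnj ?y * (- ?x)) / of_real (l 0 * l 2)) *
        ((cnj ?z * (- ?y)) / of_real (l 1 * l 0))"
      using c[of 0] c[of 1] c[of 2] by simp
    also have "\<dots> = - ((cnj ?x * ?x) * (cnj ?y * ?y) * (cnj ?z * ?z)) /
        (of_real (l 2 * l 1) * of_real (l 0 * l 2) * of_real (l 1 * l 0))"
    proof -
      have "(cnj x * (- z)) / a * ((cnj y * (- x)) / b) * ((cnj z * (- y)) / c) =
          - ((cnj x * x) * (cnj y * y) * (cnj z * z)) / (a * b * c)" for x y z a b c :: complex
        by (simp add: mult_ac)
      then show ?thesis .
    qed
    also have "\<dots> = -1" unfolding ll using nz by (simp add: power2_eq_square field_simps)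
    finally have "Re (cis (?o * ?S)) = -1" by simp
    moreover have "Re (cis (?o * x)) = cos x" for x using A by (cases "area Q > 0") simp_all
    ultimately have "cos ?S = -1" by metis
    then obtain m :: int where m: "?S = (2 * real_of_int m + 1) * pi" using cos_eq_minus1 by blast
    have "0 < ?S" "?S < 3 * pi" using bd[of 0] bd[of 1] bd[of 2] by linarith+
    then have "0 < (2 * real_of_int m + 1) * pi" "(2 * real_of_int m + 1) * pi < 3 * pi" unfolding m by auto
    then have "0 < (2 * real_of_int m + 1)" "2 * real_of_int m + 1 < 3"
      by (simp_all add: zero_less_mult_iff)
    then have "m = 0" by linarith
    then show ?thesis using m by simp
  qed
  have ab: "angle_at Q 1 = \<alpha>" "angle_at Q 2 = \<beta>" using sh by (auto simp: shape_def)
  have \<phi>: "\<phi> j = angle_at Q j" for j using label_cases[of j] ab sum by (auto simp: \<phi>_def)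
  show "sin (\<phi> j) > 0" unfolding \<phi> using bd by (rule sin_gt_zero)
  show "shaped \<phi> ?o Q" unfolding shaped_def
  proof
    fix j
    let ?p = "Q (j + 1) - Q j" and ?q = "Q (j + 2) - Q j"
    have l3: "l (j + 1 + 2) = l j" "l (j + 1 + 1) = l (j + 2)" "l (j + 2 + 2) = l (j + 1)" "l (j + 2 + 1) = l j"
      by (simp_all add: add.assoc)
    have r: "sin (\<phi> (j + 1)) / sin (\<phi> (j + 2)) = l (j + 1) / l (j + 2)"
      unfolding \<phi> sn l3 using A lpos[of j] lpos[of "j + 1"] lpos[of "j + 2"] by (simp add: field_simps)
    have pp: "?p * cnj ?p = of_real ((l (j + 2))\<^sup>2)" using complex_norm_square[of ?p] n[of j] by simp
    have "of_real (l (j + 1) / l (j + 2)) * (cnj ?p * ?q / of_real (l (j + 2) * l (j + 1))) * ?p =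
        of_real (l (j + 1) / l (j + 2)) / of_real (l (j + 2) * l (j + 1)) * (?p * cnj ?p) * ?q"
      by (simp add: mult_ac del: complex_cnj_diff)
    also have "\<dots> = of_real (l (j + 1) / l (j + 2) / (l (j + 2) * l (j + 1)) * (l (j + 2))\<^sup>2) * ?q"
      unfolding pp by simp
    also have "l (j + 1) / l (j + 2) / (l (j + 2) * l (j + 1)) * (l (j + 2))\<^sup>2 = 1"
      using lpos[of "j + 1"] lpos[of "j + 2"] by (simp add: field_simps power2_eq_square)
    finally show "?q = of_real (sin (\<phi> (j + 1)) / sin (\<phi> (j + 2))) * cis (?o * \<phi> j) * ?p"
      unfolding r unfolding \<phi> c[of j] by simp
  qed
qed

lemma side_length_area:
  assumes nd: "nondegenerate Q"
  shows "cmod (Q 2 - Q 1) > 0"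
  using vertices_distinct(1)[OF area_nonzero[OF nd], of 1] by simp

lemma reflect_triangle_diff:
  "reflect_triangle P i j - reflect_triangle P i k =
    (P (i + 2) - P (i + 1)) / cnj (P (i + 2) - P (i + 1)) * cnj (P j - P k)"
proof -
  define m where "m = (P (i + 2) - P (i + 1)) / cnj (P (i + 2) - P (i + 1))"
  have e: "reflect_triangle P i j = P (i + 1) + m * cnj (P j - P (i + 1))" for j
    by (simp only: reflect_triangle_def reflect_point_def reflect_direction_def Let_def m_def)
  show ?thesis unfolding e[of j] e[of k] m_def[symmetric] by (simp add: algebra_simps)
qed

lemma reflect_triangle_shaped:
  assumes "shaped \<phi> e P"
  shows "shaped \<phi> (- e) (reflect_triangle P i)"
  unfolding shaped_def
proof
  fix j
  let ?R = "reflect_triangle P i" and ?m = "(P (i + 2) - P (i + 1)) / cnj (P (i + 2) - P (i + 1))"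
  let ?r = "of_real (sin (\<phi> (j + 1)) / sin (\<phi> (j + 2))) :: complex"
  have h: "P (j + 2) - P j = ?r * cis (e * \<phi> j) * (P (j + 1) - P j)" using assms by (simp add: shaped_def)
  have "?R (j + 2) - ?R j = ?m * cnj (?r * cis (e * \<phi> j) * (P (j + 1) - P j))"
    unfolding reflect_triangle_diff h ..
  also have "\<dots> = ?r * cis (- e * \<phi> j) * (?m * cnj (P (j + 1) - P j))"
    unfolding complex_cnj_mult complex_cnj_complex_of_real cis_cnj by (simp add: mult_ac del: complex_cnj_diff)
  finally show "?R (j + 2) - ?R j = ?r * cis (- e * \<phi> j) * (?R (j + 1) - ?R j)"
    unfolding reflect_triangle_diff .
qed

lemma reflect_triangle_fixed:
  assumes "P (i + 2) \<noteq> P (i + 1)" "j \<noteq> i"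
  shows "reflect_triangle P i j = P j"
proof -
  have "j = i + 1 \<or> j = i + 2" using assms(2) label_cases[of i] label_cases[of j] by auto
  then show ?thesis using assms(1)
    by (auto simp: reflect_triangle_def reflect_point_def reflect_direction_def Let_def simp del: complex_cnj_diff)
qed

lemma reflect_triangle_dist:
  assumes "P (i + 2) \<noteq> P (i + 1)"
  shows "cmod (reflect_triangle P i j - reflect_triangle P i k) = cmod (P j - P k)"
  unfolding reflect_triangle_diff norm_mult norm_divide complex_mod_cnj using assms by simp

lemma shaped_area:
  assumes s: "shaped \<phi> e P" "\<And>j. sin (\<phi> j) > 0" and e: "e = 1 \<or> e = -1" and ne: "P 1 \<noteq> P 0"
  shows "e * area P > 0"
proof -
  let ?p = "P 1 - P 0" and ?r = "sin (\<phi> 1) / sin (\<phi> 2)"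
  have "P (0 + 2) - P 0 = of_real (sin (\<phi> (0 + 1)) / sin (\<phi> (0 + 2))) * cis (e * \<phi> 0) * (P (0 + 1) - P 0)"
    using s(1) unfolding shaped_def by blast
  then have q: "P 2 - P 0 = of_real ?r * cis (e * \<phi> 0) * ?p" by simp
  have "cnj ?p * (of_real ?r * cis (e * \<phi> 0) * ?p) = of_real ?r * cis (e * \<phi> 0) * (?p * cnj ?p)"
    by (simp only: mult_ac)
  also have "\<dots> = of_real (?r * (cmod ?p)\<^sup>2) * cis (e * \<phi> 0)"
    unfolding complex_norm_square[symmetric] by simp
  finally have eq: "cnj ?p * (of_real ?r * cis (e * \<phi> 0) * ?p) = of_real (?r * (cmod ?p)\<^sup>2) * cis (e * \<phi> 0)" .
  have im: "Im (of_real c * cis x) = c * sin x" for c x by simp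
  have "area P = ?r * (cmod ?p)\<^sup>2 * sin (e * \<phi> 0)" unfolding area_def q eq im ..
  then have "e * area P = ?r * (cmod ?p)\<^sup>2 * sin (\<phi> 0)" using e by auto
  then show ?thesis using s(2) ne by simp
qed

lemma interior_off_edge:
  assumes A: "area P \<noteq> 0" and z: "z \<in> interior (region P)"
  shows "Im (cnj (P (i + 2) - P (i + 1)) * (z - P (i + 1))) \<noteq> 0"
proof
  let ?d = "P (i + 2) - P (i + 1)"
  assume 0: "Im (cnj ?d * (z - P (i + 1))) = 0"
  obtain e where e: "e > 0" "ball z e \<subseteq> region P" using z by (meson mem_interior)
  have d: "?d \<noteq> 0" using vertices_distinct(2)[OF A, of i] by simp
  \<comment> \<open>A step of length \<open>e / 2\<close> away from the triangle, perpendicular to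
    the edge: it stays in the ball but makes the coordinate of vertex \<open>i\<close>
    negative.\<close>
  define k where "k = sgn (area P) * (e / 2 / cmod ?d)"
  define z' where "z' = z - of_real k * (\<i> * ?d)"
  have "\<bar>k\<bar> * cmod ?d = e / 2" using A d e by (simp add: k_def abs_mult abs_sgn_eq)
  then have "z' \<in> region P" using e unfolding z'_def by (intro subsetD[OF e(2)]) (simp add: dist_norm norm_mult)
  then obtain u v w where c: "u \<ge> 0" "u + v + w = 1" "z' = u *\<^sub>R P i + v *\<^sub>R P (i + 1) + w *\<^sub>R P (i + 2)"
    using region_coordinates by metis
  have "Im (cnj ?d * (z' - P (i + 1))) = u * area P" unfolding c(3) by (rule edge_height[OF c(2)])
  moreover have "cnj ?d * (z' - P (i + 1)) = cnj ?d * (z - P (i + 1)) - of_real k * \<i> * (?d * cnj ?d)"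
    unfolding z'_def by (simp add: algebra_simps)
  moreover have "Im (A - of_real k * \<i> * of_real c) = Im A - k * c" for A c by simp
  ultimately have "u * area P = - (k * (cmod ?d)\<^sup>2)"
    unfolding complex_norm_square[symmetric] using 0 by (metis diff_0)
  note uP = this
  have "u * (sgn (area P) * area P) = sgn (area P) * (u * area P)" by (simp only: mult_ac)
  also have "\<dots> = - (sgn (area P) * k * (cmod ?d)\<^sup>2)" unfolding uP by (simp only: mult_ac mult_minus_right)
  finally have "u * (sgn (area P) * area P) = - (sgn (area P) * k * (cmod ?d)\<^sup>2)" .
  moreover have "sgn (area P) * k = e / 2 / cmod ?d" using A by (simp add: k_def sgn_if)
  moreover have "sgn (area P) * area P = \<bar>area P\<bar>" using A by (simp add: sgn_if)
  ultimately have "u * \<bar>area P\<bar> = - (e / 2 / cmod ?d * (cmod ?d)\<^sup>2)" by simp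
  moreover have "u * \<bar>area P\<bar> \<ge> 0" using c(1) by simp
  moreover have "e / 2 / cmod ?d * (cmod ?d)\<^sup>2 > 0" using e d by simp
  ultimately show False by linarith
qed

text \<open>Just before time \<open>b\<close> the point is inside, so the edge is crossed outwards.
  Together with the orientation this decides on which side of the direction \<open>\<tau>\<close>
  each endpoint lies.\<close>

lemma crossing_sides:
  assumes A: "area P \<noteq> 0" and ab: "a < b"
    and int: "\<And>s. a < s \<Longrightarrow> s < b \<Longrightarrow> x + s *\<^sub>R \<tau> \<in> interior (region P)"
    and b: "x + b *\<^sub>R \<tau> \<in> edge P i - range P"
  shows "sgn (area P) * Im (cnj \<tau> * (P (i + 2) - x)) > 0" "sgn (area P) * Im (cnj \<tau> * (P (i + 1) - x)) < 0"
proof -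
  let ?d = "P (i + 2) - P (i + 1)"
  obtain l where l: "0 \<le> l" "l \<le> 1" "x + b *\<^sub>R \<tau> = (1 - l) *\<^sub>R P (i + 1) + l *\<^sub>R P (i + 2)"
    using b unfolding edge_def closed_segment_def by auto
  have "l \<noteq> 0" "l \<noteq> 1" using b l(3) by auto
  then have l': "0 < l" "l < 1" using l by auto
  define c where "c = (a + b) / 2"
  have c: "a < c" "c < b" using ab by (auto simp: c_def)
  define z where "z = x + c *\<^sub>R \<tau>"
  have zi: "z \<in> interior (region P)" unfolding z_def by (rule int[OF c])
  then have "z \<in> region P" using interior_subset by blast
  then obtain u v w where co: "u \<ge> 0" "u + v + w = 1" "z = u *\<^sub>R P i + v *\<^sub>R P (i + 1) + w *\<^sub>R P (i + 2)"
    using region_coordinates by metis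
  have G: "Im (cnj ?d * (z - P (i + 1))) = u * area P" unfolding co(3) by (rule edge_height[OF co(2)])
  then have "u \<noteq> 0" using interior_off_edge[OF A zi, of i] by auto
  then have u: "u > 0" using co(1) by simp
  have zz: "z - P (i + 1) = l *\<^sub>R ?d - (b - c) *\<^sub>R \<tau>"
  proof -
    have "z = (x + b *\<^sub>R \<tau>) - (b - c) *\<^sub>R \<tau>" by (simp add: z_def algebra_simps)
    then show ?thesis unfolding l(3) by (simp add: algebra_simps)
  qed
  define m where "m = Im (cnj ?d * \<tau>)"
  have dd: "Im (cnj ?d * ?d) = 0" by (simp add: algebra_simps)
  have "Im (cnj ?d * (l *\<^sub>R ?d - (b - c) *\<^sub>R \<tau>)) = l * Im (cnj ?d * ?d) - (b - c) * Im (cnj ?d * \<tau>)"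
    by (simp only: right_diff_distrib mult_scaleR_right minus_complex.sel scaleR_complex.sel)
  then have "u * area P = - ((b - c) * m)" using G unfolding zz dd m_def by simp
  then have "(b - c) * (sgn (area P) * m) = - (u * \<bar>area P\<bar>)"
    using A by (auto simp: sgn_if)
  moreover have "u * \<bar>area P\<bar> > 0" using u A by simp
  ultimately have "(b - c) * (sgn (area P) * m) < 0" by linarith
  then have m: "sgn (area P) * m < 0" using c by (simp add: mult_less_0_iff)
  have td: "Im (cnj \<tau> * ?d) = - m" and tt: "Im (cnj \<tau> * \<tau>) = 0" by (simp_all add: m_def algebra_simps)
  have "P (i + 2) - x = (1 - l) *\<^sub>R ?d + b *\<^sub>R \<tau>" "P (i + 1) - x = (- l) *\<^sub>R ?d + b *\<^sub>R \<tau>"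
    using l(3) by (simp_all add: algebra_simps)
  then have "Im (cnj \<tau> * (P (i + 2) - x)) = (1 - l) * Im (cnj \<tau> * ?d) + b * Im (cnj \<tau> * \<tau>)"
    "Im (cnj \<tau> * (P (i + 1) - x)) = (- l) * Im (cnj \<tau> * ?d) + b * Im (cnj \<tau> * \<tau>)"
    by (simp_all only: distrib_left mult_scaleR_right plus_complex.sel scaleR_complex.sel)
  then have e: "Im (cnj \<tau> * (P (i + 2) - x)) = - ((1 - l) * m)" "Im (cnj \<tau> * (P (i + 1) - x)) = l * m"
    unfolding td tt by simp_all
  have "(1 - l) * (sgn (area P) * m) < 0" "l * (sgn (area P) * m) < 0" using m l' by (simp_all add: mult_pos_neg)
  then show "sgn (area P) * Im (cnj \<tau> * (P (i + 2) - x)) > 0" "sgn (area P) * Im (cnj \<tau> * (P (i + 1) - x)) < 0"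
    unfolding e by (simp_all add: mult_ac)
qed

lemma unfolding_copy_Suc:
  "k < length ws \<Longrightarrow> unfolding_copy Q ws (Suc k) = reflect_triangle (unfolding_copy Q ws k) (ws ! k)"
  by (simp add: unfolding_copy_def take_Suc_conv_app_nth)

text \<open>The unfolding is continued in both directions by the translation. It is conjugated if
  \<open>Q\<close> is negatively oriented, which makes \<open>s 0 = 1\<close>, then turned until the
  translation is a positive real, and scaled to circumscribed diameter 1 so that the triangles stay
  bounded and do not shrink in the limit.\<close>

lemma admits_path:
  assumes nd: "nondegenerate Q" and sh: "shape Q = (\<alpha>, \<beta>)" and ad: "admits_sequence Q ws" and ne: "ws \<noteq> []"
    and \<phi>_def: "\<phi> = (\<lambda>j :: 3. if j = 1 then \<alpha> else if j = 2 then \<beta> else pi - \<alpha> - \<beta>)"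
  defines "n \<equiv> int (length ws)" and "w \<equiv> \<lambda>k. ws ! nat (k mod int (length ws))"
    and "s \<equiv> \<lambda>k :: int. if even k then 1 else - 1 :: real"
  shows "even n \<and> (\<exists>W L h. qpath w s \<phi> (\<lambda>j. sin (\<phi> (j + 1)) / sin (\<phi> (j + 2))) W \<and>
    (\<forall>k. cmod (W k 2 - W k 1) = sin (\<phi> 0)) \<and> (\<forall>k j. W (k + n) j = W k j + of_real L) \<and> L > 0 \<and>
    (\<forall>k. s k * (Im (W k (w k + 2)) - h) > 0 \<and> s k * (Im (W k (w k + 1)) - h) < 0) \<and> W 0 1 = 0)"
proof -
  define N where "N = length ws"
  have N: "N > 0" "n = int N" using ne by (simp_all add: N_def n_def)
  define U where "U = unfolding_copy Q ws"
  define e where "e = sgn (area Q)"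
  have A: "area Q \<noteq> 0" by (rule area_nonzero[OF nd])
  have e: "e = 1 \<or> e = -1" using A by (auto simp: e_def sgn_if)
  have ns: "shaped \<phi> e Q" "sin (\<phi> j) > 0" for j
    using nondegenerate_shaped[OF nd sh] unfolding \<phi>_def e_def by blast+
  define ek where "ek k = (if even k then e else - e)" for k :: nat
  have ek: "ek k = 1 \<or> ek k = -1" for k using e by (auto simp: ek_def)
  have ne01: "P 1 \<noteq> P 0" if "\<And>i j. cmod (P i - P j) = cmod (Q i - Q j)" for P :: triangle
    using that[of 1 0] vertices_distinct(1)[OF A, of 0] by auto
  have inv: "k \<le> N \<Longrightarrow> shaped \<phi> (ek k) (U k) \<and> (\<forall>i j. cmod (U k i - U k j) = cmod (Q i - Q j))" for k
  proof (induction k)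
    case 0
    show ?case using ns(1) by (simp add: U_def unfolding_copy_def ek_def)
  next
    case (Suc k)
    then have IH: "shaped \<phi> (ek k) (U k)" "\<And>i j. cmod (U k i - U k j) = cmod (Q i - Q j)" by simp_all
    have U: "U (Suc k) = reflect_triangle (U k) (ws ! k)"
      using Suc.prems unfolding U_def N_def by (intro unfolding_copy_Suc) simp
    have d: "U k (i + 2) \<noteq> U k (i + 1)" for i
      using IH(2)[of "i + 2" "i + 1"] vertices_distinct(2)[OF A, of i] by auto
    have "ek (Suc k) = - ek k" by (simp add: ek_def)
    then show ?case unfolding U using reflect_triangle_shaped[OF IH(1)] reflect_triangle_dist[of "U k", OF d] IH(2) by simp
  qed
  have UA: "ek k * area (U k) > 0" if "k \<le> N" for k
    by (rule shaped_area[where \<phi> = \<phi>, OF _ ns(2) ek]) (use inv[OF that] ne01 in auto)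
  have Une: "U k (i + 2) \<noteq> U k (i + 1)" if "k \<le> N" for i k
  proof -
    have "area (U k) \<noteq> 0" using UA[OF that] by auto
    then show ?thesis by (rule vertices_distinct(2))
  qed
  have U_fixed: "U (Suc k) j = U k j" if "k < N" "j \<noteq> ws ! k" for k j
  proof -
    have "U (Suc k) = reflect_triangle (U k) (ws ! k)"
      using unfolding_copy_Suc[of k ws Q] that(1) by (simp only: U_def N_def)
    then show ?thesis by (simp only: reflect_triangle_fixed[OF Une[OF less_imp_le[OF that(1)]] that(2)])
  qed
  obtain \<tau> x \<sigma> where tr: "translate_by \<tau> Q (U N)"
    and \<sigma>: "\<And>k. k \<le> N \<Longrightarrow> \<sigma> k < \<sigma> (Suc k)"
    and int: "\<And>k y. k \<le> N \<Longrightarrow> \<sigma> k < y \<Longrightarrow> y < \<sigma> (Suc k) \<Longrightarrow> x + y *\<^sub>R \<tau> \<in> interior (region (U k))"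
    and edge: "\<And>k. k < N \<Longrightarrow> x + \<sigma> (Suc k) *\<^sub>R \<tau> \<in> edge (U k) (ws ! k) - range (U k)"
  proof -
    obtain \<tau> x \<sigma> where h: "translate_by \<tau> Q (U N)" "\<forall>k\<le>N. \<sigma> k < \<sigma> (Suc k)"
      "\<forall>k\<le>N. \<forall>y\<in>{\<sigma> k<..<\<sigma> (Suc k)}. x + y *\<^sub>R \<tau> \<in> interior (region (U k))"
      "\<forall>k<N. x + \<sigma> (Suc k) *\<^sub>R \<tau> \<in> edge (U k) (ws ! k) - range (U k)"
      using ad unfolding admits_sequence_def U_def[symmetric] N_def[symmetric] by (elim exE conjE) (rule that)
    show ?thesis
    proof (rule that[OF h(1)])
      show "\<And>k. k \<le> N \<Longrightarrow> \<sigma> k < \<sigma> (Suc k)" using h(2) by blast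
      show "\<And>k y. k \<le> N \<Longrightarrow> \<sigma> k < y \<Longrightarrow> y < \<sigma> (Suc k) \<Longrightarrow> x + y *\<^sub>R \<tau> \<in> interior (region (U k))"
        using h(3) by simp
      show "\<And>k. k < N \<Longrightarrow> x + \<sigma> (Suc k) *\<^sub>R \<tau> \<in> edge (U k) (ws ! k) - range (U k)" using h(4) by blast
    qed
  qed
  have UN: "U N j = U 0 j + \<tau>" for j using tr by (simp add: translate_by_def U_def unfolding_copy_def)
  have sgnU: "sgn (area (U k)) = ek k" if "k \<le> N" for k
    using UA[OF that] ek[of k] by (auto simp: sgn_if zero_less_mult_iff)
  have cs: "ek k * Im (cnj \<tau> * (U k (ws ! k + 2) - x)) > 0" "ek k * Im (cnj \<tau> * (U k (ws ! k + 1) - x)) < 0"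
    if k: "k < N" for k
  proof -
    have kN: "k \<le> N" using k by simp
    have a: "area (U k) \<noteq> 0" using UA[OF kN] by auto
    show "ek k * Im (cnj \<tau> * (U k (ws ! k + 2) - x)) > 0" "ek k * Im (cnj \<tau> * (U k (ws ! k + 1) - x)) < 0"
      using crossing_sides[OF a \<sigma>[OF kN] int[OF kN] edge[OF k]] unfolding sgnU[OF kN] by blast+
  qed
  have \<tau>0: "\<tau> \<noteq> 0" using cs(1)[of 0] N by auto
  \<comment> \<open>A translation preserves the orientation, and each reflection reverses
    it.\<close>
  have evN: "even N"
  proof -
    have "area (U N) = area (U 0)" unfolding area_def UN by simp
    then have "ek N = ek 0" using sgnU[of N] sgnU[of 0] by simp
    then show ?thesis using e by (auto simp: ek_def split: if_splits)
  qed
  define f where "f z = (if e = 1 then z else cnj z)" for z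
  have f_diff: "f (a - b) = f a - f b" and f_add: "f (a + b) = f a + f b" and f_mult: "f (a * b) = f a * f b"
    and f_re: "f (of_real c) = of_real c" and f_norm: "cmod (f a) = cmod a" and f_Im: "Im (f a) = e * Im a"
    and f_cnj: "f (cnj a) = cnj (f a)" for a b c using e by (auto simp: f_def)
  have f_cis: "f (cis (e * y)) = cis y" for y using e by (auto simp: f_def cis_cnj)
  define l0 where "l0 = cmod (Q 2 - Q 1)"
  have l0: "l0 > 0" unfolding l0_def by (rule side_length_area[OF nd])
  define c0 where "c0 = sin (\<phi> 0) / (l0 * cmod \<tau>)"
  have c0: "c0 > 0" using ns(2)[of 0] l0 \<tau>0 by (simp add: c0_def)
  define C where "C = of_real c0 * cnj (f \<tau>)"
  have C_norm: "cmod C = sin (\<phi> 0) / l0" using c0 \<tau>0 l0 by (simp add: C_def norm_mult f_norm) (simp add: c0_def)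
  define idx where "idx k = nat (k mod n)" for k
  have idx: "idx k < N" "int (idx k) = k mod n" for k using N by (auto simp: idx_def nat_less_iff)
  define Pk where "Pk k j = U (idx k) j + of_int (k div n) * \<tau>" for k j
  define W where "W k j = C * f (Pk k j - Q 1)" for k j
  define h where "h = Im (C * f (x - Q 1))"
  have Wdiff: "W k j - W k j' = C * f (U (idx k) j - U (idx k) j')" for k j j'
    unfolding W_def right_diff_distrib[symmetric] f_diff[symmetric] by (simp add: Pk_def)
  have even_idx: "even (idx k) = even k" for k
  proof -
    have "even (k mod n) = even k" using evN N(2) by (simp add: dvd_mod_iff)
    then show ?thesis using idx(2)[of k] by (metis even_of_nat)
  qed
  have ek_s: "ek (idx k) = e * s k" for k unfolding ek_def even_idx by (simp add: s_def)
  have Pk_Suc: "Pk (k + 1) j = Pk k j" if "j \<noteq> w k" for k j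
  proof -
    have w: "w k = ws ! idx k" by (simp add: w_def idx_def n_def)
    have step: "U (Suc (idx k)) j = U (idx k) j" using U_fixed[OF idx(1)] that unfolding w by blast
    have kd: "k = n * (k div n) + int (idx k)" by (simp add: idx)
    show ?thesis
    proof (cases "Suc (idx k) < N")
      case True
      have "k + 1 = int (Suc (idx k)) + n * (k div n)" using kd by simp
      then have d: "(k + 1) mod n = int (Suc (idx k))" "(k + 1) div n = k div n"
        using True N by (simp_all only: mod_mult_self2 div_mult_self2) simp_all
      have "idx (k + 1) = Suc (idx k)" unfolding idx_def[of "k + 1"] d(1) nat_int ..
      then show ?thesis unfolding Pk_def d(2) by (simp only: step)
    next
      case False
      then have "Suc (idx k) = N" using idx(1)[of k] by simp
      note sN = this
      have "int (idx k) + 1 = n" using sN N(2) by simp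
      moreover have "n * (k div n + 1) = n * (k div n) + n" by (simp add: algebra_simps)
      ultimately have k1: "k + 1 = n * (k div n + 1)" using kd by linarith
      have n0: "n \<noteq> 0" using N by simp
      have d: "(k + 1) mod n = 0" "(k + 1) div n = k div n + 1"
        unfolding k1 using n0 by (simp_all only: mod_mult_self1_is_0 nonzero_mult_div_cancel_left not_False_eq_True)
      have "idx (k + 1) = 0" unfolding idx_def[of "k + 1"] d(1) by simp
      then have "Pk (k + 1) j = U 0 j + of_int (k div n + 1) * \<tau>" unfolding Pk_def d(2) by (simp only:)
      also have "\<dots> = U N j + of_int (k div n) * \<tau>" unfolding UN by (simp add: algebra_simps)
      also have "\<dots> = Pk k j" unfolding Pk_def step[symmetric] sN ..
      finally show ?thesis .
    qed
  qed
  have q: "qpath w s \<phi> (\<lambda>j. sin (\<phi> (j + 1)) / sin (\<phi> (j + 2))) W"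
    unfolding qpath_def
  proof (intro conjI allI impI)
    show "sin (\<phi> (j + 1)) / sin (\<phi> (j + 2)) > 0" for j using ns(2) by simp
    show "W (k + 1) j = W k j" if "j \<noteq> w k" for k j unfolding W_def Pk_Suc[OF that] ..
    show "W k (j + 2) - W k j = of_real (sin (\<phi> (j + 1)) / sin (\<phi> (j + 2))) * cis (s k * \<phi> j) * (W k (j + 1) - W k j)" for k j
    proof -
      have "U (idx k) (j + 2) - U (idx k) j = of_real (sin (\<phi> (j + 1)) / sin (\<phi> (j + 2))) *
          cis (e * (s k * \<phi> j)) * (U (idx k) (j + 1) - U (idx k) j)"
        using inv[of "idx k"] idx(1)[of k] unfolding shaped_def ek_s by (simp add: mult.assoc)
      then show ?thesis unfolding Wdiff by (simp only: f_mult f_re f_cis mult_ac)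
    qed
  qed
  have norm: "cmod (W k 2 - W k 1) = sin (\<phi> 0)" for k
    using inv[of "idx k"] idx(1)[of k] l0 unfolding Wdiff norm_mult f_norm C_norm by (simp add: l0_def)
  define L where "L = c0 * (cmod \<tau>)\<^sup>2"
  have CL: "C * f \<tau> = of_real L"
    using complex_norm_square[of "f \<tau>"] by (simp add: C_def L_def f_norm mult.assoc)
  have per: "W (k + n) j = W k j + of_real L" for k j
  proof -
    have "idx (k + n) = idx k" "(k + n) div n = k div n + 1" using N by (simp_all add: idx_def)
    then have "Pk (k + n) j - Q 1 = (Pk k j - Q 1) + \<tau>" unfolding Pk_def by (simp add: algebra_simps)
    then show ?thesis unfolding W_def by (simp only: f_add distrib_left CL)
  qed
  have cross: "s k * (Im (W k j) - h) = c0 * (ek (idx k) * Im (cnj \<tau> * (U (idx k) j - x)))" for k j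
  proof -
    have "Im (W k j) - h = Im (C * f (Pk k j - x))"
      unfolding W_def h_def minus_complex.sel(2)[symmetric] right_diff_distrib[symmetric] f_diff[symmetric] by simp
    also have "\<dots> = c0 * Im (f (cnj \<tau> * (Pk k j - x)))" unfolding C_def by (simp add: f_mult f_cnj mult.assoc)
    also have "\<dots> = c0 * (e * Im (cnj \<tau> * (Pk k j - x)))" unfolding f_Im ..
    also have "cnj \<tau> * (Pk k j - x) = cnj \<tau> * (U (idx k) j - x) + of_int (k div n) * (\<tau> * cnj \<tau>)"
      by (simp add: Pk_def algebra_simps)
    also have "Im \<dots> = Im (cnj \<tau> * (U (idx k) j - x))"
      unfolding complex_norm_square[symmetric] by (simp del: of_real_power)
    finally show ?thesis unfolding ek_s by (simp add: mult_ac)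
  qed
  have cr: "s k * (Im (W k (w k + 2)) - h) > 0 \<and> s k * (Im (W k (w k + 1)) - h) < 0" for k
  proof -
    have w: "w k = ws ! idx k" by (simp add: w_def idx_def n_def)
    show ?thesis unfolding cross w using cs[OF idx(1)[of k]] c0 by (simp add: mult_pos_neg)
  qed
  have "W 0 1 = 0" by (simp add: W_def Pk_def idx_def U_def unfolding_copy_def f_def)
  moreover have "L > 0" using c0 \<tau>0 by (simp add: L_def)
  moreover have "even n" using evN N(2) by simp
  ultimately show ?thesis using q norm per cr by blast
qed

section \<open>Passage to a convergent subsequence\<close>

lemma qpath_convergent:
  fixes W :: "nat \<Rightarrow> int \<Rightarrow> 3 \<Rightarrow> complex"
  assumes q: "\<And>\<nu>. qpath w s (\<phi> \<nu>) (\<lambda>j. sin (\<phi> \<nu> (j + 1)) / sin (\<phi> \<nu> (j + 2))) (W \<nu>)"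
    and s: "\<And>k. s (k + 1) = - s k"
    and \<phi>: "\<And>j. (\<lambda>\<nu>. \<phi> \<nu> j) \<longlonglongrightarrow> \<phi>0 j" "\<And>j. sin (\<phi>0 j) \<noteq> 0"
    and base: "\<And>\<nu>. W \<nu> 0 1 = 0" "(\<lambda>\<nu>. W \<nu> 0 2) \<longlonglongrightarrow> z"
  shows "convergent (\<lambda>\<nu>. W \<nu> k j)"
proof -
  have c: "convergent (\<lambda>\<nu>. cis (x * \<phi> \<nu> j))" for x j
  proof -
    have "(\<lambda>\<nu>. cis (x * \<phi> \<nu> j)) \<longlonglongrightarrow> cis (x * \<phi>0 j)" unfolding cis_conv_exp by (intro tendsto_intros \<phi>)
    then show ?thesis by (rule convergentI)
  qed
  have "\<forall>j. convergent (\<lambda>\<nu>. W \<nu> k j)"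
  proof (induction k rule: int_induct[where k = 0])
    case base
    have 1: "convergent (\<lambda>\<nu>. W \<nu> 0 1)" unfolding assms(5) by (rule convergent_const)
    have 2: "convergent (\<lambda>\<nu>. W \<nu> 0 2)" using assms(6) by (rule convergentI)
    have "(\<lambda>\<nu>. complex_of_real (sin (\<phi> \<nu> 2) / sin (\<phi> \<nu> 0))) \<longlonglongrightarrow> of_real (sin (\<phi>0 2) / sin (\<phi>0 0))"
      by (intro tendsto_intros \<phi>)
    then have r: "convergent (\<lambda>\<nu>. complex_of_real (sin (\<phi> \<nu> 2) / sin (\<phi> \<nu> 0)))" by (rule convergentI)
    have "W \<nu> 0 0 = of_real (sin (\<phi> \<nu> 2) / sin (\<phi> \<nu> 0)) * cis (s 0 * \<phi> \<nu> 1) * W \<nu> 0 2" for \<nu>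
      using qpath_shape[OF q[of \<nu>], of 0 1] by (simp add: assms(5))
    then have "convergent (\<lambda>\<nu>. W \<nu> 0 0)"
      using convergent_mult[OF convergent_mult[OF r c[of "s 0" 1]] 2] by simp
    then show ?case using 1 2 label_cases by metis
  next
    case (step1 k)
    show ?case
    proof
      fix j show "convergent (\<lambda>\<nu>. W \<nu> (k + 1) j)"
      proof (cases "j = w k")
        case False
        then have "W \<nu> (k + 1) j = W \<nu> k j" for \<nu> by (rule qpath_Suc[OF q])
        then show ?thesis using step1 by simp
      next
        case True
        define i where "i = j + 2"
        have i: "j = i + 1" by (simp add: i_def add.assoc)
        have "W \<nu> (k + 1) j = W \<nu> k i + cis (2 * s k * \<phi> \<nu> i) * (W \<nu> k j - W \<nu> k i)" for \<nu>
          using qpath_step[OF q[of \<nu>] s, of k i] True i by (simp add: diff_eq_eq add.commute)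
        moreover have "convergent (\<lambda>\<nu>. W \<nu> k i + cis (2 * s k * \<phi> \<nu> i) * (W \<nu> k j - W \<nu> k i))"
          using step1 by (intro convergent_add convergent_mult convergent_diff c) auto
        ultimately show ?thesis by simp
      qed
    qed
  next
    case (step2 k)
    define l where "l = k - 1"
    have k: "k = l + 1" by (simp add: l_def)
    show ?case unfolding l_def[symmetric]
    proof
      fix j show "convergent (\<lambda>\<nu>. W \<nu> l j)"
      proof (cases "j = w l")
        case False
        then have "W \<nu> k j = W \<nu> l j" for \<nu> unfolding k by (rule qpath_Suc[OF q])
        then have "(\<lambda>\<nu>. W \<nu> k j) = (\<lambda>\<nu>. W \<nu> l j)" by (rule ext)
        then show ?thesis using step2(2) by metis
      next
        case True
        define i where "i = j + 2"
        have i: "j = i + 1" "i \<noteq> w l" using True by (simp_all add: i_def add.assoc)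
        have "W \<nu> l j = W \<nu> k i + cis (- (2 * s l) * \<phi> \<nu> i) * (W \<nu> k j - W \<nu> k i)" for \<nu>
        proof -
          have Wi: "W \<nu> k i = W \<nu> l i" unfolding k by (rule qpath_Suc[OF q i(2)])
          have "W \<nu> k j - W \<nu> l i = cis (2 * s l * \<phi> \<nu> i) * (W \<nu> l j - W \<nu> l i)"
            using qpath_step[OF q[of \<nu>] s, of l i] True i unfolding k by simp
          then have "cis (- (2 * s l) * \<phi> \<nu> i) * (W \<nu> k j - W \<nu> l i) = W \<nu> l j - W \<nu> l i"
            by (simp add: mult.assoc[symmetric] cis_mult)
          then show ?thesis unfolding Wi by simp
        qed
        moreover have "convergent (\<lambda>\<nu>. W \<nu> k i + cis (- (2 * s l) * \<phi> \<nu> i) * (W \<nu> k j - W \<nu> k i))"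
          using step2 by (intro convergent_add convergent_mult convergent_diff c) auto
        ultimately show ?thesis by simp
      qed
    qed
  qed
  then show ?thesis by blast
qed

text \<open>Letter \<open>2\<close> turns this side about vertex \<open>1\<close>, letter
  \<open>1\<close> turns it about vertex \<open>2\<close> in the opposite sense, and letter
  \<open>0\<close> fixes it. The direction thus depends on the signed letter counts alone.\<close>

lemma side_direction:
  assumes q: "qpath w s \<phi> \<rho> P" and s: "\<And>k. s (k + 1) = - s k" "\<And>k. s k = 1 \<or> s k = -1"
    and x1: "\<And>k. x1 (k + 1) = x1 k + (if s k = 1 then 1 else - 1) * (if w k = 1 then 1 else (0::int))"
    and x2: "\<And>k. x2 (k + 1) = x2 k + (if s k = 1 then 1 else - 1) * (if w k = 2 then 1 else (0::int))"
  shows "P (int m) 2 - P (int m) 1 =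
    cis (2 * (of_int (x2 (int m) - x2 0) * \<phi> 1 - of_int (x1 (int m) - x1 0) * \<phi> 2)) * (P 0 2 - P 0 1)"
proof (induction m)
  case (Suc m)
  define k where "k = int m"
  have k: "int (Suc m) = k + 1" by (simp add: k_def)
  have \<rho>: "\<rho> 2 > 0" by (rule qpath_pos[OF q])
  let ?e = "if w k = 1 then - (2 * s k * \<phi> 2) else if w k = 2 then 2 * s k * \<phi> 1 else 0"
  have D: "P (k + 1) 2 - P (k + 1) 1 = cis ?e * (P k 2 - P k 1)"
  proof -
    consider "w k = 1" | "w k = 2" | "w k = 0" using label_cases[of "w k"] by blast
    then show ?thesis
    proof cases
      case 1
      have e: "P (k + 1) 2 = P k 2" "P (k + 1) 0 = P k 0" using qpath_Suc[OF q] 1 by auto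
      have a: "P k 1 - P k 2 = of_real (\<rho> 2) * cis (s k * \<phi> 2) * (P k 0 - P k 2)"
        using qpath_shape[OF q, of k 2] by simp
      have b: "P (k + 1) 1 - P k 2 = of_real (\<rho> 2) * cis (- s k * \<phi> 2) * (P k 0 - P k 2)"
        using qpath_shape[OF q, of "k + 1" 2] by (simp add: e s)
      have c: "cis (- s k * \<phi> 2) = cis (- (2 * s k * \<phi> 2)) * cis (s k * \<phi> 2)" by (simp add: cis_mult)
      have "P (k + 1) 1 - P k 2 = cis (- (2 * s k * \<phi> 2)) * (P k 1 - P k 2)"
        unfolding a b c by (simp only: mult_ac)
      then have "- (P (k + 1) 1 - P k 2) = cis (- (2 * s k * \<phi> 2)) * (- (P k 1 - P k 2))" by (simp only: mult_minus_right)
      then show ?thesis using 1 by (simp add: e)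
    next
      case 2
      have e: "P (k + 1) 1 = P k 1" using qpath_Suc[OF q] 2 by auto
      show ?thesis using qpath_step[OF q s(1), of k 1] 2 by (simp add: e)
    next
      case 3
      then show ?thesis using qpath_Suc[OF q, of 1 k] qpath_Suc[OF q, of 2 k] by simp
    qed
  qed
  have "?e + 2 * (of_int (x2 k - x2 0) * \<phi> 1 - of_int (x1 k - x1 0) * \<phi> 2) =
      2 * (of_int (x2 (k + 1) - x2 0) * \<phi> 1 - of_int (x1 (k + 1) - x1 0) * \<phi> 2)"
    using s(2)[of k] unfolding x1 x2 by (auto simp: algebra_simps)
  then show ?case unfolding k D Suc[folded k_def] by (simp only: mult.assoc[symmetric] cis_mult)
qed simp

text \<open>Compactness is applied to one side of copy \<open>0\<close>; all other vertices arise
  from it by rotations through convergent angles.\<close>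

lemma no_degenerating_sequence:
  fixes Q :: "nat \<Rightarrow> triangle"
  assumes ne: "ws \<noteq> []" and nd: "\<And>\<nu>. nondegenerate (Q \<nu>)"
    and sh: "\<And>\<nu>. shape (Q \<nu>) = (pi / 6 + t \<nu>, pi / 3 - t \<nu> - r \<nu>)"
    and ad: "\<And>\<nu>. admits_sequence (Q \<nu>) ws"
    and t: "\<And>\<nu>. t \<nu> > 0" "t \<longlonglongrightarrow> 0" and r: "\<And>\<nu>. r \<nu> > 0" "(\<lambda>\<nu>. r \<nu> / t \<nu>) \<longlonglongrightarrow> 0"
  shows False
proof -
  define \<phi> where "\<phi> \<nu> j = (if j = 1 then pi / 6 + t \<nu> else if j = 2 then pi / 3 - t \<nu> - r \<nu> else pi / 2 + r \<nu>)"
    for \<nu> and j :: 3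
  have \<phi>e: "\<phi> \<nu> = (\<lambda>j. if j = 1 then pi / 6 + t \<nu> else if j = 2 then pi / 3 - t \<nu> - r \<nu>
      else pi - (pi / 6 + t \<nu>) - (pi / 3 - t \<nu> - r \<nu>))" for \<nu>
    by (auto simp: \<phi>_def fun_eq_iff)
  define n where "n = int (length ws)"
  define w where "w k = ws ! nat (k mod n)" for k
  define s where "s k = (if even k then 1 else - 1 :: real)" for k :: int
  define \<Phi> where "\<Phi> \<nu> W L h \<longleftrightarrow> qpath w s (\<phi> \<nu>) (\<lambda>j. sin (\<phi> \<nu> (j + 1)) / sin (\<phi> \<nu> (j + 2))) W \<and>
    (\<forall>k. cmod (W k 2 - W k 1) = sin (\<phi> \<nu> 0)) \<and> (\<forall>k j. W (k + n) j = W k j + of_real L) \<and> L > 0 \<and>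
    (\<forall>k. s k * (Im (W k (w k + 2)) - h) > 0 \<and> s k * (Im (W k (w k + 1)) - h) < 0) \<and> W 0 1 = 0" for \<nu> W L h
  have ap: "even n \<and> (\<exists>W L h. \<Phi> \<nu> W L h)" for \<nu>
    using admits_path[OF nd sh ad ne \<phi>e, of \<nu>] unfolding n_def[symmetric] w_def[symmetric] s_def[symmetric] \<Phi>_def
    by blast
  have n: "n > 0" "even n" using ne ap by (simp_all add: n_def)
  have "\<forall>\<nu>. \<exists>p. \<Phi> \<nu> (fst p) (fst (snd p)) (snd (snd p))" using ap by force
  then obtain p where p: "\<And>\<nu>. \<Phi> \<nu> (fst (p \<nu>)) (fst (snd (p \<nu>))) (snd (snd (p \<nu>)))" by metis
  define W L h where "W \<nu> = fst (p \<nu>)" and "L \<nu> = fst (snd (p \<nu>))" and "h \<nu> = snd (snd (p \<nu>))" for \<nu>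
  have WLh: "\<Phi> \<nu> (W \<nu>) (L \<nu>) (h \<nu>)" for \<nu> using p[of \<nu>] unfolding W_def L_def h_def .
  have q: "qpath w s (\<phi> \<nu>) (\<lambda>j. sin (\<phi> \<nu> (j + 1)) / sin (\<phi> \<nu> (j + 2))) (W \<nu>)"
    and norm: "cmod (W \<nu> k 2 - W \<nu> k 1) = sin (\<phi> \<nu> 0)"
    and Wn: "W \<nu> (k + n) j = W \<nu> k j + of_real (L \<nu>)" and L: "L \<nu> > 0"
    and cr: "s k * (Im (W \<nu> k (w k + 2)) - h \<nu>) > 0" "s k * (Im (W \<nu> k (w k + 1)) - h \<nu>) < 0"
    and W01: "W \<nu> 0 1 = 0" for \<nu> k j
    using WLh[of \<nu>] unfolding \<Phi>_def by blast+
  have s: "s (k + 1) = - s k" "s k = 1 \<or> s k = -1" "s (k + n) = s k" for k using n by (auto simp: s_def)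
  have wn: "w (k + n) = w k" for k by (simp add: w_def)
  have r0: "r \<longlonglongrightarrow> 0"
  proof -
    have "(\<lambda>\<nu>. r \<nu> / t \<nu> * t \<nu>) \<longlonglongrightarrow> 0 * 0" by (intro tendsto_intros r t)
    moreover have "r \<nu> / t \<nu> * t \<nu> = r \<nu>" for \<nu> using t(1)[of \<nu>] by simp
    ultimately show ?thesis by simp
  qed
  obtain x1 where x1: "\<And>k. x1 (k + 1) = x1 k + (if s k = 1 then 1 else - 1) * (if w k = 1 then 1 else (0::int))"
    using int_rec[of 0 "\<lambda>k. (if s k = 1 then 1 else - 1) * (if w k = 1 then 1 else 0)"] by blast
  obtain x2 where x2: "\<And>k. x2 (k + 1) = x2 k + (if s k = 1 then 1 else - 1) * (if w k = 2 then 1 else (0::int))"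
    using int_rec[of 0 "\<lambda>k. (if s k = 1 then 1 else - 1) * (if w k = 2 then 1 else 0)"] by blast
  define d1 d2 where "d1 = x1 n - x1 0" and "d2 = x2 n - x2 0"
  have shift: "x (k + n) - x k = x n - x 0" if "\<And>k. x (k + 1) = x k + c k" "\<And>k. c (k + n) = c k" for x c :: "int \<Rightarrow> int" and k
  proof (induction k rule: int_induct[where k = 0])
    case (step1 k)
    have e: "k + 1 + n = k + n + 1" by simp
    show ?case unfolding e that(1)[of "k + n"] that(1)[of k] that(2) using step1 by simp
  next
    case (step2 k)
    define m where "m = k - 1"
    have k: "k = m + 1" and e: "m + 1 + n = m + n + 1" by (simp_all add: m_def)
    have "x (m + n + 1) - x (m + 1) = x n - x 0" using step2(2) unfolding k e .
    then show ?case unfolding m_def[symmetric] using that(1)[of "m + n"] that(1)[of m] that(2)[of m] by linarith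
  qed simp
  have rot: "cis (2 * (of_int d2 * \<phi> \<nu> 1 - of_int d1 * \<phi> \<nu> 2)) = 1" for \<nu>
  proof -
    have "cmod (W \<nu> 0 2 - W \<nu> 0 1) = sin (\<phi> \<nu> 0)" by (rule norm)
    moreover have "sin (\<phi> \<nu> 0) > 0"
      unfolding \<phi>e using nondegenerate_shaped(2)[OF nd[of \<nu>] sh[of \<nu>], of 0] by simp
    ultimately have D0: "W \<nu> 0 2 - W \<nu> 0 1 \<noteq> 0" by auto
    have "W \<nu> n 2 - W \<nu> n 1 = cis (2 * (of_int d2 * \<phi> \<nu> 1 - of_int d1 * \<phi> \<nu> 2)) * (W \<nu> 0 2 - W \<nu> 0 1)"
      using side_direction[OF q[of \<nu>] s(1,2) x1 x2, of "nat n"] n unfolding d1_def d2_def by simp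
    moreover have "W \<nu> n 2 - W \<nu> n 1 = W \<nu> 0 2 - W \<nu> 0 1" using Wn[of \<nu> 0 2] Wn[of \<nu> 0 1] by simp
    ultimately show ?thesis using D0 by simp
  qed
  \<comment> \<open>The translation keeps the side from \<open>1\<close> to \<open>2\<close>
    parallel, so an integer combination of the angles is a multiple of \<open>pi\<close> for every
    \<open>\<nu>\<close>. Its constant part drops out by passing to the limit, and the orders of
    \<open>t\<close> and \<open>r\<close> are then compared.\<close>
  have zero: "d1 = 0 \<and> d2 = 0"
  proof -
    define y where "y \<nu> = t \<nu> * of_int (d1 + d2) + r \<nu> * of_int d1" for \<nu>
    define y0 where "y0 = of_int d2 * (pi / 6) - of_int d1 * (pi / 3)"
    have yy: "2 * (of_int d2 * \<phi> \<nu> 1 - of_int d1 * \<phi> \<nu> 2) = 2 * y0 + 2 * y \<nu>" for \<nu>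
      by (simp add: \<phi>_def y_def y0_def algebra_simps)
    have "y \<longlonglongrightarrow> 0 * of_int (d1 + d2) + 0 * of_int d1" unfolding y_def by (intro tendsto_intros t r0)
    then have yl: "(\<lambda>\<nu>. 2 * y \<nu>) \<longlonglongrightarrow> 0" by (auto intro: tendsto_mult_right_zero)
    have "(\<lambda>\<nu>. cis (2 * y0 + 2 * y \<nu>)) \<longlonglongrightarrow> cis (2 * y0 + 0)" unfolding cis_conv_exp by (intro tendsto_intros yl)
    then have "cis (2 * y0) = 1" using rot unfolding yy by (simp add: LIMSEQ_const_iff)
    then have c1: "cis (2 * y \<nu>) = 1" for \<nu> using rot[of \<nu>] unfolding yy cis_mult[symmetric] by simp
    have "\<forall>\<^sub>F \<nu> in sequentially. 2 * y \<nu> < pi" "\<forall>\<^sub>F \<nu> in sequentially. - pi < 2 * y \<nu>"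
      by (rule order_tendstoD[OF yl], simp)+
    then have y0: "\<forall>\<^sub>F \<nu> in sequentially. y \<nu> = 0"
    proof eventually_elim
      case (elim \<nu>)
      have "sin (2 * y \<nu>) = 0" using c1[of \<nu>] by (metis cis.sel(2) one_complex.sel(2))
      then have "2 * y \<nu> = 0" using elim sin_eq_0_pi by blast
      then show ?case by simp
    qed
    have "(\<lambda>\<nu>. of_int (d1 + d2) + r \<nu> / t \<nu> * of_int d1) \<longlonglongrightarrow> of_int (d1 + d2) + 0 * of_int d1"
      by (intro tendsto_intros r)
    moreover have "\<forall>\<^sub>F \<nu> in sequentially. of_int (d1 + d2) + r \<nu> / t \<nu> * of_int d1 = (0::real)"
      using y0
    proof eventually_elim
      case (elim \<nu>)
      have "of_int (d1 + d2) + r \<nu> / t \<nu> * of_int d1 = y \<nu> / t \<nu>"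
        using t(1)[of \<nu>] by (simp add: y_def add_divide_distrib)
      then show ?case using elim by simp
    qed
    ultimately have "(\<lambda>\<nu>::nat. 0::real) \<longlonglongrightarrow> of_int (d1 + d2)" using Lim_transform_eventually by fastforce
    then have d: "real_of_int (d1 + d2) = 0" by (simp only: LIMSEQ_const_iff)
    obtain \<nu> where "y \<nu> = 0" using eventually_happens'[OF sequentially_bot y0] by blast
    then have "d1 = 0" using d r(1)[of \<nu>] by (simp add: y_def)
    then show ?thesis using d by simp
  qed
  have xn: "x1 (k + n) = x1 k" "x2 (k + n) = x2 k" for k
    using shift[where x = x1, OF x1, of k] shift[where x = x2, OF x2, of k] zero s(3) wn by (simp_all add: d1_def d2_def)
  have "W \<nu> 0 2 \<in> cball 0 1" for \<nu> using norm[of \<nu> 0] by (simp add: W01)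
  then have "\<forall>\<nu>. W \<nu> 0 2 \<in> cball 0 1" by blast
  then obtain z g where g: "strict_mono (g :: nat \<Rightarrow> nat)" "((\<lambda>\<nu>. W \<nu> 0 2) \<circ> g) \<longlonglongrightarrow> z"
    using compact_cball[of "0::complex" 1] unfolding compact_def by (elim allE[of _ "\<lambda>\<nu>. W \<nu> 0 2"]) blast
  have sub: "(\<lambda>\<nu>. f (g \<nu>)) \<longlonglongrightarrow> l" if "f \<longlonglongrightarrow> l" for f :: "nat \<Rightarrow> real" and l
    using LIMSEQ_subseq_LIMSEQ[OF that g(1)] by (simp add: o_def)
  define \<phi>0 :: "3 \<Rightarrow> real" where "\<phi>0 j = (if j = 1 then pi / 6 else if j = 2 then pi / 3 else pi / 2)" for j
  have \<phi>l: "(\<lambda>\<nu>. \<phi> (g \<nu>) j) \<longlonglongrightarrow> \<phi>0 j" for j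
  proof -
    have "(\<lambda>\<nu>. pi / 6 + t \<nu>) \<longlonglongrightarrow> pi / 6 + 0" "(\<lambda>\<nu>. pi / 3 - t \<nu> - r \<nu>) \<longlonglongrightarrow> pi / 3 - 0 - 0"
      "(\<lambda>\<nu>. pi / 2 + r \<nu>) \<longlonglongrightarrow> pi / 2 + 0" by (intro tendsto_intros t r0)+
    then have "(\<lambda>\<nu>. \<phi> \<nu> j) \<longlonglongrightarrow> \<phi>0 j" using label_cases[of j] by (auto simp: \<phi>_def \<phi>0_def)
    then show ?thesis by (rule sub)
  qed
  have \<phi>0s: "sin (\<phi>0 j) \<noteq> 0" for j by (simp add: \<phi>0_def sin_30 sin_60)
  have "convergent (\<lambda>\<nu>. W (g \<nu>) k j)" for k j
    by (rule qpath_convergent[where \<phi> = "\<lambda>\<nu>. \<phi> (g \<nu>)" and W = "\<lambda>\<nu>. W (g \<nu>)", OF q s(1) \<phi>l \<phi>0s W01])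
      (use g(2) in \<open>simp add: o_def\<close>)
  then have lim: "(\<lambda>\<nu>. W (g \<nu>) k j) \<longlonglongrightarrow> lim (\<lambda>\<nu>. W (g \<nu>) k j)" for k j
    by (simp add: convergent_LIMSEQ_iff)
  have "degenerating_path w s n x1 x2 (\<lambda>\<nu>. t (g \<nu>)) (\<lambda>\<nu>. r (g \<nu>)) (\<lambda>\<nu>. L (g \<nu>)) (\<lambda>\<nu>. h (g \<nu>)) (\<lambda>\<nu>. \<phi> (g \<nu>))
      (\<lambda>\<nu>. W (g \<nu>)) (\<lambda>k j. lim (\<lambda>\<nu>. W (g \<nu>) k j))"
  proof
    show "\<phi> (g \<nu>) 1 = pi / 6 + t (g \<nu>)" "\<phi> (g \<nu>) 2 = pi / 3 - t (g \<nu>) - r (g \<nu>)" "\<phi> (g \<nu>) 0 = pi / 2 + r (g \<nu>)" for \<nu>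
      by (simp_all add: \<phi>_def)
  qed (fact n(1) wn s x1 x2 xn t(1) sub[OF t(2)] r(1) sub[OF r(2)] q norm Wn L cr lim)+
  then show False by (rule degenerating_path.contradiction)
qed

theorem theorem4p1:
  fixes \<O> :: "(real \<times> real) set" and T :: "real \<times> real"
  assumes "T = (pi / 6, pi / 3)"
    and "is_orbit_tile \<O>"
    and "open \<O>"
    and "T \<in> closure \<O>"
  shows "\<exists>\<eta>>0. \<forall>\<epsilon> \<delta>. 0 < \<epsilon> \<and> \<epsilon> < \<eta> \<and> 0 < \<delta> \<and> \<delta> < \<eta> \<longrightarrow>
           ray T (7 * pi / 4 - \<epsilon>) \<inter> (\<O> \<inter> ball T \<delta>) = {}"
proof (rule ccontr)
  assume neg: "\<not> ?thesis"
  obtain P f a where P: "nondegenerate P" "periodic_trajectory P f a" and O: "\<O> = orbit_tile P f a"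
    using assms(2) unfolding is_orbit_tile_def by blast
  define ws where "ws = hit_sequence P f a"
  have ws: "ws \<noteq> []" unfolding ws_def by (rule hit_sequence_nonempty[OF P])
  define \<gamma> where "\<gamma> \<epsilon> x = T + x *\<^sub>R (cos (7 * pi / 4 - \<epsilon>), sin (7 * pi / 4 - \<epsilon>))" for \<epsilon> x
  have "\<exists>p. 0 < fst p \<and> fst p < 1 / (real \<nu> + 2) \<and> 0 < snd p \<and> snd p < 1 / (real \<nu> + 2) \<and> \<gamma> (fst p) (snd p) \<in> \<O>" for \<nu> :: nat
  proof -
    \<comment> \<open>The summand 2 keeps \<open>\<epsilon>\<close> below 1/2, hence below
      \<open>pi / 4\<close>.\<close>
    define \<eta> where "\<eta> = 1 / (real \<nu> + 2)"
    have \<eta>: "\<eta> > 0" by (simp add: \<eta>_def)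
    have "\<exists>\<epsilon> \<delta>. 0 < \<epsilon> \<and> \<epsilon> < \<eta> \<and> 0 < \<delta> \<and> \<delta> < \<eta> \<and> ray T (7 * pi / 4 - \<epsilon>) \<inter> (\<O> \<inter> ball T \<delta>) \<noteq> {}"
      using neg \<eta> by blast
    then obtain \<epsilon> \<delta> z where e: "0 < \<epsilon>" "\<epsilon> < \<eta>" "0 < \<delta>" "\<delta> < \<eta>"
      and z: "z \<in> ray T (7 * pi / 4 - \<epsilon>)" "z \<in> \<O>" "z \<in> ball T \<delta>" by blast
    obtain x where x: "x \<ge> 0" "z = \<gamma> \<epsilon> x" using z(1) unfolding ray_def \<gamma>_def by blast
    have dist: "dist T (\<gamma> \<epsilon> y) = \<bar>y\<bar>" for y
    proof -
      have "(y * c)\<^sup>2 + (y * c')\<^sup>2 = y\<^sup>2" if "c\<^sup>2 + c'\<^sup>2 = 1" for c c' :: real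
        using that by (simp only: power_mult_distrib distrib_left[symmetric] mult_1_right)
      from this[OF sin_cos_squared_add2] show ?thesis by (simp add: \<gamma>_def dist_norm norm_Pair)
    qed
    have "x < \<delta>" using z(3) x dist[of x] by simp
    have "\<exists>y. 0 < y \<and> y < \<eta> \<and> \<gamma> \<epsilon> y \<in> \<O>"
    proof (cases "x = 0")
      case False
      then show ?thesis using x z(2) \<open>x < \<delta>\<close> e by (intro exI[of _ x]) auto
    next
      \<comment> \<open>The ray contains its origin, so the point found may be \<open>T\<close>
        itself; openness of the tile then supplies another point of the ray.\<close>
      case True
      then have "T \<in> \<O>" using z(2) x by (simp add: \<gamma>_def zero_prod_def[symmetric])
      then obtain d where d: "d > 0" "ball T d \<subseteq> \<O>" using assms(3) open_contains_ball by blast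
      define y where "y = min d \<eta> / 2"
      have y: "0 < y" "y < d" "y < \<eta>" using d(1) \<eta> by (auto simp: y_def)
      then have "\<gamma> \<epsilon> y \<in> ball T d" using dist[of y] by simp
      then show ?thesis using y d(2) by blast
    qed
    then show ?thesis using e unfolding \<eta>_def[symmetric] by (metis fst_conv snd_conv)
  qed
  then obtain p where p: "\<And>\<nu>::nat. 0 < fst (p \<nu>) \<and> fst (p \<nu>) < 1 / (real \<nu> + 2) \<and> 0 < snd (p \<nu>) \<and>
      snd (p \<nu>) < 1 / (real \<nu> + 2) \<and> \<gamma> (fst (p \<nu>)) (snd (p \<nu>)) \<in> \<O>" by metis
  define \<epsilon> x where "\<epsilon> \<nu> = fst (p \<nu>)" and "x \<nu> = snd (p \<nu>)" for \<nu>
  have px: "0 < \<epsilon> \<nu>" "\<epsilon> \<nu> < 1 / (real \<nu> + 2)" "0 < x \<nu>" "x \<nu> < 1 / (real \<nu> + 2)" "\<gamma> (\<epsilon> \<nu>) (x \<nu>) \<in> \<O>" for \<nu>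
    using p[of \<nu>] by (simp_all add: \<epsilon>_def x_def)
  have z: "(\<lambda>\<nu>. 1 / (real \<nu> + 2)) \<longlonglongrightarrow> 0"
    using LIMSEQ_ignore_initial_segment[OF lim_inverse_n', of 2] by (simp add: add.commute)
  have squeeze: "g \<longlonglongrightarrow> 0" if "\<And>\<nu>. 0 < g \<nu>" "\<And>\<nu>. g \<nu> < 1 / (real \<nu> + 2)" for g :: "nat \<Rightarrow> real"
    by (rule tendsto_sandwich[OF _ _ tendsto_const z]) (use that in \<open>auto intro!: always_eventually less_imp_le\<close>)
  have \<epsilon>0: "\<epsilon> \<longlonglongrightarrow> 0" and x0: "x \<longlonglongrightarrow> 0" using squeeze px by blast+
  \<comment> \<open>In the direction \<open>7 * pi / 4 - \<epsilon>\<close> the first angle grows by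
    \<open>t\<close> and the second one shrinks by \<open>t + r\<close>, so the third exceeds a
    right angle by \<open>r\<close>. The quotient
    \<open>r / t = tan (pi / 4 + \<epsilon>) - 1\<close> tends to 0.\<close>
  define t r where "t \<nu> = x \<nu> * cos (pi / 4 + \<epsilon> \<nu>)"
    and "r \<nu> = x \<nu> * (sin (pi / 4 + \<epsilon> \<nu>) - cos (pi / 4 + \<epsilon> \<nu>))" for \<nu>
  have \<epsilon>b: "\<epsilon> \<nu> < pi / 4" for \<nu>
  proof -
    have "1 / (real \<nu> + 2) \<le> 1 / 2" by (simp add: field_simps)
    then show ?thesis using px(2)[of \<nu>] pi_gt3 by linarith
  qed
  have cpos: "cos (pi / 4 + \<epsilon> \<nu>) > 0" for \<nu> using px(1)[of \<nu>] \<epsilon>b[of \<nu>] by (intro cos_gt_zero) auto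
  have t: "t \<nu> > 0" for \<nu> using px(3) cpos by (simp add: t_def)
  have r: "r \<nu> > 0" for \<nu>
  proof -
    have "sin (\<epsilon> \<nu>) > 0" using px(1)[of \<nu>] \<epsilon>b[of \<nu>] by (intro sin_gt_zero) auto
    moreover have "sin (pi / 4 + \<epsilon> \<nu>) - cos (pi / 4 + \<epsilon> \<nu>) = sqrt 2 * sin (\<epsilon> \<nu>)"
      by (simp add: sin_add cos_add sin_45 cos_45 algebra_simps)
    ultimately show ?thesis using px(3)[of \<nu>] by (simp add: r_def)
  qed
  have cl: "(\<lambda>\<nu>. cos (pi / 4 + \<epsilon> \<nu>)) \<longlonglongrightarrow> cos (pi / 4 + 0)" and sl: "(\<lambda>\<nu>. sin (pi / 4 + \<epsilon> \<nu>)) \<longlonglongrightarrow> sin (pi / 4 + 0)"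
    by (intro tendsto_intros \<epsilon>0)+
  have tl: "t \<longlonglongrightarrow> 0" using tendsto_mult[OF x0 cl] by (simp add: t_def[abs_def])
  have "(\<lambda>\<nu>. (sin (pi / 4 + \<epsilon> \<nu>) - cos (pi / 4 + \<epsilon> \<nu>)) / cos (pi / 4 + \<epsilon> \<nu>)) \<longlonglongrightarrow>
      (sin (pi / 4 + 0) - cos (pi / 4 + 0)) / cos (pi / 4 + 0)"
    by (intro tendsto_intros cl sl) (simp add: cos_45)
  moreover have "(sin (pi / 4 + \<epsilon> \<nu>) - cos (pi / 4 + \<epsilon> \<nu>)) / cos (pi / 4 + \<epsilon> \<nu>) = r \<nu> / t \<nu>" for \<nu>
    using px(3)[of \<nu>] by (simp add: r_def t_def)
  ultimately have rl: "(\<lambda>\<nu>. r \<nu> / t \<nu>) \<longlonglongrightarrow> 0" by (simp add: sin_45 cos_45)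
  have \<gamma>: "\<gamma> (\<epsilon> \<nu>) (x \<nu>) = (pi / 6 + t \<nu>, pi / 3 - t \<nu> - r \<nu>)" for \<nu>
  proof -
    have e: "7 * pi / 4 - \<epsilon> \<nu> = 2 * pi - (pi / 4 + \<epsilon> \<nu>)" by simp
    have "cos (7 * pi / 4 - \<epsilon> \<nu>) = cos (pi / 4 + \<epsilon> \<nu>)" "sin (7 * pi / 4 - \<epsilon> \<nu>) = - sin (pi / 4 + \<epsilon> \<nu>)"
      unfolding e by (simp_all only: cos_2pi_minus sin_2pi_minus)
    then show ?thesis unfolding \<gamma>_def assms(1) by (simp add: t_def r_def algebra_simps)
  qed
  have "\<exists>Q. nondegenerate Q \<and> shape Q = (pi / 6 + t \<nu>, pi / 3 - t \<nu> - r \<nu>) \<and> admits_sequence Q ws" for \<nu>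
  proof -
    obtain Q where Q: "(pi / 6 + t \<nu>, pi / 3 - t \<nu> - r \<nu>) = shape Q" "nondegenerate Q" "admits_sequence Q ws"
      using px(5)[of \<nu>] unfolding \<gamma> O orbit_tile_def ws_def by auto
    then show ?thesis by (intro exI[of _ Q]) simp
  qed
  then obtain Q where Q: "\<And>\<nu>. nondegenerate (Q \<nu>) \<and> shape (Q \<nu>) = (pi / 6 + t \<nu>, pi / 3 - t \<nu> - r \<nu>) \<and> admits_sequence (Q \<nu>) ws"
    by metis
  show False
    by (rule no_degenerating_sequence[OF ws _ _ _ t tl r rl, of Q]) (use Q in blast)+
qed

end
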